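(* Assume conditions (i)--(iv) listed in the context. Then, as $N\to\infty$, the processes $$U^{(N)}_t=\sum_{i=1}^{\lfloor tN/T\rfloor}\log\left(1+R^{(N)}_{i,Y^{(N)}_i}\right),\qquad t\in[0,T],$$ converge weakly in the Skorokhod topology (i.e. as random elements of $D([0,T])$) to the process $$\left(\int_0^t\sigma_{Y_s}\,dW_s+\int_0^t\left(\mu_{Y_s}-\frac{\sigma_{Y_s}^2}{2}\right)ds\right)_{t\in[0,T]}.$$
   Context: Fix $T>0$. $\mathbb N=\{1,2,\dots\}$. Limit model. On a probability space $(\Omega,\mathcal F,\mathbb P)$ let $W=(W_t)_{t\ge0}$ be a Wiener process and $(Y_t)_{t\ge0}$ a uniformly ergodic Markov jump process with values in $\mathbb N$, independent of $W$, with $Y_0=1$ and infinitesimal matrix having diagonal entries $-\lambda_i$ and off-diagonal entries $\lambda_{ij}>0$ ($i\ne j$), where $\sum_{j\neq i}\lambda_{ij}=\lambda_i$ for all $i$, $\lambda_*=\inf_i\lambda_i>0$ and $\lambda^*=\sup_i\lambda_i<\infty$. Its transition probabilities are denoted $p_{ij}(t)=\mathbb P(Y_t=j\mid Y_0=i)$. The sequences $(\mu_k)_{k\ge1}$ and $(\sigma_k)_{k\ge1}$ consist of real numbers with $\sigma_k>0$, $\sup_k|\mu_k|<\infty$, $\sup_k\sigma_k<\infty$. Discrete models. For each $N\in\mathbb N$, on a probability space $(\Omega^{(N)},\mathcal F^{(N)},\mathbb P^{(N)})$, let $(Y^{(N)}_k)_{k\ge0}$ be a time-homogeneous Markov chain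 in $\mathbb N$ with $Y^{(N)}_0=1$ whose one-step transition matrix has diagonal entries $$\mathbb P^{(N)}(Y^{(N)}_{k+1}=i\mid Y^{(N)}_k=i)=\mathbb P(Y_s=i,\ 0\le s\le T/N\mid Y_0=i)=e^{-\lambda_iT/N}$$ and off-diagonal entries $$p^{(N)}_{ij}=\mathbb P^{(N)}(Y^{(N)}_{k+1}=j\mid Y^{(N)}_k=i)=p_{ij}(T/N),\qquad i\ne j.$$ Let $\{R^{(N)}_{i,j}:0\le i\le N,\ j\in\mathbb N\}$ be independent real random variables on the same space. The conditions are: (i) $R^{(N)}_{i,j}>-1$ a.s., and there are non-negative reals $\gamma_N\to0$ ($N\to\infty$) with $\sup_{i,j}|R^{(N)}_{i,j}|\le\gamma_N$ a.s. (ii) $\mu^{(N)}_j:=\mathbb E^{(N)}R^{(N)}_{i,j}$ does not depend on $i$, and $\lim_{N\to\infty}(1+\mu^{(N)}_j)^N=e^{\mu_jT}$ for each $j$. (iii) For every fixed $t\in[0,T]$, $\sup_j\left|\sum_{i=1}^{\lfloor Nt/T\rfloor}\operatorname{Var}R^{(N)}_{i,j}-\sigma_j^2t\right|\to0$ as $N\to\infty$. (iv) The families $\{R^{(N)}_{i,j}:0\le i\le N,\ j\in\mathbb N\}$ and $\{Y^{(N)}_k:1\le k\le N\}$ are independent.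
   Formalization: The displayed one-step matrix has row sums below 1, so no chain has it; the formal statement instead lets the chain have any stochastic matrix whose entries are at least the displayed ones (the missing mass in each row is distributed arbitrarily). *)

theory Defs
  imports "HOL-Probability.Probability"
begin

section \<open>The Skorokhod space \<open>D([0,T])\<close>\<close>

text \<open>
  At an endpoint of \<open>S\<close> the filter \<open>at t within \<dots>\<close> is trivial, so that the
  corresponding one-sided condition holds vacuously.
\<close>

definition cadlag_on :: "real set \<Rightarrow> (real \<Rightarrow> 'x::topological_space) \<Rightarrow> bool" where
  "cadlag_on S f \<longleftrightarrow>
     (\<forall>t\<in>S. (f \<longlongrightarrow> f t) (at t within S \<inter> {t<..}) \<and>
            (\<exists>l. (f \<longlongrightarrow> l) (at t within S \<inter> {..<t})))"

text \<open>
  Functions on \<open>[0,T]\<close> are represented by their extensions with the value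
  \<^const>\<open>undefined\<close> outside \<open>[0,T]\<close>, so that equality is equality on \<open>[0,T]\<close>.
\<close>

definition skorokhod_space :: "real \<Rightarrow> (real \<Rightarrow> real) set" where
  "skorokhod_space T = {x \<in> extensional {0..T}. cadlag_on {0..T} x}"

text \<open>A strictly increasing surjection of \<open>[0,T]\<close> is automatically a homeomorphism.\<close>

definition time_changes :: "real \<Rightarrow> (real \<Rightarrow> real) set" where
  "time_changes T = {l. strict_mono_on {0..T} l \<and> l ` {0..T} = {0..T}}"

definition skorokhod_close :: "real \<Rightarrow> (real \<Rightarrow> real) \<Rightarrow> (real \<Rightarrow> real) \<Rightarrow> real \<Rightarrow> bool" where
  "skorokhod_close T x y r \<longleftrightarrow>
     0 \<le> r \<and> (\<exists>l\<in>time_changes T. \<forall>t\<in>{0..T}. \<bar>l t - t\<bar> \<le> r \<and> \<bar>x t - y (l t)\<bar> \<le> r)"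

definition skorokhod_dist :: "real \<Rightarrow> (real \<Rightarrow> real) \<Rightarrow> (real \<Rightarrow> real) \<Rightarrow> real" where
  "skorokhod_dist T x y =
     (if x \<in> skorokhod_space T \<and> y \<in> skorokhod_space T
      then Inf {r. skorokhod_close T x y r} else 0)"

definition skorokhod_topology :: "real \<Rightarrow> (real \<Rightarrow> real) topology" where
  "skorokhod_topology T = Metric_space.mtopology (skorokhod_space T) (skorokhod_dist T)"

lemma cadlag_bounded:
  fixes x :: "real \<Rightarrow> real"
  assumes "cadlag_on {0..T} x"
  obtains B where "B \<ge> 0" "\<And>t. t \<in> {0..T} \<Longrightarrow> \<bar>x t\<bar> \<le> B"
proof -
  have loc: "\<exists>U B. open U \<and> t \<in> U \<and> (\<forall>s \<in> U \<inter> {0..T}. \<bar>x s\<bar> \<le> B)" if t: "t \<in> {0..T}" for t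
  proof -
    from assms t obtain l where
      r: "(x \<longlongrightarrow> x t) (at t within {0..T} \<inter> {t<..})" and
      l: "(x \<longlongrightarrow> l) (at t within {0..T} \<inter> {..<t})"
      unfolding cadlag_on_def by blast
    from r have "eventually (\<lambda>s. dist (x s) (x t) < 1) (at t within {0..T} \<inter> {t<..})"
      by (rule tendstoD) simp
    then obtain d1 where d1: "d1 > 0"
      "\<And>s. s \<in> {0..T} \<inter> {t<..} \<Longrightarrow> dist s t < d1 \<Longrightarrow> dist (x s) (x t) < 1"
      unfolding eventually_at by fastforce
    from l have "eventually (\<lambda>s. dist (x s) l < 1) (at t within {0..T} \<inter> {..<t})"
      by (rule tendstoD) simp
    then obtain d2 where d2: "d2 > 0"
      "\<And>s. s \<in> {0..T} \<inter> {..<t} \<Longrightarrow> dist s t < d2 \<Longrightarrow> dist (x s) l < 1"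
      unfolding eventually_at by fastforce
    let ?U = "ball t (min d1 d2)"
    have "\<bar>x s\<bar> \<le> \<bar>x t\<bar> + \<bar>l\<bar> + 1" if s: "s \<in> ?U \<inter> {0..T}" for s
    proof -
      consider "s = t" | "s > t" | "s < t" by linarith
      then show ?thesis
      proof cases
        case 2
        then have "dist (x s) (x t) < 1" using s by (intro d1) (auto simp: dist_commute)
        then show ?thesis by (auto simp: dist_real_def)
      next
        case 3
        then have "dist (x s) l < 1" using s by (intro d2) (auto simp: dist_commute)
        then show ?thesis by (auto simp: dist_real_def)
      qed auto
    qed
    moreover have "open ?U" "t \<in> ?U" using d1(1) d2(1) by auto
    ultimately show ?thesis by blast
  qed
  then obtain U B where UB: "\<And>t. t \<in> {0..T} \<Longrightarrow> open (U t) \<and> t \<in> U t \<and> (\<forall>s \<in> U t \<inter> {0..T}. \<bar>x s\<bar> \<le> B t)"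
    by metis
  have "compact {0..T}" by simp
  then obtain C where C: "C \<subseteq> {0..T}" "finite C" "{0..T} \<subseteq> (\<Union>c\<in>C. U c)"
    by (rule compactE_image[of _ "{0..T}" U]) (use UB in auto)
  show thesis
  proof
    show "0 \<le> (\<Sum>c\<in>C. \<bar>B c\<bar>)" by (rule sum_nonneg) simp
    fix t assume t: "t \<in> {0..T}"
    then obtain c where c: "c \<in> C" "t \<in> U c" using C(3) by blast
    then have "\<bar>x t\<bar> \<le> \<bar>B c\<bar>" using UB[of c] C(1) t by force
    also have "\<dots> \<le> (\<Sum>c\<in>C. \<bar>B c\<bar>)" by (rule member_le_sum) (use c C(2) in auto)
    finally show "\<bar>x t\<bar> \<le> (\<Sum>c\<in>C. \<bar>B c\<bar>)" .
  qed
qed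

lemma time_changes_id: "(\<lambda>t. t) \<in> time_changes T"
  by (auto simp: time_changes_def strict_mono_on_def)

lemma time_changes_mem: "l \<in> time_changes T \<Longrightarrow> t \<in> {0..T} \<Longrightarrow> l t \<in> {0..T}"
  by (auto simp: time_changes_def)

lemma time_changes_comp:
  assumes "l \<in> time_changes T" "l' \<in> time_changes T"
  shows "(\<lambda>t. l' (l t)) \<in> time_changes T"
proof -
  have "(\<lambda>t. l' (l t)) ` {0..T} = l' ` (l ` {0..T})" by auto
  moreover have "strict_mono_on {0..T} (\<lambda>t. l' (l t))"
  proof (rule strict_mono_onI)
    fix r s assume rs: "r \<in> {0..T}" "s \<in> {0..T}" "r < s"
    then have "l r < l s" using assms(1) by (auto simp: time_changes_def strict_mono_on_def)
    then show "l' (l r) < l' (l s)"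
      using assms(2) time_changes_mem[OF assms(1)] rs
      by (auto simp: time_changes_def strict_mono_on_def)
  qed
  ultimately show ?thesis using assms by (auto simp: time_changes_def)
qed

lemma time_changes_inv:
  assumes l: "l \<in> time_changes T"
  obtains l' where "l' \<in> time_changes T"
    "\<And>t. t \<in> {0..T} \<Longrightarrow> l (l' t) = t" "\<And>t. t \<in> {0..T} \<Longrightarrow> l' (l t) = t"
proof
  have inj: "inj_on l {0..T}"
    using l by (auto simp: time_changes_def intro: strict_mono_on_imp_inj_on)
  have im: "l ` {0..T} = {0..T}" using l by (simp add: time_changes_def)
  let ?i = "inv_into {0..T} l"
  show 1: "l (?i t) = t" if "t \<in> {0..T}" for t
    using that im by (intro f_inv_into_f) simp
  show 2: "?i (l t) = t" if "t \<in> {0..T}" for t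
    using that inj by (rule inv_into_f_f[rotated])
  have mem: "?i t \<in> {0..T}" if "t \<in> {0..T}" for t
    using that im by (metis inv_into_into)
  show "?i \<in> time_changes T"
    unfolding time_changes_def
  proof (intro CollectI conjI strict_mono_onI)
    fix r s assume rs: "r \<in> {0..T}" "s \<in> {0..T}" "r < s"
    show "?i r < ?i s"
    proof (rule ccontr)
      assume "\<not> ?thesis"
      then have "?i s \<le> ?i r" by simp
      moreover have "strict_mono_on {0..T} l" using l by (simp add: time_changes_def)
      ultimately have "l (?i s) \<le> l (?i r)"
        using mem[OF rs(1)] mem[OF rs(2)] by (meson strict_mono_on_leD)
      with rs 1 show False by simp
    qed
  next
    show "?i ` {0..T} = {0..T}"
    proof
      show "?i ` {0..T} \<subseteq> {0..T}" using mem by blast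
      show "{0..T} \<subseteq> ?i ` {0..T}"
      proof
        fix t assume t: "t \<in> {0..T}"
        then have "?i (l t) = t" "l t \<in> {0..T}" using 2 time_changes_mem[OF l] by blast+
        then show "t \<in> ?i ` {0..T}" by (metis imageI)
      qed
    qed
  qed
qed

lemma time_changes_end:
  assumes l: "l \<in> time_changes T" and "0 \<le> T"
  shows "l T = T"
proof -
  have "T \<in> l ` {0..T}" using assms by (simp add: time_changes_def)
  then obtain t where t: "t \<in> {0..T}" "l t = T" by force
  have "l t \<le> l T"
    using l t(1) assms(2) by (auto simp: time_changes_def intro: strict_mono_on_leD)
  moreover have "l T \<in> {0..T}" using time_changes_mem[OF l] assms(2) by auto
  ultimately show ?thesis using t by simp
qed

lemma skorokhod_close_ex:
  assumes "x \<in> skorokhod_space T" "y \<in> skorokhod_space T"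
  shows "\<exists>r. skorokhod_close T x y r"
proof -
  obtain B where B: "B \<ge> 0" "\<And>t. t \<in> {0..T} \<Longrightarrow> \<bar>x t\<bar> \<le> B"
    using assms cadlag_bounded unfolding skorokhod_space_def by blast
  obtain C where C: "C \<ge> 0" "\<And>t. t \<in> {0..T} \<Longrightarrow> \<bar>y t\<bar> \<le> C"
    using assms cadlag_bounded unfolding skorokhod_space_def by blast
  have "\<bar>x t - y t\<bar> \<le> B + C" if "t \<in> {0..T}" for t using B(2)[OF that] C(2)[OF that] by linarith
  then have "skorokhod_close T x y (B + C)"
    unfolding skorokhod_close_def using B(1) C(1)
    by (intro conjI bexI[OF _ time_changes_id]) auto
  then show ?thesis by blast
qed

lemma skorokhod_close_sym:
  assumes "skorokhod_close T x y r"
  shows "skorokhod_close T y x r"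
proof -
  from assms obtain l where r: "0 \<le> r" and l: "l \<in> time_changes T"
    and c: "\<And>t. t \<in> {0..T} \<Longrightarrow> \<bar>l t - t\<bar> \<le> r \<and> \<bar>x t - y (l t)\<bar> \<le> r"
    unfolding skorokhod_close_def by blast
  obtain l' where l': "l' \<in> time_changes T" "\<And>t. t \<in> {0..T} \<Longrightarrow> l (l' t) = t"
    using time_changes_inv[OF l] by blast
  have "\<bar>l' t - t\<bar> \<le> r \<and> \<bar>y t - x (l' t)\<bar> \<le> r" if t: "t \<in> {0..T}" for t
    using c[OF time_changes_mem[OF l'(1) t]] l'(2)[OF t] by auto
  with r l'(1) show ?thesis unfolding skorokhod_close_def by blast
qed

lemma skorokhod_close_trans:
  assumes "skorokhod_close T x y r" "skorokhod_close T y z s"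
  shows "skorokhod_close T x z (r + s)"
proof -
  from assms obtain l where r: "0 \<le> r" and l: "l \<in> time_changes T"
    and c: "\<And>t. t \<in> {0..T} \<Longrightarrow> \<bar>l t - t\<bar> \<le> r \<and> \<bar>x t - y (l t)\<bar> \<le> r"
    unfolding skorokhod_close_def by blast
  from assms obtain m where s: "0 \<le> s" and m: "m \<in> time_changes T"
    and d: "\<And>t. t \<in> {0..T} \<Longrightarrow> \<bar>m t - t\<bar> \<le> s \<and> \<bar>y t - z (m t)\<bar> \<le> s"
    unfolding skorokhod_close_def by blast
  have "\<bar>m (l t) - t\<bar> \<le> r + s \<and> \<bar>x t - z (m (l t))\<bar> \<le> r + s" if t: "t \<in> {0..T}" for t
    using c[OF t] d[OF time_changes_mem[OF l t]] by linarith
  with r s time_changes_comp[OF l m] show ?thesis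
    unfolding skorokhod_close_def by (intro conjI bexI[of _ "\<lambda>t. m (l t)"]) auto
qed

lemma skorokhod_close_bdd: "bdd_below {r. skorokhod_close T x y r}"
  by (rule bdd_belowI[of _ 0]) (auto simp: skorokhod_close_def)

lemma skorokhod_dist_lessD:
  assumes "x \<in> skorokhod_space T" "y \<in> skorokhod_space T" "skorokhod_dist T x y < e"
  shows "\<exists>r<e. skorokhod_close T x y r"
  using assms skorokhod_close_ex[OF assms(1,2)] skorokhod_close_bdd[of T x y]
  by (auto simp: skorokhod_dist_def cInf_less_iff)

lemma skorokhod_dist_le:
  assumes "x \<in> skorokhod_space T" "y \<in> skorokhod_space T" "skorokhod_close T x y r"
  shows "skorokhod_dist T x y \<le> r"
  using assms skorokhod_close_bdd[of T x y] by (auto simp: skorokhod_dist_def intro: cInf_lower)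

lemma skorokhod_dist_nonneg: "0 \<le> skorokhod_dist T x y"
  using skorokhod_close_ex[of x T y]
  by (auto simp: skorokhod_dist_def skorokhod_close_def intro!: cInf_greatest)

lemma skorokhod_dist_zeroD:
  assumes x: "x \<in> skorokhod_space T" and y: "y \<in> skorokhod_space T"
    and 0: "skorokhod_dist T x y = 0"
  shows "x = y"
proof (rule extensionalityI[of _ "{0..T}"])
  fix t assume t: "t \<in> {0..T}"
  have close: "\<exists>r<e. skorokhod_close T x y r" if "e > 0" for e
    using skorokhod_dist_lessD[OF x y] 0 that by simp
  have "\<bar>x t - y t\<bar> \<le> e" if e: "e > 0" for e
  proof (cases "t = T")
    case True
    obtain r l where rl: "r < e" "l \<in> time_changes T"
      and c: "\<And>t. t \<in> {0..T} \<Longrightarrow> \<bar>l t - t\<bar> \<le> r \<and> \<bar>x t - y (l t)\<bar> \<le> r"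
      using close[OF e] unfolding skorokhod_close_def by blast
    have "\<bar>x T - y (l T)\<bar> \<le> r" using c t True by blast
    moreover have "l T = T" using time_changes_end[OF rl(2)] t by auto
    ultimately show ?thesis using True rl(1) by simp
  next
    case False
    then have tT: "t < T" using t by simp
    have "(y \<longlongrightarrow> y t) (at t within {0..T} \<inter> {t<..})" "(x \<longlongrightarrow> x t) (at t within {0..T} \<inter> {t<..})"
      using x y t by (auto simp: skorokhod_space_def cadlag_on_def)
    then have "eventually (\<lambda>s. dist (y s) (y t) < e/3) (at t within {0..T} \<inter> {t<..})"
      "eventually (\<lambda>s. dist (x s) (x t) < e/3) (at t within {0..T} \<inter> {t<..})"
      using e by (simp_all only: tendstoD divide_pos_pos zero_less_numeral)
    then obtain d1 d2 where d1: "d1 > 0"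
      "\<And>s. s \<in> {0..T} \<inter> {t<..} \<Longrightarrow> dist s t < d1 \<Longrightarrow> dist (y s) (y t) < e/3" and d2: "d2 > 0"
      "\<And>s. s \<in> {0..T} \<inter> {t<..} \<Longrightarrow> dist s t < d2 \<Longrightarrow> dist (x s) (x t) < e/3"
      unfolding eventually_at by (metis Int_iff greaterThan_iff less_irrefl)
    define h where "h = min (min d1 d2) (T - t) / 2"
    have h: "h > 0" "2 * h \<le> d1" "2 * h \<le> d2" "2 * h \<le> T - t"
      using d1(1) d2(1) tT by (auto simp: h_def)
    obtain r l where rl: "r < min h (e/3)" "l \<in> time_changes T"
      and c: "\<And>t. t \<in> {0..T} \<Longrightarrow> \<bar>l t - t\<bar> \<le> r \<and> \<bar>x t - y (l t)\<bar> \<le> r"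
      using close[of "min h (e/3)"] h(1) e unfolding skorokhod_close_def by auto
    let ?s = "t + h"
    have s: "?s \<in> {0..T}" using t h by auto
    have cs: "\<bar>l ?s - ?s\<bar> \<le> r" "\<bar>x ?s - y (l ?s)\<bar> \<le> r" using c[OF s] by auto
    have "dist (x ?s) (x t) < e/3" using s h by (intro d2) (auto simp: dist_real_def)
    moreover have "dist (y (l ?s)) (y t) < e/3"
    proof (rule d1)
      show "l ?s \<in> {0..T} \<inter> {t<..}" using time_changes_mem[OF rl(2) s] cs rl by auto
      show "dist (l ?s) t < d1" using cs rl h by (auto simp: dist_real_def)
    qed
    ultimately show ?thesis using cs(2) rl(1) unfolding dist_real_def by linarith
  qed
  then have "\<bar>x t - y t\<bar> \<le> 0" by (rule field_le_epsilon) simp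
  then show "x t = y t" by simp
qed (use x y in \<open>auto simp: skorokhod_space_def\<close>)

lemma Metric_space_skorokhod: "Metric_space (skorokhod_space T) (skorokhod_dist T)"
proof
  fix x y
  show "0 \<le> skorokhod_dist T x y" by (rule skorokhod_dist_nonneg)
  have "{r. skorokhod_close T x y r} = {r. skorokhod_close T y x r}"
    using skorokhod_close_sym by blast
  then show "skorokhod_dist T x y = skorokhod_dist T y x" by (auto simp: skorokhod_dist_def)
next
  fix x y assume xy: "x \<in> skorokhod_space T" "y \<in> skorokhod_space T"
  have "skorokhod_dist T x x \<le> 0"
    using xy(1) by (intro skorokhod_dist_le)
      (auto simp: skorokhod_close_def intro!: bexI[OF _ time_changes_id])
  then have "skorokhod_dist T x x = 0" using skorokhod_dist_nonneg[of T x x] by simp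
  then show "skorokhod_dist T x y = 0 \<longleftrightarrow> x = y" using skorokhod_dist_zeroD[OF xy] by auto
next
  fix x y z assume xyz: "x \<in> skorokhod_space T" "y \<in> skorokhod_space T" "z \<in> skorokhod_space T"
  show "skorokhod_dist T x z \<le> skorokhod_dist T x y + skorokhod_dist T y z"
  proof (rule field_le_epsilon)
    fix e :: real assume e: "e > 0"
    obtain r where r: "r < skorokhod_dist T x y + e/2" "skorokhod_close T x y r"
      using skorokhod_dist_lessD[OF xyz(1,2), of "skorokhod_dist T x y + e/2"] e by auto
    obtain s where s: "s < skorokhod_dist T y z + e/2" "skorokhod_close T y z s"
      using skorokhod_dist_lessD[OF xyz(2,3), of "skorokhod_dist T y z + e/2"] e by auto
    have "skorokhod_dist T x z \<le> r + s"
      by (rule skorokhod_dist_le[OF xyz(1,3) skorokhod_close_trans[OF r(2) s(2)]])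
    then show "skorokhod_dist T x z \<le> skorokhod_dist T x y + skorokhod_dist T y z + e"
      using r(1) s(1) by linarith
  qed
qed


section \<open>Weak convergence of random elements of a topological space\<close>

definition borel_of_top :: "'x topology \<Rightarrow> 'x measure" where
  "borel_of_top S = sigma (topspace S) {U. openin S U}"

text \<open>
  The models are indexed by \<open>N = 1, 2, \<dots>\<close>; nothing is required of the index 0.
\<close>

definition converges_weakly ::
  "'x topology \<Rightarrow> (nat \<Rightarrow> 'b measure) \<Rightarrow> (nat \<Rightarrow> 'b \<Rightarrow> 'x) \<Rightarrow> 'a measure \<Rightarrow> ('a \<Rightarrow> 'x) \<Rightarrow> bool" where
  "converges_weakly S P X M Z \<longleftrightarrow>
     (\<forall>N\<ge>1. X N \<in> P N \<rightarrow>\<^sub>M borel_of_top S) \<and>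
     Z \<in> M \<rightarrow>\<^sub>M borel_of_top S \<and>
     (\<forall>f. continuous_map S euclideanreal f \<and> bounded (f ` topspace S) \<longrightarrow>
        (\<lambda>N. \<integral>\<omega>. f (X N \<omega>) \<partial>P N) \<longlonglongrightarrow> (\<integral>\<omega>. f (Z \<omega>) \<partial>M))"


section \<open>Independence of random elements of different types\<close>

text \<open>
  \<^const>\<open>prob_space.indep_var\<close> requires both random variables to take values in the same type.
\<close>

definition indep_elements ::
  "'a measure \<Rightarrow> 'x measure \<Rightarrow> ('a \<Rightarrow> 'x) \<Rightarrow> 'y measure \<Rightarrow> ('a \<Rightarrow> 'y) \<Rightarrow> bool" where
  "indep_elements M S X S' X' \<longleftrightarrow>
     X \<in> M \<rightarrow>\<^sub>M S \<and> X' \<in> M \<rightarrow>\<^sub>M S' \<and>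
     prob_space.indep_set M
       (sets (vimage_algebra (space M) X S)) (sets (vimage_algebra (space M) X' S'))"


section \<open>Markov chains and Markov jump processes on \<open>{1, 2, \<dots>}\<close>\<close>

text \<open>
  Transition probabilities \<open>p\<^sub>i\<^sub>j(t)\<close> are written \<open>pmf (p t i) j\<close>; rows are probability
  distributions on \<open>{1, 2, \<dots>}\<close>.  The index 0 is not a state.
\<close>

definition transition_function :: "(real \<Rightarrow> nat \<Rightarrow> nat pmf) \<Rightarrow> bool" where
  "transition_function p \<longleftrightarrow>
     (\<forall>i\<ge>1. p 0 i = return_pmf i) \<and>
     (\<forall>i\<ge>1. \<forall>t\<ge>0. set_pmf (p t i) \<subseteq> {1..}) \<and>
     (\<forall>i\<ge>1. \<forall>s\<ge>0. \<forall>t\<ge>0. p (s + t) i = bind_pmf (p s i) (p t))"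

definition infinitesimal_matrix ::
  "(real \<Rightarrow> nat \<Rightarrow> nat pmf) \<Rightarrow> (nat \<Rightarrow> nat \<Rightarrow> real) \<Rightarrow> bool" where
  "infinitesimal_matrix p q \<longleftrightarrow>
     (\<forall>i\<ge>1. \<forall>j\<ge>1. ((\<lambda>t. pmf (p t i) j) has_real_derivative q i j) (at 0 within {0..}))"

definition total_variation :: "nat pmf \<Rightarrow> nat pmf \<Rightarrow> real" where
  "total_variation \<alpha> \<beta> =
     (SUP A. \<bar>measure (measure_pmf \<alpha>) A - measure (measure_pmf \<beta>) A\<bar>)"

definition uniformly_ergodic :: "(real \<Rightarrow> nat \<Rightarrow> nat pmf) \<Rightarrow> bool" where
  "uniformly_ergodic p \<longleftrightarrow>
     (\<exists>\<pi>. set_pmf \<pi> \<subseteq> {1..} \<and>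
        uniform_limit {1..} (\<lambda>t i. total_variation (p t i) \<pi>) (\<lambda>_. 0) at_top)"

text \<open>
  Since \<^typ>\<open>nat\<close> carries the discrete topology, the paths are piecewise constant with
  finitely many jumps in every bounded time interval.
\<close>

definition markov_jump_process ::
  "'a measure \<Rightarrow> (real \<Rightarrow> 'a \<Rightarrow> nat) \<Rightarrow> (real \<Rightarrow> nat \<Rightarrow> nat pmf) \<Rightarrow> bool" where
  "markov_jump_process M Y p \<longleftrightarrow>
     transition_function p \<and>
     (\<forall>t\<ge>0. Y t \<in> M \<rightarrow>\<^sub>M count_space UNIV) \<and>
     (\<forall>\<omega>\<in>space M. cadlag_on {0..} (\<lambda>t. Y t \<omega>) \<and> (\<forall>t\<ge>0. Y t \<omega> \<ge> 1)) \<and>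
     (\<forall>n t i. 0 \<le> t 0 \<and> (\<forall>k\<le>n. t k < t (Suc k)) \<and>
        \<P>(\<omega> in M. \<forall>k\<le>n. Y (t k) \<omega> = i k) > 0 \<longrightarrow>
        \<P>(\<omega> in M. Y (t (Suc n)) \<omega> = i (Suc n) \<bar> \<forall>k\<le>n. Y (t k) \<omega> = i k)
          = pmf (p (t (Suc n) - t n) (i n)) (i (Suc n)))"

definition markov_chain ::
  "'a measure \<Rightarrow> (nat \<Rightarrow> 'a \<Rightarrow> nat) \<Rightarrow> (nat \<Rightarrow> nat pmf) \<Rightarrow> bool" where
  "markov_chain M Y K \<longleftrightarrow>
     (\<forall>k. Y k \<in> M \<rightarrow>\<^sub>M count_space UNIV) \<and>
     (\<forall>\<omega>\<in>space M. \<forall>k. Y k \<omega> \<ge> 1) \<and>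
     (\<forall>i\<ge>1. set_pmf (K i) \<subseteq> {1..}) \<and>
     (\<forall>n i. \<P>(\<omega> in M. \<forall>k\<le>n. Y k \<omega> = i k) > 0 \<longrightarrow>
        \<P>(\<omega> in M. Y (Suc n) \<omega> = i (Suc n) \<bar> \<forall>k\<le>n. Y k \<omega> = i k) = pmf (K (i n)) (i (Suc n)))"

text \<open>
  The matrix with diagonal entries \<open>exp (- \<lambda>\<^sub>i h)\<close> (no jump of the limit process before
  time \<open>h\<close>) and off-diagonal entries \<open>p\<^sub>i\<^sub>j(h)\<close>.  The limit process may leave \<open>i\<close> and be back
  at time \<open>h\<close>, so \<open>exp (- \<lambda>\<^sub>i h) < p\<^sub>i\<^sub>i(h)\<close> if all jump rates are positive, and row \<open>i\<close> sums
  to \<open>1 - (p\<^sub>i\<^sub>i(h) - exp (- \<lambda>\<^sub>i h)) < 1\<close>: no Markov chain has exactly these entries.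
\<close>

definition step_entry ::
  "(real \<Rightarrow> nat \<Rightarrow> nat pmf) \<Rightarrow> (nat \<Rightarrow> real) \<Rightarrow> real \<Rightarrow> nat \<Rightarrow> nat \<Rightarrow> real" where
  "step_entry p lam h i j = (if i = j then exp (- lam i * h) else pmf (p h i) j)"

text \<open>
  A stochastic matrix obtained from \<^const>\<open>step_entry\<close> by distributing the missing mass
  (which is of order \<open>h\<^sup>2\<close>) over the entries of the row in an arbitrary way.  This
  includes the case of equality, diagonal entries \<open>p\<^sub>i\<^sub>i(h)\<close> with the off-diagonal entries
  unchanged, and diagonal entries \<open>exp (- \<lambda>\<^sub>i h)\<close> with renormalised off-diagonal ones.
\<close>

definition completes_step_matrix ::
  "(nat \<Rightarrow> nat pmf) \<Rightarrow> (real \<Rightarrow> nat \<Rightarrow> nat pmf) \<Rightarrow> (nat \<Rightarrow> real) \<Rightarrow> real \<Rightarrow> bool" where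
  "completes_step_matrix K p lam h \<longleftrightarrow>
     (\<forall>i\<ge>1. \<forall>j\<ge>1. step_entry p lam h i j \<le> pmf (K i) j)"


section \<open>Wiener process and Ito integral\<close>

definition wiener_process :: "'a measure \<Rightarrow> (real \<Rightarrow> 'a \<Rightarrow> real) \<Rightarrow> bool" where
  "wiener_process M W \<longleftrightarrow>
     (\<forall>t\<ge>0. W t \<in> borel_measurable M) \<and>
     (AE \<omega> in M. W 0 \<omega> = 0) \<and>
     (\<forall>s t. 0 \<le> s \<and> s < t \<longrightarrow>
        distributed M lborel (\<lambda>\<omega>. W t \<omega> - W s \<omega>) (normal_density 0 (sqrt (t - s)))) \<and>
     (\<forall>n t. 0 \<le> t 0 \<and> (\<forall>k<n. t k < t (Suc k)) \<longrightarrow>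
        prob_space.indep_vars M (\<lambda>_. borel) (\<lambda>k \<omega>. W (t (Suc k)) \<omega> - W (t k) \<omega>) {..<n::nat}) \<and>
     (AE \<omega> in M. continuous_on {0..} (\<lambda>t. W t \<omega>))"

definition joint_filtration ::
  "'a measure \<Rightarrow> (real \<Rightarrow> 'a \<Rightarrow> real) \<Rightarrow> (real \<Rightarrow> 'a \<Rightarrow> nat) \<Rightarrow> real \<Rightarrow> 'a measure" where
  "joint_filtration M W Y t =
     sigma (space M)
       ({W s -` A \<inter> space M |s A. 0 \<le> s \<and> s \<le> t \<and> A \<in> sets borel} \<union>
        {Y s -` B \<inter> space M |s B. 0 \<le> s \<and> s \<le> t})"

text \<open>
  A simple process \<open>\<Sum>\<^sub>k\<^sub><\<^sub>n \<xi>\<^sub>k 1\<^bsub>(t\<^sub>k, t\<^sub>k\<^sub>+\<^sub>1]\<^esub>\<close> on \<open>[0,T]\<close> is given by \<open>n\<close>, \<open>t\<close> and \<open>\<xi>\<close>.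
\<close>

definition simple_process ::
  "'a measure \<Rightarrow> (real \<Rightarrow> 'a measure) \<Rightarrow> real \<Rightarrow> nat \<Rightarrow> (nat \<Rightarrow> real) \<Rightarrow> (nat \<Rightarrow> 'a \<Rightarrow> real) \<Rightarrow> bool" where
  "simple_process M F T n t \<xi> \<longleftrightarrow>
     t 0 = 0 \<and> t n = T \<and> (\<forall>k<n. t k < t (Suc k)) \<and>
     (\<forall>k<n. \<xi> k \<in> borel_measurable (F (t k))) \<and>
     (\<exists>B. \<forall>k<n. \<forall>\<omega>\<in>space M. \<bar>\<xi> k \<omega>\<bar> \<le> B)"

definition simple_value ::
  "nat \<Rightarrow> (nat \<Rightarrow> real) \<Rightarrow> (nat \<Rightarrow> 'a \<Rightarrow> real) \<Rightarrow> real \<Rightarrow> 'a \<Rightarrow> real" where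
  "simple_value n t \<xi> s \<omega> = (\<Sum>k<n. \<xi> k \<omega> * indicator {t k<..t (Suc k)} s)"

definition simple_integral ::
  "(real \<Rightarrow> 'a \<Rightarrow> real) \<Rightarrow> nat \<Rightarrow> (nat \<Rightarrow> real) \<Rightarrow> (nat \<Rightarrow> 'a \<Rightarrow> real) \<Rightarrow> real \<Rightarrow> 'a \<Rightarrow> real" where
  "simple_integral W n t \<xi> s \<omega> =
     (\<Sum>k<n. \<xi> k \<omega> * (W (min (t (Suc k)) s) \<omega> - W (min (t k) s) \<omega>))"

text \<open>
  \<open>J\<close> is a continuous version of \<open>(\<integral>\<^sub>0\<^sup>t H\<^sub>s dW\<^sub>s)\<close>, \<open>t \<in> [0,T]\<close>: it is the mean-square limit
  of integrals of simple \<open>F\<close>-adapted processes approximating \<open>H\<close> in \<open>L\<^sup>2(ds \<otimes> M)\<close>.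
  By the Ito isometry this determines \<open>J\<close> up to indistinguishability.
\<close>

definition is_ito_integral ::
  "'a measure \<Rightarrow> (real \<Rightarrow> 'a measure) \<Rightarrow> (real \<Rightarrow> 'a \<Rightarrow> real) \<Rightarrow> real \<Rightarrow>
   (real \<Rightarrow> 'a \<Rightarrow> real) \<Rightarrow> (real \<Rightarrow> 'a \<Rightarrow> real) \<Rightarrow> bool" where
  "is_ito_integral M F W T H J \<longleftrightarrow>
     (\<lambda>(s, \<omega>). H s \<omega>) \<in> borel_measurable (restrict_space borel {0..T} \<Otimes>\<^sub>M M) \<and>
     (\<forall>t\<in>{0..T}. J t \<in> borel_measurable M) \<and>
     (\<forall>\<omega>\<in>space M. continuous_on {0..T} (\<lambda>t. J t \<omega>)) \<and>
     (\<exists>n t \<xi>. (\<forall>m. simple_process M F T (n m) (t m) (\<xi> m)) \<and>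
        (\<lambda>m. \<integral>\<^sup>+\<omega>. (\<integral>\<^sup>+s\<in>{0..T}. ennreal ((simple_value (n m) (t m) (\<xi> m) s \<omega> - H s \<omega>)\<^sup>2) \<partial>lborel) \<partial>M)
          \<longlonglongrightarrow> 0 \<and>
        (\<forall>s\<in>{0..T}.
          (\<lambda>m. \<integral>\<^sup>+\<omega>. ennreal ((simple_integral W (n m) (t m) (\<xi> m) s \<omega> - J s \<omega>)\<^sup>2) \<partial>M)
            \<longlonglongrightarrow> 0))"

end

theory Submission
  imports Defs
begin

text \<open>
  Freeze the path \<open>y\<close> of the environment.  Then the log-returns \<open>log (1 + R i (y (iT/N)))\<close>
  form a triangular array of independent variables of vanishing size, and \<open>y\<close> is constant between
  finitely many jumps.  Means and variances are Riemann sums along \<open>y\<close>, so characteristic functions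
  show that the increments over \<open>n\<close> blocks become independent normal variables with means
  \<open>\<integral> (\<mu> - \<sigma>\<^sup>2/2)(y\<^sub>s) ds\<close> and variances \<open>\<integral> \<sigma>\<^sup>2(y\<^sub>s) ds\<close>, while an exponential maximal inequality with
  parameter \<open>\<surd>n\<close> bounds the oscillation within the blocks.  Hence expectations of bounded Lipschitz
  functionals on the Skorokhod space converge for every fixed \<open>y\<close>.

  The transition matrices of the discrete environment and of the skeleton of the jump process at mesh
  \<open>T/N\<close> differ by \<open>O(N\<^sup>-\<^sup>2)\<close> in total variation, hence the laws of the \<open>N\<close>-step paths by \<open>O(1/N)\<close>,
  and the environment of the discrete model may be replaced by the jump process itself; then
  integrate over \<open>y\<close> by dominated convergence.

  The same Gaussian functionals describe the limit process.  The Ito integral is the mean-square limit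
  of \<open>\<Sum>\<^sub>k \<sigma> (Y (t k)) (W (t (k + 1)) - W (t k))\<close>, and given \<open>Y\<close> these sums have independent normal increments because
  \<open>W\<close> and \<open>Y\<close> are independent.
\<close>

section \<open>Weak convergence in metric spaces\<close>

text \<open>Tightness is replaced by a Cauchy argument. Every path is compared with the step path
  through its values at \<open>n\<close> coarse times, a continuous image of a point of a sequence
  space. For fixed \<open>n\<close> the step paths of the discrete models have a limit as N grows,
  and their error is small for all large N. Hence the expectations converge, and their limit is also
  the limit in \<open>n\<close> of the functionals \<open>limit_fid\<close>. It is never computed,
  only matched with the same functionals of the limit process. The comparison of paths is uniform in
  time, with an error that the test functional must not amplify beyond a constant factor; this is
  why Lipschitz functionals come in and have to be shown sufficient. The discrete environments live
  on different probability spaces. They meet the jump process only through laws of finite paths,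
  which is enough because the expectation given the environment is a bounded function of its first N
  steps. The mass missing from a transition row is a leave-and-return probability, two events of
  order 1/N each.\<close>

lemma space_borel_of_top [simp]: "space (borel_of_top S) = topspace S"
  unfolding borel_of_top_def by (rule space_measure_of) (auto dest: openin_subset)

lemma openin_in_sets_borel_of_top: "openin S U \<Longrightarrow> U \<in> sets (borel_of_top S)"
  unfolding borel_of_top_def
  by (subst sets_measure_of) (auto dest: openin_subset)

lemma measurable_borel_of_topI:
  assumes "\<And>\<omega>. \<omega> \<in> space N \<Longrightarrow> X \<omega> \<in> topspace S"
    and "\<And>U. openin S U \<Longrightarrow> X -` U \<inter> space N \<in> sets N"
  shows "X \<in> N \<rightarrow>\<^sub>M borel_of_top S"
  unfolding borel_of_top_def
  by (rule measurable_measure_of) (use assms in \<open>auto dest: openin_subset\<close>)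

lemma borel_measurable_continuous_map:
  fixes f :: "'x \<Rightarrow> real"
  assumes "continuous_map S euclideanreal f"
  shows "f \<in> borel_measurable (borel_of_top S)"
proof (rule borel_measurableI)
  fix U :: "real set" assume "open U"
  then have "openin S {x \<in> topspace S. f x \<in> U}"
    using assms by (intro openin_continuous_map_preimage) auto
  moreover have "f -` U \<inter> space (borel_of_top S) = {x \<in> topspace S. f x \<in> U}" by auto
  ultimately show "f -` U \<inter> space (borel_of_top S) \<in> sets (borel_of_top S)"
    by (simp add: openin_in_sets_borel_of_top)
qed

context Metric_space
begin

text \<open>Preimages of open sets are built by countable operations: the limit lies in
  \<open>U\<close> exactly if for some \<open>k\<close> the sequence is eventually in
  \<open>V k\<close>. One direction uses a ball around the limit inside \<open>U\<close>, the other
  that a point closer than \<open>1 / (k + 1)\<close> to a point of \<open>V k\<close> lies in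
  \<open>U\<close>.\<close>

lemma measurable_limit:
  assumes X: "\<And>n::nat. X n \<in> N \<rightarrow>\<^sub>M borel_of_top mtopology"
    and lim: "\<And>\<omega>. \<omega> \<in> space N \<Longrightarrow> limitin mtopology (\<lambda>n. X n \<omega>) (Z \<omega>) sequentially"
  shows "Z \<in> N \<rightarrow>\<^sub>M borel_of_top mtopology"
proof (rule measurable_borel_of_topI)
  fix \<omega> assume "\<omega> \<in> space N"
  then show "Z \<omega> \<in> topspace mtopology" using lim by (auto simp: limitin_metric)
next
  fix U assume U: "openin mtopology U"
  \<comment> \<open>The centres keep twice the radius inside \<open>U\<close>; the spare radius
    absorbs the distance from \<open>X n\<close> to its limit.\<close>
  define V where "V k = \<Union>{mball x (1 / real (Suc k)) | x. x \<in> M \<and> mball x (2 / real (Suc k)) \<subseteq> U}" for k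
  have V: "openin mtopology (V k)" for k
    unfolding V_def by (rule openin_Union) auto
  have XV: "X n -` V k \<inter> space N \<in> sets N" for n k
    using measurable_sets[OF X openin_in_sets_borel_of_top[OF V]] .
  have XM: "X n \<omega> \<in> M" if "\<omega> \<in> space N" for n \<omega>
    using measurable_space[OF X that] by simp
  have "Z -` U \<inter> space N = (\<Union>k. \<Union>m. \<Inter>n\<in>{m..}. X n -` V k \<inter> space N)" (is "_ = ?R")
  proof (intro equalityI subsetI)
    fix \<omega> assume "\<omega> \<in> Z -` U \<inter> space N"
    then have \<omega>: "\<omega> \<in> space N" "Z \<omega> \<in> U" by auto
    then obtain r where r: "r > 0" "mball (Z \<omega>) r \<subseteq> U" "Z \<omega> \<in> M"
      using U unfolding openin_mtopology by blast
    obtain k where "inverse (real (Suc k)) < r / 2"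
      using reals_Archimedean[of "r / 2"] r by auto
    then have k: "2 / real (Suc k) < r" by (simp add: field_simps)
    have "eventually (\<lambda>n. X n \<omega> \<in> M \<and> d (X n \<omega>) (Z \<omega>) < 1 / real (Suc k)) sequentially"
      using lim[OF \<omega>(1)] unfolding limitin_metric by (meson of_nat_0_less_iff zero_less_Suc zero_less_divide_1_iff)
    then obtain m where m: "\<And>n. n \<ge> m \<Longrightarrow> d (X n \<omega>) (Z \<omega>) < 1 / real (Suc k)"
      unfolding eventually_sequentially by blast
    have "mball (Z \<omega>) (2 / real (Suc k)) \<subseteq> U"
      using k r(2) mball_subset_concentric[of "2 / real (Suc k)" r "Z \<omega>"] by auto
    then have "X n \<omega> \<in> V k" if "n \<ge> m" for n
      using m[OF that] r(3) XM[OF \<omega>(1), of n] unfolding V_def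
      by (auto intro!: exI[of _ "mball (Z \<omega>) (1 / real (Suc k))"] simp: commute)
    then show "\<omega> \<in> ?R" using \<omega>(1) by auto
  next
    fix \<omega> assume "\<omega> \<in> ?R"
    then obtain k m where \<omega>: "\<omega> \<in> space N" and m: "\<And>n. n \<ge> m \<Longrightarrow> X n \<omega> \<in> V k" by auto
    have "eventually (\<lambda>n. X n \<omega> \<in> M \<and> d (X n \<omega>) (Z \<omega>) < 1 / real (Suc k)) sequentially"
      using lim[OF \<omega>(1)] unfolding limitin_metric by (meson of_nat_0_less_iff zero_less_Suc zero_less_divide_1_iff)
    then obtain m' where m': "\<And>n. n \<ge> m' \<Longrightarrow> d (X n \<omega>) (Z \<omega>) < 1 / real (Suc k)"
      unfolding eventually_sequentially by blast
    define n where "n = max m m'"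
    obtain x where x: "x \<in> M" "mball x (2 / real (Suc k)) \<subseteq> U" "X n \<omega> \<in> mball x (1 / real (Suc k))"
      using m[of n] unfolding V_def n_def by auto
    have ZM: "Z \<omega> \<in> M" using lim[OF \<omega>] by (auto simp: limitin_metric)
    have "d x (Z \<omega>) \<le> d x (X n \<omega>) + d (X n \<omega>) (Z \<omega>)"
      using x(1) ZM XM[OF \<omega>] by (intro triangle) auto
    also have "\<dots> < 1 / real (Suc k) + 1 / real (Suc k)"
      using x(3) m'[of n] by (intro add_strict_mono) (auto simp: n_def)
    finally have "d x (Z \<omega>) < 2 / real (Suc k)" by simp
    then have "Z \<omega> \<in> mball x (2 / real (Suc k))" using x ZM by simp
    with x(2) \<omega> show "\<omega> \<in> Z -` U \<inter> space N" by blast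
  qed
  also have "\<dots> \<in> sets N"
  proof -
    have "(\<Inter>n\<in>{m..}. X n -` V k \<inter> space N) \<in> sets N" for k m
      by (rule sets.countable_INT') (use XV in auto)
    then show ?thesis by (intro sets.countable_UN'') auto
  qed
  finally show "Z -` U \<inter> space N \<in> sets N" .
qed

lemma Lipschitz_continuous_map_real:
  fixes f :: "'a \<Rightarrow> real"
  assumes "L \<ge> 0" and "\<And>x y. x \<in> M \<Longrightarrow> y \<in> M \<Longrightarrow> \<bar>f x - f y\<bar> \<le> L * d x y"
  shows "continuous_map mtopology euclideanreal f"
  unfolding continuous_map_def
proof (intro conjI allI impI)
  fix U :: "real set" assume U: "openin euclidean U"
  show "openin mtopology {x \<in> topspace mtopology. f x \<in> U}"
    unfolding openin_mtopology
  proof (intro conjI allI impI)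
    fix x assume x: "x \<in> {x \<in> topspace mtopology. f x \<in> U}"
    then obtain e where e: "e > 0" "ball (f x) e \<subseteq> U" using U by (auto simp: open_contains_ball)
    \<comment> \<open>Dividing by \<open>L + 1\<close> instead of \<open>L\<close> covers
      \<open>L = 0\<close>.\<close>
    have "f y \<in> U" if "y \<in> mball x (e / (L + 1))" for y
    proof -
      have xy: "x \<in> M" "y \<in> M" "d x y < e / (L + 1)" using that by auto
      have "\<bar>f x - f y\<bar> \<le> (L + 1) * d x y"
        using assms(2)[OF xy(1,2)] nonneg[of x y] by (simp only: distrib_right mult_1_left)
      also have "\<dots> < e" using xy(3) assms(1) by (simp add: field_simps)
      finally show ?thesis using e(2) by (auto simp: dist_real_def subset_iff)
    qed
    then show "\<exists>r>0. mball x r \<subseteq> {x \<in> topspace mtopology. f x \<in> U}"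
      using e(1) assms(1) by (intro exI[of _ "e / (L + 1)"]) auto
  qed auto
qed auto

text \<open>
  The \<open>L\<close>-Lipschitz regularisation \<open>x \<mapsto> inf\<^sub>y (f y + L d x y)\<close> increases pointwise to \<open>f\<close>
  as \<open>L \<longrightarrow> \<infinity>\<close>.
\<close>

lemma Lipschitz_regularisation:
  fixes f :: "'a \<Rightarrow> real"
  assumes f: "continuous_map mtopology euclideanreal f" and B: "\<And>x. x \<in> M \<Longrightarrow> \<bar>f x\<bar> \<le> B"
  obtains F :: "nat \<Rightarrow> 'a \<Rightarrow> real" where
    "\<And>k x y. x \<in> M \<Longrightarrow> y \<in> M \<Longrightarrow> \<bar>F k x - F k y\<bar> \<le> real k * d x y"
    "\<And>k x. x \<in> M \<Longrightarrow> \<bar>F k x\<bar> \<le> B" "\<And>k x. x \<in> M \<Longrightarrow> F k x \<le> f x"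
    "\<And>x. x \<in> M \<Longrightarrow> (\<lambda>k. F k x) \<longlonglongrightarrow> f x"
proof
  define F where "F k x = (INF y\<in>M. f y + real k * d x y)" for k x
  have bdd: "bdd_below ((\<lambda>y. f y + real k * d x y) ` M)" for k x
  proof (rule bdd_belowI2)
    fix y assume "y \<in> M"
    then show "-B \<le> f y + real k * d x y"
      using B[of y] mult_nonneg_nonneg[OF of_nat_0_le_iff nonneg[of x y], of k] by linarith
  qed
  have le: "F k x \<le> f y + real k * d x y" if "y \<in> M" for k x y
    unfolding F_def by (rule cINF_lower[OF bdd that])
  show Ff: "F k x \<le> f x" if "x \<in> M" for k x using le[OF that, of k x] that by simp
  have low: "c \<le> F k x" if "x \<in> M" "\<And>y. y \<in> M \<Longrightarrow> c \<le> f y + real k * d x y" for c k x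
    unfolding F_def using that by (intro cINF_greatest) auto
  have "F k x \<le> F k y + real k * d x y" if xy: "x \<in> M" "y \<in> M" for k x y
  proof -
    have "F k x - real k * d x y \<le> F k y"
    proof (rule low[OF xy(2)])
      fix z assume z: "z \<in> M"
      have "F k x \<le> f z + real k * d x z" by (rule le[OF z])
      also have "\<dots> \<le> f z + real k * (d x y + d y z)"
        using triangle[OF xy z] by (intro add_mono mult_left_mono) auto
      finally show "F k x - real k * d x y \<le> f z + real k * d y z" by (simp add: algebra_simps)
    qed
    then show ?thesis by simp
  qed
  then show "\<bar>F k x - F k y\<bar> \<le> real k * d x y" if "x \<in> M" "y \<in> M" for k x y
    using that by (metis (no_types, lifting) abs_le_iff add.commute commute diff_le_eq minus_diff_eq)
  show "\<bar>F k x\<bar> \<le> B" if x: "x \<in> M" for k x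
  proof -
    have "-B \<le> F k x"
    proof (rule low[OF x])
      fix y assume "y \<in> M"
      then show "-B \<le> f y + real k * d x y"
        using B[of y] mult_nonneg_nonneg[OF of_nat_0_le_iff nonneg[of x y], of k] by linarith
    qed
    then show ?thesis using Ff[OF x, of k] B[OF x] by (simp add: abs_le_iff)
  qed
  show "(\<lambda>k. F k x) \<longlonglongrightarrow> f x" if x: "x \<in> M" for x
  proof (rule LIMSEQ_I)
    fix e :: real assume e: "e > 0"
    have "openin mtopology {y \<in> topspace mtopology. f y \<in> ball (f x) (e/2)}"
      by (rule openin_continuous_map_preimage[OF f]) auto
    then obtain r where r: "r > 0" "\<And>y. y \<in> M \<Longrightarrow> d x y < r \<Longrightarrow> \<bar>f x - f y\<bar> < e/2"
      using x e unfolding openin_mtopology by (fastforce simp: dist_real_def subset_iff)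
    \<comment> \<open>Once \<open>k * r\<close> is at least \<open>2 * B\<close>, the penalty
      outside the ball of radius \<open>r\<close> outweighs any possible drop of \<open>f\<close>,
      so only points near \<open>x\<close> compete in the infimum.\<close>
    obtain K :: nat where K: "2 * B / r \<le> real K" using real_arch_simple by blast
    have "norm (F k x - f x) < e" if k: "k \<ge> K" for k
    proof -
      have "f x - e/2 \<le> F k x"
      proof (rule low[OF x])
        fix y assume y: "y \<in> M"
        show "f x - e/2 \<le> f y + real k * d x y"
        proof (cases "d x y < r")
          case True
          then show ?thesis using r(2)[OF y] mult_nonneg_nonneg[OF of_nat_0_le_iff nonneg[of x y], of k] by linarith
        next
          case False
          have "2 * B \<le> real k * r" using K k r(1) by (simp add: field_simps) (metis dual_order.trans mult.commute mult_right_mono of_nat_mono less_imp_le)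
          also have "\<dots> \<le> real k * d x y" using False by (intro mult_left_mono) auto
          finally show ?thesis using B[OF x] B[OF y] e by (simp add: abs_le_iff)
        qed
      qed
      then show ?thesis using Ff[OF x, of k] e by simp
    qed
    then show "\<exists>K. \<forall>k\<ge>K. norm (F k x - f x) < e" by blast
  qed
qed

text \<open>Lipschitz minorants converging upwards to \<open>f\<close> give a lower bound for the
  limit inferior of the expectations; the upper bound is the same argument for
  \<open>-f\<close>.\<close>

lemma converges_weakly_Lipschitz:
  assumes P: "\<And>N. N \<ge> 1 \<Longrightarrow> prob_space (P N)" and Q: "prob_space Q"
    and X: "\<And>N::nat. N \<ge> 1 \<Longrightarrow> X N \<in> P N \<rightarrow>\<^sub>M borel_of_top mtopology"
    and Z: "Z \<in> Q \<rightarrow>\<^sub>M borel_of_top mtopology"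
    and lip: "\<And>(f :: 'a \<Rightarrow> real) L B. L \<ge> 0 \<Longrightarrow> (\<And>x y. x \<in> M \<Longrightarrow> y \<in> M \<Longrightarrow> \<bar>f x - f y\<bar> \<le> L * d x y) \<Longrightarrow>
        (\<And>x. x \<in> M \<Longrightarrow> \<bar>f x\<bar> \<le> B) \<Longrightarrow> (\<lambda>N. \<integral>\<omega>. f (X N \<omega>) \<partial>P N) \<longlonglongrightarrow> (\<integral>\<omega>. f (Z \<omega>) \<partial>Q)"
  shows "converges_weakly mtopology P X Q Z"
proof -
  interpret Q: prob_space Q by (rule Q)
  have ZM: "Z \<omega> \<in> M" if "\<omega> \<in> space Q" for \<omega> using measurable_space[OF Z that] by simp
  have XM: "X N \<omega> \<in> M" if "\<omega> \<in> space (P N)" "N \<ge> 1" for N \<omega>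
    using measurable_space[OF X[OF that(2)] that(1)] by simp
  \<comment> \<open>For a suitable \<open>k\<close> the minorant \<open>F k\<close> already loses
    less than \<open>e\<close> under the limit law, and \<open>F k\<close> is Lipschitz, so its
    expectations converge.\<close>
  have lower: "eventually (\<lambda>N. (\<integral>\<omega>. f (X N \<omega>) \<partial>P N) > (\<integral>\<omega>. f (Z \<omega>) \<partial>Q) - e) sequentially"
    if f: "continuous_map mtopology euclideanreal f" and B: "\<And>x. x \<in> M \<Longrightarrow> \<bar>f x\<bar> \<le> B" and e: "e > 0"
    for f :: "'a \<Rightarrow> real" and B e
  proof -
    obtain F :: "nat \<Rightarrow> 'a \<Rightarrow> real" where F:
      "\<And>k x y. x \<in> M \<Longrightarrow> y \<in> M \<Longrightarrow> \<bar>F k x - F k y\<bar> \<le> real k * d x y"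
      "\<And>k x. x \<in> M \<Longrightarrow> \<bar>F k x\<bar> \<le> B" "\<And>k x. x \<in> M \<Longrightarrow> F k x \<le> f x"
      "\<And>x. x \<in> M \<Longrightarrow> (\<lambda>k. F k x) \<longlonglongrightarrow> f x"
      using Lipschitz_regularisation[OF f B] by metis
    have Fc: "continuous_map mtopology euclideanreal (F k)" for k
      by (rule Lipschitz_continuous_map_real[of "real k"]) (use F(1) in auto)
    have "(\<lambda>k. \<integral>\<omega>. F k (Z \<omega>) \<partial>Q) \<longlonglongrightarrow> (\<integral>\<omega>. f (Z \<omega>) \<partial>Q)"
    proof (rule integral_dominated_convergence[where w="\<lambda>_. B"])
      show "(\<lambda>\<omega>. f (Z \<omega>)) \<in> borel_measurable Q"
        by (rule measurable_compose[OF Z borel_measurable_continuous_map[OF f]])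
      show "(\<lambda>\<omega>. F k (Z \<omega>)) \<in> borel_measurable Q" for k
        by (rule measurable_compose[OF Z borel_measurable_continuous_map[OF Fc]])
    qed (use F ZM in auto)
    then have "eventually (\<lambda>k. (\<integral>\<omega>. F k (Z \<omega>) \<partial>Q) > (\<integral>\<omega>. f (Z \<omega>) \<partial>Q) - e) sequentially"
      using e by (intro order_tendstoD) auto
    then obtain k where k: "(\<integral>\<omega>. F k (Z \<omega>) \<partial>Q) > (\<integral>\<omega>. f (Z \<omega>) \<partial>Q) - e"
      by (auto simp: eventually_sequentially)
    have "(\<lambda>N. \<integral>\<omega>. F k (X N \<omega>) \<partial>P N) \<longlonglongrightarrow> (\<integral>\<omega>. F k (Z \<omega>) \<partial>Q)"
      by (rule lip[of "real k" _ B]) (use F in auto)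
    then have "eventually (\<lambda>N. (\<integral>\<omega>. F k (X N \<omega>) \<partial>P N) > (\<integral>\<omega>. f (Z \<omega>) \<partial>Q) - e) sequentially"
      using k by (rule order_tendstoD)
    moreover have "eventually (\<lambda>N::nat. N \<ge> 1) sequentially" by (rule eventually_ge_at_top)
    ultimately show ?thesis
    proof eventually_elim
      case (elim N)
      interpret PN: prob_space "P N" by (rule P[OF elim(2)])
      have "(\<integral>\<omega>. F k (X N \<omega>) \<partial>P N) \<le> (\<integral>\<omega>. f (X N \<omega>) \<partial>P N)"
      proof (rule integral_mono)
        show "integrable (P N) (\<lambda>\<omega>. F k (X N \<omega>))"
          by (rule PN.integrable_const_bound[of _ B])
            (use F XM elim in \<open>auto intro!: AE_I2 measurable_compose[OF X borel_measurable_continuous_map[OF Fc]]\<close>)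
        show "integrable (P N) (\<lambda>\<omega>. f (X N \<omega>))"
          by (rule PN.integrable_const_bound[of _ B])
            (use B XM elim in \<open>auto intro!: AE_I2 measurable_compose[OF X borel_measurable_continuous_map[OF f]]\<close>)
      qed (use F(3) XM elim in auto)
      with elim show ?case by linarith
    qed
  qed
  show ?thesis
    unfolding converges_weakly_def
  proof (intro conjI allI impI)
    fix f :: "'a \<Rightarrow> real" assume "continuous_map mtopology euclideanreal f \<and> bounded (f ` topspace mtopology)"
    then have f: "continuous_map mtopology euclideanreal f" and "bounded (f ` M)" by auto
    then obtain B where B: "\<And>x. x \<in> M \<Longrightarrow> \<bar>f x\<bar> \<le> B" by (auto simp: bounded_iff)
    show "(\<lambda>N. \<integral>\<omega>. f (X N \<omega>) \<partial>P N) \<longlonglongrightarrow> (\<integral>\<omega>. f (Z \<omega>) \<partial>Q)"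
    proof (rule order_tendstoI)
      fix a assume a: "a < (\<integral>\<omega>. f (Z \<omega>) \<partial>Q)"
      show "eventually (\<lambda>N. a < (\<integral>\<omega>. f (X N \<omega>) \<partial>P N)) sequentially"
        using lower[OF f B, of "(\<integral>\<omega>. f (Z \<omega>) \<partial>Q) - a"] a by simp
    next
      fix a assume a: "(\<integral>\<omega>. f (Z \<omega>) \<partial>Q) < a"
      have mf: "continuous_map mtopology euclideanreal (\<lambda>x. - f x)"
        using f by (rule continuous_map_minus)
      show "eventually (\<lambda>N. (\<integral>\<omega>. f (X N \<omega>) \<partial>P N) < a) sequentially"
        using lower[OF mf, of B "a - (\<integral>\<omega>. f (Z \<omega>) \<partial>Q)"] a B by simp
    qed
  qed (use X Z in auto)
qed

end

section \<open>Step functions in the Skorokhod space\<close>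

text \<open>For \<open>n > 0\<close> the path equals \<open>x l\<close> on the l-th of
  \<open>n\<close> equal intervals, closed on the left, and \<open>x n\<close> at \<open>T\<close>;
  only \<open>x 0, ..., x n\<close> are read. Taking a whole sequence as argument places the values
  in a product space, where measurability can be checked coordinatewise.\<close>

definition grid_step :: "real \<Rightarrow> nat \<Rightarrow> (nat \<Rightarrow> real) \<Rightarrow> real \<Rightarrow> real" where
  "grid_step T n x = (\<lambda>t\<in>{0..T}. x (nat \<lfloor>t * real n / T\<rfloor>))"

lemma topspace_skorokhod [simp]: "topspace (skorokhod_topology T) = skorokhod_space T"
proof -
  interpret Metric_space "skorokhod_space T" "skorokhod_dist T" by (rule Metric_space_skorokhod)
  show ?thesis by (simp add: skorokhod_topology_def)
qed

lemma skorokhod_dist_le_sup: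
  assumes "x \<in> skorokhod_space T" "y \<in> skorokhod_space T" "0 \<le> r"
    and "\<And>t. t \<in> {0..T} \<Longrightarrow> \<bar>x t - y t\<bar> \<le> r"
  shows "skorokhod_dist T x y \<le> r"
  by (rule skorokhod_dist_le[OF assms(1,2)])
    (use assms(3,4) in \<open>auto simp: skorokhod_close_def intro!: bexI[OF _ time_changes_id]\<close>)

lemma grid_step_skorokhod:
  assumes T: "T > 0"
  shows "grid_step T n x \<in> skorokhod_space T"
proof -
  have "cadlag_on {0..T} (grid_step T n x)"
    unfolding cadlag_on_def
  proof (intro ballI conjI)
    fix t assume t: "t \<in> {0..T}"
    define a where "a = real n / T"
    have a: "a \<ge> 0" using T by (simp add: a_def)
    have fl: "\<lfloor>s * real n / T\<rfloor> = \<lfloor>s * a\<rfloor>" for s by (simp add: a_def)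
    have c: "isCont (\<lambda>s. s * a) t" by simp
    have "eventually (\<lambda>s. s * a < of_int \<lfloor>t * a\<rfloor> + 1) (at t)"
      by (rule order_tendstoD(2)[OF c[unfolded isCont_def]]) linarith
    then have "eventually (\<lambda>s. s * a < of_int \<lfloor>t * a\<rfloor> + 1) (at t within {0..T} \<inter> {t<..})"
      by (rule filter_leD[OF at_le, rotated]) simp
    moreover have "eventually (\<lambda>s. s \<in> {0..T} \<inter> {t<..}) (at t within {0..T} \<inter> {t<..})"
      by (auto simp: eventually_at_filter)
    ultimately have "eventually (\<lambda>s. grid_step T n x s = grid_step T n x t) (at t within {0..T} \<inter> {t<..})"
    proof eventually_elim
      case (elim s)
      have "t * a \<le> s * a" using elim a by (intro mult_right_mono) auto
      then have "\<lfloor>s * a\<rfloor> = \<lfloor>t * a\<rfloor>" using elim by (intro floor_unique) linarith+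
      then show ?case using elim t by (simp add: grid_step_def fl)
    qed
    then show "(grid_step T n x \<longlongrightarrow> grid_step T n x t) (at t within {0..T} \<inter> {t<..})"
      by (rule tendsto_eventually)
    \<comment> \<open>Just left of \<open>t\<close> the floor is the ceiling of \<open>t * a\<close>
      minus 1, also when \<open>t * a\<close> is an integer; this gives the left limit. The case
      \<open>a = 0\<close>, where \<open>s * a\<close> does not grow, is separate.\<close>
    have "eventually (\<lambda>s. s * a > of_int (\<lceil>t * a\<rceil> - 1)) (at t)"
      by (rule order_tendstoD(1)[OF c[unfolded isCont_def]]) linarith
    then have "eventually (\<lambda>s. s * a > of_int (\<lceil>t * a\<rceil> - 1)) (at t within {0..T} \<inter> {..<t})"
      by (rule filter_leD[OF at_le, rotated]) simp
    moreover have "eventually (\<lambda>s. s \<in> {0..T} \<inter> {..<t}) (at t within {0..T} \<inter> {..<t})"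
      by (auto simp: eventually_at_filter)
    ultimately have "eventually (\<lambda>s. grid_step T n x s =
        (if a = 0 then x 0 else x (nat (\<lceil>t * a\<rceil> - 1)))) (at t within {0..T} \<inter> {..<t})"
    proof eventually_elim
      case (elim s)
      show ?case
      proof (cases "a = 0")
        case True
        then show ?thesis using elim by (simp add: grid_step_def fl)
      next
        case False
        then have "s * a < t * a" using elim a by (intro mult_strict_right_mono) auto
        then have "\<lfloor>s * a\<rfloor> = \<lceil>t * a\<rceil> - 1" using elim by (intro floor_unique) linarith+
        then show ?thesis using elim False by (simp add: grid_step_def fl)
      qed
    qed
    then show "\<exists>l. (grid_step T n x \<longlongrightarrow> l) (at t within {0..T} \<inter> {..<t})"
      by (intro exI tendsto_eventually)
  qed
  then show ?thesis by (simp add: skorokhod_space_def grid_step_def)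
qed

lemma grid_index_le:
  assumes "T > 0" "t \<in> {0..T}"
  shows "nat \<lfloor>t * real n / T\<rfloor> \<le> n"
proof -
  have "t * real n / T \<le> T * real n / T" using assms by (intro divide_right_mono mult_right_mono) auto
  then have "\<lfloor>t * real n / T\<rfloor> \<le> int n" using assms by (simp add: floor_le_iff)
  then show ?thesis by simp
qed

lemma grid_step_dist_le:
  assumes T: "T > 0" and r: "0 \<le> r" and "\<And>l. l \<le> n \<Longrightarrow> \<bar>x l - y l\<bar> \<le> r"
  shows "skorokhod_dist T (grid_step T n x) (grid_step T n y) \<le> r"
  by (rule skorokhod_dist_le_sup[OF grid_step_skorokhod[OF T] grid_step_skorokhod[OF T] r])
    (use assms(3) grid_index_le[OF T] in \<open>auto simp: grid_step_def\<close>)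

text \<open>Changing the first \<open>n + 1\<close> coordinates by at most \<open>r / 2\<close>
  moves the step path by at most \<open>r / 2\<close>, so an open cylinder fits into the preimage.
  This continuity makes random step paths Borel for the Skorokhod topology and turns continuous
  functionals of paths into continuous functions of sequences.\<close>

lemma open_grid_step_vimage:
  assumes T: "T > 0" and U: "openin (skorokhod_topology T) U"
  shows "open {x. grid_step T n x \<in> U}"
proof (subst open_subopen, intro ballI)
  interpret Metric_space "skorokhod_space T" "skorokhod_dist T" by (rule Metric_space_skorokhod)
  fix x assume "x \<in> {x. grid_step T n x \<in> U}"
  then obtain r where r: "r > 0" "mball (grid_step T n x) r \<subseteq> U"
    using U unfolding skorokhod_topology_def openin_mtopology by blast
  let ?V = "{y :: nat \<Rightarrow> real. \<forall>l\<in>{..n}. y l \<in> ball (x l) (r/2)}"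
  have "open ?V"
  proof -
    have "?V = (\<Inter>l\<in>{..n}. (\<lambda>y. y l) -` ball (x l) (r/2))" by auto
    also have "open \<dots>"
      by (intro open_INT ballI open_vimage) (auto intro: continuous_on_product_coordinates)
    finally show ?thesis .
  qed
  moreover have "?V \<subseteq> {x. grid_step T n x \<in> U}"
  proof
    fix y assume y: "y \<in> ?V"
    have "skorokhod_dist T (grid_step T n x) (grid_step T n y) \<le> r/2"
      using y r by (intro grid_step_dist_le[OF T]) (auto simp: dist_real_def less_imp_le)
    then have "grid_step T n y \<in> mball (grid_step T n x) r"
      using r grid_step_skorokhod[OF T] by auto
    then show "y \<in> {x. grid_step T n x \<in> U}" using r by auto
  qed
  moreover have "x \<in> ?V" using r by auto
  ultimately show "\<exists>V. open V \<and> x \<in> V \<and> V \<subseteq> {x. grid_step T n x \<in> U}" by blast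
qed

lemma measurable_grid_step [measurable]:
  assumes "T > 0"
  shows "grid_step T n \<in> borel \<rightarrow>\<^sub>M borel_of_top (skorokhod_topology T)"
  by (rule measurable_borel_of_topI)
    (use grid_step_skorokhod[OF assms] open_grid_step_vimage[OF assms] in
      \<open>auto simp: vimage_def intro!: borel_open\<close>)

lemma measurable_nat_fun:
  fixes X :: "nat \<Rightarrow> 'a \<Rightarrow> real"
  assumes "\<And>l. X l \<in> borel_measurable N"
  shows "(\<lambda>\<omega> l. X l \<omega>) \<in> borel_measurable N"
  by (rule measurable_coordinatewise_then_product) (use assms in auto)

text \<open>Uniform continuity on the compact interval: \<open>t\<close> and the grid point to its
  left are less than \<open>T / n\<close> apart. For indices above \<open>n\<close>, which the step
  path does not read, \<open>min T\<close> keeps the sampling time inside the interval.\<close>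

lemma grid_sample_dist_small:
  fixes z :: "real \<Rightarrow> real"
  assumes T: "T > 0" and z: "continuous_on {0..T} z" and e: "e > 0"
  shows "eventually (\<lambda>n. \<forall>t\<in>{0..T}. \<bar>grid_step T n (\<lambda>l. z (min T (real l * T / real n))) t - z t\<bar> \<le> e) sequentially"
proof -
  have "uniformly_continuous_on {0..T} z"
    using z by (intro compact_uniformly_continuous) auto
  then obtain r where r: "r > 0" "\<And>s t. s \<in> {0..T} \<Longrightarrow> t \<in> {0..T} \<Longrightarrow> dist t s < r \<Longrightarrow> dist (z t) (z s) < e"
    using e unfolding uniformly_continuous_on_def by blast
  have "eventually (\<lambda>n. T / real n < r) sequentially"
    using r(1) by (intro order_tendstoD[OF lim_const_over_n])
  then show ?thesis
    using eventually_gt_at_top[of 0]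
  proof (eventually_elim, intro ballI)
    fix n t assume n: "T / real n < r" "0 < n" and t: "t \<in> {0..T}"
    define l where "l = nat \<lfloor>t * real n / T\<rfloor>"
    have l: "real l \<le> t * real n / T" "t * real n / T < real l + 1"
      using t T unfolding l_def by (auto simp: of_nat_nat)
    have 1: "real l * T / real n \<le> t" "t < real l * T / real n + T / real n"
      using l n T by (auto simp: field_simps)
    have 2: "min T (real l * T / real n) = real l * T / real n" using 1 t by auto
    have "dist (z (real l * T / real n)) (z t) < e"
      using 1 n t T by (intro r(2)) (auto simp: dist_real_def)
    then show "\<bar>grid_step T n (\<lambda>l. z (min T (real l * T / real n))) t - z t\<bar> \<le> e"
      using t by (simp add: grid_step_def l_def[symmetric] 2 dist_real_def)
  qed
qed

lemma continuous_restrict_skorokhod: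
  assumes "continuous_on {0..T} z"
  shows "(\<lambda>t\<in>{0..T}. z t) \<in> skorokhod_space T"
proof -
  have "((\<lambda>t\<in>{0..T}. z t) \<longlongrightarrow> z t) (at t within {0..T} \<inter> A)" if "t \<in> {0..T}" for t A
  proof -
    have "(z \<longlongrightarrow> z t) (at t within {0..T} \<inter> A)"
      using assms that by (meson continuous_on_def inf_le1 tendsto_within_subset)
    then show ?thesis
      by (rule Lim_transform_eventually) (auto simp: eventually_at_filter)
  qed
  then show ?thesis
    unfolding skorokhod_space_def cadlag_on_def by auto blast
qed

text \<open>The coordinates are measurable, while the target carries the Borel sets of the Skorokhod
  topology. Sampled step paths bridge the gap: they are measurable through \<open>grid_step\<close>
  and converge uniformly to the continuous path.\<close>

lemma measurable_continuous_skorokhod: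
  fixes Z :: "real \<Rightarrow> 'a \<Rightarrow> real"
  assumes T: "T > 0" and Z: "\<And>t. t \<in> {0..T} \<Longrightarrow> Z t \<in> borel_measurable Q"
    and c: "\<And>\<omega>. \<omega> \<in> space Q \<Longrightarrow> continuous_on {0..T} (\<lambda>t. Z t \<omega>)"
  shows "(\<lambda>\<omega>. \<lambda>t\<in>{0..T}. Z t \<omega>) \<in> Q \<rightarrow>\<^sub>M borel_of_top (skorokhod_topology T)"
proof -
  interpret Metric_space "skorokhod_space T" "skorokhod_dist T" by (rule Metric_space_skorokhod)
  show ?thesis
    unfolding skorokhod_topology_def
  proof (rule measurable_limit)
    let ?X = "\<lambda>n \<omega>. grid_step T n (\<lambda>l. Z (min T (real l * T / real n)) \<omega>)"
    show "?X n \<in> Q \<rightarrow>\<^sub>M borel_of_top mtopology" for n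
      unfolding skorokhod_topology_def[symmetric]
      by (rule measurable_compose[OF measurable_nat_fun measurable_grid_step[OF T]])
        (use T in \<open>auto intro!: Z\<close>)
    fix \<omega> assume \<omega>: "\<omega> \<in> space Q"
    note sp = continuous_restrict_skorokhod[OF c[OF \<omega>]]
    show "limitin mtopology (\<lambda>n. ?X n \<omega>) (\<lambda>t\<in>{0..T}. Z t \<omega>) sequentially"
      unfolding limitin_metric
    proof (intro conjI allI impI sp)
      fix e :: real assume e: "e > 0"
      then have "e / 2 > 0" by simp
      from grid_sample_dist_small[OF T c[OF \<omega>] this]
      show "eventually (\<lambda>n. ?X n \<omega> \<in> skorokhod_space T \<and>
          skorokhod_dist T (?X n \<omega>) (\<lambda>t\<in>{0..T}. Z t \<omega>) < e) sequentially"
      proof eventually_elim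
        case (elim n)
        have "skorokhod_dist T (?X n \<omega>) (\<lambda>t\<in>{0..T}. Z t \<omega>) \<le> e / 2"
          using elim e by (intro skorokhod_dist_le_sup[OF grid_step_skorokhod[OF T] sp]) auto
        then show ?case using e grid_step_skorokhod[OF T] by auto
      qed
    qed
  qed
qed

section \<open>Path laws of Markov chains\<close>

lemma integrable_measure_pmf_bounded:
  fixes f :: "'x \<Rightarrow> real"
  assumes "\<And>x. x \<in> set_pmf q \<Longrightarrow> \<bar>f x\<bar> \<le> B"
  shows "integrable (measure_pmf q) f"
  by (rule measure_pmf.integrable_const_bound[of _ B]) (use assms in \<open>auto simp: AE_measure_pmf_iff\<close>)

lemma integral_measure_pmf_le:
  fixes f :: "'x \<Rightarrow> real"
  assumes "\<And>x. x \<in> set_pmf q \<Longrightarrow> \<bar>f x\<bar> \<le> B"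
  shows "\<bar>\<integral>x. f x \<partial>measure_pmf q\<bar> \<le> B"
proof -
  have i: "integrable (measure_pmf q) f" by (rule integrable_measure_pmf_bounded) (fact assms)
  have "(\<integral>x. f x \<partial>measure_pmf q) \<le> B"
    by (rule measure_pmf.integral_le_const[OF i]) (use assms in \<open>auto simp: AE_measure_pmf_iff abs_le_iff\<close>)
  moreover have "-B \<le> (\<integral>x. f x \<partial>measure_pmf q)"
    by (rule measure_pmf.integral_ge_const[OF i]) (use assms in \<open>auto simp: AE_measure_pmf_iff abs_le_iff minus_le_iff\<close>)
  ultimately show ?thesis by (simp add: abs_le_iff)
qed

lemma integral_bind_pmf_bounded:
  fixes f :: "'y \<Rightarrow> real"
  assumes "\<And>y. \<bar>f y\<bar> \<le> B"
  shows "(\<integral>y. f y \<partial>measure_pmf (bind_pmf q k)) = (\<integral>x. (\<integral>y. f y \<partial>measure_pmf (k x)) \<partial>measure_pmf q)"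
  unfolding measure_pmf_bind
  by (rule integral_bind[where K="count_space UNIV" and B=B and B'=1])
    (use assms in \<open>auto simp: measure_pmf.emeasure_space_1[simplified] measure_pmf.finite_measure_axioms measurable_def measure_pmf_in_subprob_algebra\<close>)

text \<open>Paths are listed in reverse order, the current state first.\<close>

definition rev_path :: "(nat \<Rightarrow> 'a \<Rightarrow> nat) \<Rightarrow> nat \<Rightarrow> 'a \<Rightarrow> nat list" where
  "rev_path Y n \<omega> = map (\<lambda>k. Y k \<omega>) (rev [0..<Suc n])"

lemma rev_path_0 [simp]: "rev_path Y 0 \<omega> = [Y 0 \<omega>]"
  and rev_path_Suc [simp]: "rev_path Y (Suc n) \<omega> = Y (Suc n) \<omega> # rev_path Y n \<omega>"
  by (simp_all add: rev_path_def)

lemma rev_path_nth: "k \<le> n \<Longrightarrow> rev_path Y n \<omega> ! (n - k) = Y k \<omega>"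
  by (induction n) (auto simp: le_Suc_eq Suc_diff_le)

lemma rev_path_eq_iff: "rev_path Y n \<omega> = rev_path Y n \<omega>' \<longleftrightarrow> (\<forall>k\<le>n. Y k \<omega> = Y k \<omega>')"
  by (induction n) (auto simp: le_Suc_eq)

lemma measurable_rev_path:
  assumes "\<And>k. Y k \<in> M \<rightarrow>\<^sub>M count_space UNIV"
  shows "rev_path Y n \<in> M \<rightarrow>\<^sub>M count_space UNIV"
proof (induction n)
  case 0
  show ?case using measurable_compose[OF assms[of 0], of "\<lambda>j. [j]" "count_space UNIV"] by simp
next
  case (Suc n)
  have "(\<lambda>\<omega>. (Y (Suc n) \<omega>, rev_path Y n \<omega>)) \<in> M \<rightarrow>\<^sub>M count_space UNIV"
    using measurable_Pair[OF assms[of "Suc n"] Suc] by (simp add: pair_measure_countable)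
  from measurable_compose[OF this, of "\<lambda>(j, xs). j # xs" "count_space UNIV"] show ?case by simp
qed

text \<open>Law of the reversed path of the states 0 to n. With the current state at the head, a
  step conses a state drawn from the kernel at \<open>hd\<close>.\<close>

primrec chain_law :: "(nat \<Rightarrow> nat pmf) \<Rightarrow> nat \<Rightarrow> nat \<Rightarrow> nat list pmf" where
  "chain_law K i 0 = return_pmf [i]"
| "chain_law K i (Suc n) = bind_pmf (chain_law K i n) (\<lambda>xs. map_pmf (\<lambda>j. j # xs) (K (hd xs)))"

text \<open>Consing is injective, so the only history leading to \<open>j # ys\<close> is
  \<open>ys\<close> and the mixture collapses to one product.\<close>

lemma pmf_chain_law_Suc:
  "pmf (chain_law K i (Suc n)) (j # ys) = pmf (chain_law K i n) ys * pmf (K (hd ys)) j"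
proof -
  have *: "pmf (map_pmf (\<lambda>j. j # zs) (K (hd zs))) (j # ys) = indicator {ys} zs * pmf (K (hd ys)) j" for zs
  proof (cases "zs = ys")
    case True
    then show ?thesis using pmf_map_inj'[of "\<lambda>j. j # ys" "K (hd ys)" j] by (simp add: inj_def)
  next
    case False
    then have "j # ys \<notin> set_pmf (map_pmf (\<lambda>j. j # zs) (K (hd zs)))" by auto
    then show ?thesis using False by (simp add: pmf_eq_0_set_pmf)
  qed
  show ?thesis by (simp add: pmf_bind * measure_pmf_single)
qed

lemma chain_law_hd:
  assumes "\<And>i. i \<ge> 1 \<Longrightarrow> set_pmf (K i) \<subseteq> {1..}" "i \<ge> 1" "xs \<in> set_pmf (chain_law K i n)"
  shows "hd xs \<ge> 1"
  using assms(3)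
proof (induction n arbitrary: xs)
  case 0
  then show ?case using assms(2) by simp
next
  case (Suc n)
  then obtain ys j where "ys \<in> set_pmf (chain_law K i n)" "xs = j # ys" "j \<in> set_pmf (K (hd ys))"
    by (auto simp: set_bind_pmf)
  then show ?case using Suc.IH[of ys] assms(1)[of "hd ys"] by auto
qed

lemma (in prob_space) prob_rev_path:
  assumes chain: "markov_chain M Y K" and Y0: "\<And>\<omega>. \<omega> \<in> space M \<Longrightarrow> Y 0 \<omega> = i0"
  shows "prob {\<omega> \<in> space M. rev_path Y n \<omega> = xs} = pmf (chain_law K i0 n) xs"
proof (induction n arbitrary: xs)
  case 0
  have "{\<omega> \<in> space M. rev_path Y 0 \<omega> = xs} = (if xs = [i0] then space M else {})" using Y0 by auto
  then show ?case by (simp add: prob_space)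
next
  case (Suc n)
  have Ym [measurable]: "Y k \<in> M \<rightarrow>\<^sub>M count_space UNIV" for k using chain by (simp add: markov_chain_def)
  note pm [measurable] = measurable_rev_path[of Y M, OF Ym]
  show ?case
  proof (cases xs)
    case Nil
    have "[] \<notin> set_pmf (chain_law K i0 (Suc n))" by (auto simp: set_bind_pmf)
    then show ?thesis using Nil by (simp add: pmf_eq_0_set_pmf)
  next
    case (Cons j ys)
    have sub: "{\<omega> \<in> space M. rev_path Y (Suc n) \<omega> = xs} = {\<omega> \<in> space M. Y (Suc n) \<omega> = j \<and> rev_path Y n \<omega> = ys}"
      using Cons by auto
    show ?thesis
    proof (cases "prob {\<omega> \<in> space M. rev_path Y n \<omega> = ys} > 0")
      \<comment> \<open>The Markov property only speaks of histories of positive probability; after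
        a null history both sides vanish.\<close>
      case False
      then have 0: "prob {\<omega> \<in> space M. rev_path Y n \<omega> = ys} = 0"
        using measure_nonneg[of M "{\<omega> \<in> space M. rev_path Y n \<omega> = ys}"] by linarith
      have "prob {\<omega> \<in> space M. Y (Suc n) \<omega> = j \<and> rev_path Y n \<omega> = ys} \<le> prob {\<omega> \<in> space M. rev_path Y n \<omega> = ys}"
        by (rule finite_measure_mono) auto
      then have "prob {\<omega> \<in> space M. rev_path Y (Suc n) \<omega> = xs} = 0"
        using 0 sub measure_nonneg[of M "{\<omega> \<in> space M. Y (Suc n) \<omega> = j \<and> rev_path Y n \<omega> = ys}"] by simp
      then show ?thesis using 0 Suc[of ys] by (simp only: Cons pmf_chain_law_Suc)
    next
      case True
      then have "{\<omega> \<in> space M. rev_path Y n \<omega> = ys} \<noteq> {}" by (metis less_irrefl measure_empty)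
      then obtain \<omega>0 where \<omega>0: "\<omega>0 \<in> space M" "rev_path Y n \<omega>0 = ys" by auto
      \<comment> \<open>A sample point realising the history turns the list \<open>ys\<close> into
        the state sequence on which \<open>markov_chain\<close> conditions; slot
        \<open>n + 1\<close> holds the new state.\<close>
      define i where "i k = (if k = Suc n then j else Y k \<omega>0)" for k
      have eq: "rev_path Y n \<omega> = ys \<longleftrightarrow> (\<forall>k\<le>n. Y k \<omega> = i k)" for \<omega>
        unfolding \<omega>0(2)[symmetric] rev_path_eq_iff by (auto simp: i_def)
      have hd: "hd ys = i n" using \<omega>0(2) by (cases n) (auto simp: i_def)
      have "\<P>(\<omega> in M. Y (Suc n) \<omega> = i (Suc n) \<bar> \<forall>k\<le>n. Y k \<omega> = i k) = pmf (K (i n)) (i (Suc n))"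
        using chain True unfolding markov_chain_def eq by blast
      then have "prob {\<omega> \<in> space M. Y (Suc n) \<omega> = j \<and> rev_path Y n \<omega> = ys}
          = prob {\<omega> \<in> space M. rev_path Y n \<omega> = ys} * pmf (K (hd ys)) j"
        using True by (simp add: cond_prob_def eq hd field_simps i_def)
      then show ?thesis using sub Suc[of ys] by (simp only: Cons pmf_chain_law_Suc)
    qed
  qed
qed

lemma (in prob_space) distr_rev_path:
  assumes chain: "markov_chain M Y K" and Y0: "\<And>\<omega>. \<omega> \<in> space M \<Longrightarrow> Y 0 \<omega> = i0"
  shows "distr M (count_space UNIV) (rev_path Y n) = measure_pmf (chain_law K i0 n)"
proof (rule measure_eqI_countable[where A=UNIV])
  have Ym: "Y k \<in> M \<rightarrow>\<^sub>M count_space UNIV" for k using chain by (simp add: markov_chain_def)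
  note pm = measurable_rev_path[of Y M, OF Ym]
  fix xs :: "nat list"
  have "emeasure (distr M (count_space UNIV) (rev_path Y n)) {xs} = emeasure M (rev_path Y n -` {xs} \<inter> space M)"
    by (rule emeasure_distr[OF pm]) simp
  also have "rev_path Y n -` {xs} \<inter> space M = {\<omega> \<in> space M. rev_path Y n \<omega> = xs}" by auto
  finally show "emeasure (distr M (count_space UNIV) (rev_path Y n)) {xs} = emeasure (measure_pmf (chain_law K i0 n)) {xs}"
    by (simp add: emeasure_eq_measure prob_rev_path[OF chain Y0] emeasure_pmf_single)
qed auto

lemma (in prob_space) expectation_rev_path:
  fixes \<phi> :: "nat list \<Rightarrow> real"
  assumes chain: "markov_chain M Y K" and Y0: "\<And>\<omega>. \<omega> \<in> space M \<Longrightarrow> Y 0 \<omega> = i0"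
  shows "(\<integral>\<omega>. \<phi> (rev_path Y n \<omega>) \<partial>M) = (\<integral>xs. \<phi> xs \<partial>measure_pmf (chain_law K i0 n))"
proof -
  have Ym: "Y k \<in> M \<rightarrow>\<^sub>M count_space UNIV" for k using chain by (simp add: markov_chain_def)
  show ?thesis
    by (subst distr_rev_path[OF chain Y0, symmetric]) (auto intro!: integral_distr[symmetric] measurable_rev_path Ym)
qed

text \<open>One-step errors add up along the path. Integrating a [0,1]-valued test function over its
  last state leaves a [0,1]-valued function of the shorter path, so the induction pays
  \<open>e\<close> once per step.\<close>

lemma chain_law_diff:
  fixes \<phi> :: "nat list \<Rightarrow> real"
  assumes close: "\<And>i \<psi>. i \<ge> 1 \<Longrightarrow> (\<And>j. 0 \<le> \<psi> j \<and> \<psi> j \<le> 1) \<Longrightarrow>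
        \<bar>(\<integral>j. \<psi> j \<partial>measure_pmf (K i)) - (\<integral>j. \<psi> j \<partial>measure_pmf (K' i))\<bar> \<le> e"
    and K': "\<And>i. i \<ge> 1 \<Longrightarrow> set_pmf (K' i) \<subseteq> {1..}" and i0: "i0 \<ge> 1"
    and \<phi>: "\<And>xs. 0 \<le> \<phi> xs \<and> \<phi> xs \<le> 1"
  shows "\<bar>(\<integral>xs. \<phi> xs \<partial>measure_pmf (chain_law K i0 n)) - (\<integral>xs. \<phi> xs \<partial>measure_pmf (chain_law K' i0 n))\<bar> \<le> real n * e"
  using \<phi>
proof (induction n arbitrary: \<phi>)
  case 0
  then show ?case by simp
next
  case (Suc n)
  let ?k = "\<lambda>K xs. \<integral>j. \<phi> (j # xs) \<partial>measure_pmf (K (hd xs))"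
  have step: "(\<integral>xs. \<phi> xs \<partial>measure_pmf (chain_law K i0 (Suc n))) = (\<integral>xs. ?k K xs \<partial>measure_pmf (chain_law K i0 n))" for K
    using Suc.prems by (simp only: chain_law.simps) (subst integral_bind_pmf_bounded[where B=1], auto)
  have k01: "0 \<le> ?k K xs \<and> ?k K xs \<le> 1" for K xs
    using integral_measure_pmf_le[of "K (hd xs)" "\<lambda>j. \<phi> (j # xs)" 1] Suc.prems
    by (auto intro: integral_nonneg_AE simp: abs_le_iff)
  \<comment> \<open>The law of the first \<open>n\<close> steps is changed while the last kernel is
    still \<open>K\<close>. Then the last kernel is changed under the law built from
    \<open>K'\<close>, whose current states are at least 1, so that \<open>close\<close>
    applies.\<close>
  have 1: "\<bar>(\<integral>xs. ?k K xs \<partial>measure_pmf (chain_law K i0 n)) - (\<integral>xs. ?k K xs \<partial>measure_pmf (chain_law K' i0 n))\<bar> \<le> real n * e"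
    by (rule Suc.IH) (rule k01)
  have "\<bar>\<integral>xs. ?k K xs - ?k K' xs \<partial>measure_pmf (chain_law K' i0 n)\<bar> \<le> e"
    using chain_law_hd[of K', OF K' i0] Suc.prems by (intro integral_measure_pmf_le close) auto
  also have "(\<integral>xs. ?k K xs - ?k K' xs \<partial>measure_pmf (chain_law K' i0 n)) =
      (\<integral>xs. ?k K xs \<partial>measure_pmf (chain_law K' i0 n)) - (\<integral>xs. ?k K' xs \<partial>measure_pmf (chain_law K' i0 n))"
    using k01 by (intro Bochner_Integration.integral_diff integrable_measure_pmf_bounded[where B=1]) (auto simp: abs_le_iff intro: order_trans[of _ 0])
  finally have 2: "\<bar>\<dots>\<bar> \<le> e" .
  have "real (Suc n) * e = real n * e + e" by (simp add: algebra_simps)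
  then show ?case using 1 2 unfolding step by linarith
qed

text \<open>Off \<open>i\<close> the law \<open>q'\<close> dominates \<open>q\<close>, so it arises
  from \<open>q\<close> by moving the mass \<open>q i - q' i\<close> away from \<open>i\<close>.
  Monotonicity, applied to a test function and to its complement on the other states, bounds its
  change there by this mass.\<close>

lemma pmf_diff_le:
  fixes \<psi> :: "nat \<Rightarrow> real"
  assumes le: "\<And>j. j \<noteq> i \<Longrightarrow> pmf q j \<le> pmf q' j" and d: "pmf q i - pmf q' i \<le> e"
    and \<psi>: "\<And>j. 0 \<le> \<psi> j \<and> \<psi> j \<le> 1"
  shows "\<bar>(\<integral>j. \<psi> j \<partial>measure_pmf q') - (\<integral>j. \<psi> j \<partial>measure_pmf q)\<bar> \<le> e"
proof -
  define D where "D q = (\<lambda>f::nat\<Rightarrow>real. \<integral>j. f j \<partial>measure_pmf q)" for q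
  have int: "integrable (measure_pmf q) f" if "\<And>j. \<bar>f j\<bar> \<le> 1" for f :: "nat \<Rightarrow> real" and q
    by (rule integrable_measure_pmf_bounded[where B=1]) (rule that)
  have mono: "D q f \<le> D q' f" if f: "\<And>j. 0 \<le> f j \<and> f j \<le> 1" "f i = 0" for f
  proof -
    have a: "\<bar>f j\<bar> \<le> 1" for j using f(1)[of j] by auto
    have "ennreal (D q f) = (\<integral>\<^sup>+j. ennreal (f j) \<partial>measure_pmf q)"
      unfolding D_def using f(1) by (intro nn_integral_eq_integral[symmetric] int a) auto
    also have "\<dots> \<le> (\<integral>\<^sup>+j. ennreal (f j) \<partial>measure_pmf q')"
      unfolding nn_integral_measure_pmf
    proof (rule nn_integral_mono)
      fix j show "ennreal (pmf q j) * ennreal (f j) \<le> ennreal (pmf q' j) * ennreal (f j)"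
        using le[of j] f(2) by (cases "j = i") (auto intro!: mult_right_mono ennreal_leI)
    qed
    also have "\<dots> = ennreal (D q' f)"
      unfolding D_def using f(1) by (intro nn_integral_eq_integral int a) auto
    finally show ?thesis
      using f(1) by (subst (asm) ennreal_le_iff) (auto simp: D_def intro: integral_nonneg_AE)
  qed
  have split: "D r f = f i * pmf r i + D r (\<lambda>j. f j * indicator (-{i}) j)" if f: "\<And>j. 0 \<le> f j \<and> f j \<le> 1" for f r
  proof -
    have "D r f = D r (\<lambda>j. f i * indicator {i} j + f j * indicator (-{i}) j)"
      unfolding D_def by (intro Bochner_Integration.integral_cong) (auto simp: indicator_def)
    also have "\<dots> = f i * pmf r i + D r (\<lambda>j. f j * indicator (-{i}) j)"
    proof -
      have a: "\<bar>f j\<bar> \<le> 1" for j using f[of j] by auto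
      have "integrable (measure_pmf r) (\<lambda>j. f i * indicator {i} j)"
        "integrable (measure_pmf r) (\<lambda>j. f j * indicator (-{i}) j)"
        using a by (auto intro!: int simp: indicator_def)
      then show ?thesis unfolding D_def
        by (subst Bochner_Integration.integral_add) (simp_all add: measure_pmf_single)
    qed
    finally show ?thesis .
  qed
  have one: "D r (\<lambda>j. 1 * indicator (-{i}) j) = 1 - pmf r i" for r
    using split[of "\<lambda>_. 1" r] by (simp add: D_def)
  let ?f = "\<lambda>j. \<psi> j * indicator (-{i}) j" and ?g = "\<lambda>j. (1 - \<psi> j) * indicator (-{i}) j :: real"
  have fg: "D r ?g = 1 - pmf r i - D r ?f" for r
  proof -
    have "D r ?g = D r (\<lambda>j. 1 * indicator (-{i}) j - ?f j)" unfolding D_def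
      by (intro Bochner_Integration.integral_cong) (auto simp: algebra_simps)
    also have "\<dots> = D r (\<lambda>j. 1 * indicator (-{i}) j) - D r ?f"
      unfolding D_def using \<psi> by (intro Bochner_Integration.integral_diff int) (auto simp: indicator_def abs_le_iff intro: order_trans[of _ 0])
    finally show ?thesis using one by simp
  qed
  have m1: "D q ?f \<le> D q' ?f" by (rule mono) (use \<psi> in \<open>auto simp: indicator_def\<close>)
  have m2: "D q ?g \<le> D q' ?g" by (rule mono) (use \<psi> in \<open>auto simp: indicator_def\<close>)
  define \<delta> where "\<delta> = pmf q i - pmf q' i"
  have \<delta>: "0 \<le> \<delta>" "\<delta> \<le> e" "D q' ?f - D q ?f \<le> \<delta>" using m1 m2 fg d by (auto simp: \<delta>_def)
  have "D q' \<psi> - D q \<psi> = (D q' ?f - D q ?f) - \<psi> i * \<delta>"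
    using \<psi> by (simp add: split[of \<psi>] \<delta>_def algebra_simps)
  moreover have "0 \<le> \<psi> i * \<delta>" "\<psi> i * \<delta> \<le> \<delta>" using \<psi>[of i] \<delta>(1) by (auto intro: mult_left_le_one_le)
  ultimately show ?thesis using m1 \<delta> unfolding D_def by linarith
qed

section \<open>Transition functions with bounded rates\<close>

text \<open>\<open>f (s / m) ^ m = exp (m * ln (f (s / m)))\<close> for large \<open>m\<close>, and
  \<open>ln f\<close> has derivative \<open>a\<close> at 0 because \<open>f 0 = 1\<close>.\<close>

lemma power_seq_exp:
  fixes f :: "real \<Rightarrow> real"
  assumes d: "(f has_real_derivative a) (at 0 within {0..})" and f0: "f 0 = 1" and s: "s \<ge> 0"
  shows "(\<lambda>m. f (s / real m) ^ m) \<longlonglongrightarrow> exp (a * s)"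
proof (cases "s = 0")
  case True
  then show ?thesis using f0 by simp
next
  case False
  have "((\<lambda>t. ln (f t)) has_real_derivative (1 / f 0) * a) (at 0 within {0..})"
    using DERIV_chain2[of ln "inverse (f 0)" f 0, OF _ d] f0 DERIV_ln[of "f 0"] by simp
  then have lim: "((\<lambda>t. ln (f t) / t) \<longlongrightarrow> a) (at 0 within {0..})"
    using f0 by (simp add: has_field_derivative_iff)
  have seq: "(\<lambda>m. s / real m) \<longlonglongrightarrow> 0" by (rule lim_const_over_n)
  have at: "filterlim (\<lambda>m. s / real m) (at 0 within {0..}) sequentially"
    unfolding filterlim_at using seq s False
    by (auto intro!: eventually_mono[OF eventually_gt_at_top[of 0]])
  have 1: "(\<lambda>m. ln (f (s / real m)) / (s / real m) * s) \<longlonglongrightarrow> a * s"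
    by (intro tendsto_mult tendsto_const filterlim_compose[OF lim at])
  have "continuous (at 0 within {0..}) f" using d by (rule DERIV_continuous)
  then have "(f \<longlongrightarrow> 1) (at 0 within {0..})" using f0 by (simp add: continuous_within)
  then have "(\<lambda>m. f (s / real m)) \<longlonglongrightarrow> 1" using filterlim_compose[OF _ at] by blast
  then have "eventually (\<lambda>m. f (s / real m) > 0) sequentially" by (rule order_tendstoD) simp
  then have "eventually (\<lambda>m. exp (ln (f (s / real m)) / (s / real m) * s) = f (s / real m) ^ m) sequentially"
    using eventually_gt_at_top[of 0]
  proof eventually_elim
    case (elim m)
    then have "ln (f (s / real m)) / (s / real m) * s = real m * ln (f (s / real m))" using False by simp
    then show ?case using elim by (simp add: exp_of_nat_mult)
  qed
  with tendsto_exp[OF 1] show ?thesis by (rule Lim_transform_eventually)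
qed

locale bounded_rates =
  fixes p :: "real \<Rightarrow> nat \<Rightarrow> nat pmf" and lam :: "nat \<Rightarrow> real" and \<Lambda> :: real
  assumes p: "transition_function p"
    and der: "\<And>i. i \<ge> 1 \<Longrightarrow> ((\<lambda>t. pmf (p t i) i) has_real_derivative - lam i) (at 0 within {0..})"
    and lam_le: "\<And>i. i \<ge> 1 \<Longrightarrow> lam i \<le> \<Lambda>" and \<Lambda>: "\<Lambda> \<ge> 0"
begin

lemma set_p: "i \<ge> 1 \<Longrightarrow> t \<ge> 0 \<Longrightarrow> set_pmf (p t i) \<subseteq> {1..}"
  using p by (auto simp: transition_function_def)

lemma chapman_kolmogorov:
  "i \<ge> 1 \<Longrightarrow> s \<ge> 0 \<Longrightarrow> t \<ge> 0 \<Longrightarrow> pmf (p (s + t) i) j = (\<integral>l. pmf (p t l) j \<partial>measure_pmf (p s i))"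
  using p by (auto simp: transition_function_def pmf_bind)

lemma p_0: "i \<ge> 1 \<Longrightarrow> p 0 i = return_pmf i"
  using p by (auto simp: transition_function_def)

text \<open>Being in \<open>i\<close> at time \<open>s\<close> is one of the ways to be there at
  time \<open>s + t\<close>.\<close>

lemma stay_mult:
  assumes "i \<ge> 1" "s \<ge> 0" "t \<ge> 0"
  shows "pmf (p s i) i * pmf (p t i) i \<le> pmf (p (s + t) i) i"
proof -
  have "pmf (p s i) i * pmf (p t i) i = (\<integral>l. indicator {i} l * pmf (p t i) i \<partial>measure_pmf (p s i))"
    by (simp add: measure_pmf_single)
  also have "\<dots> \<le> (\<integral>l. pmf (p t l) i \<partial>measure_pmf (p s i))"
    by (intro integral_mono integrable_measure_pmf_bounded[where B=1])
      (auto simp: indicator_def pmf_le_1)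
  also have "\<dots> = pmf (p (s + t) i) i" using chapman_kolmogorov assms by simp
  finally show ?thesis .
qed

lemma stay_power:
  assumes "i \<ge> 1" "s \<ge> 0"
  shows "pmf (p s i) i ^ m \<le> pmf (p (real m * s) i) i"
proof (induction m)
  case 0
  then show ?case using p_0[OF assms(1)] by simp
next
  case (Suc m)
  have "pmf (p s i) i ^ Suc m \<le> pmf (p s i) i * pmf (p (real m * s) i) i"
    using Suc by (auto intro: mult_left_mono)
  also have "\<dots> \<le> pmf (p (s + real m * s) i) i" using assms by (intro stay_mult) auto
  also have "s + real m * s = real (Suc m) * s" by (simp add: algebra_simps)
  finally show ?case .
qed

lemma stay_limit:
  assumes "i \<ge> 1" "s \<ge> 0"
  shows "(\<lambda>m. pmf (p (s / real m) i) i ^ m) \<longlonglongrightarrow> exp (- lam i * s)"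
  by (rule power_seq_exp[OF der[OF assms(1)]]) (use assms p_0[OF assms(1)] in auto)

text \<open>Being in \<open>i\<close> at all times \<open>k * s / m\<close> is harder than being
  there at time \<open>s\<close>; its probability tends to \<open>exp (- lam i * s)\<close> as the
  mesh shrinks.\<close>

lemma stay_ge:
  assumes "i \<ge> 1" "s \<ge> 0"
  shows "exp (- lam i * s) \<le> pmf (p s i) i"
proof (rule tendsto_upperbound[OF stay_limit[OF assms]])
  show "eventually (\<lambda>m. pmf (p (s / real m) i) i ^ m \<le> pmf (p s i) i) sequentially"
    using eventually_gt_at_top[of 0]
  proof eventually_elim
    case (elim m)
    then show ?case using stay_power[OF assms(1), of "s / real m" m] assms(2) by simp
  qed
qed auto

lemma stay_ge_linear:
  assumes "i \<ge> 1" "s \<ge> 0"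
  shows "1 - \<Lambda> * s \<le> pmf (p s i) i"
proof -
  have "\<Lambda> * s \<ge> lam i * s" using lam_le[OF assms(1)] assms(2) by (rule mult_right_mono)
  moreover have "1 + (- lam i * s) \<le> exp (- lam i * s)" by (rule exp_ge_add_one_self)
  ultimately show ?thesis using stay_ge[OF assms] by simp
qed

text \<open>\<open>p s j\<close> already puts at least \<open>1 - \<Lambda> * s\<close> on
  \<open>j\<close>, uniformly in \<open>j\<close>, which leaves at most \<open>\<Lambda> * s\<close>
  for any other state.\<close>

lemma move_le:
  assumes "j \<ge> 1" "i \<noteq> j" "s \<ge> 0"
  shows "pmf (p s j) i \<le> \<Lambda> * s"
proof -
  have "pmf (p s j) i + pmf (p s j) j = measure (measure_pmf (p s j)) {i, j}"
    using assms(2) by (simp add: measure_measure_pmf_finite)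
  also have "\<dots> \<le> 1" by simp
  finally show ?thesis using stay_ge_linear[OF assms(1,3)] by linarith
qed

text \<open>
  Being back in \<open>i\<close> at time \<open>m\<delta>\<close> means never having left on the grid of mesh \<open>\<delta>\<close>, or having left
  and come back, which has conditional probability at most \<open>c\<close>.
\<close>

lemma return_bound:
  assumes i: "i \<ge> 1" and \<delta>: "\<delta> \<ge> 0" and c: "\<And>j s. j \<ge> 1 \<Longrightarrow> j \<noteq> i \<Longrightarrow> 0 \<le> s \<Longrightarrow> s \<le> real m * \<delta> \<Longrightarrow> pmf (p s j) i \<le> c"
  shows "pmf (p (real m * \<delta>) i) i \<le> pmf (p \<delta> i) i ^ m + (1 - pmf (p \<delta> i) i ^ m) * c"
  using c
proof (induction m)
  case 0
  show ?case by (simp add: pmf_le_1)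
next
  case (Suc m)
  define q where "q = pmf (p \<delta> i) i"
  let ?r = "pmf (p (real m * \<delta>) i) i"
  have le: "real m * \<delta> \<le> real (Suc m) * \<delta>" using \<delta> by (intro mult_right_mono) auto
  have IH: "?r \<le> q ^ m + (1 - q ^ m) * c"
    unfolding q_def by (rule Suc.IH) (use le in \<open>auto intro!: Suc.prems\<close>)
  have "pmf (p (\<delta> + real m * \<delta>) i) i = (\<integral>l. pmf (p (real m * \<delta>) l) i \<partial>measure_pmf (p \<delta> i))"
    using i \<delta> by (intro chapman_kolmogorov) auto
  \<comment> \<open>Condition on the first grid point: state \<open>i\<close> contributes
    \<open>?r\<close>, every other state at most \<open>c\<close>.\<close>
  also have "\<dots> \<le> (\<integral>l. (?r - c) * indicator {i} l + c \<partial>measure_pmf (p \<delta> i))"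
  proof (rule integral_mono_AE)
    show "integrable (measure_pmf (p \<delta> i)) (\<lambda>l. pmf (p (real m * \<delta>) l) i)"
      by (rule integrable_measure_pmf_bounded[where B=1]) (simp add: pmf_le_1)
    show "integrable (measure_pmf (p \<delta> i)) (\<lambda>l. (?r - c) * indicator {i} l + c)"
    proof (rule integrable_measure_pmf_bounded[where B="\<bar>?r - c\<bar> + \<bar>c\<bar>"])
      fix l show "\<bar>(?r - c) * indicator {i} l + c\<bar> \<le> \<bar>?r - c\<bar> + \<bar>c\<bar>" by (cases "l = i") auto
    qed
    show "AE l in measure_pmf (p \<delta> i). pmf (p (real m * \<delta>) l) i \<le> (?r - c) * indicator {i} l + c"
      unfolding AE_measure_pmf_iff
    proof
      fix l assume "l \<in> set_pmf (p \<delta> i)"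
      then have "l \<ge> 1" using set_p[OF i \<delta>] by auto
      then show "pmf (p (real m * \<delta>) l) i \<le> (?r - c) * indicator {i} l + c"
        using Suc.prems[of l "real m * \<delta>"] le \<delta> by (cases "l = i") auto
    qed
  qed
  also have "\<dots> = (?r - c) * q + c" by (simp add: measure_pmf_single q_def integrable_measure_pmf_bounded[where B="1"])
  also have "\<dots> \<le> (q ^ m + (1 - q ^ m) * c - c) * q + c"
    using IH by (intro add_right_mono mult_right_mono) (auto simp: q_def)
  also have "\<dots> = q ^ Suc m + (1 - q ^ Suc m) * c" by (simp add: algebra_simps)
  finally show ?case by (simp add: q_def algebra_simps)
qed

text \<open>In \<open>return_bound\<close> with mesh \<open>h / m\<close> and
  \<open>c = \<Lambda> * h\<close>, the no-jump term tends to \<open>exp (- lam i * h)\<close>. What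
  remains is a leave-and-return probability: at most
  \<open>1 - exp (- lam i * h) \<le> \<Lambda> * h\<close> for leaving, times
  \<open>\<Lambda> * h\<close> for coming back.\<close>

lemma stay_le:
  assumes i: "i \<ge> 1" and h: "h \<ge> 0"
  shows "pmf (p h i) i \<le> exp (- lam i * h) + (\<Lambda> * h)\<^sup>2"
proof -
  let ?c = "\<Lambda> * h"
  have "pmf (p h i) i \<le> exp (- lam i * h) + (1 - exp (- lam i * h)) * ?c"
  proof (rule tendsto_lowerbound)
    show "(\<lambda>m. pmf (p (h / real m) i) i ^ m + (1 - pmf (p (h / real m) i) i ^ m) * ?c)
        \<longlonglongrightarrow> exp (- lam i * h) + (1 - exp (- lam i * h)) * ?c"
      by (intro tendsto_intros stay_limit i h)
    show "eventually (\<lambda>m. pmf (p h i) i \<le> pmf (p (h / real m) i) i ^ m + (1 - pmf (p (h / real m) i) i ^ m) * ?c) sequentially"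
      using eventually_gt_at_top[of 0]
    proof eventually_elim
      case (elim m)
      have "pmf (p s j) i \<le> ?c" if "j \<ge> 1" "j \<noteq> i" "0 \<le> s" "s \<le> real m * (h / real m)" for j s
      proof -
        have "\<Lambda> * s \<le> ?c" using that(4) elim \<Lambda> by (intro mult_left_mono) auto
        then show ?thesis using move_le[of j i s] that by linarith
      qed
      then show ?case using return_bound[OF i, of "h / real m" m ?c] h elim by simp
    qed
  qed auto
  also have "(1 - exp (- lam i * h)) * ?c \<le> ?c * ?c"
  proof (rule mult_right_mono)
    have "lam i * h \<le> ?c" using lam_le[OF i] h by (rule mult_right_mono)
    moreover have "1 + (- lam i * h) \<le> exp (- lam i * h)" by (rule exp_ge_add_one_self)
    ultimately show "1 - exp (- lam i * h) \<le> ?c" by simp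
  qed (use h \<Lambda> in auto)
  finally show ?thesis by (simp add: power2_eq_square)
qed

text \<open>However the missing mass is distributed, \<open>K i\<close> dominates
  \<open>p h i\<close> off the diagonal and is at most \<open>(\<Lambda> * h)^2\<close> below it on
  the diagonal.\<close>

lemma completion_close:
  assumes K: "completes_step_matrix K p lam h" "\<And>i. i \<ge> 1 \<Longrightarrow> set_pmf (K i) \<subseteq> {1..}" and h: "h \<ge> 0" and i: "i \<ge> 1"
    and \<psi>: "\<And>j. 0 \<le> \<psi> j \<and> \<psi> j \<le> (1::real)"
  shows "\<bar>(\<integral>j. \<psi> j \<partial>measure_pmf (K i)) - (\<integral>j. \<psi> j \<partial>measure_pmf (p h i))\<bar> \<le> (\<Lambda> * h)\<^sup>2"
proof (rule pmf_diff_le[OF _ _ \<psi>])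
  fix j assume "j \<noteq> i"
  show "pmf (p h i) j \<le> pmf (K i) j"
  proof (cases "j \<ge> 1")
    case True
    then show ?thesis using K(1) i \<open>j \<noteq> i\<close> unfolding completes_step_matrix_def step_entry_def by metis
  next
    \<comment> \<open>The step matrix constrains only positive indices; state 0 carries no mass of
      \<open>p h i\<close>.\<close>
    case False
    then have "j \<notin> set_pmf (p h i)" using set_p[OF i h] by auto
    then have "pmf (p h i) j = 0" by (simp add: pmf_eq_0_set_pmf)
    then show ?thesis by simp
  qed
next
  have "exp (- lam i * h) \<le> pmf (K i) i"
    using K(1) i unfolding completes_step_matrix_def step_entry_def by metis
  then show "pmf (p h i) i - pmf (K i) i \<le> (\<Lambda> * h)\<^sup>2" using stay_le[OF i h] by linarith
qed

end

lemma markov_chain_skeleton: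
  assumes Y: "markov_jump_process M Y p" and h: "h > 0"
  shows "markov_chain M (\<lambda>k. Y (real k * h)) (p h)"
  unfolding markov_chain_def
proof (intro conjI allI impI ballI)
  fix n and i :: "nat \<Rightarrow> nat" assume pos: "\<P>(\<omega> in M. \<forall>k\<le>n. Y (real k * h) \<omega> = i k) > 0"
  have "0 \<le> real 0 * h \<and> (\<forall>k\<le>n. real k * h < real (Suc k) * h)" using h by simp
  moreover have "\<forall>n t i. 0 \<le> t 0 \<and> (\<forall>k\<le>n. t k < t (Suc k)) \<and>
        \<P>(\<omega> in M. \<forall>k\<le>n. Y (t k) \<omega> = i k) > 0 \<longrightarrow>
        \<P>(\<omega> in M. Y (t (Suc n)) \<omega> = i (Suc n) \<bar> \<forall>k\<le>n. Y (t k) \<omega> = i k)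
          = pmf (p (t (Suc n) - t n) (i n)) (i (Suc n))"
    using Y unfolding markov_jump_process_def by (elim conjE)
  note this[THEN spec[of _ n], THEN spec[of _ "\<lambda>k. real k * h"], THEN spec[of _ i]]
  ultimately have "\<P>(\<omega> in M. Y (real (Suc n) * h) \<omega> = i (Suc n) \<bar> \<forall>k\<le>n. Y (real k * h) \<omega> = i k)
          = pmf (p (real (Suc n) * h - real n * h) (i n)) (i (Suc n))"
    using pos by satx
  also have "real (Suc n) * h - real n * h = h" by (simp add: algebra_simps)
  finally show "\<P>(\<omega> in M. Y (real (Suc n) * h) \<omega> = i (Suc n) \<bar> \<forall>k\<le>n. Y (real k * h) \<omega> = i k)
          = pmf (p h (i n)) (i (Suc n))" .
next
  fix i :: nat assume "1 \<le> i" then show "set_pmf (p h i) \<subseteq> {1..}"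
    using Y h by (auto simp: markov_jump_process_def transition_function_def)
qed (use Y h in \<open>auto simp: markov_jump_process_def\<close>)

text \<open>There are \<open>n\<close> steps, each with kernel error
  \<open>(\<Lambda> * h)^2\<close>; the factor \<open>2 * B\<close> comes from rescaling
  \<open>\<phi>\<close> from \<open>[-B, B]\<close> to \<open>[0, 1]\<close>.\<close>

lemma (in bounded_rates) rev_path_expectation_diff:
  fixes \<phi> :: "nat list \<Rightarrow> real"
  assumes M: "prob_space M" "markov_jump_process M Y p" "\<And>\<omega>. \<omega> \<in> space M \<Longrightarrow> Y 0 \<omega> = i0"
    and Q: "prob_space Q" "markov_chain Q X K" "\<And>\<omega>. \<omega> \<in> space Q \<Longrightarrow> X 0 \<omega> = i0"
    and K: "completes_step_matrix K p lam h" and h: "h > 0" and i0: "i0 \<ge> 1"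
    and \<phi>: "\<And>xs. \<bar>\<phi> xs\<bar> \<le> B"
  shows "\<bar>(\<integral>\<omega>. \<phi> (rev_path X n \<omega>) \<partial>Q) - (\<integral>\<omega>. \<phi> (rev_path (\<lambda>k. Y (real k * h)) n \<omega>) \<partial>M)\<bar> \<le> 2 * B * real n * (\<Lambda> * h)\<^sup>2"
proof (cases "B = 0")
  case True
  then show ?thesis using \<phi> by simp
next
  case False
  have B: "B > 0" using \<phi>[of "[]"] False by linarith
  interpret M: prob_space M by fact
  interpret Q: prob_space Q by fact
  let ?\<psi> = "\<lambda>xs. (\<phi> xs + B) / (2 * B)"
  define L where "L K = (\<lambda>f::nat list \<Rightarrow> real. \<integral>xs. f xs \<partial>measure_pmf (chain_law K i0 n))" for K
  have "\<bar>L K ?\<psi> - L (p h) ?\<psi>\<bar> \<le> real n * (\<Lambda> * h)\<^sup>2"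
    unfolding L_def
  proof (rule chain_law_diff)
    fix xs show "0 \<le> ?\<psi> xs \<and> ?\<psi> xs \<le> 1" using \<phi>[of xs] B by (auto simp: abs_le_iff)
  next
    fix i :: nat and \<psi> :: "nat \<Rightarrow> real" assume "1 \<le> i" "\<And>j. 0 \<le> \<psi> j \<and> \<psi> j \<le> (1::real)"
    then show "\<bar>(\<integral>j. \<psi> j \<partial>measure_pmf (K i)) - (\<integral>j. \<psi> j \<partial>measure_pmf (p h i))\<bar> \<le> (\<Lambda> * h)\<^sup>2"
      using Q(2) h by (intro completion_close K) (auto simp: markov_chain_def)
  qed (use set_p h i0 in auto)
  moreover have "L K' ?\<psi> = (L K' \<phi> + B) / (2 * B)" for K'
    unfolding L_def using integrable_measure_pmf_bounded[of _ \<phi> B] \<phi> by simp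
  ultimately have "\<bar>(L K \<phi> - L (p h) \<phi>) / (2 * B)\<bar> \<le> real n * (\<Lambda> * h)\<^sup>2"
    by (simp add: diff_divide_distrib add_divide_distrib)
  then have "\<bar>L K \<phi> - L (p h) \<phi>\<bar> \<le> 2 * B * real n * (\<Lambda> * h)\<^sup>2"
    using B by (simp add: field_simps)
  moreover have "(\<integral>\<omega>. \<phi> (rev_path X n \<omega>) \<partial>Q) = L K \<phi>"
    unfolding L_def by (rule Q.expectation_rev_path[OF Q(2,3)])
  moreover have "(\<integral>\<omega>. \<phi> (rev_path (\<lambda>k. Y (real k * h)) n \<omega>) \<partial>M) = L (p h) \<phi>"
    unfolding L_def by (rule M.expectation_rev_path[OF markov_chain_skeleton[OF M(2) h]]) (use M(3) in simp)
  ultimately show ?thesis by simp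
qed

section \<open>Independent random elements\<close>

lemma (in prob_space) indep_elements_distr:
  assumes "indep_elements M S X S' X'"
  shows "distr M (S \<Otimes>\<^sub>M S') (\<lambda>\<omega>. (X \<omega>, X' \<omega>)) = distr M S X \<Otimes>\<^sub>M distr M S' X'"
proof -
  have X [measurable]: "X \<in> M \<rightarrow>\<^sub>M S" and X' [measurable]: "X' \<in> M \<rightarrow>\<^sub>M S'"
    and ind: "indep_set (sets (vimage_algebra (space M) X S)) (sets (vimage_algebra (space M) X' S'))"
    using assms by (auto simp: indep_elements_def)
  interpret X: prob_space "distr M S X" by (rule prob_space_distr) fact
  interpret X': prob_space "distr M S' X'" by (rule prob_space_distr) fact
  show ?thesis
  proof (rule pair_measure_eqI[symmetric])
    show "sigma_finite_measure (distr M S X)" "sigma_finite_measure (distr M S' X')" ..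
    fix A B assume A: "A \<in> sets (distr M S X)" and B: "B \<in> sets (distr M S' X')"
    have "emeasure (distr M (S \<Otimes>\<^sub>M S') (\<lambda>\<omega>. (X \<omega>, X' \<omega>))) (A \<times> B)
        = emeasure M ((\<lambda>\<omega>. (X \<omega>, X' \<omega>)) -` (A \<times> B) \<inter> space M)"
      using A B by (intro emeasure_distr) auto
    also have "(\<lambda>\<omega>. (X \<omega>, X' \<omega>)) -` (A \<times> B) \<inter> space M = (X -` A \<inter> space M) \<inter> (X' -` B \<inter> space M)" by auto
    also have "emeasure M \<dots> = emeasure M (X -` A \<inter> space M) * emeasure M (X' -` B \<inter> space M)"
      using indep_setD[OF ind, of "X -` A \<inter> space M" "X' -` B \<inter> space M"] A B
      by (simp add: emeasure_eq_measure ennreal_mult in_vimage_algebra)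
    also have "\<dots> = emeasure (distr M S X) A * emeasure (distr M S' X') B"
      using A B by (simp add: emeasure_distr)
    finally show "emeasure (distr M S X) A * emeasure (distr M S' X') B =
        emeasure (distr M (S \<Otimes>\<^sub>M S') (\<lambda>\<omega>. (X \<omega>, X' \<omega>))) (A \<times> B)" by simp
  qed simp
qed

text \<open>Fubini for the product of the two laws: the second element may be taken at an
  independent sample point \<open>\<omega>'\<close>. This is what permits freezing one element while
  averaging over the other.\<close>

lemma (in prob_space) indep_elements_integral:
  fixes G :: "'x \<Rightarrow> 'y \<Rightarrow> real"
  assumes ind: "indep_elements M S X S' X'"
    and G [measurable]: "(\<lambda>(x, y). G x y) \<in> borel_measurable (S \<Otimes>\<^sub>M S')"
    and B: "\<And>x y. \<bar>G x y\<bar> \<le> B"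
  shows "(\<integral>\<omega>. G (X \<omega>) (X' \<omega>) \<partial>M) = (\<integral>\<omega>'. (\<integral>\<omega>. G (X \<omega>) (X' \<omega>') \<partial>M) \<partial>M)"
proof -
  have X [measurable]: "X \<in> M \<rightarrow>\<^sub>M S" and X' [measurable]: "X' \<in> M \<rightarrow>\<^sub>M S'"
    using ind by (auto simp: indep_elements_def)
  interpret X: prob_space "distr M S X" by (rule prob_space_distr) fact
  interpret X': prob_space "distr M S' X'" by (rule prob_space_distr) fact
  interpret XX: pair_prob_space "distr M S X" "distr M S' X'" ..
  have "(\<integral>\<omega>. G (X \<omega>) (X' \<omega>) \<partial>M) = (\<integral>z. (\<lambda>(x, y). G x y) z \<partial>distr M (S \<Otimes>\<^sub>M S') (\<lambda>\<omega>. (X \<omega>, X' \<omega>)))"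
    by (subst integral_distr) auto
  also have "\<dots> = (\<integral>z. (\<lambda>(x, y). G x y) z \<partial>(distr M S X \<Otimes>\<^sub>M distr M S' X'))"
    by (simp add: indep_elements_distr[OF ind])
  also have "\<dots> = (\<integral>y. (\<integral>x. G x y \<partial>distr M S X) \<partial>distr M S' X')"
    by (rule XX.integral_snd[symmetric], rule XX.integrable_const_bound[of _ B]) (use B in auto)
  also have "\<dots> = (\<integral>\<omega>'. (\<integral>x. G x (X' \<omega>') \<partial>distr M S X) \<partial>M)"
    by (subst integral_distr) auto
  also have "\<dots> = (\<integral>\<omega>'. (\<integral>\<omega>. G (X \<omega>) (X' \<omega>') \<partial>M) \<partial>M)"
  proof (rule Bochner_Integration.integral_cong[OF refl])
    fix \<omega>' assume "\<omega>' \<in> space M"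
    then have [measurable]: "X' \<omega>' \<in> space S'" using measurable_space[OF X'] by blast
    have [measurable]: "(\<lambda>x. G x (X' \<omega>')) \<in> borel_measurable S"
      using measurable_compose[OF measurable_Pair2'[OF \<open>X' \<omega>' \<in> space S'\<close>, of S] G] by simp
    show "(\<integral>x. G x (X' \<omega>') \<partial>distr M S X) = (\<integral>\<omega>. G (X \<omega>) (X' \<omega>') \<partial>M)"
      by (subst integral_distr) auto
  qed
  finally show ?thesis .
qed

section \<open>Sums over blocks of independent random variables\<close>

lemma measurable_PiM_coordinatewise:
  assumes "\<And>i. i \<in> I \<Longrightarrow> f i \<in> \<Omega> i \<rightarrow>\<^sub>M N i"
  shows "(\<lambda>x. \<lambda>i\<in>I. f i (x i)) \<in> PiM I \<Omega> \<rightarrow>\<^sub>M PiM I N"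
proof (rule measurable_restrict)
  fix i assume i: "i \<in> I"
  show "(\<lambda>x. f i (x i)) \<in> PiM I \<Omega> \<rightarrow>\<^sub>M N i"
    by (rule measurable_compose[of "\<lambda>x. x i" _ "\<Omega> i"], rule measurable_component_singleton[OF i], rule assms[OF i])
qed

text \<open>Lets representations of single laws, each on its own space, be assembled on the product
  space.\<close>

lemma distr_PiM_coordinatewise:
  fixes \<Omega> :: "'i \<Rightarrow> 'x measure" and f :: "'i \<Rightarrow> 'x \<Rightarrow> 'y"
  assumes \<Omega>: "\<And>i. prob_space (\<Omega> i)" and f: "\<And>i. f i \<in> \<Omega> i \<rightarrow>\<^sub>M N i" and I: "finite I"
  shows "distr (PiM I \<Omega>) (PiM I N) (\<lambda>x. \<lambda>i\<in>I. f i (x i)) = PiM I (\<lambda>i. distr (\<Omega> i) (N i) (f i))"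
proof -
  have 1: "prob_space (distr (\<Omega> i) (N i) (f i))" for i
    by (rule prob_space.prob_space_distr[OF \<Omega> f])
  interpret \<Omega>: product_prob_space \<Omega>
    unfolding product_prob_space_def product_prob_space_axioms_def product_sigma_finite_def
    using \<Omega> by (auto intro: prob_space_imp_sigma_finite)
  interpret D: product_prob_space "\<lambda>i. distr (\<Omega> i) (N i) (f i)"
    unfolding product_prob_space_def product_prob_space_axioms_def product_sigma_finite_def
    using 1 by (auto intro: prob_space_imp_sigma_finite)
  have m: "(\<lambda>x. \<lambda>i\<in>I. f i (x i)) \<in> PiM I \<Omega> \<rightarrow>\<^sub>M PiM I N"
    by (rule measurable_PiM_coordinatewise) (rule f)
  show ?thesis
  proof (rule D.PiM_eqI[OF I])
    show "sets (distr (PiM I \<Omega>) (PiM I N) (\<lambda>x. \<lambda>i\<in>I. f i (x i))) = sets (PiM I (\<lambda>i. distr (\<Omega> i) (N i) (f i)))"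
      by (simp cong: sets_PiM_cong)
    fix A assume A: "\<And>i. i \<in> I \<Longrightarrow> A i \<in> sets (distr (\<Omega> i) (N i) (f i))"
    have "emeasure (distr (PiM I \<Omega>) (PiM I N) (\<lambda>x. \<lambda>i\<in>I. f i (x i))) (Pi\<^sub>E I A)
        = emeasure (PiM I \<Omega>) ((\<lambda>x. \<lambda>i\<in>I. f i (x i)) -` (Pi\<^sub>E I A) \<inter> space (PiM I \<Omega>))"
      using A I by (intro emeasure_distr[OF m] sets_PiM_I_finite) auto
    also have "(\<lambda>x. \<lambda>i\<in>I. f i (x i)) -` (Pi\<^sub>E I A) \<inter> space (PiM I \<Omega>) = Pi\<^sub>E I (\<lambda>i. f i -` A i \<inter> space (\<Omega> i))"
      by (auto simp: space_PiM PiE_iff extensional_def)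
    also have "emeasure (PiM I \<Omega>) \<dots> = (\<Prod>i\<in>I. emeasure (\<Omega> i) (f i -` A i \<inter> space (\<Omega> i)))"
      using A f by (intro \<Omega>.emeasure_PiM[OF I]) (auto intro: measurable_sets)
    also have "\<dots> = (\<Prod>i\<in>I. emeasure (distr (\<Omega> i) (N i) (f i)) (A i))"
      using A f by (intro prod.cong refl emeasure_distr[symmetric]) auto
    finally show "emeasure (distr (PiM I \<Omega>) (PiM I N) (\<lambda>x. \<lambda>i\<in>I. f i (x i))) (Pi\<^sub>E I A)
        = (\<Prod>i\<in>I. emeasure (distr (\<Omega> i) (N i) (f i)) (A i))" .
  qed
qed

text \<open>Partial sums stopped after \<open>n\<close> terms: \<open>n\<close> block increments
  become a full sequence, constant from index \<open>n\<close> on, which is the kind of argument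
  \<open>grid_step\<close> takes.\<close>

definition cum :: "nat \<Rightarrow> (nat \<Rightarrow> real) \<Rightarrow> nat \<Rightarrow> real" where
  "cum n x l = (\<Sum>i<min l n. x i)"

lemma cum_cong: "(\<And>i. i < n \<Longrightarrow> x i = y i) \<Longrightarrow> cum n x = cum n y"
  by (auto simp: cum_def fun_eq_iff intro!: sum.cong)

lemma measurable_cum_PiM [measurable]: "cum n \<in> borel_measurable (PiM {..<n} (\<lambda>_. borel))"
  unfolding cum_def[abs_def]
  by (rule measurable_coordinatewise_then_product) (auto intro!: borel_measurable_sum measurable_component_singleton)

lemma tendsto_cum:
  assumes "\<And>i. i < n \<Longrightarrow> (\<lambda>q. x q i) \<longlonglongrightarrow> y i"
  shows "(\<lambda>q. cum n (x q)) \<longlonglongrightarrow> cum n y"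
  unfolding limitin_canonical_iff[symmetric] euclidean_product_topology[symmetric] limitin_componentwise
  by (auto simp: cum_def intro!: tendsto_sum assms)

text \<open>
  The blocks converge in distribution by Levy's continuity theorem; Skorokhod's representation turns
  this into pointwise convergence on a product space.
\<close>

lemma block_convergence:
  fixes P :: "nat \<Rightarrow> 'a measure" and \<zeta> :: "nat \<Rightarrow> nat \<Rightarrow> 'a \<Rightarrow> real" and k :: "nat \<Rightarrow> nat \<Rightarrow> nat"
    and \<nu> :: "nat \<Rightarrow> real measure" and g :: "(nat \<Rightarrow> real) \<Rightarrow> real"
  assumes P: "\<And>q. prob_space (P q)"
    and ind: "\<And>q. prob_space.indep_vars (P q) (\<lambda>_. borel) (\<zeta> q) {0<..k q n}"
    and k0: "\<And>q. k q 0 = 0" and k: "\<And>q l. l < n \<Longrightarrow> k q l \<le> k q (Suc l)" and n: "n > 0"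
    and \<nu>: "\<And>l. l < n \<Longrightarrow> real_distribution (\<nu> l)"
    and char: "\<And>l \<theta>. l < n \<Longrightarrow>
        (\<lambda>q. \<Prod>i\<in>{k q l<..k q (Suc l)}. char (distr (P q) borel (\<zeta> q i)) \<theta>) \<longlonglongrightarrow> char (\<nu> l) \<theta>"
    and g: "continuous_on UNIV g" and B: "\<And>x. \<bar>g x\<bar> \<le> B"
  shows "(\<lambda>q. \<integral>\<omega>. g (\<lambda>l. \<Sum>i\<in>{0<..k q (min l n)}. \<zeta> q i \<omega>) \<partial>P q) \<longlonglongrightarrow> (\<integral>x. g (cum n x) \<partial>PiM {..<n} \<nu>)"
proof -
  define D where "D q l \<omega> = (\<Sum>i\<in>{k q l<..k q (Suc l)}. \<zeta> q i \<omega>)" for q l \<omega>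
  \<comment> \<open>Representations are chosen for every natural \<open>l\<close>; indices from
    \<open>n\<close> on repeat block 0, for which the hypotheses hold since
    \<open>n > 0\<close>.\<close>
  define c where "c l = (if l < n then l else 0)" for l
  have c: "c l < n" for l using n by (simp add: c_def)
  have mono: "k q l \<le> k q l'" if "l \<le> l'" "l' \<le> n" for q l l'
    using that by (induction l' rule: dec_induct) (auto intro: order_trans[OF _ k])
  have gm [measurable]: "g \<in> borel_measurable borel" using g by (rule borel_measurable_continuous_onI)
  have zm: "\<zeta> q i \<in> borel_measurable (P q)" if "i \<in> {0<..k q n}" for q i
    using ind[of q] that unfolding prob_space.indep_vars_def2[OF P[of q]] by (elim conjE) (rule bspec)
  have sub: "{k q l<..k q (Suc l)} \<subseteq> {0<..k q n}" if "l < n" for q l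
    using mono[of "Suc l" n q] that by auto
  have Dm: "D q l \<in> borel_measurable (P q)" if "l < n" for q l
    unfolding D_def using sub[OF that, of q] by (intro borel_measurable_sum zm) auto
  have Dind: "prob_space.indep_vars (P q) (\<lambda>_. borel) (D q) {..<n}" for q
  proof -
    interpret prob_space "P q" by (rule P)
    let ?K = "\<lambda>l. {k q l<..k q (Suc l)}"
    have "disjoint_family_on ?K {..<n}"
    proof (unfold disjoint_family_on_def, intro ballI impI)
      fix a b assume "a \<in> {..<n}" "b \<in> {..<n}" "a \<noteq> b"
      then show "?K a \<inter> ?K b = {}"
        using mono[of "Suc a" b q] mono[of "Suc b" a q] by (cases "a < b") auto
    qed
    then have "indep_vars (\<lambda>l. PiM (?K l) (\<lambda>_. borel)) (\<lambda>l \<omega>. restrict (\<lambda>i. \<zeta> q i \<omega>) (?K l)) {..<n}"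
      using sub by (intro indep_vars_restrict[OF ind]) auto
    then have "indep_vars (\<lambda>_. borel) (\<lambda>l \<omega>. (\<lambda>x. \<Sum>i\<in>?K l. x i) (restrict (\<lambda>i. \<zeta> q i \<omega>) (?K l))) {..<n}"
      by (rule indep_vars_compose2) (auto intro!: borel_measurable_sum measurable_component_singleton)
    then show ?thesis
      by (rule indep_vars_cong[THEN iffD1, rotated 3]) (auto simp: D_def fun_eq_iff intro!: sum.cong)
  qed
  define \<mu> where "\<mu> q l = distr (P q) borel (D q (c l))" for q l
  have \<mu>: "real_distribution (\<mu> q l)" for q l
    unfolding \<mu>_def by (intro prob_space.real_distribution_distr P Dm c)
  have "\<exists>\<Omega> Vs V. prob_space (\<Omega> :: real measure) \<and> (\<forall>q. Vs q \<in> measurable \<Omega> borel) \<and>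
      (\<forall>q. distr \<Omega> borel (Vs q) = \<mu> q l) \<and> V \<in> measurable \<Omega> lborel \<and> distr \<Omega> borel V = \<nu> (c l) \<and>
      (\<forall>x \<in> space \<Omega>. (\<lambda>q. Vs q x :: real) \<longlonglongrightarrow> V x)" for l
  proof (rule Skorohod)
    show "real_distribution (\<mu> q l)" for q by (rule \<mu>)
    show "real_distribution (\<nu> (c l))" by (rule \<nu>[OF c])
    show "weak_conv_m (\<lambda>q. \<mu> q l) (\<nu> (c l))"
    proof (rule levy_continuity)
      fix \<theta>
      have "char (\<mu> q l) \<theta> = (\<Prod>i\<in>{k q (c l)<..k q (Suc (c l))}. char (distr (P q) borel (\<zeta> q i)) \<theta>)" for q
        unfolding \<mu>_def D_def
        by (rule prob_space.char_distr_sum[OF P prob_space.indep_vars_subset[OF P ind sub[OF c]]])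
      then show "(\<lambda>q. char (\<mu> q l) \<theta>) \<longlonglongrightarrow> char (\<nu> (c l)) \<theta>" using char[OF c] by simp
    qed (use \<mu> \<nu>[OF c] in auto)
  qed
  then obtain \<Omega> Vs V where \<Omega>: "\<And>l. prob_space (\<Omega> l :: real measure)"
    and Vs: "\<And>l q. Vs l q \<in> borel_measurable (\<Omega> l)" "\<And>l q. distr (\<Omega> l) borel (Vs l q) = \<mu> q l"
    and V: "\<And>l. V l \<in> borel_measurable (\<Omega> l)" "\<And>l. distr (\<Omega> l) borel (V l) = \<nu> (c l)"
    and lim: "\<And>l x. x \<in> space (\<Omega> l) \<Longrightarrow> (\<lambda>q. Vs l q x :: real) \<longlonglongrightarrow> V l x"
    by (simp add: measurable_lborel1) metis
  let ?I = "{..<n}"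
  have \<Omega>I: "prob_space (PiM ?I \<Omega>)" by (rule prob_space_PiM) (rule \<Omega>)
  interpret \<Omega>I: prob_space "PiM ?I \<Omega>" by (rule \<Omega>I)
  \<comment> \<open>Integrals over a product of laws are moved to the product of the representing
    spaces, where all \<open>q\<close> live together and pointwise limits make sense.\<close>
  have tr: "(\<integral>x. g (cum n x) \<partial>PiM ?I (\<lambda>l. distr (\<Omega> l) borel (f l))) = (\<integral>x. g (cum n (\<lambda>l. f l (x l))) \<partial>PiM ?I \<Omega>)"
    if f: "\<And>l. f l \<in> borel_measurable (\<Omega> l)" for f
  proof -
    have m: "(\<lambda>x. \<lambda>i\<in>?I. f i (x i)) \<in> PiM ?I \<Omega> \<rightarrow>\<^sub>M PiM ?I (\<lambda>_. borel)"
      by (rule measurable_PiM_coordinatewise) (rule f)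
    have "(\<integral>x. g (cum n x) \<partial>PiM ?I (\<lambda>l. distr (\<Omega> l) borel (f l)))
       = (\<integral>x. g (cum n x) \<partial>distr (PiM ?I \<Omega>) (PiM ?I (\<lambda>_. borel)) (\<lambda>x. \<lambda>i\<in>?I. f i (x i)))"
      by (subst distr_PiM_coordinatewise[OF \<Omega> f]) auto
    also have "\<dots> = (\<integral>x. g (cum n (\<lambda>i\<in>?I. f i (x i))) \<partial>PiM ?I \<Omega>)"
      by (rule integral_distr[OF m]) measurable
    also have "\<dots> = (\<integral>x. g (cum n (\<lambda>l. f l (x l))) \<partial>PiM ?I \<Omega>)"
      by (intro Bochner_Integration.integral_cong refl arg_cong[where f=g] cum_cong) auto
    finally show ?thesis .
  qed
  \<comment> \<open>The block sums are independent, so their joint law is the product of their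
    marginals, and the represented variables \<open>Vs\<close> have the same marginals.\<close>
  have lhs: "(\<integral>\<omega>. g (\<lambda>l. \<Sum>i\<in>{0<..k q (min l n)}. \<zeta> q i \<omega>) \<partial>P q) = (\<integral>x. g (cum n (\<lambda>l. Vs l q (x l))) \<partial>PiM ?I \<Omega>)" for q
  proof -
    interpret prob_space "P q" by (rule P)
    have sumD: "(\<Sum>i\<in>{0<..k q l}. \<zeta> q i \<omega>) = (\<Sum>j<l. D q j \<omega>)" if "l \<le> n" for l \<omega>
      using that
    proof (induction l)
      case (Suc l)
      have "{0<..k q (Suc l)} = {0<..k q l} \<union> {k q l<..k q (Suc l)}" using k[of l q] Suc.prems by auto
      then have "(\<Sum>i\<in>{0<..k q (Suc l)}. \<zeta> q i \<omega>) = (\<Sum>i\<in>{0<..k q l}. \<zeta> q i \<omega>) + D q l \<omega>"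
        unfolding D_def by (simp add: sum.union_disjoint)
      then show ?case using Suc by simp
    qed (simp add: k0)
    have m: "(\<lambda>\<omega>. \<lambda>l\<in>?I. D q l \<omega>) \<in> P q \<rightarrow>\<^sub>M PiM ?I (\<lambda>_. borel)"
      by (intro measurable_restrict Dm) auto
    have "(\<integral>\<omega>. g (\<lambda>l. \<Sum>i\<in>{0<..k q (min l n)}. \<zeta> q i \<omega>) \<partial>P q) = (\<integral>\<omega>. g (cum n (\<lambda>l\<in>?I. D q l \<omega>)) \<partial>P q)"
      by (intro Bochner_Integration.integral_cong refl arg_cong[where f=g]) (auto simp: cum_def sumD fun_eq_iff)
    also have "\<dots> = (\<integral>x. g (cum n x) \<partial>distr (P q) (PiM ?I (\<lambda>_. borel)) (\<lambda>\<omega>. \<lambda>l\<in>?I. D q l \<omega>))"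
      by (rule integral_distr[OF m, symmetric]) measurable
    also have "distr (P q) (PiM ?I (\<lambda>_. borel)) (\<lambda>\<omega>. \<lambda>l\<in>?I. D q l \<omega>) = PiM ?I (\<lambda>l. distr (P q) borel (D q l))"
      using Dind[of q] n by (subst (asm) indep_vars_iff_distr_eq_PiM') (auto intro: Dm)
    also have "\<dots> = PiM ?I (\<lambda>l. distr (\<Omega> l) borel (Vs l q))"
      by (intro PiM_cong) (auto simp: Vs \<mu>_def c_def)
    finally show ?thesis unfolding tr[OF Vs(1)] .
  qed
  have rhs: "(\<integral>x. g (cum n x) \<partial>PiM {..<n} \<nu>) = (\<integral>x. g (cum n (\<lambda>l. V l (x l))) \<partial>PiM ?I \<Omega>)"
    unfolding tr[OF V(1), symmetric] V(2)
    by (intro Bochner_Integration.integral_cong PiM_cong) (auto simp: c_def)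
  have mm: "(\<lambda>x. g (cum n (\<lambda>l. f l (x l)))) \<in> borel_measurable (PiM ?I \<Omega>)"
    if f: "\<And>l. f l \<in> borel_measurable (\<Omega> l)" for f
  proof -
    have m: "(\<lambda>x. \<lambda>i\<in>?I. f i (x i)) \<in> PiM ?I \<Omega> \<rightarrow>\<^sub>M PiM ?I (\<lambda>_. borel)"
      by (rule measurable_PiM_coordinatewise) (rule f)
    have "(\<lambda>x. g (cum n (\<lambda>l. f l (x l)))) = (\<lambda>x. g (cum n (\<lambda>i\<in>?I. f i (x i))))"
      by (intro ext arg_cong[where f=g] cum_cong) auto
    then show ?thesis using measurable_compose[OF measurable_compose[OF m measurable_cum_PiM] gm] by simp
  qed
  show ?thesis
    unfolding lhs rhs
  proof (rule integral_dominated_convergence[where w="\<lambda>_. B"])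
    show "AE x in PiM ?I \<Omega>. (\<lambda>q. g (cum n (\<lambda>l. Vs l q (x l)))) \<longlonglongrightarrow> g (cum n (\<lambda>l. V l (x l)))"
    proof (rule AE_I2)
      fix x assume x: "x \<in> space (PiM ?I \<Omega>)"
      have "(\<lambda>q. cum n (\<lambda>l. Vs l q (x l))) \<longlonglongrightarrow> cum n (\<lambda>l. V l (x l))"
        using x by (intro tendsto_cum lim) (auto simp: space_PiM)
      then show "(\<lambda>q. g (cum n (\<lambda>l. Vs l q (x l)))) \<longlonglongrightarrow> g (cum n (\<lambda>l. V l (x l)))"
        using g by (intro isCont_tendsto_compose[of _ g]) (auto simp: continuous_on_eq_continuous_at)
    qed
  qed (use mm Vs V B in auto)
qed

section \<open>An exponential maximal inequality\<close>

text \<open>For \<open>x = -y\<close> with \<open>0 < y\<close>, take reciprocals in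
  \<open>1 + y \<le> exp y\<close> and use \<open>(1 - y + y^2) * (1 + y) = 1 + y^3\<close>.\<close>

lemma exp_le_quadratic:
  fixes x :: real
  assumes "\<bar>x\<bar> \<le> 1"
  shows "exp x \<le> 1 + x + x\<^sup>2"
proof (cases "0 \<le> x")
  case True
  then show ?thesis using assms exp_bound[of x] by simp
next
  case False
  define y where "y = - x"
  have y: "0 < y" "y \<le> 1" using assms False by (auto simp: y_def)
  have "1 + y \<le> exp y" by (rule exp_ge_add_one_self)
  then have "inverse (exp y) \<le> inverse (1 + y)" using y by (intro le_imp_inverse_le) auto
  also have "\<dots> \<le> 1 - y + y\<^sup>2"
  proof -
    have "1 \<le> 1 + y ^ 3" using y by simp
    also have "\<dots> = (1 - y + y\<^sup>2) * (1 + y)" by (simp add: algebra_simps power2_eq_square power3_eq_cube)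
    finally show ?thesis using y by (simp add: inverse_eq_divide pos_divide_le_eq)
  qed
  finally show ?thesis by (simp add: y_def exp_minus)
qed

context prob_space
begin

text \<open>Integrate the quadratic bound and use \<open>1 + x \<le> exp x\<close>. The absolute
  value of the mean makes the bound at least 1 and insensitive to the sign of
  \<open>\<xi>\<close>.\<close>

lemma exp_moment_le:
  fixes \<xi> :: "'a \<Rightarrow> real"
  assumes m: "random_variable borel \<xi>" and b: "AE \<omega> in M. \<bar>\<theta> * \<xi> \<omega>\<bar> \<le> 1" and \<theta>: "\<theta> > 0"
  shows "integrable M (\<lambda>\<omega>. exp (\<theta> * \<xi> \<omega>))"
    and "(\<integral>\<omega>. exp (\<theta> * \<xi> \<omega>) \<partial>M) \<le> exp (\<theta> * \<bar>\<integral>\<omega>. \<xi> \<omega> \<partial>M\<bar> + \<theta>\<^sup>2 * (\<integral>\<omega>. (\<xi> \<omega>)\<^sup>2 \<partial>M))"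
proof -
  have [measurable]: "\<xi> \<in> borel_measurable M" by (rule m)
  have b': "AE \<omega> in M. \<bar>\<xi> \<omega>\<bar> \<le> 1 / \<theta>" using b \<theta> by (auto simp: abs_mult field_simps)
  have i1: "integrable M \<xi>" by (rule integrable_const_bound[of _ "1 / \<theta>"]) (use b' in auto)
  have i2: "integrable M (\<lambda>\<omega>. (\<xi> \<omega>)\<^sup>2)"
    by (rule integrable_const_bound[of _ "(1 / \<theta>)\<^sup>2"]) (use b' \<theta> in \<open>auto simp: power2_le_iff_abs_le\<close>)
  show i: "integrable M (\<lambda>\<omega>. exp (\<theta> * \<xi> \<omega>))"
    by (rule integrable_const_bound[of _ "exp 1"]) (use b in auto)
  have "(\<integral>\<omega>. exp (\<theta> * \<xi> \<omega>) \<partial>M) \<le> (\<integral>\<omega>. 1 + \<theta> * \<xi> \<omega> + \<theta>\<^sup>2 * (\<xi> \<omega>)\<^sup>2 \<partial>M)"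
  proof (rule integral_mono_AE[OF i])
    show "integrable M (\<lambda>\<omega>. 1 + \<theta> * \<xi> \<omega> + \<theta>\<^sup>2 * (\<xi> \<omega>)\<^sup>2)" using i1 i2 by auto
    show "AE \<omega> in M. exp (\<theta> * \<xi> \<omega>) \<le> 1 + \<theta> * \<xi> \<omega> + \<theta>\<^sup>2 * (\<xi> \<omega>)\<^sup>2"
      using b by eventually_elim (use exp_le_quadratic in \<open>simp add: power_mult_distrib[symmetric]\<close>)
  qed
  also have "\<dots> = 1 + (\<theta> * (\<integral>\<omega>. \<xi> \<omega> \<partial>M) + \<theta>\<^sup>2 * (\<integral>\<omega>. (\<xi> \<omega>)\<^sup>2 \<partial>M))"
    using i1 i2 by (simp add: prob_space)
  also have "\<dots> \<le> 1 + (\<theta> * \<bar>\<integral>\<omega>. \<xi> \<omega> \<partial>M\<bar> + \<theta>\<^sup>2 * (\<integral>\<omega>. (\<xi> \<omega>)\<^sup>2 \<partial>M))"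
    using \<theta> by (intro add_mono mult_left_mono) auto
  also have "\<dots> \<le> exp (\<theta> * \<bar>\<integral>\<omega>. \<xi> \<omega> \<partial>M\<bar> + \<theta>\<^sup>2 * (\<integral>\<omega>. (\<xi> \<omega>)\<^sup>2 \<partial>M))" by (rule exp_ge_add_one_self)
  finally show "(\<integral>\<omega>. exp (\<theta> * \<xi> \<omega>) \<partial>M) \<le> exp (\<theta> * \<bar>\<integral>\<omega>. \<xi> \<omega> \<partial>M\<bar> + \<theta>\<^sup>2 * (\<integral>\<omega>. (\<xi> \<omega>)\<^sup>2 \<partial>M))" .
qed

text \<open>
  With \<open>c\<^sub>i \<ge> 1\<close> dominating the exponential moments, the process \<open>exp (\<theta> S)\<close> stopped (at the value
  \<open>exp (\<theta> \<epsilon>)\<close>) when \<open>S\<close> reaches \<open>\<epsilon>\<close> and divided by \<open>\<Prod> c\<^sub>i\<close> is a supermartingale.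
\<close>

lemma one_sided_maximal:
  fixes \<xi> :: "nat \<Rightarrow> 'a \<Rightarrow> real"
  assumes ind: "indep_vars (\<lambda>_. borel) \<xi> {k<..m}" and km: "k \<le> m"
    and b: "\<And>i. i \<in> {k<..m} \<Longrightarrow> AE \<omega> in M. \<bar>\<theta> * \<xi> i \<omega>\<bar> \<le> 1" and \<theta>: "\<theta> > 0"
    and c: "\<And>i. i \<in> {k<..m} \<Longrightarrow> (\<integral>\<omega>. exp (\<theta> * \<xi> i \<omega>) \<partial>M) \<le> c i" "\<And>i. i \<in> {k<..m} \<Longrightarrow> 1 \<le> c i"
  shows "prob {\<omega> \<in> space M. \<exists>l\<in>{k<..m}. (\<Sum>i\<in>{k<..l}. \<xi> i \<omega>) \<ge> \<epsilon>} \<le> (\<Prod>i\<in>{k<..m}. c i) * exp (- \<theta> * \<epsilon>)"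
proof -
  \<comment> \<open>On \<open>A n\<close> the partial sums have stayed below
    \<open>\<epsilon>\<close> up to \<open>n\<close>. Below, \<open>X n\<close> keeps only the
    coordinates up to \<open>n\<close>, so that functions of it are independent of the next
    variable.\<close>
  define A where "A n = {x :: nat \<Rightarrow> real. \<forall>l\<in>{k<..n}. (\<Sum>i\<in>{k<..l}. x i) < \<epsilon>}" for n
  define E where "E n x = indicator (A n) x * exp (\<theta> * (\<Sum>i\<in>{k<..n}. x i))" for n and x :: "nat \<Rightarrow> real"
  define X where "X n \<omega> = (\<lambda>i\<in>{k<..n}. \<xi> i \<omega>)" for n \<omega>
  \<comment> \<open>The stopped exponential: \<open>exp (\<theta> * S)\<close> while below the
    level, and the constant \<open>exp (\<theta> * \<epsilon>)\<close> from the first passage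
    on.\<close>
  define F where "F n \<omega> = E n (X n \<omega>) + exp (\<theta> * \<epsilon>) * (1 - indicator (A n) (X n \<omega>))" for n \<omega>
  have \<xi>m: "\<xi> i \<in> borel_measurable M" if "i \<in> {k<..m}" for i
    using ind that unfolding indep_vars_def2 by blast
  have Xm: "X n \<in> M \<rightarrow>\<^sub>M PiM {k<..n} (\<lambda>_. borel)" if "n \<le> m" for n
    unfolding X_def using that by (intro measurable_restrict \<xi>m) auto
  have sm [measurable]: "(\<lambda>x. \<Sum>i\<in>{k<..l}. x i) \<in> borel_measurable (PiM {k<..n} (\<lambda>_. borel :: real measure))" if "l \<le> n" for l n
    using that by (intro borel_measurable_sum measurable_component_singleton) auto
  have Am: "(\<lambda>x. indicator (A n) x :: real) \<in> borel_measurable (PiM {k<..n} (\<lambda>_. borel))" for n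
  proof -
    have "{x \<in> space (PiM {k<..n} (\<lambda>_. borel)). \<forall>l\<in>{k<..n}. (\<Sum>i\<in>{k<..l}. x i) < \<epsilon>} \<in> sets (PiM {k<..n} (\<lambda>_. borel :: real measure))"
      by (intro sets.sets_Collect_finite_All borel_measurable_less sm borel_measurable_const) auto
    then show ?thesis
      by (subst borel_measurable_indicator_iff) (simp add: A_def Int_def conj_commute)
  qed
  have Em: "E n \<in> borel_measurable (PiM {k<..n} (\<lambda>_. borel))" for n
    unfolding E_def by (intro borel_measurable_times Am measurable_compose[OF _ borel_measurable_exp] borel_measurable_const sm) auto
  have sumX: "(\<Sum>i\<in>{k<..l}. X n \<omega> i) = (\<Sum>i\<in>{k<..l}. \<xi> i \<omega>)" if "l \<le> n" for l n \<omega>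
    unfolding X_def using that by (intro sum.cong) auto
  have AX: "X n \<omega> \<in> A n \<longleftrightarrow> (\<forall>l\<in>{k<..n}. (\<Sum>i\<in>{k<..l}. \<xi> i \<omega>) < \<epsilon>)" for n \<omega>
    unfolding A_def using sumX by auto
  have EX: "E n (X n \<omega>) = indicator (A n) (X n \<omega>) * exp (\<theta> * (\<Sum>i\<in>{k<..n}. \<xi> i \<omega>))" for n \<omega>
    unfolding E_def by (simp add: sumX)
  have iA: "integrable M (\<lambda>\<omega>. exp (\<theta> * \<epsilon>) * (1 - indicator (A n) (X n \<omega>)))" if "n \<le> m" for n
    by (rule integrable_const_bound[of _ "exp (\<theta> * \<epsilon>)"])
      (auto simp: indicator_def intro!: borel_measurable_times borel_measurable_diff borel_measurable_const measurable_compose[OF Xm[OF that] Am, unfolded indicator_def])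
  have iE: "integrable M (\<lambda>\<omega>. E n (X n \<omega>))" if "n \<le> m" for n
  proof (rule integrable_const_bound[of _ "exp (real (card {k<..n}))"])
    have "AE \<omega> in M. \<forall>i\<in>{k<..n}. \<bar>\<theta> * \<xi> i \<omega>\<bar> \<le> 1"
      using b that by (intro AE_finite_allI) auto
    then show "AE \<omega> in M. norm (E n (X n \<omega>)) \<le> exp (real (card {k<..n}))"
    proof eventually_elim
      case (elim \<omega>)
      have "\<theta> * (\<Sum>i\<in>{k<..n}. \<xi> i \<omega>) \<le> (\<Sum>i\<in>{k<..n}. 1)"
        unfolding sum_distrib_left using elim by (intro sum_mono) (auto simp: abs_le_iff)
      then show ?case unfolding EX by (auto simp: indicator_def)
    qed
    show "(\<lambda>\<omega>. E n (X n \<omega>)) \<in> borel_measurable M" by (rule measurable_compose[OF Xm[OF that] Em])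
  qed
  have "(\<integral>\<omega>. F n \<omega> \<partial>M) \<le> (\<Prod>i\<in>{k<..n}. c i)" if "k \<le> n" "n \<le> m" for n
    using that
  proof (induction n rule: dec_induct)
    case base
    have "F k \<omega> = 1" for \<omega> by (simp add: F_def EX AX)
    then show ?case by (simp add: prob_space)
  next
    case (step n)
    then have n: "n \<le> m" "Suc n \<le> m" "Suc n \<in> {k<..m}" by auto
    have S: "(\<Sum>i\<in>{k<..Suc n}. \<xi> i \<omega>) = (\<Sum>i\<in>{k<..n}. \<xi> i \<omega>) + \<xi> (Suc n) \<omega>" for \<omega>
    proof -
      have "{k<..Suc n} = insert (Suc n) {k<..n}" using step by auto
      then show ?thesis by simp
    qed
    have iv: "indep_var borel (\<lambda>\<omega>. E n (X n \<omega>)) borel (\<lambda>\<omega>. exp (\<theta> * \<xi> (Suc n) \<omega>))"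
    proof -
      have "indep_var (PiM {k<..n} (\<lambda>_. borel)) (\<lambda>\<omega>. restrict (\<lambda>i. \<xi> i \<omega>) {k<..n})
          (PiM {Suc n} (\<lambda>_. borel)) (\<lambda>\<omega>. restrict (\<lambda>i. \<xi> i \<omega>) {Suc n})"
        by (rule indep_var_restrict[OF ind]) (use n in auto)
      then have "indep_var borel (E n \<circ> (\<lambda>\<omega>. restrict (\<lambda>i. \<xi> i \<omega>) {k<..n}))
          borel ((\<lambda>x. exp (\<theta> * x (Suc n))) \<circ> (\<lambda>\<omega>. restrict (\<lambda>i. \<xi> i \<omega>) {Suc n}))"
        by (rule indep_var_compose) (auto intro!: Em measurable_compose[OF _ borel_measurable_exp] borel_measurable_times measurable_component_singleton)
      then show ?thesis by (simp add: comp_def X_def)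
    qed
    have ie: "integrable M (\<lambda>\<omega>. exp (\<theta> * \<xi> (Suc n) \<omega>))"
      by (rule exp_moment_le(1)) (use \<xi>m b \<theta> n in auto)
    note prod = indep_var_lebesgue_integral[OF iv iE[OF n(1)] ie] indep_var_integrable[OF iv iE[OF n(1)] ie]
    have "(\<integral>\<omega>. F (Suc n) \<omega> \<partial>M) \<le> (\<integral>\<omega>. E n (X n \<omega>) * exp (\<theta> * \<xi> (Suc n) \<omega>) + exp (\<theta> * \<epsilon>) * (1 - indicator (A n) (X n \<omega>)) \<partial>M)"
    proof (rule integral_mono)
      show "integrable M (F (Suc n))" unfolding F_def using iE iA n by auto
      show "integrable M (\<lambda>\<omega>. E n (X n \<omega>) * exp (\<theta> * \<xi> (Suc n) \<omega>) + exp (\<theta> * \<epsilon>) * (1 - indicator (A n) (X n \<omega>)))"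
        using prod iA n by auto
      fix \<omega>
      have sub: "X (Suc n) \<omega> \<in> A (Suc n) \<longleftrightarrow> X n \<omega> \<in> A n \<and> (\<Sum>i\<in>{k<..Suc n}. \<xi> i \<omega>) < \<epsilon>"
        unfolding AX using step by (auto simp: le_Suc_eq)
      have "E n (X n \<omega>) * exp (\<theta> * \<xi> (Suc n) \<omega>) = indicator (A n) (X n \<omega>) * exp (\<theta> * (\<Sum>i\<in>{k<..Suc n}. \<xi> i \<omega>))"
        unfolding EX S by (simp add: distrib_left exp_add)
      \<comment> \<open>If \<open>A\<close> is left at step \<open>n + 1\<close>, the sum is at
        least \<open>\<epsilon>\<close>, so replacing its exponential by
        \<open>exp (\<theta> * \<epsilon>)\<close> only lowers the value.\<close>
      then show "F (Suc n) \<omega> \<le> E n (X n \<omega>) * exp (\<theta> * \<xi> (Suc n) \<omega>) + exp (\<theta> * \<epsilon>) * (1 - indicator (A n) (X n \<omega>))"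
        unfolding F_def EX[of "Suc n"] using sub \<theta> by (auto simp: indicator_def)
    qed
    also have "\<dots> = (\<integral>\<omega>. E n (X n \<omega>) \<partial>M) * (\<integral>\<omega>. exp (\<theta> * \<xi> (Suc n) \<omega>) \<partial>M) + (\<integral>\<omega>. exp (\<theta> * \<epsilon>) * (1 - indicator (A n) (X n \<omega>)) \<partial>M)"
      using prod iA[OF n(1)] by simp
    \<comment> \<open>Since \<open>c (Suc n)\<close> is at least 1, the stopped part may be
      multiplied by it as well, which restores \<open>F n\<close>.\<close>
    also have "\<dots> \<le> (\<integral>\<omega>. E n (X n \<omega>) \<partial>M) * c (Suc n) + (\<integral>\<omega>. exp (\<theta> * \<epsilon>) * (1 - indicator (A n) (X n \<omega>)) \<partial>M) * c (Suc n)"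
    proof (rule add_mono)
      show "(\<integral>\<omega>. E n (X n \<omega>) \<partial>M) * (\<integral>\<omega>. exp (\<theta> * \<xi> (Suc n) \<omega>) \<partial>M) \<le> (\<integral>\<omega>. E n (X n \<omega>) \<partial>M) * c (Suc n)"
        using c(1)[OF n(3)] by (intro mult_left_mono integral_nonneg_AE) (auto simp: E_def)
      have "0 \<le> (\<integral>\<omega>. exp (\<theta> * \<epsilon>) * (1 - indicator (A n) (X n \<omega>)) \<partial>M)"
        by (intro integral_nonneg_AE) (auto simp: indicator_def)
      then show "(\<integral>\<omega>. exp (\<theta> * \<epsilon>) * (1 - indicator (A n) (X n \<omega>)) \<partial>M) \<le> (\<integral>\<omega>. exp (\<theta> * \<epsilon>) * (1 - indicator (A n) (X n \<omega>)) \<partial>M) * c (Suc n)"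
        using c(2)[OF n(3)] by (metis mult.right_neutral mult_left_mono)
    qed
    also have "\<dots> = (\<integral>\<omega>. F n \<omega> \<partial>M) * c (Suc n)"
      unfolding F_def using iE[OF n(1)] iA[OF n(1)] by (simp add: distrib_right)
    also have "\<dots> \<le> (\<Prod>i\<in>{k<..n}. c i) * c (Suc n)"
      using step.IH n c(2)[OF n(3)] by (intro mult_right_mono) auto
    also have "\<dots> = (\<Prod>i\<in>{k<..Suc n}. c i)"
    proof -
      have "{k<..Suc n} = insert (Suc n) {k<..n}" using step by auto
      then show ?thesis by (simp add: mult.commute)
    qed
    finally show ?case .
  qed
  from this[OF km order_refl] have F: "(\<integral>\<omega>. F m \<omega> \<partial>M) \<le> (\<Prod>i\<in>{k<..m}. c i)" .
  let ?H = "{\<omega> \<in> space M. \<exists>l\<in>{k<..m}. (\<Sum>i\<in>{k<..l}. \<xi> i \<omega>) \<ge> \<epsilon>}"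
  have H: "?H \<in> events"
    using \<xi>m by (intro sets.sets_Collect_finite_Ex borel_measurable_le) (auto intro!: borel_measurable_sum)
  \<comment> \<open>Markov's inequality: \<open>F m\<close> is at least
    \<open>exp (\<theta> * \<epsilon>)\<close> once the level has been reached.\<close>
  have "exp (\<theta> * \<epsilon>) * prob ?H = (\<integral>\<omega>. exp (\<theta> * \<epsilon>) * indicator ?H \<omega> \<partial>M)" using H by simp
  also have "\<dots> \<le> (\<integral>\<omega>. F m \<omega> \<partial>M)"
  proof (rule integral_mono)
    show "integrable M (\<lambda>\<omega>. exp (\<theta> * \<epsilon>) * indicator ?H \<omega>)"
      using H by (intro integrable_mult_right integrable_real_indicator) (auto simp: emeasure_eq_measure)
    show "integrable M (F m)" unfolding F_def using iE iA by auto
    fix \<omega> assume "\<omega> \<in> space M"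
    then have "\<omega> \<in> ?H \<longleftrightarrow> X m \<omega> \<notin> A m" unfolding AX by (auto simp: not_less)
    moreover have "0 \<le> E m (X m \<omega>)" by (simp add: E_def)
    ultimately show "exp (\<theta> * \<epsilon>) * indicator ?H \<omega> \<le> F m \<omega>"
      unfolding F_def by (auto simp: indicator_def)
  qed
  also note F
  finally show ?thesis by (simp add: exp_minus field_simps)
qed

text \<open>The one-sided bound is applied to \<open>\<xi>\<close> and to \<open>-\<xi>\<close>; the
  same factors \<open>c i\<close> serve both signs.\<close>

lemma two_sided_maximal:
  fixes \<xi> :: "nat \<Rightarrow> 'a \<Rightarrow> real"
  assumes ind: "indep_vars (\<lambda>_. borel) \<xi> {k<..m}" and km: "k \<le> m"
    and b: "\<And>i. i \<in> {k<..m} \<Longrightarrow> AE \<omega> in M. \<bar>\<theta> * \<xi> i \<omega>\<bar> \<le> 1" and \<theta>: "\<theta> > 0"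
  shows "prob {\<omega> \<in> space M. \<exists>l\<in>{k<..m}. \<bar>\<Sum>i\<in>{k<..l}. \<xi> i \<omega>\<bar> \<ge> \<epsilon>}
      \<le> 2 * exp (\<theta> * (\<Sum>i\<in>{k<..m}. \<bar>\<integral>\<omega>. \<xi> i \<omega> \<partial>M\<bar>) + \<theta>\<^sup>2 * (\<Sum>i\<in>{k<..m}. \<integral>\<omega>. (\<xi> i \<omega>)\<^sup>2 \<partial>M) - \<theta> * \<epsilon>)"
    (is "_ \<le> 2 * exp ?e")
proof -
  define c where "c i = exp (\<theta> * \<bar>\<integral>\<omega>. \<xi> i \<omega> \<partial>M\<bar> + \<theta>\<^sup>2 * (\<integral>\<omega>. (\<xi> i \<omega>)\<^sup>2 \<partial>M))" for i
  have \<xi>m: "\<xi> i \<in> borel_measurable M" if "i \<in> {k<..m}" for i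
    using ind that unfolding indep_vars_def2 by blast
  have c1: "1 \<le> c i" for i using \<theta> by (simp add: c_def)
  have C: "(\<Prod>i\<in>{k<..m}. c i) * exp (- \<theta> * \<epsilon>) = exp ?e"
    unfolding c_def by (simp add: exp_sum[symmetric] sum.distrib sum_distrib_left exp_add[symmetric] exp_diff exp_minus field_simps)
  have 1: "prob {\<omega> \<in> space M. \<exists>l\<in>{k<..m}. (\<Sum>i\<in>{k<..l}. \<xi> i \<omega>) \<ge> \<epsilon>} \<le> exp ?e"
    unfolding C[symmetric]
    by (rule one_sided_maximal[OF ind km b \<theta> _ c1]) (use \<xi>m b \<theta> in \<open>auto simp: c_def intro!: exp_moment_le(2)\<close>)
  have ind': "indep_vars (\<lambda>_. borel) (\<lambda>i \<omega>. - \<xi> i \<omega>) {k<..m}"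
    by (rule indep_vars_compose2[OF ind]) auto
  have 2: "prob {\<omega> \<in> space M. \<exists>l\<in>{k<..m}. (\<Sum>i\<in>{k<..l}. - \<xi> i \<omega>) \<ge> \<epsilon>} \<le> exp ?e"
    unfolding C[symmetric]
  proof (rule one_sided_maximal[OF ind' km _ \<theta> _ c1])
    fix i assume i: "i \<in> {k<..m}"
    show "AE \<omega> in M. \<bar>\<theta> * - \<xi> i \<omega>\<bar> \<le> 1" using b[OF i] by simp
    show "(\<integral>\<omega>. exp (\<theta> * - \<xi> i \<omega>) \<partial>M) \<le> c i"
      using exp_moment_le(2)[of "\<lambda>\<omega>. - \<xi> i \<omega>" \<theta>] \<xi>m[OF i] b[OF i] \<theta> by (simp add: c_def)
  qed
  let ?H = "{\<omega> \<in> space M. \<exists>l\<in>{k<..m}. (\<Sum>i\<in>{k<..l}. \<xi> i \<omega>) \<ge> \<epsilon>}"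
    and ?H' = "{\<omega> \<in> space M. \<exists>l\<in>{k<..m}. (\<Sum>i\<in>{k<..l}. - \<xi> i \<omega>) \<ge> \<epsilon>}"
  have ev: "?H \<in> events" "?H' \<in> events"
    using \<xi>m by (auto intro!: sets.sets_Collect_finite_Ex borel_measurable_le borel_measurable_sum borel_measurable_uminus)
  have "prob {\<omega> \<in> space M. \<exists>l\<in>{k<..m}. \<bar>\<Sum>i\<in>{k<..l}. \<xi> i \<omega>\<bar> \<ge> \<epsilon>} \<le> prob (?H \<union> ?H')"
  proof (rule finite_measure_mono)
    show "?H \<union> ?H' \<in> events" using ev by auto
    show "{\<omega> \<in> space M. \<exists>l\<in>{k<..m}. \<bar>\<Sum>i\<in>{k<..l}. \<xi> i \<omega>\<bar> \<ge> \<epsilon>} \<subseteq> ?H \<union> ?H'"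
      by (auto simp: sum_negf abs_real_def split: if_splits)
  qed
  also have "\<dots> \<le> prob ?H + prob ?H'" using ev by (intro measure_Un_le)
  finally show ?thesis using 1 2 by linarith
qed

end

section \<open>Logarithms of small perturbations of 1\<close>

text \<open>The function inside the absolute value vanishes at 0 and has derivative
  \<open>t^2 / (1 + t)\<close>, which is at most \<open>2 * x^2\<close> between \<open>-|x|\<close>
  and \<open>|x|\<close>.\<close>

lemma ln_one_plus_second_order:
  fixes x :: real
  assumes x: "\<bar>x\<bar> \<le> 1/2"
  shows "\<bar>ln (1 + x) - x + x\<^sup>2 / 2\<bar> \<le> 2 * \<bar>x\<bar> ^ 3"
proof -
  let ?f = "\<lambda>t::real. ln (1 + t) - t + t\<^sup>2 / 2"
  have "norm (?f x - ?f 0) \<le> (2 * x\<^sup>2) * norm (x - 0)"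
  proof (rule field_differentiable_bound[where S="{- \<bar>x\<bar>..\<bar>x\<bar>}"])
    fix t assume t: "t \<in> {- \<bar>x\<bar>..\<bar>x\<bar>}"
    then have t1: "1 + t \<ge> 1/2" using x by auto
    show "(?f has_field_derivative t\<^sup>2 / (1 + t)) (at t within {- \<bar>x\<bar>..\<bar>x\<bar>})"
      using t1 by (auto intro!: derivative_eq_intros simp: field_simps power2_eq_square)
    have "norm (t\<^sup>2 / (1 + t)) = t\<^sup>2 * (1 / (1 + t))" using t1 by simp
    also have "\<dots> \<le> x\<^sup>2 * 2"
      using t t1 by (intro mult_mono) (auto simp: field_simps abs_le_square_iff[symmetric])
    finally show "norm (t\<^sup>2 / (1 + t)) \<le> 2 * x\<^sup>2" by simp
  qed auto
  then show ?thesis by (simp add: power3_eq_cube power2_eq_square abs_mult)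
qed

lemma ln_one_plus_le: "\<bar>x\<bar> \<le> 1/2 \<Longrightarrow> \<bar>ln (1 + x)\<bar> \<le> 2 * \<bar>x\<bar>" for x :: real
proof -
  assume x: "\<bar>x\<bar> \<le> 1/2"
  have "2 * x\<^sup>2 \<le> \<bar>x\<bar>" using mult_right_mono[OF x, of "\<bar>x\<bar>"] by (simp add: power2_eq_square)
  then show ?thesis using abs_ln_one_plus_x_minus_x_bound[OF x] by linarith
qed

text \<open>The second-order term collects two effects: the curvature of the logarithm, which is the
  source of the drift correction \<open>- sigma^2 / 2\<close>, and the second-order term of the
  exponential. Of the three constants, the first comes from the Taylor remainder of the exponential
  with \<open>|ln (1 + x)| \<le> 2 * |x|\<close>, the second from the remainder of the logarithm,
  the third from replacing \<open>u^2\<close> by \<open>x^2\<close>.\<close>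

lemma iexp_ln_expansion:
  fixes x \<theta> :: real
  assumes x: "\<bar>x\<bar> \<le> 1/2"
  shows "norm (iexp (\<theta> * ln (1 + x)) - (1 + \<i> * \<theta> * x - (\<i> * \<theta> + \<theta>\<^sup>2) / 2 * x\<^sup>2))
      \<le> (2 * \<bar>\<theta>\<bar> ^ 3 + 2 * \<bar>\<theta>\<bar> + 3 * \<theta>\<^sup>2) * \<bar>x\<bar> ^ 3"
proof -
  define u where "u = ln (1 + x)"
  have u: "\<bar>u\<bar> \<le> 2 * \<bar>x\<bar>" unfolding u_def by (rule ln_one_plus_le[OF x])
  have 1: "norm (iexp (\<theta> * u) - (1 + \<i> * (\<theta> * u) - (\<theta> * u)\<^sup>2 / 2)) \<le> \<bar>\<theta> * u\<bar> ^ 3 / 6"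
    using iexp_approx1[of "\<theta> * u" 2]
    by (simp add: numeral_2_eq_2 power2_eq_square fact_numeral eval_nat_numeral algebra_simps)
  have "\<bar>\<theta> * u\<bar> ^ 3 \<le> (\<bar>\<theta>\<bar> * (2 * \<bar>x\<bar>)) ^ 3"
    unfolding abs_mult using u by (intro power_mono mult_left_mono) auto
  also have "\<dots> = 8 * (\<bar>\<theta>\<bar> ^ 3 * \<bar>x\<bar> ^ 3)" by (simp add: power_mult_distrib)
  also have "\<dots> \<le> 12 * (\<bar>\<theta>\<bar> ^ 3 * \<bar>x\<bar> ^ 3)" by (intro mult_right_mono) auto
  finally have b1: "\<bar>\<theta> * u\<bar> ^ 3 / 6 \<le> 2 * \<bar>\<theta>\<bar> ^ 3 * \<bar>x\<bar> ^ 3" by simp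
  have 2: "\<bar>u - x + x\<^sup>2 / 2\<bar> \<le> 2 * \<bar>x\<bar> ^ 3" unfolding u_def by (rule ln_one_plus_second_order[OF x])
  have 3: "\<bar>u\<^sup>2 - x\<^sup>2\<bar> \<le> 6 * \<bar>x\<bar> ^ 3"
  proof -
    have "\<bar>u\<^sup>2 - x\<^sup>2\<bar> = \<bar>u - x\<bar> * \<bar>u + x\<bar>" by (simp add: power2_eq_square abs_mult[symmetric] algebra_simps)
    also have "\<dots> \<le> (2 * x\<^sup>2) * (3 * \<bar>x\<bar>)"
      using abs_ln_one_plus_x_minus_x_bound[OF x] u by (intro mult_mono) (auto simp: u_def)
    finally show ?thesis by (simp add: power3_eq_cube power2_eq_square abs_mult)
  qed
  have tri: "norm (A + B - C) \<le> norm A + norm B + norm C" for A B C :: complex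
    using norm_triangle_ineq4[of "A + B" C] norm_triangle_ineq[of A B] by linarith
  have "iexp (\<theta> * u) - (1 + \<i> * \<theta> * x - (\<i> * \<theta> + \<theta>\<^sup>2) / 2 * x\<^sup>2) =
      (iexp (\<theta> * u) - (1 + \<i> * (\<theta> * u) - (\<theta> * u)\<^sup>2 / 2)) + \<i> * \<theta> * (u - x + x\<^sup>2 / 2) - \<theta>\<^sup>2 / 2 * (u\<^sup>2 - x\<^sup>2)"
    by (simp add: algebra_simps power_mult_distrib add_divide_distrib diff_divide_distrib)
  also have "norm \<dots> \<le> \<bar>\<theta> * u\<bar> ^ 3 / 6 + norm (\<i> * \<theta> * (u - x + x\<^sup>2 / 2)) + norm (complex_of_real (\<theta>\<^sup>2 / 2 * (u\<^sup>2 - x\<^sup>2)))"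
    by (rule order_trans[OF tri add_right_mono[OF add_right_mono[OF 1]]])
  also have "norm (\<i> * \<theta> * (u - x + x\<^sup>2 / 2)) = \<bar>\<theta>\<bar> * \<bar>u - x + x\<^sup>2 / 2\<bar>"
    by (simp only: norm_mult norm_ii norm_of_real mult_1)
  also have "\<dots> \<le> \<bar>\<theta>\<bar> * (2 * \<bar>x\<bar> ^ 3)" using 2 by (intro mult_left_mono) auto
  also have "norm (complex_of_real (\<theta>\<^sup>2 / 2 * (u\<^sup>2 - x\<^sup>2))) = \<theta>\<^sup>2 / 2 * \<bar>u\<^sup>2 - x\<^sup>2\<bar>"
    by (simp only: norm_of_real) (simp add: abs_mult)
  also have "\<dots> \<le> \<theta>\<^sup>2 / 2 * (6 * \<bar>x\<bar> ^ 3)" using 3 by (intro mult_left_mono) auto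
  finally show ?thesis using b1 unfolding u_def by (simp add: algebra_simps)
qed

section \<open>Riemann sums along a piecewise constant path\<close>

definition idx :: "real \<Rightarrow> nat \<Rightarrow> real \<Rightarrow> nat" where
  "idx T N t = nat \<lfloor>t * real N / T\<rfloor>"

lemma grid_step_idx: "t \<in> {0..T} \<Longrightarrow> grid_step T n x t = x (idx T n t)"
  by (simp add: grid_step_def idx_def)

context
  fixes T :: real assumes T: "T > 0"
begin

lemma idx_le: "t \<in> {0..T} \<Longrightarrow> idx T N t \<le> N"
  unfolding idx_def by (rule grid_index_le[OF T])

lemma idx_mono: "s \<le> t \<Longrightarrow> idx T N s \<le> idx T N t"
  unfolding idx_def using T by (intro nat_mono floor_mono divide_right_mono mult_right_mono) auto

lemma idx_0 [simp]: "idx T N 0 = 0"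
  and idx_T [simp]: "idx T N T = N"
  using T by (auto simp: idx_def)

lemma idx_bounds:
  assumes "N > 0" "t \<ge> 0"
  shows "real (idx T N t) * T / real N \<le> t" "t < (real (idx T N t) + 1) * T / real N"
proof -
  have 0: "0 \<le> t * real N / T" using assms T by simp
  then have "real (idx T N t) \<le> t * real N / T" "t * real N / T < real (idx T N t) + 1"
    unfolding idx_def by (auto simp: of_nat_nat)
  then show "real (idx T N t) * T / real N \<le> t" "t < (real (idx T N t) + 1) * T / real N"
    using assms T by (auto simp: field_simps)
qed

lemma less_idx: assumes "N > 0" "t \<ge> 0" "idx T N t < i" shows "t < real i * T / real N"
proof -
  have "(real (idx T N t) + 1) * T / real N \<le> real i * T / real N"
    using assms T by (intro divide_right_mono mult_right_mono) auto
  then show ?thesis using idx_bounds(2)[OF assms(1,2)] by linarith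
qed

lemma le_idx: assumes "N > 0" "t \<ge> 0" "i \<le> idx T N t" shows "real i * T / real N \<le> t"
proof -
  have "real i * T / real N \<le> real (idx T N t) * T / real N"
    using assms T by (intro divide_right_mono mult_right_mono) auto
  then show ?thesis using idx_bounds(1)[OF assms(1,2)] by linarith
qed

lemma idx_ratio: assumes "t \<ge> 0" shows "(\<lambda>N. real (idx T N t) / real N) \<longlonglongrightarrow> t / T"
proof -
  have "eventually (\<lambda>N. norm (real (idx T N t) / real N - t / T) \<le> 1 / real N) sequentially"
    using eventually_gt_at_top[of 0]
  proof eventually_elim
    case (elim N)
    have "real (idx T N t) / real N = real (idx T N t) * T / real N / T" using T by simp
    also have "\<dots> \<le> t / T" using idx_bounds(1)[OF elim assms] T by (intro divide_right_mono) auto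
    finally have 1: "real (idx T N t) / real N \<le> t / T" .
    have "t / T \<le> (real (idx T N t) + 1) * T / real N / T"
      using idx_bounds(2)[OF elim assms] T by (intro divide_right_mono) auto
    also have "\<dots> = real (idx T N t) / real N + 1 / real N" using T by (simp add: add_divide_distrib)
    finally show ?case using 1 by (simp add: abs_le_iff)
  qed
  then have "(\<lambda>N. real (idx T N t) / real N - t / T) \<longlonglongrightarrow> 0"
    by (rule Lim_null_comparison) (rule lim_1_over_n)
  then show ?thesis by (simp add: LIM_zero_iff)
qed

end

text \<open>In a discrete space a one-sided limit means that the path is constant on a short
  interval on that side.\<close>

lemma cadlag_nat_locally_constant:
  fixes y :: "real \<Rightarrow> nat"
  assumes y: "cadlag_on {0..} y" and y1: "\<And>t. t \<ge> 0 \<Longrightarrow> y t \<ge> 1" and x: "x \<ge> 0"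
  obtains d j where "d > 0" "j \<ge> 1" "\<And>s. x \<le> s \<Longrightarrow> s < x + d \<Longrightarrow> y s = y x"
    "\<And>s. 0 \<le> s \<Longrightarrow> x - d < s \<Longrightarrow> s < x \<Longrightarrow> y s = j"
proof -
  obtain l where r: "(y \<longlongrightarrow> y x) (at x within {0..} \<inter> {x<..})" and l: "(y \<longlongrightarrow> l) (at x within {0..} \<inter> {..<x})"
    using y x unfolding cadlag_on_def by auto
  have "eventually (\<lambda>s. y s \<in> {y x}) (at x within {0..} \<inter> {x<..})"
    by (rule topological_tendstoD[OF r]) (rule discrete_topology_class.open_discrete, simp)
  then obtain d1 where d1: "d1 > 0" "\<And>s. s \<in> {0..} \<inter> {x<..} \<Longrightarrow> dist s x < d1 \<Longrightarrow> y s = y x"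
    unfolding eventually_at by fastforce
  have "eventually (\<lambda>s. y s \<in> {l}) (at x within {0..} \<inter> {..<x})"
    by (rule topological_tendstoD[OF l]) (rule discrete_topology_class.open_discrete, simp)
  then obtain d2 where d2: "d2 > 0" "\<And>s. s \<in> {0..} \<inter> {..<x} \<Longrightarrow> dist s x < d2 \<Longrightarrow> y s = l"
    unfolding eventually_at by fastforce
  show thesis
  \<comment> \<open>At \<open>x = 0\<close> nothing lies to the left and \<open>l\<close> is
    arbitrary; \<open>max 1\<close> makes it a state anyway.\<close>
  proof (rule that[of "min d1 d2" "max 1 l"])
    show "y s = y x" if "x \<le> s" "s < x + min d1 d2" for s
      using that d1(2)[of s] x by (cases "s = x") (auto simp: dist_real_def)
    show "y s = max 1 l" if "0 \<le> s" "x - min d1 d2 < s" "s < x" for s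
      using that d2(2)[of s] y1[of s] by (auto simp: dist_real_def)
  qed (use d1 d2 in auto)
qed

text \<open>Both claims, integrability and convergence, are additive over adjacent intervals, so
  bisection reduces them to short intervals around one point, where \<open>y\<close> has one value
  before and one from that point on. There the sums for a frozen state apply, and
  \<open>small\<close> removes the one summand whose grid point may coincide with the jump.\<close>

lemma path_sum_limit:
  fixes c :: "nat \<Rightarrow> nat \<Rightarrow> nat \<Rightarrow> real" and y :: "real \<Rightarrow> nat"
  assumes T: "T > 0" and y: "cadlag_on {0..} y" and y1: "\<And>t. t \<ge> 0 \<Longrightarrow> y t \<ge> 1"
    and lim: "\<And>j t. j \<ge> 1 \<Longrightarrow> t \<in> {0..T} \<Longrightarrow> (\<lambda>N. \<Sum>i\<in>{0<..idx T N t}. c N i j) \<longlonglongrightarrow> C j * t"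
    and small: "\<And>j. j \<ge> 1 \<Longrightarrow> \<exists>g. g \<longlonglongrightarrow> 0 \<and> (\<forall>N i. N \<ge> 1 \<longrightarrow> i \<le> N \<longrightarrow> \<bar>c N i j\<bar> \<le> g N)"
    and ab: "0 \<le> a" "a \<le> b" "b \<le> T"
  shows "\<exists>I. has_bochner_integral lborel (\<lambda>s. indicator {a<..b} s * C (y s)) I \<and>
    (\<lambda>N. \<Sum>i\<in>{idx T N a<..idx T N b}. c N i (y (real i * T / real N))) \<longlonglongrightarrow> I"
proof -
  \<comment> \<open>The guards belong to the property because short intervals around a point of
    \<open>[a,b]\<close> may stick out of \<open>[0,T]\<close>.\<close>
  define P where "P u v \<longleftrightarrow> 0 \<le> u \<longrightarrow> v \<le> T \<longrightarrow> (\<exists>I. has_bochner_integral lborel (\<lambda>s. indicator {u<..v} s * C (y s)) I \<and>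
    (\<lambda>N. \<Sum>i\<in>{idx T N u<..idx T N v}. c N i (y (real i * T / real N))) \<longlonglongrightarrow> I)" for u v
  have trans: "P u w" if tr: "P u v" "P v w" "u \<le> v" "v \<le> w" for u v w
    unfolding P_def
  proof (intro impI)
    assume "0 \<le> u" "w \<le> T"
    then have uw: "0 \<le> u" "w \<le> T" "0 \<le> v" "v \<le> T" using tr by auto
    obtain I1 where I1: "has_bochner_integral lborel (\<lambda>s. indicator {u<..v} s * C (y s)) I1"
      "(\<lambda>N. \<Sum>i\<in>{idx T N u<..idx T N v}. c N i (y (real i * T / real N))) \<longlonglongrightarrow> I1"
      using tr uw unfolding P_def by auto
    obtain I2 where I2: "has_bochner_integral lborel (\<lambda>s. indicator {v<..w} s * C (y s)) I2"
      "(\<lambda>N. \<Sum>i\<in>{idx T N v<..idx T N w}. c N i (y (real i * T / real N))) \<longlonglongrightarrow> I2"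
 using tr uw unfolding P_def by auto
    have ind: "indicator {u<..v} s * C (y s) + indicator {v<..w} s * C (y s) = indicator {u<..w} s * C (y s)" for s
      using tr(3,4) by (auto simp: indicator_def)
    have sum: "(\<Sum>i\<in>{idx T N u<..idx T N v}. h i) + (\<Sum>i\<in>{idx T N v<..idx T N w}. h i) = (\<Sum>i\<in>{idx T N u<..idx T N w}. h i)" for N and h :: "nat \<Rightarrow> real"
    proof -
      have "{idx T N u<..idx T N w} = {idx T N u<..idx T N v} \<union> {idx T N v<..idx T N w}"
        using idx_mono[OF T tr(3), of N] idx_mono[OF T tr(4), of N] by auto
      then show ?thesis by (simp add: sum.union_disjoint)
    qed
    show "\<exists>I. has_bochner_integral lborel (\<lambda>s. indicator {u<..w} s * C (y s)) I \<and>
      (\<lambda>N. \<Sum>i\<in>{idx T N u<..idx T N w}. c N i (y (real i * T / real N))) \<longlonglongrightarrow> I"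
      using has_bochner_integral_add[OF I1(1) I2(1)] tendsto_add[OF I1(2) I2(2)]
      unfolding ind sum by (intro exI[of _ "I1 + I2"] conjI)
  qed
  have diff: "(\<lambda>N. \<Sum>i\<in>{idx T N u<..idx T N v}. c N i j) \<longlonglongrightarrow> C j * (v - u)"
    if "j \<ge> 1" "0 \<le> u" "u \<le> v" "v \<le> T" for j u v
  proof -
    have eq: "(\<Sum>i\<in>{idx T N u<..idx T N v}. c N i j) = (\<Sum>i\<in>{0<..idx T N v}. c N i j) - (\<Sum>i\<in>{0<..idx T N u}. c N i j)" for N
    proof -
      have "{0<..idx T N v} = {0<..idx T N u} \<union> {idx T N u<..idx T N v}"
        using idx_mono[OF T that(3), of N] by auto
      then show ?thesis by (simp add: sum.union_disjoint)
    qed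
    have 1: "(\<lambda>N. \<Sum>i\<in>{0<..idx T N v}. c N i j) \<longlonglongrightarrow> C j * v" using that by (intro lim) auto
    have 2: "(\<lambda>N. \<Sum>i\<in>{0<..idx T N u}. c N i j) \<longlonglongrightarrow> C j * u" using that by (intro lim) auto
    have 3: "(\<lambda>N. (\<Sum>i\<in>{0<..idx T N v}. c N i j) - (\<Sum>i\<in>{0<..idx T N u}. c N i j)) \<longlonglongrightarrow> C j * v - C j * u"
      by (rule tendsto_diff[OF 1 2])
    have 4: "C j * v - C j * u = C j * (v - u)" by (rule right_diff_distrib[symmetric])
    show ?thesis
      unfolding eq using 3 unfolding 4 .
  qed
  have right: "P x v" if x: "0 \<le> x" "x \<le> v" and const: "\<And>s. x \<le> s \<Longrightarrow> s \<le> v \<Longrightarrow> y s = y x" for x v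
    unfolding P_def
  proof (intro impI exI conjI)
    assume v: "v \<le> T"
    have eq: "(\<lambda>s. indicator {x<..v} s * C (y s)) = (\<lambda>s. indicator {x<..v} s * C (y x))"
    proof
      fix s show "indicator {x<..v} s * C (y s) = indicator {x<..v} s * C (y x)"
      proof (cases "s \<in> {x<..v}")
        case True
        then have "y s = y x" by (intro const) auto
        then show ?thesis by simp
      qed simp
    qed
    show "has_bochner_integral lborel (\<lambda>s. indicator {x<..v} s * C (y s)) (C (y x) * (v - x))"
      unfolding eq using x by (auto simp: has_bochner_integral_iff mult.commute)
    have ev: "eventually (\<lambda>N. (\<Sum>i\<in>{idx T N x<..idx T N v}. c N i (y x)) = (\<Sum>i\<in>{idx T N x<..idx T N v}. c N i (y (real i * T / real N)))) sequentially"
      using eventually_gt_at_top[of 0]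
    proof eventually_elim
      case (elim N)
      show ?case
      proof (rule sum.cong[OF refl])
        fix i assume "i \<in> {idx T N x<..idx T N v}"
        then have "y (real i * T / real N) = y x"
          using less_idx[OF T elim x(1), of i] le_idx[OF T elim, of v i] x by (intro const) auto
        then show "c N i (y x) = c N i (y (real i * T / real N))" by simp
      qed
    qed
    show "(\<lambda>N. \<Sum>i\<in>{idx T N x<..idx T N v}. c N i (y (real i * T / real N))) \<longlonglongrightarrow> C (y x) * (v - x)"
      by (rule Lim_transform_eventually[OF diff[OF y1[OF x(1)] x v] ev])
  qed
  have left: "P u x" if u: "0 \<le> u" "u \<le> x" and j: "j \<ge> 1" and const: "\<And>s. u < s \<Longrightarrow> s < x \<Longrightarrow> y s = j" for u x j
    unfolding P_def
  proof (intro impI exI conjI)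
    assume v: "x \<le> T"
    \<comment> \<open>The integrand differs from that of the state \<open>j\<close> only at the jump
      time \<open>x\<close>, a null set.\<close>
    have eq: "(\<lambda>s. indicator {u<..x} s * C (y s)) = (\<lambda>s. indicator {u<..x} s * C j + indicator ({x} \<inter> {u<..x}) s * (C (y x) - C j))"
    proof
      fix s show "indicator {u<..x} s * C (y s) = indicator {u<..x} s * C j + indicator ({x} \<inter> {u<..x}) s * (C (y x) - C j)"
        using const[of s] by (cases "s = x"; cases "s \<in> {u<..x}") auto
    qed
    have "has_bochner_integral lborel (\<lambda>s. indicator {u<..x} s * C j + indicator ({x} \<inter> {u<..x}) s * (C (y x) - C j)) (C j * (x - u) + 0)"
    proof (rule has_bochner_integral_add)
      show "has_bochner_integral lborel (\<lambda>s. indicator {u<..x} s * C j) (C j * (x - u))"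
        using u by (auto simp: has_bochner_integral_iff mult.commute)
      have "AE s in lborel. s \<noteq> x" by (rule AE_lborel_singleton)
      then have "AE s in lborel. indicator ({x} \<inter> {u<..x}) s * (C (y x) - C j) = (0::real)"
        by eventually_elim (auto simp: indicator_def)
      then show "has_bochner_integral lborel (\<lambda>s. indicator ({x} \<inter> {u<..x}) s * (C (y x) - C j)) 0"
        using has_bochner_integral_zero[of lborel] by (subst has_bochner_integral_cong_AE) auto
    qed
    then show "has_bochner_integral lborel (\<lambda>s. indicator {u<..x} s * C (y s)) (C j * (x - u))"
      unfolding eq by simp
    obtain g1 where g1: "g1 \<longlonglongrightarrow> 0" "\<And>N i. N \<ge> 1 \<Longrightarrow> i \<le> N \<Longrightarrow> \<bar>c N i j\<bar> \<le> g1 N" using small[OF j] by blast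
    obtain g2 where g2: "g2 \<longlonglongrightarrow> 0" "\<And>N i. N \<ge> 1 \<Longrightarrow> i \<le> N \<Longrightarrow> \<bar>c N i (y x)\<bar> \<le> g2 N"
      using small[OF y1[of x]] u by auto
    let ?d = "\<lambda>N. (\<Sum>i\<in>{idx T N u<..idx T N x}. c N i (y (real i * T / real N))) - (\<Sum>i\<in>{idx T N u<..idx T N x}. c N i j)"
    have "eventually (\<lambda>N. norm (?d N) \<le> g1 N + g2 N) sequentially"
      using eventually_gt_at_top[of 0]
    proof eventually_elim
      case (elim N)
      define h where "h i = c N i (y (real i * T / real N)) - c N i j" for i
      let ?m = "idx T N x"
      have m: "?m \<le> N" using idx_le[OF T, of x N] u v by auto
      \<comment> \<open>Grid points before the last one lie strictly left of \<open>x\<close>, so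
        the state \<open>j\<close> is exact there; only the last summand can see
        \<open>y x\<close>.\<close>
      have h0: "h i = 0" if "i \<in> {idx T N u<..?m} - {?m}" for i
      proof -
        have "real i * T / real N < real ?m * T / real N"
          using that elim T by (intro divide_strict_right_mono mult_strict_right_mono) auto
        then have "real i * T / real N < x" using idx_bounds(1)[OF T elim, of x] u by linarith
        moreover have "u < real i * T / real N" using less_idx[OF T elim u(1)] that by auto
        ultimately show ?thesis using const by (simp add: h_def)
      qed
      have hm: "\<bar>h ?m\<bar> \<le> g1 N + g2 N" if "?m \<in> {idx T N u<..?m}"
      proof -
        have b: "real ?m * T / real N \<le> x" "u < real ?m * T / real N"
          using idx_bounds(1)[OF T elim, of x] u less_idx[OF T elim u(1)] that by auto
        have g10: "0 \<le> g1 N" using g1(2)[of N 0] elim by linarith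
        have g20: "0 \<le> g2 N" using g2(2)[of N 0] elim by linarith
        show ?thesis
        proof (cases "real ?m * T / real N = x")
          case True
          then show ?thesis using g1(2)[of N ?m] g2(2)[of N ?m] elim m unfolding h_def by simp
        next
          case False
          then have "y (real ?m * T / real N) = j" using b const by simp
          then show ?thesis using g10 g20 by (simp add: h_def)
        qed
      qed
      have "?d N = (\<Sum>i\<in>{idx T N u<..?m}. h i)" by (simp add: h_def sum_subtractf)
      also have "\<dots> = (if ?m \<in> {idx T N u<..?m} then h ?m else 0)"
      proof (cases "?m \<in> {idx T N u<..?m}")
        case True
        then show ?thesis using sum.remove[of "{idx T N u<..?m}" ?m h] sum.neutral[of "{idx T N u<..?m} - {?m}" h] h0 by simp
      qed auto
      finally show ?case
        using hm g1(2)[of N 0] g2(2)[of N 0] elim by (auto split: if_splits)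
    qed
    then have "?d \<longlonglongrightarrow> 0"
      by (rule Lim_null_comparison) (use tendsto_add[OF g1(1) g2(1)] in simp)
    from tendsto_add[OF this diff[OF j u v]]
    show "(\<lambda>N. \<Sum>i\<in>{idx T N u<..idx T N x}. c N i (y (real i * T / real N))) \<longlonglongrightarrow> C j * (x - u)" by simp
  qed
  have "P a b" using ab(2)
  proof (induct rule: Bolzano)
    case (trans u v w)
    then show ?case using \<open>\<And>u v w. P u v \<Longrightarrow> P v w \<Longrightarrow> u \<le> v \<Longrightarrow> v \<le> w \<Longrightarrow> P u w\<close> by blast
  next
    case (local x)
    then have x: "0 \<le> x" using ab by simp
    obtain d j where d: "d > 0" "j \<ge> 1" "\<And>s. x \<le> s \<Longrightarrow> s < x + d \<Longrightarrow> y s = y x"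
      "\<And>s. 0 \<le> s \<Longrightarrow> x - d < s \<Longrightarrow> s < x \<Longrightarrow> y s = j"
      using cadlag_nat_locally_constant[OF y y1 x] by metis
    have "P u v" if uv: "u \<le> x" "x \<le> v" "v - u < d" for u v
    proof (cases "0 \<le> u")
      case True
      have "P u x" by (rule left[OF True uv(1) d(2)]) (use uv True in \<open>auto intro!: d(4)\<close>)
      moreover have "P x v" by (rule right[OF x uv(2)]) (use uv in \<open>auto intro!: d(3)\<close>)
      ultimately show ?thesis using uv trans by blast
    qed (simp add: P_def)
    then show ?case using d(1) by blast
  qed
  then show ?thesis using ab unfolding P_def by blast
qed

lemma path_sum_limit':
  fixes c :: "nat \<Rightarrow> nat \<Rightarrow> nat \<Rightarrow> real" and y :: "real \<Rightarrow> nat"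
  assumes T: "T > 0" and y: "cadlag_on {0..} y" and y1: "\<And>t. t \<ge> 0 \<Longrightarrow> y t \<ge> 1"
    and lim: "\<And>j t. j \<ge> 1 \<Longrightarrow> t \<in> {0..T} \<Longrightarrow> (\<lambda>N. \<Sum>i\<in>{0<..idx T N t}. c N i j) \<longlonglongrightarrow> C j * t"
    and small: "\<And>j. j \<ge> 1 \<Longrightarrow> \<exists>g. g \<longlonglongrightarrow> 0 \<and> (\<forall>N i. N \<ge> 1 \<longrightarrow> i \<le> N \<longrightarrow> \<bar>c N i j\<bar> \<le> g N)"
    and ab: "0 \<le> a" "a \<le> b" "b \<le> T"
  shows "(\<lambda>N. \<Sum>i\<in>{idx T N a<..idx T N b}. c N i (y (real i * T / real N))) \<longlonglongrightarrow> (LBINT s:{a<..b}. C (y s))"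
proof -
  obtain I where I: "has_bochner_integral lborel (\<lambda>s. indicator {a<..b} s * C (y s)) I"
    "(\<lambda>N. \<Sum>i\<in>{idx T N a<..idx T N b}. c N i (y (real i * T / real N))) \<longlonglongrightarrow> I"
    using path_sum_limit[where c=c and C=C, OF T y y1 lim small ab] by blast
  have "(LBINT s:{a<..b}. C (y s)) = I"
    using I(1) by (auto simp: set_lebesgue_integral_def has_bochner_integral_iff)
  with I(2) show ?thesis by simp
qed

text \<open>Integrability comes with the Riemann sums of \<open>path_sum_limit\<close> for weights
  \<open>C j * (b + 1) / N\<close>; the horizon \<open>b + 1\<close> is positive even for
  \<open>b = 0\<close>.\<close>

lemma path_set_integrable:
  fixes y :: "real \<Rightarrow> nat" and C :: "nat \<Rightarrow> real"
  assumes y: "cadlag_on {0..} y" and y1: "\<And>t. t \<ge> 0 \<Longrightarrow> y t \<ge> 1" and ab: "0 \<le> a" "a \<le> b"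
  shows "set_integrable lborel {a<..b} (\<lambda>s. C (y s))"
proof -
  let ?T = "b + 1"
  have T: "?T > 0" using ab by simp
  have "\<exists>I. has_bochner_integral lborel (\<lambda>s. indicator {a<..b} s * C (y s)) I \<and>
    (\<lambda>N. \<Sum>i\<in>{idx ?T N a<..idx ?T N b}. C (y (real i * ?T / real N)) * ?T / real N) \<longlonglongrightarrow> I"
  proof (rule path_sum_limit[where c="\<lambda>N i j. C j * ?T / real N", OF T y y1])
    fix j t assume t: "t \<in> {0..?T}"
    have "(\<lambda>N. real (idx ?T N t) / real N * (C j * ?T)) \<longlonglongrightarrow> t / ?T * (C j * ?T)"
      using t by (intro tendsto_mult tendsto_const idx_ratio[OF T]) auto
    moreover have "t / ?T * (C j * ?T) = C j * t" using T by simp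
    moreover have "(\<Sum>i\<in>{0<..idx ?T N t}. C j * ?T / real N) = real (idx ?T N t) / real N * (C j * ?T)" for N by simp
    ultimately show "(\<lambda>N. \<Sum>i\<in>{0<..idx ?T N t}. C j * ?T / real N) \<longlonglongrightarrow> C j * t" by (simp only:)
  next
    fix j show "\<exists>g. g \<longlonglongrightarrow> 0 \<and> (\<forall>N i. N \<ge> 1 \<longrightarrow> i \<le> N \<longrightarrow> \<bar>C j * ?T / real N\<bar> \<le> g N)"
      by (intro exI[of _ "\<lambda>N. \<bar>C j * ?T\<bar> / real N"] conjI lim_const_over_n) auto
  qed (use ab in auto)
  then show ?thesis by (auto simp: set_integrable_def has_bochner_integral_iff)
qed

section \<open>Triangular arrays of logarithms\<close>

lemma norm_exp_minus_linear:
  fixes z :: complex assumes "norm z \<le> 1" shows "norm (exp z - (1 + z)) \<le> 3 * (norm z)\<^sup>2"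
proof -
  have "norm (exp z - (1 + z)) \<le> exp \<bar>Re z\<bar> * (norm z)\<^sup>2"
    using Taylor_exp[of z 1] by (simp add: numeral_2_eq_2)
  also have "\<dots> \<le> exp 1 * (norm z)\<^sup>2"
    using assms abs_Re_le_cmod[of z] by (intro mult_right_mono) auto
  also have "\<dots> \<le> 3 * (norm z)\<^sup>2" using exp_le by (intro mult_right_mono) auto
  finally show ?thesis .
qed

text \<open>\<open>|X|^3 \<le> g * X^2\<close> turns the cubic remainder into \<open>g\<close> times
  a second moment, which vanishes when summed over an array whose second moments have bounded
  sum.\<close>

lemma (in prob_space) char_ln_expansion:
  fixes X :: "'a \<Rightarrow> real"
  assumes X: "random_variable borel X" and b: "AE \<omega> in M. \<bar>X \<omega>\<bar> \<le> g" and g: "g \<le> 1/2"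
  shows "norm (char (distr M borel (\<lambda>\<omega>. ln (1 + X \<omega>))) \<theta> -
      (1 + (\<i> * \<theta> * expectation X - (\<i> * \<theta> + \<theta>\<^sup>2) / 2 * expectation (\<lambda>\<omega>. (X \<omega>)\<^sup>2))))
    \<le> (2 * \<bar>\<theta>\<bar> ^ 3 + 2 * \<bar>\<theta>\<bar> + 3 * \<theta>\<^sup>2) * g * expectation (\<lambda>\<omega>. (X \<omega>)\<^sup>2)"
proof -
  have [measurable]: "X \<in> borel_measurable M" by (rule X)
  have b1: "AE \<omega> in M. \<bar>X \<omega>\<bar> \<le> 1/2" using b by eventually_elim (use g in auto)
  have i1: "integrable M X" by (rule integrable_const_bound[of _ "1/2"]) (use b1 in auto)
  have i2: "integrable M (\<lambda>\<omega>. (X \<omega>)\<^sup>2)"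
    by (rule integrable_const_bound[of _ "(1/2)\<^sup>2"]) (use b1 in \<open>auto simp: power2_le_iff_abs_le simp del: power_divide\<close>)
  let ?e = "\<lambda>\<omega>. iexp (\<theta> * ln (1 + X \<omega>))"
  let ?t = "\<lambda>\<omega>. 1 + \<i> * \<theta> * X \<omega> - (\<i> * \<theta> + \<theta>\<^sup>2) / 2 * (X \<omega>)\<^sup>2"
  let ?K = "2 * \<bar>\<theta>\<bar> ^ 3 + 2 * \<bar>\<theta>\<bar> + 3 * \<theta>\<^sup>2"
  have K: "?K \<ge> 0" by simp
  have ie: "integrable M ?e" by (rule integrable_const_bound[of _ 1]) auto
  have i1': "integrable M (\<lambda>\<omega>. complex_of_real (X \<omega>))" using i1 by simp
  have i2': "integrable M (\<lambda>\<omega>. complex_of_real ((X \<omega>)\<^sup>2))" using i2 by (rule integrable_of_real)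
  have it: "integrable M ?t" using i1' i2' by (intro Bochner_Integration.integrable_diff Bochner_Integration.integrable_add integrable_mult_right) auto
  have "(\<integral>\<omega>. ?t \<omega> \<partial>M) = (\<integral>\<omega>. 1 + \<i> * \<theta> * X \<omega> \<partial>M) - (\<integral>\<omega>. (\<i> * \<theta> + \<theta>\<^sup>2) / 2 * complex_of_real ((X \<omega>)\<^sup>2) \<partial>M)"
    using i1' i2' by (intro Bochner_Integration.integral_diff Bochner_Integration.integrable_add integrable_mult_right) auto
  also have "\<dots> = 1 + (\<i> * \<theta> * expectation X - (\<i> * \<theta> + \<theta>\<^sup>2) / 2 * expectation (\<lambda>\<omega>. (X \<omega>)\<^sup>2))"
  proof -
    have "(\<integral>\<omega>. complex_of_real ((X \<omega>)\<^sup>2) \<partial>M) = complex_of_real (expectation (\<lambda>\<omega>. (X \<omega>)\<^sup>2))"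
      using i2 by (rule integral_of_real)
    then show ?thesis
      using i1' i2' by (simp add: prob_space del: of_real_power)
  qed
  finally have t: "1 + (\<i> * \<theta> * expectation X - (\<i> * \<theta> + \<theta>\<^sup>2) / 2 * expectation (\<lambda>\<omega>. (X \<omega>)\<^sup>2)) = (\<integral>\<omega>. ?t \<omega> \<partial>M)" ..
  have "char (distr M borel (\<lambda>\<omega>. ln (1 + X \<omega>))) \<theta> = (\<integral>\<omega>. ?e \<omega> \<partial>M)"
    unfolding char_def by (subst integral_distr) auto
  then have "norm (char (distr M borel (\<lambda>\<omega>. ln (1 + X \<omega>))) \<theta> -
      (1 + (\<i> * \<theta> * expectation X - (\<i> * \<theta> + \<theta>\<^sup>2) / 2 * expectation (\<lambda>\<omega>. (X \<omega>)\<^sup>2)))) = norm (\<integral>\<omega>. ?e \<omega> - ?t \<omega> \<partial>M)"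
    unfolding t using Bochner_Integration.integral_diff[OF ie it] by simp
  also have "\<dots> \<le> (\<integral>\<omega>. norm (?e \<omega> - ?t \<omega>) \<partial>M)" by (rule integral_norm_bound)
  also have "\<dots> \<le> (\<integral>\<omega>. ?K * g * (X \<omega>)\<^sup>2 \<partial>M)"
  proof (rule integral_mono_AE)
    show "integrable M (\<lambda>\<omega>. norm (?e \<omega> - ?t \<omega>))" by (rule integrable_norm[OF Bochner_Integration.integrable_diff[OF ie it]])
    show "integrable M (\<lambda>\<omega>. ?K * g * (X \<omega>)\<^sup>2)" using i2 by simp
    show "AE \<omega> in M. norm (?e \<omega> - ?t \<omega>) \<le> ?K * g * (X \<omega>)\<^sup>2"
      using b b1
    proof eventually_elim
      case (elim \<omega>)
      have "\<bar>X \<omega>\<bar> ^ 3 \<le> g * (X \<omega>)\<^sup>2"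
        using mult_right_mono[OF elim(1), of "(X \<omega>)\<^sup>2"] by (simp add: power3_eq_cube power2_eq_square)
      then have "?K * \<bar>X \<omega>\<bar> ^ 3 \<le> ?K * (g * (X \<omega>)\<^sup>2)" using K by (intro mult_left_mono)
      then show ?case using iexp_ln_expansion[OF elim(2), of \<theta>] by (simp only: mult.assoc)
    qed
  qed
  finally show ?thesis by simp
qed

text \<open>All factors lie in the unit disc, so two products differ by at most the sum of the
  differences of their factors. Replacing each characteristic function by \<open>exp (z N i)\<close>
  makes the product an exponential of sums of means and second moments, whose limits are given. The
  sums of absolute means serve to bound the sum of \<open>|z N i|\<close>.\<close>

lemma char_log_array:
  fixes X :: "nat \<Rightarrow> 'i \<Rightarrow> 'a \<Rightarrow> real" and P :: "nat \<Rightarrow> 'a measure" and \<theta> :: real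
  assumes P: "\<And>N. N \<ge> 1 \<Longrightarrow> prob_space (P N)"
    and X: "\<And>N i. N \<ge> 1 \<Longrightarrow> i \<in> A N \<Longrightarrow> X N i \<in> borel_measurable (P N)"
    and b: "\<And>N i. N \<ge> 1 \<Longrightarrow> i \<in> A N \<Longrightarrow> AE \<omega> in P N. \<bar>X N i \<omega>\<bar> \<le> g N" and g: "g \<longlonglongrightarrow> 0" and g0: "\<And>N. N \<ge> 1 \<Longrightarrow> g N \<ge> 0"
    and m: "(\<lambda>N. \<Sum>i\<in>A N. \<integral>\<omega>. X N i \<omega> \<partial>P N) \<longlonglongrightarrow> a"
    and am: "(\<lambda>N. \<Sum>i\<in>A N. \<bar>\<integral>\<omega>. X N i \<omega> \<partial>P N\<bar>) \<longlonglongrightarrow> a'"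
    and q: "(\<lambda>N. \<Sum>i\<in>A N. \<integral>\<omega>. (X N i \<omega>)\<^sup>2 \<partial>P N) \<longlonglongrightarrow> v"
  shows "(\<lambda>N. \<Prod>i\<in>A N. char (distr (P N) borel (\<lambda>\<omega>. ln (1 + X N i \<omega>))) \<theta>)
      \<longlonglongrightarrow> exp (\<i> * \<theta> * (a - v / 2) - \<theta>\<^sup>2 * v / 2)"
proof -
  define w where "w N i = char (distr (P N) borel (\<lambda>\<omega>. ln (1 + X N i \<omega>))) \<theta>" for N i
  define mm where "mm N i = (\<integral>\<omega>. X N i \<omega> \<partial>P N)" for N i
  define qq where "qq N i = (\<integral>\<omega>. (X N i \<omega>)\<^sup>2 \<partial>P N)" for N i
  define z where "z N i = \<i> * \<theta> * mm N i - (\<i> * \<theta> + \<theta>\<^sup>2) / 2 * qq N i" for N i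
  define K where "K = 2 * \<bar>\<theta>\<bar> ^ 3 + 2 * \<bar>\<theta>\<bar> + 3 * \<theta>\<^sup>2"
  define D where "D = \<bar>\<theta>\<bar> + \<theta>\<^sup>2"
  have D0: "D \<ge> 0" by (simp add: D_def)
  \<comment> \<open>The first summand bounds the cubic remainders. The second bounds the sum of
    \<open>3 * |z|^2\<close> by a uniform bound for \<open>|z|\<close> times a bound for the sum of
    all \<open>|z|\<close>.\<close>
  let ?E = "\<lambda>N. K * g N * (\<Sum>i\<in>A N. qq N i) + 3 * (D * (g N + (g N)\<^sup>2)) * (D * ((\<Sum>i\<in>A N. \<bar>mm N i\<bar>) + (\<Sum>i\<in>A N. qq N i)))"
  have E: "?E \<longlonglongrightarrow> 0"
  proof -
    have "?E \<longlonglongrightarrow> K * 0 * v + 3 * (D * (0 + 0\<^sup>2)) * (D * (a' + v))"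
      using m am q g unfolding mm_def qq_def by (intro tendsto_intros)
    then show ?thesis by simp
  qed
  have gD: "(\<lambda>N. D * (g N + (g N)\<^sup>2)) \<longlonglongrightarrow> 0"
  proof -
    have "(\<lambda>N. D * (g N + (g N)\<^sup>2)) \<longlonglongrightarrow> D * (0 + 0\<^sup>2)" by (intro tendsto_intros g)
    then show ?thesis by simp
  qed
  have "eventually (\<lambda>N. norm ((\<Prod>i\<in>A N. w N i) - (\<Prod>i\<in>A N. exp (z N i))) \<le> ?E N) sequentially"
    using order_tendstoD(2)[OF g half_gt_zero[OF zero_less_one]] order_tendstoD(2)[OF gD zero_less_one] eventually_ge_at_top[of 1]
  proof eventually_elim
    case (elim N)
    then have N: "N \<ge> 1" and g2: "g N \<le> 1/2" by auto
    interpret prob_space "P N" by (rule P[OF N])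
    have pointwise: "norm (w N i) \<le> 1 \<and> norm (exp (z N i)) \<le> 1 \<and>
        norm (w N i - exp (z N i)) \<le> K * g N * qq N i + 3 * (D * (g N + (g N)\<^sup>2)) * (D * (\<bar>mm N i\<bar> + qq N i))"
      if i: "i \<in> A N" for i
    proof -
      note [measurable] = X[OF N i]
      have i1: "integrable (P N) (X N i)" by (rule integrable_const_bound[of _ "g N"]) (use b[OF N i] in auto)
      have i2: "integrable (P N) (\<lambda>\<omega>. (X N i \<omega>)\<^sup>2)"
        by (rule integrable_const_bound[of _ "(g N)\<^sup>2"]) (use b[OF N i] g0[OF N] in \<open>auto simp: power2_le_iff_abs_le\<close>)
      have q0: "0 \<le> qq N i" unfolding qq_def by (rule integral_nonneg_AE) auto
      have q1: "qq N i \<le> (g N)\<^sup>2"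
        unfolding qq_def by (rule integral_le_const[OF i2]) (use b[OF N i] g0[OF N] in \<open>auto simp: power2_le_iff_abs_le\<close>)
      have m1: "\<bar>mm N i\<bar> \<le> g N"
      proof -
        have "norm (mm N i) \<le> (\<integral>\<omega>. norm (X N i \<omega>) \<partial>P N)" unfolding mm_def by (rule integral_norm_bound)
        also have "\<dots> \<le> g N" by (rule integral_le_const) (use i1 b[OF N i] in auto)
        finally show ?thesis by simp
      qed
      interpret d: real_distribution "distr (P N) borel (\<lambda>\<omega>. ln (1 + X N i \<omega>))" by simp
      have w1: "norm (w N i) \<le> 1" unfolding w_def by (rule d.cmod_char_le_1)
      \<comment> \<open>The real part is not positive, so \<open>exp (z N i)\<close> stays in the
        unit disc.\<close>
      have "Re (z N i) = - (\<theta>\<^sup>2 / 2 * qq N i)" by (simp add: z_def)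
      then have e1: "norm (exp (z N i)) \<le> 1" using q0 by simp
      have zn: "norm (z N i) \<le> D * (\<bar>mm N i\<bar> + qq N i)"
      proof -
        have "norm (z N i) \<le> norm (\<i> * \<theta> * mm N i) + norm ((\<i> * \<theta> + \<theta>\<^sup>2) / 2 * qq N i)"
          unfolding z_def by (rule norm_triangle_ineq4)
        also have "norm (\<i> * \<theta> * mm N i) = \<bar>\<theta>\<bar> * \<bar>mm N i\<bar>" by (simp add: norm_mult)
        also have "norm ((\<i> * \<theta> + \<theta>\<^sup>2) / 2 * qq N i) = norm (\<i> * \<theta> + \<theta>\<^sup>2) / 2 * qq N i"
          using q0 by (simp add: norm_mult norm_divide)
        also have "norm (\<i> * complex_of_real \<theta> + \<theta>\<^sup>2) \<le> D"
          using norm_triangle_ineq[of "\<i> * complex_of_real \<theta>" "complex_of_real (\<theta>\<^sup>2)"] by (simp add: norm_mult D_def norm_power)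
        finally have "norm (z N i) \<le> \<bar>\<theta>\<bar> * \<bar>mm N i\<bar> + D / 2 * qq N i"
          using q0 by (simp add: mult_right_mono divide_right_mono)
        also have "\<dots> \<le> D * \<bar>mm N i\<bar> + D * qq N i"
          using q0 D0 by (intro add_mono mult_right_mono) (auto simp: D_def)
        finally show ?thesis by (simp add: distrib_left)
      qed
      also have zb: "D * (\<bar>mm N i\<bar> + qq N i) \<le> D * (g N + (g N)\<^sup>2)" using q1 m1 D0 by (intro mult_left_mono add_mono) auto
      finally have zb': "norm (z N i) \<le> D * (g N + (g N)\<^sup>2)" .
      have "norm (w N i - exp (z N i)) \<le> norm (w N i - (1 + z N i)) + norm (exp (z N i) - (1 + z N i))"
        using norm_triangle_ineq4[of "w N i - (1 + z N i)" "exp (z N i) - (1 + z N i)"] by simp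
      also have "norm (w N i - (1 + z N i)) \<le> K * g N * qq N i"
        using char_ln_expansion[OF X[OF N i] b[OF N i] g2, of \<theta>] unfolding w_def z_def mm_def qq_def K_def by simp
      also have "norm (exp (z N i) - (1 + z N i)) \<le> 3 * (norm (z N i))\<^sup>2"
        using zb' elim by (intro norm_exp_minus_linear) auto
      also have "3 * (norm (z N i))\<^sup>2 \<le> 3 * (D * (g N + (g N)\<^sup>2)) * (D * (\<bar>mm N i\<bar> + qq N i))"
        using mult_mono[OF zb' zn] D0 g0[OF N] by (simp add: power2_eq_square)
      finally show ?thesis using w1 e1 by auto
    qed
    have "norm ((\<Prod>i\<in>A N. w N i) - (\<Prod>i\<in>A N. exp (z N i))) \<le> (\<Sum>i\<in>A N. norm (w N i - exp (z N i)))"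
      using pointwise by (intro norm_prod_diff) auto
    also have "\<dots> \<le> (\<Sum>i\<in>A N. K * g N * qq N i + 3 * (D * (g N + (g N)\<^sup>2)) * (D * (\<bar>mm N i\<bar> + qq N i)))"
      using pointwise by (intro sum_mono) auto
    also have "\<dots> = ?E N" by (simp add: sum.distrib sum_distrib_left distrib_left)
    finally show ?case .
  qed
  then have 1: "(\<lambda>N. (\<Prod>i\<in>A N. w N i) - (\<Prod>i\<in>A N. exp (z N i))) \<longlonglongrightarrow> 0"
    using E by (rule Lim_null_comparison)
  have fin: "eventually (\<lambda>N. (\<Prod>i\<in>A N. exp (z N i)) = exp (\<i> * \<theta> * (\<Sum>i\<in>A N. mm N i) - (\<i> * \<theta> + \<theta>\<^sup>2) / 2 * (\<Sum>i\<in>A N. qq N i))) sequentially"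
  proof (rule always_eventually, rule allI)
    fix N
    show "(\<Prod>i\<in>A N. exp (z N i)) = exp (\<i> * \<theta> * (\<Sum>i\<in>A N. mm N i) - (\<i> * \<theta> + \<theta>\<^sup>2) / 2 * (\<Sum>i\<in>A N. qq N i))"
    proof (cases "finite (A N)")
      case True
      then show ?thesis by (simp add: exp_sum[symmetric] z_def sum_subtractf sum_distrib_left)
    qed simp
  qed
  have "(\<lambda>N. exp (\<i> * \<theta> * (\<Sum>i\<in>A N. mm N i) - (\<i> * \<theta> + \<theta>\<^sup>2) / 2 * (\<Sum>i\<in>A N. qq N i))) \<longlonglongrightarrow> exp (\<i> * \<theta> * a - (\<i> * \<theta> + \<theta>\<^sup>2) / 2 * v)"
    using m q unfolding mm_def qq_def by (intro tendsto_intros)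
  then have 2: "(\<lambda>N. \<Prod>i\<in>A N. exp (z N i)) \<longlonglongrightarrow> exp (\<i> * \<theta> * a - (\<i> * \<theta> + \<theta>\<^sup>2) / 2 * v)"
    by (rule Lim_transform_eventually) (use fin in eventually_elim, simp only:)
  have "exp (\<i> * \<theta> * a - (\<i> * \<theta> + \<theta>\<^sup>2) / 2 * v) = exp (\<i> * \<theta> * (a - v / 2) - \<theta>\<^sup>2 * v / 2)"
    by (simp add: algebra_simps add_divide_distrib diff_divide_distrib)
  then show ?thesis using tendsto_add[OF 1 2] by (simp add: w_def)
qed

text \<open>An image of the standard normal law, so that variance 0 is allowed and gives the point
  mass at \<open>a\<close>.\<close>

definition gauss :: "real \<Rightarrow> real \<Rightarrow> real measure" where
  "gauss a v = distr std_normal_distribution borel (\<lambda>x. a + sqrt v * x)"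

lemma real_distribution_gauss [simp]: "real_distribution (gauss a v)"
proof -
  interpret prob_space std_normal_distribution by (rule prob_space_normal_density) simp
  show ?thesis unfolding gauss_def by simp
qed

lemma char_gauss:
  assumes "v \<ge> 0"
  shows "char (gauss a v) \<theta> = exp (\<i> * \<theta> * a - \<theta>\<^sup>2 * v / 2)"
proof -
  have "char (gauss a v) \<theta> = (\<integral>x. iexp (\<theta> * a) * iexp ((\<theta> * sqrt v) * x) \<partial>std_normal_distribution)"
    unfolding char_def gauss_def by (subst integral_distr) (auto simp: distrib_left exp_add algebra_simps)
  also have "\<dots> = iexp (\<theta> * a) * char std_normal_distribution (\<theta> * sqrt v)"
    unfolding char_def by (rule integral_mult_right_zero)
  also have "(\<theta> * sqrt v)\<^sup>2 = \<theta>\<^sup>2 * v" using assms by (simp add: power_mult_distrib)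
  then have "char std_normal_distribution (\<theta> * sqrt v) = exp (complex_of_real (- (\<theta>\<^sup>2 * v) / 2))"
    by (simp only: char_std_normal_distribution exp_of_real)
  also have "iexp (\<theta> * a) * exp (complex_of_real (- (\<theta>\<^sup>2 * v) / 2)) = exp (\<i> * \<theta> * a - \<theta>\<^sup>2 * v / 2)"
    by (simp only: exp_add[symmetric]) (simp add: algebra_simps)
  finally show ?thesis .
qed

section \<open>The discrete model along a fixed path of the environment\<close>

lemma continuous_on_grid_step:
  assumes T: "T > 0" and f: "continuous_map (skorokhod_topology T) euclideanreal f"
  shows "continuous_on UNIV (\<lambda>x. f (grid_step T n x))"
  unfolding continuous_on_open_vimage[OF open_UNIV]
proof (intro allI impI)
  fix U :: "real set" assume "open U"
  then have "openin (skorokhod_topology T) {z \<in> topspace (skorokhod_topology T). f z \<in> U}"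
    using f by (intro openin_continuous_map_preimage) auto
  from open_grid_step_vimage[OF T this, of n]
  have "open {x. f (grid_step T n x) \<in> U}" using grid_step_skorokhod[OF T] by simp
  then show "open ((\<lambda>x. f (grid_step T n x)) -` U \<inter> UNIV)" by (simp add: vimage_def)
qed

text \<open>Expectation of \<open>g\<close> over a Gaussian walk with \<open>n\<close> independent
  block increments determined by the path \<open>y\<close>; the common target of the discrete and of
  the limit model.\<close>

definition limit_fid ::
  "real \<Rightarrow> (nat \<Rightarrow> real) \<Rightarrow> (nat \<Rightarrow> real) \<Rightarrow> nat \<Rightarrow> (real \<Rightarrow> nat) \<Rightarrow> ((nat \<Rightarrow> real) \<Rightarrow> real) \<Rightarrow> real" where
  "limit_fid T mu sig n y g =
     (\<integral>x. g (cum n x) \<partial>PiM {..<n} (\<lambda>l.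
        let I = {real l * T / real n<..real (Suc l) * T / real n} in
        gauss ((LBINT s:I. mu (y s)) - (LBINT s:I. (sig (y s))\<^sup>2) / 2) (LBINT s:I. (sig (y s))\<^sup>2)))"

text \<open>The returns alone; the environment enters later, as a fixed path or by averaging over an
  independent one. Here \<open>Cs\<close> bounds the squares of the volatilities.\<close>

locale discrete_model =
  fixes T :: real and P :: "nat \<Rightarrow> 'b measure" and R :: "nat \<Rightarrow> nat \<Rightarrow> nat \<Rightarrow> 'b \<Rightarrow> real"
    and muN :: "nat \<Rightarrow> nat \<Rightarrow> real" and gam :: "nat \<Rightarrow> real" and mu sig :: "nat \<Rightarrow> real" and Cm Cs :: real
  assumes T: "T > 0"
    and P: "\<And>N. N \<ge> 1 \<Longrightarrow> prob_space (P N)"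
    and R_indep: "\<And>N. N \<ge> 1 \<Longrightarrow>
          prob_space.indep_vars (P N) (\<lambda>_. borel) (\<lambda>(i, j). R N i j) ({0..N} \<times> {1..})"
    and gam0: "\<And>N. N \<ge> 1 \<Longrightarrow> gam N \<ge> 0" and gam: "gam \<longlonglongrightarrow> 0"
    and R_le: "\<And>N. N \<ge> 1 \<Longrightarrow> AE \<omega> in P N. \<forall>i\<le>N. \<forall>j\<ge>1. \<bar>R N i j \<omega>\<bar> \<le> gam N"
    and R_mean: "\<And>N i j. N \<ge> 1 \<Longrightarrow> i \<le> N \<Longrightarrow> j \<ge> 1 \<Longrightarrow> (\<integral>\<omega>. R N i j \<omega> \<partial>P N) = muN N j"
    and muN_lim: "\<And>j. j \<ge> 1 \<Longrightarrow> (\<lambda>N. (1 + muN N j) ^ N) \<longlonglongrightarrow> exp (mu j * T)"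
    and R_var: "\<And>j t. j \<ge> 1 \<Longrightarrow> t \<in> {0..T} \<Longrightarrow>
          (\<lambda>N. \<Sum>i\<in>{0<..idx T N t}. prob_space.variance (P N) (R N i j)) \<longlonglongrightarrow> (sig j)\<^sup>2 * t"
    and Cm: "\<And>j. j \<ge> 1 \<Longrightarrow> \<bar>mu j\<bar> \<le> Cm" and Cs: "\<And>j. j \<ge> 1 \<Longrightarrow> (sig j)\<^sup>2 \<le> Cs"
begin

lemma R_measurable: "N \<ge> 1 \<Longrightarrow> i \<le> N \<Longrightarrow> j \<ge> 1 \<Longrightarrow> R N i j \<in> borel_measurable (P N)"
proof -
  assume N: "N \<ge> 1" and ij: "i \<le> N" "j \<ge> 1"
  have "\<forall>p\<in>{0..N} \<times> {1..}. (case p of (i, j) \<Rightarrow> R N i j) \<in> borel_measurable (P N)"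
    using R_indep[OF N] unfolding prob_space.indep_vars_def2[OF P[OF N]] by (rule conjunct1)
  from bspec[OF this, of "(i, j)"] show ?thesis using ij by simp
qed

lemma R_AE: "N \<ge> 1 \<Longrightarrow> i \<le> N \<Longrightarrow> j \<ge> 1 \<Longrightarrow> AE \<omega> in P N. \<bar>R N i j \<omega>\<bar> \<le> gam N"
proof -
  assume N: "N \<ge> 1" and ij: "i \<le> N" "j \<ge> 1"
  show ?thesis using R_le[OF N] by eventually_elim (use ij in auto)
qed

lemma R_integrable:
  assumes "N \<ge> 1" "i \<le> N" "j \<ge> 1"
  shows "integrable (P N) (R N i j)" "integrable (P N) (\<lambda>\<omega>. (R N i j \<omega>)\<^sup>2)"
proof -
  interpret prob_space "P N" by (rule P[OF assms(1)])
  note [measurable] = R_measurable[OF assms]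
  show "integrable (P N) (R N i j)"
    by (rule integrable_const_bound[of _ "gam N"]) (use R_AE[OF assms] in auto)
  show "integrable (P N) (\<lambda>\<omega>. (R N i j \<omega>)\<^sup>2)"
    by (rule integrable_const_bound[of _ "(gam N)\<^sup>2"])
      (use R_AE[OF assms] gam0[OF assms(1)] in \<open>auto simp: power2_le_iff_abs_le\<close>)
qed

lemma R_mean_le: assumes "N \<ge> 1" "i \<le> N" "j \<ge> 1" shows "\<bar>\<integral>\<omega>. R N i j \<omega> \<partial>P N\<bar> \<le> gam N"
proof -
  interpret prob_space "P N" by (rule P[OF assms(1)])
  have "norm (\<integral>\<omega>. R N i j \<omega> \<partial>P N) \<le> (\<integral>\<omega>. norm (R N i j \<omega>) \<partial>P N)" by (rule integral_norm_bound)
  also have "\<dots> \<le> gam N" by (rule integral_le_const) (use R_integrable[OF assms] R_AE[OF assms] in auto)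
  finally show ?thesis by simp
qed

lemma R_square_le: assumes "N \<ge> 1" "i \<le> N" "j \<ge> 1"
  shows "\<bar>\<integral>\<omega>. (R N i j \<omega>)\<^sup>2 \<partial>P N\<bar> \<le> (gam N)\<^sup>2"
proof -
  interpret prob_space "P N" by (rule P[OF assms(1)])
  have "0 \<le> (\<integral>\<omega>. (R N i j \<omega>)\<^sup>2 \<partial>P N)" by (rule integral_nonneg_AE) auto
  moreover have "(\<integral>\<omega>. (R N i j \<omega>)\<^sup>2 \<partial>P N) \<le> (gam N)\<^sup>2"
    by (rule integral_le_const)
      (use R_integrable[OF assms] R_AE[OF assms] gam0[OF assms(1)] in \<open>auto simp: power2_le_iff_abs_le\<close>)
  ultimately show ?thesis by simp
qed

section \<open>Sums of means and second moments for a frozen state\<close>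

lemma muN_0: "j \<ge> 1 \<Longrightarrow> (\<lambda>N. muN N j) \<longlonglongrightarrow> 0"
proof (rule Lim_null_comparison[OF _ gam])
  assume j: "j \<ge> 1"
  show "eventually (\<lambda>N. norm (muN N j) \<le> gam N) sequentially"
    using eventually_ge_at_top[of 1]
  proof eventually_elim
    case (elim N)
    then show ?case using R_mean_le[OF elim _ j, of 0] R_mean[OF elim _ j, of 0] by simp
  qed
qed

text \<open>Logarithms in condition (ii) give the limit of \<open>N * ln (1 + muN N j)\<close>. For
  \<open>x = muN N j\<close>, eventually below 1/4 in absolute value,
  \<open>|ln (1 + x) - x| \<le> 2 * x^2\<close> and hence \<open>|x| \<le> 2 * |ln (1 + x)|\<close>;
  so the difference to \<open>N * x\<close> is at most \<open>4 * |N * ln (1 + x)| * |x|\<close>,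
  which vanishes.\<close>

lemma muN_scaled:
  assumes j: "j \<ge> 1" shows "(\<lambda>N. real N * muN N j) \<longlonglongrightarrow> mu j * T"
proof -
  let ?x = "\<lambda>N. muN N j" and ?L = "\<lambda>N. real N * ln (1 + muN N j)"
  have small: "eventually (\<lambda>N. \<bar>?x N\<bar> < 1/4) sequentially"
    using tendstoD[OF muN_0[OF j], of "1/4"] by (simp add: dist_real_def)
  have "(\<lambda>N. ln ((1 + ?x N) ^ N)) \<longlonglongrightarrow> ln (exp (mu j * T))"
    by (rule tendsto_ln[OF muN_lim[OF j]]) simp
  moreover have "eventually (\<lambda>N. ln ((1 + ?x N) ^ N) = ?L N) sequentially"
    using small by eventually_elim (auto simp: ln_realpow abs_less_iff)
  ultimately have L: "?L \<longlonglongrightarrow> mu j * T" by (auto intro: Lim_transform_eventually)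
  have "(\<lambda>N. real N * ?x N - ?L N) \<longlonglongrightarrow> 0"
  proof (rule Lim_null_comparison)
    show "eventually (\<lambda>N. norm (real N * ?x N - ?L N) \<le> 4 * \<bar>?L N\<bar> * \<bar>?x N\<bar>) sequentially"
      using small
    proof eventually_elim
      case (elim N)
      define x where "x = ?x N"
      have x: "\<bar>x\<bar> < 1/4" using elim by (simp add: x_def)
      have 1: "\<bar>ln (1 + x) - x\<bar> \<le> 2 * x\<^sup>2" using x by (intro abs_ln_one_plus_x_minus_x_bound) auto
      have "2 * x\<^sup>2 = \<bar>x\<bar> * (2 * \<bar>x\<bar>)" by (simp add: power2_eq_square)
      also have "\<dots> \<le> \<bar>x\<bar> * (1/2)" using x by (intro mult_left_mono) auto
      finally have 2: "\<bar>x\<bar> \<le> 2 * \<bar>ln (1 + x)\<bar>" using 1 by linarith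
      have "\<bar>x - ln (1 + x)\<bar> \<le> 2 * (\<bar>x\<bar> * \<bar>x\<bar>)" using 1 by (simp add: power2_eq_square abs_minus_commute)
      also have "\<dots> \<le> 2 * ((2 * \<bar>ln (1 + x)\<bar>) * \<bar>x\<bar>)" using 2 by (intro mult_left_mono mult_right_mono) auto
      finally have "real N * \<bar>x - ln (1 + x)\<bar> \<le> real N * (2 * ((2 * \<bar>ln (1 + x)\<bar>) * \<bar>x\<bar>))"
        by (rule mult_left_mono) simp
      then show ?case by (simp add: x_def[symmetric] abs_mult right_diff_distrib[symmetric] mult.assoc)
    qed
    have "(\<lambda>N. 4 * \<bar>?L N\<bar> * \<bar>?x N\<bar>) \<longlonglongrightarrow> 4 * \<bar>mu j * T\<bar> * \<bar>0\<bar>"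
      by (intro tendsto_intros L muN_0 j)
    then show "(\<lambda>N. 4 * \<bar>?L N\<bar> * \<bar>?x N\<bar>) \<longlonglongrightarrow> 0" by simp
  qed
  from tendsto_add[OF this L] show ?thesis by simp
qed

text \<open>The number of steps up to \<open>t\<close>, divided by N, tends to
  \<open>t / T\<close>.\<close>

lemma sum_const_limit:
  assumes t: "t \<in> {0..T}" and a: "(\<lambda>N. real N * a N) \<longlonglongrightarrow> A * T"
  shows "(\<lambda>N. real (idx T N t) * a N) \<longlonglongrightarrow> A * t"
proof -
  have "(\<lambda>N. real (idx T N t) / real N * (real N * a N)) \<longlonglongrightarrow> t / T * (A * T)"
    using t by (intro tendsto_mult idx_ratio a T) auto
  then have "(\<lambda>N. real (idx T N t) / real N * (real N * a N)) \<longlonglongrightarrow> A * t" using T by (simp add: mult.commute)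
  then show ?thesis
    by (rule Lim_transform_eventually) (use eventually_gt_at_top[of 0] in eventually_elim, simp)
qed

lemma idx_memD: "N \<ge> 1 \<Longrightarrow> t \<in> {0..T} \<Longrightarrow> i \<in> {0<..idx T N t} \<Longrightarrow> i \<le> N"
  using idx_le[OF T, of t N] by simp

lemma eventually_sum_eq:
  assumes "\<And>N i. N \<ge> 1 \<Longrightarrow> i \<le> N \<Longrightarrow> f N i = (h N :: real)" "t \<in> {0..T}"
  shows "eventually (\<lambda>N. real (idx T N t) * h N = (\<Sum>i\<in>{0<..idx T N t}. f N i)) sequentially"
  using eventually_ge_at_top[of 1]
proof eventually_elim
  case (elim N)
  have "(\<Sum>i\<in>{0<..idx T N t}. f N i) = (\<Sum>i\<in>{0<..idx T N t}. h N)"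
    using assms(1)[OF elim] idx_memD[OF elim assms(2)] by (intro sum.cong) auto
  then show ?case by simp
qed

lemma mean_limit:
  assumes j: "j \<ge> 1" and t: "t \<in> {0..T}"
  shows "(\<lambda>N. \<Sum>i\<in>{0<..idx T N t}. \<integral>\<omega>. R N i j \<omega> \<partial>P N) \<longlonglongrightarrow> mu j * t"
  by (rule Lim_transform_eventually[OF sum_const_limit[OF t muN_scaled[OF j]]])
    (rule eventually_sum_eq[OF R_mean[OF _ _ j] t])

lemma abs_mean_limit:
  assumes j: "j \<ge> 1" and t: "t \<in> {0..T}"
  shows "(\<lambda>N. \<Sum>i\<in>{0<..idx T N t}. \<bar>\<integral>\<omega>. R N i j \<omega> \<partial>P N\<bar>) \<longlonglongrightarrow> \<bar>mu j\<bar> * t"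
proof -
  have "(\<lambda>N. real N * \<bar>muN N j\<bar>) \<longlonglongrightarrow> \<bar>mu j\<bar> * T"
    using tendsto_rabs[OF muN_scaled[OF j]] T by (simp add: abs_mult)
  from sum_const_limit[OF t this] show ?thesis
    by (rule Lim_transform_eventually) (rule eventually_sum_eq, use R_mean[OF _ _ j] t in auto)
qed

text \<open>A second moment is the variance plus \<open>muN^2\<close>, and \<open>N * muN^2\<close>
  vanishes because \<open>N * muN\<close> converges while \<open>muN\<close> tends to 0.\<close>

lemma square_limit:
  assumes j: "j \<ge> 1" and t: "t \<in> {0..T}"
  shows "(\<lambda>N. \<Sum>i\<in>{0<..idx T N t}. \<integral>\<omega>. (R N i j \<omega>)\<^sup>2 \<partial>P N) \<longlonglongrightarrow> (sig j)\<^sup>2 * t"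
proof -
  have "(\<lambda>N. (real N * muN N j) * muN N j) \<longlonglongrightarrow> (mu j * T) * 0"
    by (intro tendsto_mult muN_scaled muN_0 j)
  then have "(\<lambda>N. real N * (muN N j)\<^sup>2) \<longlonglongrightarrow> 0 * T" by (simp add: power2_eq_square mult.assoc)
  from tendsto_add[OF R_var[OF j t] sum_const_limit[OF t this]]
  have "(\<lambda>N. (\<Sum>i\<in>{0<..idx T N t}. prob_space.variance (P N) (R N i j)) + real (idx T N t) * (muN N j)\<^sup>2) \<longlonglongrightarrow> (sig j)\<^sup>2 * t"
    by simp
  then show ?thesis
  proof (rule Lim_transform_eventually)
    show "eventually (\<lambda>N. (\<Sum>i\<in>{0<..idx T N t}. prob_space.variance (P N) (R N i j)) + real (idx T N t) * (muN N j)\<^sup>2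
        = (\<Sum>i\<in>{0<..idx T N t}. \<integral>\<omega>. (R N i j \<omega>)\<^sup>2 \<partial>P N)) sequentially"
      using eventually_ge_at_top[of 1]
    proof eventually_elim
      case (elim N)
      interpret prob_space "P N" by (rule P[OF elim])
      have "(\<Sum>i\<in>{0<..idx T N t}. \<integral>\<omega>. (R N i j \<omega>)\<^sup>2 \<partial>P N) = (\<Sum>i\<in>{0<..idx T N t}. variance (R N i j) + (muN N j)\<^sup>2)"
      proof (rule sum.cong[OF refl])
        fix i assume "i \<in> {0<..idx T N t}"
        then have i: "i \<le> N" using idx_memD[OF elim t] by auto
        show "(\<integral>\<omega>. (R N i j \<omega>)\<^sup>2 \<partial>P N) = variance (R N i j) + (muN N j)\<^sup>2"
          using variance_eq[OF R_integrable[OF elim i j]] R_mean[OF elim i j] by simp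
      qed
      then show ?case by (simp add: sum.distrib)
    qed
  qed
qed

end

text \<open>\<open>y\<close> is one path in continuous time, the same for all N; model N reads it at
  the times \<open>i * T / N\<close>.\<close>

locale quenched_model = discrete_model +
  fixes y :: "real \<Rightarrow> nat"
  assumes y: "cadlag_on {0..} y" and y1: "\<And>t. t \<ge> 0 \<Longrightarrow> y t \<ge> 1"
begin

definition X :: "nat \<Rightarrow> nat \<Rightarrow> 'a \<Rightarrow> real" where
  "X N i \<omega> = R N i (y (real i * T / real N)) \<omega>"

definition Z :: "nat \<Rightarrow> nat \<Rightarrow> 'a \<Rightarrow> real" where
  "Z N i \<omega> = ln (1 + X N i \<omega>)"

definition S :: "nat \<Rightarrow> nat \<Rightarrow> 'a \<Rightarrow> real" where
  "S N m \<omega> = (\<Sum>i\<in>{0<..min m N}. Z N i \<omega>)"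

text \<open>Number of steps of model N made up to the l-th of \<open>n\<close> coarse times;
  \<open>n\<close> need not divide \<open>N\<close>, so blocks may differ in size.\<close>

definition k :: "nat \<Rightarrow> nat \<Rightarrow> nat \<Rightarrow> nat" where
  "k n N l = idx T N (real l * T / real n)"

definition block :: "nat \<Rightarrow> nat \<Rightarrow> nat \<Rightarrow> nat set" where
  "block n N l = {k n N l<..k n N (Suc l)}"

definition I :: "nat \<Rightarrow> nat \<Rightarrow> real set" where
  "I n l = {real l * T / real n<..real (Suc l) * T / real n}"

lemma y_grid: "y (real i * T / real N) \<ge> 1" using T by (intro y1) auto

lemma X_measurable: "N \<ge> 1 \<Longrightarrow> i \<le> N \<Longrightarrow> X N i \<in> borel_measurable (P N)"
  unfolding X_def using R_measurable y_grid by auto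

lemma X_AE: "N \<ge> 1 \<Longrightarrow> i \<le> N \<Longrightarrow> AE \<omega> in P N. \<bar>X N i \<omega>\<bar> \<le> gam N"
  unfolding X_def using R_AE y_grid by auto

lemma Z_measurable: "N \<ge> 1 \<Longrightarrow> i \<le> N \<Longrightarrow> Z N i \<in> borel_measurable (P N)"
  unfolding Z_def using X_measurable[of N i] by measurable

lemma S_measurable: "N \<ge> 1 \<Longrightarrow> S N m \<in> borel_measurable (P N)"
  unfolding S_def by (intro borel_measurable_sum Z_measurable) auto

text \<open>Distinct \<open>i\<close> select distinct entries of the independent array, whatever
  states the path visits.\<close>

lemma Z_indep:
  assumes N: "N \<ge> 1" shows "prob_space.indep_vars (P N) (\<lambda>_. borel) (Z N) {0<..N}"
proof -
  interpret prob_space "P N" by (rule P[OF N])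
  let ?p = "\<lambda>i. (i, y (real i * T / real N))"
  have "indep_vars (\<lambda>i. PiM {?p i} (\<lambda>_. borel)) (\<lambda>i \<omega>. restrict (\<lambda>p. (case p of (i, j) \<Rightarrow> R N i j) \<omega>) {?p i}) {0<..N}"
    by (rule indep_vars_restrict[OF R_indep[OF N]]) (use y_grid in \<open>auto simp: disjoint_family_on_def\<close>)
  then have "indep_vars (\<lambda>_. borel) (\<lambda>i \<omega>. (\<lambda>x. ln (1 + x (?p i))) (restrict (\<lambda>p. (case p of (i, j) \<Rightarrow> R N i j) \<omega>) {?p i})) {0<..N}"
    by (rule indep_vars_compose2)
      (auto intro!: measurable_compose[OF _ borel_measurable_ln] borel_measurable_add borel_measurable_const measurable_component_singleton)
  then show ?thesis by (simp add: Z_def[abs_def] X_def)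
qed

lemma k_0 [simp]: "k n N 0 = 0" by (simp add: k_def idx_0[OF T])

lemma grid_point: "n > 0 \<Longrightarrow> l \<le> n \<Longrightarrow> real l * T / real n \<in> {0..T}"
  using T by (auto simp: field_simps)

lemma k_le: "n > 0 \<Longrightarrow> l \<le> n \<Longrightarrow> k n N l \<le> N"
  unfolding k_def by (rule idx_le[OF T grid_point])

lemma k_mono: "l \<le> l' \<Longrightarrow> k n N l \<le> k n N l'"
  unfolding k_def using T by (intro idx_mono[OF T] divide_right_mono mult_right_mono) auto

lemma k_n [simp]: "n > 0 \<Longrightarrow> k n N n = N"
  by (simp add: k_def idx_T[OF T])

lemma block_memD: "n > 0 \<Longrightarrow> l < n \<Longrightarrow> i \<in> block n N l \<Longrightarrow> i \<le> N"
  unfolding block_def using k_le[of n "Suc l" N] by auto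

lemma block_limits:
  assumes n: "n > 0" and l: "l < n"
  shows "(\<lambda>N. \<Sum>i\<in>block n N l. \<integral>\<omega>. X N i \<omega> \<partial>P N) \<longlonglongrightarrow> (LBINT s:I n l. mu (y s))"
    and "(\<lambda>N. \<Sum>i\<in>block n N l. \<bar>\<integral>\<omega>. X N i \<omega> \<partial>P N\<bar>) \<longlonglongrightarrow> (LBINT s:I n l. \<bar>mu (y s)\<bar>)"
    and "(\<lambda>N. \<Sum>i\<in>block n N l. \<integral>\<omega>. (X N i \<omega>)\<^sup>2 \<partial>P N) \<longlonglongrightarrow> (LBINT s:I n l. (sig (y s))\<^sup>2)"
proof -
  have ab: "0 \<le> real l * T / real n" "real l * T / real n \<le> real (Suc l) * T / real n" "real (Suc l) * T / real n \<le> T"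
    using grid_point[OF n, of l] grid_point[OF n, of "Suc l"] l T by (auto intro!: divide_right_mono mult_right_mono)
  have g2: "(\<lambda>N. (gam N)\<^sup>2) \<longlonglongrightarrow> 0" using tendsto_power[OF gam, of 2] by simp
  show "(\<lambda>N. \<Sum>i\<in>block n N l. \<integral>\<omega>. X N i \<omega> \<partial>P N) \<longlonglongrightarrow> (LBINT s:I n l. mu (y s))"
    unfolding block_def I_def k_def X_def
    by (rule path_sum_limit'[where c="\<lambda>N i j. \<integral>\<omega>. R N i j \<omega> \<partial>P N" and C=mu, OF T y y1 mean_limit _ ab])
      (use R_mean_le gam in \<open>auto intro!: exI[of _ gam]\<close>)
  show "(\<lambda>N. \<Sum>i\<in>block n N l. \<bar>\<integral>\<omega>. X N i \<omega> \<partial>P N\<bar>) \<longlonglongrightarrow> (LBINT s:I n l. \<bar>mu (y s)\<bar>)"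
    unfolding block_def I_def k_def X_def
    by (rule path_sum_limit'[where c="\<lambda>N i j. \<bar>\<integral>\<omega>. R N i j \<omega> \<partial>P N\<bar>" and C="\<lambda>j. \<bar>mu j\<bar>", OF T y y1 abs_mean_limit _ ab])
      (use R_mean_le gam in \<open>auto intro!: exI[of _ gam]\<close>)
  show "(\<lambda>N. \<Sum>i\<in>block n N l. \<integral>\<omega>. (X N i \<omega>)\<^sup>2 \<partial>P N) \<longlonglongrightarrow> (LBINT s:I n l. (sig (y s))\<^sup>2)"
    unfolding block_def I_def k_def X_def
    by (rule path_sum_limit'[where c="\<lambda>N i j. \<integral>\<omega>. (R N i j \<omega>)\<^sup>2 \<partial>P N" and C="\<lambda>j. (sig j)\<^sup>2", OF T y y1 square_limit _ ab])
      (use R_square_le g2 in \<open>auto intro!: exI[of _ "\<lambda>N. (gam N)\<^sup>2"]\<close>)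
qed

lemma set_integral_sigma_nonneg: "0 \<le> (LBINT s:I n l. (sig (y s))\<^sup>2)"
  unfolding set_lebesgue_integral_def by (rule integral_nonneg_AE) auto

lemma fid_limit:
  fixes g :: "(nat \<Rightarrow> real) \<Rightarrow> real"
  assumes n: "n > 0" and g: "continuous_on UNIV g" and B: "\<And>x. \<bar>g x\<bar> \<le> B"
  shows "(\<lambda>N. \<integral>\<omega>. g (\<lambda>l. S N (k n N (min l n)) \<omega>) \<partial>P N) \<longlonglongrightarrow> limit_fid T mu sig n y g"
proof -
  let ?\<nu> = "\<lambda>l. gauss ((LBINT s:I n l. mu (y s)) - (LBINT s:I n l. (sig (y s))\<^sup>2) / 2) (LBINT s:I n l. (sig (y s))\<^sup>2)"
  \<comment> \<open>The index is shifted to \<open>Suc q\<close> because nothing is assumed about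
    the model with index 0.\<close>
  have "(\<lambda>q. \<integral>\<omega>. g (\<lambda>l. \<Sum>i\<in>{0<..k n (Suc q) (min l n)}. Z (Suc q) i \<omega>) \<partial>P (Suc q)) \<longlonglongrightarrow> (\<integral>x. g (cum n x) \<partial>PiM {..<n} ?\<nu>)"
  proof (rule block_convergence[OF _ _ _ _ n _ _ g B])
    fix q show "prob_space (P (Suc q))" by (rule P) simp
    show "prob_space.indep_vars (P (Suc q)) (\<lambda>_. borel) (Z (Suc q)) {0<..k n (Suc q) n}"
      using Z_indep[of "Suc q"] n by simp
  next
    fix l \<theta> assume l: "l < n"
    have "(\<lambda>N. \<Prod>i\<in>block n N l. char (distr (P N) borel (\<lambda>\<omega>. ln (1 + X N i \<omega>))) \<theta>)
      \<longlonglongrightarrow> exp (\<i> * \<theta> * ((LBINT s:I n l. mu (y s)) - (LBINT s:I n l. (sig (y s))\<^sup>2) / 2) - \<theta>\<^sup>2 * (LBINT s:I n l. (sig (y s))\<^sup>2) / 2)"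
      by (rule char_log_array[OF P _ _ gam gam0 block_limits[OF n l]])
        (use block_memD[OF n l] X_measurable X_AE in auto)
    also have "exp (\<i> * \<theta> * ((LBINT s:I n l. mu (y s)) - (LBINT s:I n l. (sig (y s))\<^sup>2) / 2) - \<theta>\<^sup>2 * (LBINT s:I n l. (sig (y s))\<^sup>2) / 2) = char (?\<nu> l) \<theta>"
      by (simp add: char_gauss[OF set_integral_sigma_nonneg])
    finally have "(\<lambda>N. \<Prod>i\<in>block n N l. char (distr (P N) borel (Z N i)) \<theta>) \<longlonglongrightarrow> char (?\<nu> l) \<theta>"
      by (simp only: Z_def[abs_def])
    from LIMSEQ_Suc[OF this]
    show "(\<lambda>q. \<Prod>i\<in>{k n (Suc q) l<..k n (Suc q) (Suc l)}. char (distr (P (Suc q)) borel (Z (Suc q) i)) \<theta>) \<longlonglongrightarrow> char (?\<nu> l) \<theta>"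
      by (simp add: block_def)
  qed (auto intro: k_mono)
  also have "(\<integral>x. g (cum n x) \<partial>PiM {..<n} ?\<nu>) = limit_fid T mu sig n y g"
    by (simp add: limit_fid_def I_def Let_def)
  also have "(\<lambda>q. \<integral>\<omega>. g (\<lambda>l. \<Sum>i\<in>{0<..k n (Suc q) (min l n)}. Z (Suc q) i \<omega>) \<partial>P (Suc q))
      = (\<lambda>q. \<integral>\<omega>. g (\<lambda>l. S (Suc q) (k n (Suc q) (min l n)) \<omega>) \<partial>P (Suc q))"
    using k_le[OF n] by (simp add: S_def min_absorb1)
  finally show ?thesis by (rule LIMSEQ_imp_Suc)
qed

section \<open>Oscillation between the coarse times\<close>

definition osc :: "nat \<Rightarrow> nat \<Rightarrow> real \<Rightarrow> 'a set" where
  "osc n N \<epsilon> = (\<Union>l<n. {\<omega> \<in> space (P N). \<exists>m\<in>block n N l. \<bar>\<Sum>i\<in>{k n N l<..m}. Z N i \<omega>\<bar> \<ge> \<epsilon>})"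

lemma osc_sets:
  assumes "n > 0" "N \<ge> 1" "l < n"
  shows "{\<omega> \<in> space (P N). \<exists>m\<in>block n N l. \<bar>\<Sum>i\<in>{k n N l<..m}. Z N i \<omega>\<bar> \<ge> \<epsilon>} \<in> sets (P N)"
proof -
  have "(\<lambda>\<omega>. \<bar>\<Sum>i\<in>{k n N l<..m}. Z N i \<omega>\<bar>) \<in> borel_measurable (P N)" if "m \<in> block n N l" for m
    using block_memD[OF assms(1,3) that] assms
    by (intro borel_measurable_abs borel_measurable_sum Z_measurable) auto
  then show ?thesis
    by (intro sets.sets_Collect_finite_Ex borel_measurable_le) (auto simp: block_def)
qed

text \<open>At time \<open>t\<close> the fine path has index \<open>m\<close> and the coarse path
  sits at \<open>k n N l\<close>, the start of the block containing \<open>m\<close>; their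
  difference is a partial sum of that block. The comparison is at equal times, so it bounds the
  Skorokhod distance through the identity time change.\<close>

lemma osc_step_close:
  assumes n: "n > 0" and N: "N \<ge> 1" and \<omega>: "\<omega> \<in> space (P N)" "\<omega> \<notin> osc n N \<epsilon>" and \<epsilon>: "\<epsilon> > 0" and t: "t \<in> {0..T}"
  shows "\<bar>grid_step T N (\<lambda>m. S N m \<omega>) t - grid_step T n (\<lambda>l. S N (k n N (min l n)) \<omega>) t\<bar> \<le> \<epsilon>"
proof -
  define l where "l = idx T n t"
  define m where "m = idx T N t"
  have ln: "l \<le> n" unfolding l_def by (rule idx_le[OF T t])
  have mN: "m \<le> N" unfolding m_def by (rule idx_le[OF T t])
  have lt: "real l * T / real n \<le> t" unfolding l_def using idx_bounds(1)[OF T n, of t] t by auto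
  have km: "k n N l \<le> m" unfolding k_def m_def by (rule idx_mono[OF T lt])
  have "\<bar>S N m \<omega> - S N (k n N l) \<omega>\<bar> \<le> \<epsilon>"
  proof (cases "m = k n N l")
    case True then show ?thesis using \<epsilon> by simp
  next
    case False
    \<comment> \<open>\<open>l = n\<close> would force \<open>m = N = k n N n\<close>, the case
      already treated.\<close>
    have "l < n"
    proof (rule ccontr)
      assume "\<not> l < n"
      then have "l = n" using ln by simp
      then show False using False km mN n by simp
    qed
    have "m \<le> k n N (Suc l)"
      unfolding m_def k_def by (rule idx_mono[OF T]) (use idx_bounds(2)[OF T n, of t] t in \<open>auto simp: l_def add.commute\<close>)
    then have mb: "m \<in> block n N l" using km False by (auto simp: block_def)
    have "{0<..m} = {0<..k n N l} \<union> {k n N l<..m}" using km by auto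
    then have "S N m \<omega> - S N (k n N l) \<omega> = (\<Sum>i\<in>{k n N l<..m}. Z N i \<omega>)"
      using mN km by (simp add: S_def min_absorb1 sum.union_disjoint)
    then show ?thesis using \<omega> mb \<open>l < n\<close> unfolding osc_def by (auto simp: not_le intro: less_imp_le)
  qed
  then show ?thesis using t ln by (simp add: grid_step_idx l_def[symmetric] m_def[symmetric] min_absorb1)
qed

lemma Z_moments:
  assumes N: "N \<ge> 1" and i: "i \<le> N" and g: "gam N \<le> 1/2"
  shows "\<bar>\<integral>\<omega>. Z N i \<omega> \<partial>P N\<bar> \<le> \<bar>\<integral>\<omega>. X N i \<omega> \<partial>P N\<bar> + 2 * (\<integral>\<omega>. (X N i \<omega>)\<^sup>2 \<partial>P N)"
    and "(\<integral>\<omega>. (Z N i \<omega>)\<^sup>2 \<partial>P N) \<le> 4 * (\<integral>\<omega>. (X N i \<omega>)\<^sup>2 \<partial>P N)"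
    and "AE \<omega> in P N. \<bar>Z N i \<omega>\<bar> \<le> 2 * gam N"
proof -
  interpret prob_space "P N" by (rule P[OF N])
  note [measurable] = X_measurable[OF N i] Z_measurable[OF N i]
  have i1: "integrable (P N) (X N i)" and i2: "integrable (P N) (\<lambda>\<omega>. (X N i \<omega>)\<^sup>2)"
    unfolding X_def using R_integrable[OF N i y_grid] by auto
  have b: "AE \<omega> in P N. \<bar>X N i \<omega>\<bar> \<le> gam N \<and> \<bar>X N i \<omega>\<bar> \<le> 1/2"
    using X_AE[OF N i] by eventually_elim (use g in auto)
  have z: "AE \<omega> in P N. \<bar>Z N i \<omega>\<bar> \<le> 2 * \<bar>X N i \<omega>\<bar>"
    using b by eventually_elim (simp add: Z_def ln_one_plus_le)
  show z2: "AE \<omega> in P N. \<bar>Z N i \<omega>\<bar> \<le> 2 * gam N"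
    using b z by eventually_elim auto
  have iz: "integrable (P N) (Z N i)"
    by (rule integrable_const_bound[of _ "2 * gam N"]) (use z2 in auto)
  have iz2: "integrable (P N) (\<lambda>\<omega>. (Z N i \<omega>)\<^sup>2)"
  proof (rule integrable_const_bound[of _ "(2 * gam N)\<^sup>2"])
    show "AE \<omega> in P N. norm ((Z N i \<omega>)\<^sup>2) \<le> (2 * gam N)\<^sup>2"
      using z2
    proof eventually_elim
      case (elim \<omega>)
      then have "\<bar>Z N i \<omega>\<bar> ^ 2 \<le> (2 * gam N)\<^sup>2" by (intro power_mono) auto
      then show ?case by simp
    qed
  qed simp
  have "\<bar>\<integral>\<omega>. Z N i \<omega> - X N i \<omega> \<partial>P N\<bar> \<le> (\<integral>\<omega>. \<bar>Z N i \<omega> - X N i \<omega>\<bar> \<partial>P N)"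
    using integral_norm_bound[of "P N" "\<lambda>\<omega>. Z N i \<omega> - X N i \<omega>"] by simp
  also have "\<dots> \<le> (\<integral>\<omega>. 2 * (X N i \<omega>)\<^sup>2 \<partial>P N)"
  proof (rule integral_mono_AE)
    show "integrable (P N) (\<lambda>\<omega>. \<bar>Z N i \<omega> - X N i \<omega>\<bar>)"
      by (rule integrable_abs[OF Bochner_Integration.integrable_diff[OF iz i1]])
    show "AE \<omega> in P N. \<bar>Z N i \<omega> - X N i \<omega>\<bar> \<le> 2 * (X N i \<omega>)\<^sup>2"
      using b by eventually_elim (simp add: Z_def abs_ln_one_plus_x_minus_x_bound)
  qed (use i2 in auto)
  finally have "\<bar>(\<integral>\<omega>. Z N i \<omega> \<partial>P N) - (\<integral>\<omega>. X N i \<omega> \<partial>P N)\<bar> \<le> 2 * (\<integral>\<omega>. (X N i \<omega>)\<^sup>2 \<partial>P N)"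
    using iz i1 by simp
  then show "\<bar>\<integral>\<omega>. Z N i \<omega> \<partial>P N\<bar> \<le> \<bar>\<integral>\<omega>. X N i \<omega> \<partial>P N\<bar> + 2 * (\<integral>\<omega>. (X N i \<omega>)\<^sup>2 \<partial>P N)" by linarith
  have "(\<integral>\<omega>. (Z N i \<omega>)\<^sup>2 \<partial>P N) \<le> (\<integral>\<omega>. 4 * (X N i \<omega>)\<^sup>2 \<partial>P N)"
  proof (rule integral_mono_AE[OF iz2])
    show "AE \<omega> in P N. (Z N i \<omega>)\<^sup>2 \<le> 4 * (X N i \<omega>)\<^sup>2"
      using z
    proof eventually_elim
      case (elim \<omega>)
      then have "(Z N i \<omega>)\<^sup>2 \<le> (2 * \<bar>X N i \<omega>\<bar>)\<^sup>2" by (intro power2_le_iff_abs_le[THEN iffD2]) auto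
      then show ?case by (simp add: power_mult_distrib)
    qed
  qed (use i2 in auto)
  then show "(\<integral>\<omega>. (Z N i \<omega>)\<^sup>2 \<partial>P N) \<le> 4 * (\<integral>\<omega>. (X N i \<omega>)\<^sup>2 \<partial>P N)" by simp
qed

lemma block_integral_le:
  assumes n: "n > 0" and C: "\<And>j. j \<ge> 1 \<Longrightarrow> C j \<le> c"
  shows "(LBINT s:I n l. C (y s)) \<le> c * T / real n"
proof -
  have ab: "0 \<le> real l * T / real n" "real l * T / real n \<le> real (Suc l) * T / real n"
    using T by (auto intro!: divide_right_mono mult_right_mono)
  have "(LBINT s:I n l. C (y s)) \<le> (LBINT s:I n l. c)"
  proof (rule set_integral_mono)
    show "set_integrable lborel (I n l) (\<lambda>s. C (y s))" unfolding I_def by (rule path_set_integrable[OF y y1 ab])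
    show "set_integrable lborel (I n l) (\<lambda>s. c)" unfolding I_def set_integrable_def using ab by auto
    fix s assume "s \<in> I n l"
    then have "0 \<le> s" using ab unfolding I_def by auto
    then show "C (y s) \<le> c" using y1 C by auto
  qed
  also have "\<dots> = c * (real (Suc l) * T / real n - real l * T / real n)"
    unfolding I_def set_lebesgue_integral_def using ab by simp
  also have "\<dots> = c * T / real n" by (simp add: algebra_simps add_divide_distrib diff_divide_distrib)
  finally show ?thesis .
qed

text \<open>Bound, independent of \<open>n\<close>, for the moment part of the exponent in the
  maximal inequality at \<open>\<theta> = sqrt n\<close>: the first two summands bound
  \<open>\<theta>\<close> times the absolute means of a block, the third bounds
  \<open>\<theta>^2\<close> times its second moments. Each \<open>+ 1\<close> is slack that turns a
  limit as N grows into an eventual inequality.\<close>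

definition c1 :: real where "c1 = (Cm * T + 1) + 2 * (Cs * T + 1) + 4 * (Cs * T + 1)"

text \<open>Absolute means and second moments of a block sum to order \<open>1 / n\<close>. With
  \<open>\<theta> = sqrt n\<close> their part of the exponent stays bounded while the level
  contributes \<open>- sqrt n * \<epsilon>\<close>, which still beats the factor \<open>n\<close>
  from the union over all blocks.\<close>

lemma osc_prob:
  assumes n: "n > 0" and \<epsilon>: "\<epsilon> > 0"
  shows "eventually (\<lambda>N. measure (P N) (osc n N \<epsilon>) \<le> 2 * real n * exp (c1 - sqrt (real n) * \<epsilon>)) sequentially"
proof -
  have Cm0: "Cm \<ge> 0" using Cm[of 1] by simp
  have Cs0: "Cs \<ge> 0" using Cs[of 1] zero_le_power2[of "sig 1"] by linarith
  \<comment> \<open>The second bound gives \<open>2 * sqrt n * gam N \<le> 1\<close>, the size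
    condition of the maximal inequality; the first makes the expansions of the logarithm
    valid.\<close>
  have small: "eventually (\<lambda>N. gam N < min (1/2) (1 / (2 * sqrt (real n)))) sequentially"
    using n by (intro order_tendstoD[OF gam]) auto
  have lim1: "eventually (\<lambda>N. \<forall>l\<in>{..<n}. (\<Sum>i\<in>block n N l. \<bar>\<integral>\<omega>. X N i \<omega> \<partial>P N\<bar>) < (Cm * T + 1) / real n) sequentially"
  proof (rule eventually_ball_finite, simp, intro ballI)
    fix l assume "l \<in> {..<n}"
    then have l: "l < n" by simp
    have "(LBINT s:I n l. \<bar>mu (y s)\<bar>) \<le> Cm * T / real n" by (rule block_integral_le[OF n Cm])
    also have "\<dots> < (Cm * T + 1) / real n" using n by (intro divide_strict_right_mono) auto
    finally show "eventually (\<lambda>N. (\<Sum>i\<in>block n N l. \<bar>\<integral>\<omega>. X N i \<omega> \<partial>P N\<bar>) < (Cm * T + 1) / real n) sequentially"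
      by (rule order_tendstoD[OF block_limits(2)[OF n l]])
  qed
  have lim2: "eventually (\<lambda>N. \<forall>l\<in>{..<n}. (\<Sum>i\<in>block n N l. \<integral>\<omega>. (X N i \<omega>)\<^sup>2 \<partial>P N) < (Cs * T + 1) / real n) sequentially"
  proof (rule eventually_ball_finite, simp, intro ballI)
    fix l assume "l \<in> {..<n}"
    then have l: "l < n" by simp
    have "(LBINT s:I n l. (sig (y s))\<^sup>2) \<le> Cs * T / real n" by (rule block_integral_le[OF n Cs])
    also have "\<dots> < (Cs * T + 1) / real n" using n by (intro divide_strict_right_mono) auto
    finally show "eventually (\<lambda>N. (\<Sum>i\<in>block n N l. \<integral>\<omega>. (X N i \<omega>)\<^sup>2 \<partial>P N) < (Cs * T + 1) / real n) sequentially"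
      by (rule order_tendstoD[OF block_limits(3)[OF n l]])
  qed
  from small lim1 lim2 eventually_ge_at_top[of 1] show ?thesis
  proof eventually_elim
    case (elim N)
    then have N: "N \<ge> 1" and g: "gam N \<le> 1/2" by auto
    interpret prob_space "P N" by (rule P[OF N])
    define \<theta> where "\<theta> = sqrt (real n)"
    have \<theta>: "\<theta> > 0" "\<theta>\<^sup>2 = real n" "1 \<le> \<theta>" using n by (auto simp: \<theta>_def)
    have blk: "prob {\<omega> \<in> space (P N). \<exists>m\<in>block n N l. \<bar>\<Sum>i\<in>{k n N l<..m}. Z N i \<omega>\<bar> \<ge> \<epsilon>} \<le> 2 * exp (c1 - \<theta> * \<epsilon>)"
      if l: "l < n" for l
    proof -
      let ?b = "block n N l"
      have sub: "?b \<subseteq> {0<..N}" using block_memD[OF n l, of _ N] by (auto simp: block_def)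
      have "prob {\<omega> \<in> space (P N). \<exists>m\<in>?b. \<bar>\<Sum>i\<in>{k n N l<..m}. Z N i \<omega>\<bar> \<ge> \<epsilon>}
         \<le> 2 * exp (\<theta> * (\<Sum>i\<in>?b. \<bar>\<integral>\<omega>. Z N i \<omega> \<partial>P N\<bar>) + \<theta>\<^sup>2 * (\<Sum>i\<in>?b. \<integral>\<omega>. (Z N i \<omega>)\<^sup>2 \<partial>P N) - \<theta> * \<epsilon>)"
        unfolding block_def
      proof (rule two_sided_maximal[OF _ k_mono _ \<theta>(1)])
        show "indep_vars (\<lambda>_. borel) (Z N) {k n N l<..k n N (Suc l)}"
          using indep_vars_subset[OF Z_indep[OF N] sub] by (simp add: block_def)
        fix i assume "i \<in> {k n N l<..k n N (Suc l)}"
        then have i: "i \<le> N" using block_memD[OF n l, of i N] by (simp add: block_def)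
        show "AE \<omega> in P N. \<bar>\<theta> * Z N i \<omega>\<bar> \<le> 1"
          using Z_moments(3)[OF N i g]
        proof eventually_elim
          case (elim \<omega>)
          have "\<bar>\<theta> * Z N i \<omega>\<bar> \<le> \<theta> * (2 * gam N)"
            unfolding abs_mult using elim \<theta> by (intro mult_mono) auto
          also have "\<dots> \<le> \<theta> * (2 * (1 / (2 * \<theta>)))"
            using \<open>gam N < min (1/2) (1 / (2 * sqrt (real n)))\<close> \<theta> by (intro mult_left_mono) (auto simp: \<theta>_def)
          also have "\<dots> = 1" using \<theta> by simp
          finally show ?case .
        qed
      qed simp
      also have "\<dots> \<le> 2 * exp (c1 - \<theta> * \<epsilon>)"
      proof -
        have "(\<Sum>i\<in>?b. \<bar>\<integral>\<omega>. Z N i \<omega> \<partial>P N\<bar>) \<le> (\<Sum>i\<in>?b. \<bar>\<integral>\<omega>. X N i \<omega> \<partial>P N\<bar> + 2 * (\<integral>\<omega>. (X N i \<omega>)\<^sup>2 \<partial>P N))"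
          using sub by (intro sum_mono Z_moments(1) N g) auto
        also have "\<dots> = (\<Sum>i\<in>?b. \<bar>\<integral>\<omega>. X N i \<omega> \<partial>P N\<bar>) + 2 * (\<Sum>i\<in>?b. \<integral>\<omega>. (X N i \<omega>)\<^sup>2 \<partial>P N)"
          by (simp add: sum.distrib sum_distrib_left)
        also have "\<dots> \<le> (Cm * T + 1) / real n + 2 * ((Cs * T + 1) / real n)"
          using elim l by (intro add_mono mult_left_mono) (auto intro: less_imp_le)
        finally have a1: "(\<Sum>i\<in>?b. \<bar>\<integral>\<omega>. Z N i \<omega> \<partial>P N\<bar>) \<le> ((Cm * T + 1) + 2 * (Cs * T + 1)) / real n"
          by (simp add: add_divide_distrib)
        have "(\<Sum>i\<in>?b. \<integral>\<omega>. (Z N i \<omega>)\<^sup>2 \<partial>P N) \<le> (\<Sum>i\<in>?b. 4 * (\<integral>\<omega>. (X N i \<omega>)\<^sup>2 \<partial>P N))"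
          using sub by (intro sum_mono Z_moments(2) N g) auto
        also have "\<dots> \<le> 4 * ((Cs * T + 1) / real n)"
          unfolding sum_distrib_left[symmetric] using elim l by (intro mult_left_mono) (auto intro: less_imp_le)
        finally have a2: "(\<Sum>i\<in>?b. \<integral>\<omega>. (Z N i \<omega>)\<^sup>2 \<partial>P N) \<le> 4 * (Cs * T + 1) / real n" by simp
        have "\<theta> * (\<Sum>i\<in>?b. \<bar>\<integral>\<omega>. Z N i \<omega> \<partial>P N\<bar>) \<le> \<theta> * (((Cm * T + 1) + 2 * (Cs * T + 1)) / real n)"
          using a1 \<theta> by (intro mult_left_mono) auto
        \<comment> \<open>The mean part is even of order \<open>1 / sqrt n\<close>; enlarging
          \<open>\<theta>\<close> to \<open>\<theta>^2\<close> lets the factor \<open>n\<close>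
          cancel.\<close>
        also have "\<dots> \<le> \<theta>\<^sup>2 * (((Cm * T + 1) + 2 * (Cs * T + 1)) / real n)"
        proof (rule mult_right_mono)
          have "\<theta> * 1 \<le> \<theta> * \<theta>" using \<theta> by (intro mult_left_mono) auto
          then show "\<theta> \<le> \<theta>\<^sup>2" by (simp only: power2_eq_square mult_1_right)
        qed (use Cm0 Cs0 T in auto)
        also have "\<dots> = (Cm * T + 1) + 2 * (Cs * T + 1)" using \<theta> n by simp
        finally have e1: "\<theta> * (\<Sum>i\<in>?b. \<bar>\<integral>\<omega>. Z N i \<omega> \<partial>P N\<bar>) \<le> (Cm * T + 1) + 2 * (Cs * T + 1)" .
        have "\<theta>\<^sup>2 * (\<Sum>i\<in>?b. \<integral>\<omega>. (Z N i \<omega>)\<^sup>2 \<partial>P N) \<le> \<theta>\<^sup>2 * (4 * (Cs * T + 1) / real n)"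
          using a2 by (intro mult_left_mono) auto
        also have "\<dots> = 4 * (Cs * T + 1)" using \<theta> n by simp
        finally show ?thesis using e1 unfolding c1_def by (intro mult_left_mono) auto
      qed
      finally show ?thesis .
    qed
    have "prob (osc n N \<epsilon>) \<le> (\<Sum>l<n. prob {\<omega> \<in> space (P N). \<exists>m\<in>block n N l. \<bar>\<Sum>i\<in>{k n N l<..m}. Z N i \<omega>\<bar> \<ge> \<epsilon>})"
      unfolding osc_def using osc_sets[OF n N] by (intro measure_UNION_le) auto
    also have "\<dots> \<le> (\<Sum>l<n. 2 * exp (c1 - \<theta> * \<epsilon>))" using blk by (intro sum_mono) auto
    finally show ?case by (simp add: \<theta>_def)
  qed
qed

text \<open>With \<open>u = sqrt n * \<epsilon>\<close> the sequence is a constant times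
  \<open>u^2 / exp u\<close>.\<close>

lemma osc_bound_0:
  assumes "\<epsilon> > 0" shows "(\<lambda>n. 2 * real n * exp (c1 - sqrt (real n) * \<epsilon>)) \<longlonglongrightarrow> 0"
proof -
  have "filterlim (\<lambda>n. sqrt (real n) * \<epsilon>) at_top sequentially"
    using assms by (intro filterlim_at_top_mult_tendsto_pos[OF tendsto_const] filterlim_compose[OF sqrt_at_top filterlim_real_sequentially])
  then have "(\<lambda>n. (sqrt (real n) * \<epsilon>) ^ 2 / exp (sqrt (real n) * \<epsilon>)) \<longlonglongrightarrow> 0"
    by (rule filterlim_compose[OF tendsto_power_div_exp_0])
  then have "(\<lambda>n. (2 * exp c1 / \<epsilon>\<^sup>2) * ((sqrt (real n) * \<epsilon>) ^ 2 / exp (sqrt (real n) * \<epsilon>))) \<longlonglongrightarrow> (2 * exp c1 / \<epsilon>\<^sup>2) * 0"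
    by (intro tendsto_mult tendsto_const)
  moreover have "(2 * exp c1 / \<epsilon>\<^sup>2) * ((sqrt (real n) * \<epsilon>) ^ 2 / exp (sqrt (real n) * \<epsilon>)) = 2 * real n * exp (c1 - sqrt (real n) * \<epsilon>)" for n
    using assms by (simp add: power_mult_distrib exp_diff)
  ultimately show ?thesis by simp
qed

text \<open>For large \<open>n\<close>, \<open>H N\<close> is close to \<open>Hn n N\<close> for all
  large N, and \<open>Hn n N\<close> converges to \<open>\<Gamma> n\<close>. Hence \<open>H\<close>
  is Cauchy, and \<open>\<Gamma>\<close> converges to the same number, which is left unidentified
  here.\<close>

lemma quenched_convergence:
  fixes f :: "(real \<Rightarrow> real) \<Rightarrow> real"
  assumes L: "L \<ge> 0" and f: "\<And>x z. x \<in> skorokhod_space T \<Longrightarrow> z \<in> skorokhod_space T \<Longrightarrow> \<bar>f x - f z\<bar> \<le> L * skorokhod_dist T x z"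
    and B: "\<And>x. x \<in> skorokhod_space T \<Longrightarrow> \<bar>f x\<bar> \<le> B"
  shows "\<exists>\<phi>. (\<lambda>N. \<integral>\<omega>. f (grid_step T N (\<lambda>m. S N m \<omega>)) \<partial>P N) \<longlonglongrightarrow> \<phi> \<and>
    (\<lambda>n. limit_fid T mu sig n y (\<lambda>x. f (grid_step T n x))) \<longlonglongrightarrow> \<phi>"
proof -
  interpret D: Metric_space "skorokhod_space T" "skorokhod_dist T" by (rule Metric_space_skorokhod)
  have fc: "continuous_map (skorokhod_topology T) euclideanreal f"
    unfolding skorokhod_topology_def by (rule D.Lipschitz_continuous_map_real[OF L f])
  have fm [measurable]: "f \<in> borel_measurable (borel_of_top (skorokhod_topology T))"
    by (rule borel_measurable_continuous_map[OF fc])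
  note sp = grid_step_skorokhod[OF T]
  define H where "H N = (\<integral>\<omega>. f (grid_step T N (\<lambda>m. S N m \<omega>)) \<partial>P N)" for N
  define Hn where "Hn n N = (\<integral>\<omega>. f (grid_step T n (\<lambda>l. S N (k n N (min l n)) \<omega>)) \<partial>P N)" for n N
  define \<Gamma> where "\<Gamma> n = limit_fid T mu sig n y (\<lambda>x. f (grid_step T n x))" for n
  have B0: "B \<ge> 0" using B[OF sp[of 0 "\<lambda>_. 0"]] by linarith
  have lim: "Hn n \<longlonglongrightarrow> \<Gamma> n" if "n > 0" for n
    unfolding Hn_def \<Gamma>_def using B sp by (intro fid_limit[OF that] continuous_on_grid_step[OF T fc]) auto
  have close: "\<exists>n0. \<forall>n\<ge>n0. n > 0 \<longrightarrow> eventually (\<lambda>N. \<bar>H N - Hn n N\<bar> \<le> e) sequentially" if e: "e > 0" for e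
  proof -
    define \<epsilon> where "\<epsilon> = e / (2 * (L + 1))"
    have \<epsilon>: "\<epsilon> > 0" "L * \<epsilon> \<le> e / 2" using e L by (auto simp: \<epsilon>_def field_simps)
    have "(\<lambda>n. 2 * B * (2 * real n * exp (c1 - sqrt (real n) * \<epsilon>))) \<longlonglongrightarrow> 2 * B * 0"
      by (intro tendsto_mult tendsto_const osc_bound_0 \<epsilon>)
    then have "eventually (\<lambda>n. 2 * B * (2 * real n * exp (c1 - sqrt (real n) * \<epsilon>)) < e / 2) sequentially"
      by (rule order_tendstoD(2)) (use e in simp)
    then obtain n0 where n0: "\<And>n. n \<ge> n0 \<Longrightarrow> 2 * B * (2 * real n * exp (c1 - sqrt (real n) * \<epsilon>)) < e / 2"
      unfolding eventually_sequentially by blast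
    have "eventually (\<lambda>N. \<bar>H N - Hn n N\<bar> \<le> e) sequentially" if n: "n \<ge> n0" "n > 0" for n
      using osc_prob[OF n(2) \<epsilon>(1)] eventually_ge_at_top[of 1]
    proof eventually_elim
      case (elim N)
      interpret prob_space "P N" by (rule P) (use elim in auto)
      let ?F = "\<lambda>\<omega>. f (grid_step T N (\<lambda>m. S N m \<omega>))" and ?G = "\<lambda>\<omega>. f (grid_step T n (\<lambda>l. S N (k n N (min l n)) \<omega>))"
      have m1: "?F \<in> borel_measurable (P N)"
        by (rule measurable_compose[OF measurable_compose[OF measurable_nat_fun measurable_grid_step[OF T]] fm])
          (use S_measurable elim in auto)
      have m2: "?G \<in> borel_measurable (P N)"
        by (rule measurable_compose[OF measurable_compose[OF measurable_nat_fun measurable_grid_step[OF T]] fm])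
          (use S_measurable elim in auto)
      have i1: "integrable (P N) ?F" by (rule integrable_const_bound[of _ B]) (use B sp m1 in auto)
      have i2: "integrable (P N) ?G" by (rule integrable_const_bound[of _ B]) (use B sp m2 in auto)
      have os: "osc n N \<epsilon> \<in> events" unfolding osc_def using osc_sets[OF n(2) elim(2)] by auto
      have io: "integrable (P N) (\<lambda>\<omega>. L * \<epsilon> + 2 * B * indicator (osc n N \<epsilon>) \<omega>)"
        using os by (intro Bochner_Integration.integrable_add integrable_mult_right integrable_real_indicator) (auto simp: emeasure_eq_measure)
      have "\<bar>H N - Hn n N\<bar> = \<bar>\<integral>\<omega>. ?F \<omega> - ?G \<omega> \<partial>P N\<bar>" unfolding H_def Hn_def using i1 i2 by simp
      also have "\<dots> \<le> (\<integral>\<omega>. \<bar>?F \<omega> - ?G \<omega>\<bar> \<partial>P N)" using integral_norm_bound[of "P N" "\<lambda>\<omega>. ?F \<omega> - ?G \<omega>"] by simp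
      \<comment> \<open>Off the event \<open>osc\<close> the two paths are uniformly
        \<open>\<epsilon>\<close>-close and \<open>f\<close> is Lipschitz; on it
        \<open>|f| \<le> B\<close> gives \<open>2 * B\<close>.\<close>
      also have "\<dots> \<le> (\<integral>\<omega>. L * \<epsilon> + 2 * B * indicator (osc n N \<epsilon>) \<omega> \<partial>P N)"
      proof (rule integral_mono[OF _ io])
        show "integrable (P N) (\<lambda>\<omega>. \<bar>?F \<omega> - ?G \<omega>\<bar>)" using i1 i2 by auto
        fix \<omega> assume \<omega>: "\<omega> \<in> space (P N)"
        show "\<bar>?F \<omega> - ?G \<omega>\<bar> \<le> L * \<epsilon> + 2 * B * indicator (osc n N \<epsilon>) \<omega>"
        proof (cases "\<omega> \<in> osc n N \<epsilon>")
          case True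
          have "\<bar>?F \<omega> - ?G \<omega>\<bar> \<le> 2 * B" using B[OF sp] abs_triangle_ineq4[of "?F \<omega>" "?G \<omega>"] by (smt (verit, best))
          also have "\<dots> \<le> L * \<epsilon> + 2 * B" using L \<epsilon> by simp
          finally show ?thesis using True by simp
        next
          case False
          have "\<bar>?F \<omega> - ?G \<omega>\<bar> \<le> L * skorokhod_dist T (grid_step T N (\<lambda>m. S N m \<omega>)) (grid_step T n (\<lambda>l. S N (k n N (min l n)) \<omega>))"
            by (rule f[OF sp sp])
          also have "\<dots> \<le> L * \<epsilon>"
            using osc_step_close[OF n(2) elim(2) \<omega> False \<epsilon>(1)] \<epsilon> L
            by (intro mult_left_mono skorokhod_dist_le_sup sp) auto
          finally show ?thesis using False by simp
        qed
      qed
      also have "\<dots> = L * \<epsilon> + 2 * B * prob (osc n N \<epsilon>)"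
        using os by (subst Bochner_Integration.integral_add) (auto simp: prob_space emeasure_eq_measure)
      also have "\<dots> \<le> e / 2 + 2 * B * (2 * real n * exp (c1 - sqrt (real n) * \<epsilon>))"
        using \<epsilon> elim B0 by (intro add_mono mult_left_mono) auto
      also have "\<dots> \<le> e" using n0[OF n(1)] by simp
      finally show ?case .
    qed
    then show ?thesis by blast
  qed
  have "Cauchy H"
  proof (rule metric_CauchyI)
    fix e :: real assume e: "e > 0"
    then obtain n0 where n0: "\<And>n. n \<ge> n0 \<Longrightarrow> n > 0 \<Longrightarrow> eventually (\<lambda>N. \<bar>H N - Hn n N\<bar> \<le> e / 4) sequentially"
      using close[of "e / 4"] by auto
    define n where "n = Suc n0"
    have "eventually (\<lambda>N. \<bar>Hn n N - \<Gamma> n\<bar> < e / 4) sequentially"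
      using tendstoD[OF lim[of n], of "e / 4"] e by (simp add: dist_real_def n_def)
    moreover have "eventually (\<lambda>N. \<bar>H N - Hn n N\<bar> \<le> e / 4) sequentially" by (rule n0) (auto simp: n_def)
    ultimately have "eventually (\<lambda>N. \<bar>H N - \<Gamma> n\<bar> < e / 2) sequentially"
    proof eventually_elim
      case (elim N)
      then show ?case by linarith
    qed
    then obtain N0 where N0: "\<And>N. N \<ge> N0 \<Longrightarrow> \<bar>H N - \<Gamma> n\<bar> < e / 2" unfolding eventually_sequentially by blast
    have "dist (H a) (H b) < e" if "a \<ge> N0" "b \<ge> N0" for a b
      using N0[OF that(1)] N0[OF that(2)] unfolding dist_real_def by linarith
    then show "\<exists>N0. \<forall>a\<ge>N0. \<forall>b\<ge>N0. dist (H a) (H b) < e" by blast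
  qed
  then obtain \<phi> where \<phi>: "H \<longlonglongrightarrow> \<phi>" by (auto simp: Cauchy_convergent_iff convergent_def)
  have "\<Gamma> \<longlonglongrightarrow> \<phi>"
  proof (rule LIMSEQ_I)
    fix e :: real assume e: "e > 0"
    then obtain n0 where n0: "\<And>n. n \<ge> n0 \<Longrightarrow> n > 0 \<Longrightarrow> eventually (\<lambda>N. \<bar>H N - Hn n N\<bar> \<le> e / 2) sequentially"
      using close[of "e / 2"] by auto
    have "norm (\<Gamma> n - \<phi>) < e" if n: "n \<ge> Suc n0" for n
    proof -
      have "(\<lambda>N. \<bar>H N - Hn n N\<bar>) \<longlonglongrightarrow> \<bar>\<phi> - \<Gamma> n\<bar>" using n by (intro tendsto_intros \<phi> lim) auto
      then have "\<bar>\<phi> - \<Gamma> n\<bar> \<le> e / 2" by (rule tendsto_upperbound) (use n0[of n] n in auto)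
      then show ?thesis using e unfolding real_norm_def by linarith
    qed
    then show "\<exists>no. \<forall>n\<ge>no. norm (\<Gamma> n - \<phi>) < e" by blast
  qed
  with \<phi> show ?thesis unfolding H_def \<Gamma>_def by blast
qed

end

section \<open>Ito integrals of simple processes\<close>

locale wiener_environment = prob_space M for M :: "'a measure" +
  fixes W :: "real \<Rightarrow> 'a \<Rightarrow> real" and Y :: "real \<Rightarrow> 'a \<Rightarrow> nat"
  assumes W: "wiener_process M W"
    and WY: "indep_elements M
               (PiM {0..} (\<lambda>_. borel)) (\<lambda>\<omega>. \<lambda>t\<in>{0..}. W t \<omega>)
               (PiM {0..} (\<lambda>_. count_space UNIV)) (\<lambda>\<omega>. \<lambda>t\<in>{0..}. Y t \<omega>)"
    and Ym: "\<And>t. t \<ge> 0 \<Longrightarrow> Y t \<in> M \<rightarrow>\<^sub>M count_space UNIV"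
begin

abbreviation F :: "real \<Rightarrow> 'a measure" where "F \<equiv> joint_filtration M W Y"

definition D :: "real \<Rightarrow> real \<Rightarrow> 'a \<Rightarrow> real" where "D c d \<omega> = W d \<omega> - W c \<omega>"

lemma Wm: "t \<ge> 0 \<Longrightarrow> W t \<in> borel_measurable M"
  using W by (simp add: wiener_process_def)

lemma Dm: "0 \<le> c \<Longrightarrow> 0 \<le> d \<Longrightarrow> D c d \<in> borel_measurable M"
  unfolding D_def using Wm by (intro borel_measurable_diff) auto

lemma W_increments:
  "0 \<le> t 0 \<Longrightarrow> (\<And>k. k < n \<Longrightarrow> t k < t (Suc k)) \<Longrightarrow>
    indep_vars (\<lambda>_. borel) (\<lambda>k \<omega>. D (t k) (t (Suc k)) \<omega>) {..<n::nat}"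
  using W unfolding wiener_process_def D_def by blast

text \<open>\<open>wiener_process\<close> provides independence for increments along an increasing
  time sequence. Sorting the finitely many past times together with 0 and \<open>c\<close>, and
  appending \<open>d\<close>, writes every past value as a sum of increments independent of
  \<open>D c d\<close>.\<close>

lemma D_past_indep:
  assumes S: "finite S" "S \<subseteq> {0..c}" and cd: "0 \<le> c" "c < d"
    and A: "\<And>s. s \<in> S \<Longrightarrow> A s \<in> sets borel" and B: "B \<in> sets borel"
  shows "prob ({\<omega> \<in> space M. \<forall>s\<in>S. W s \<omega> \<in> A s} \<inter> (D c d -` B \<inter> space M)) =
    prob {\<omega> \<in> space M. \<forall>s\<in>S. W s \<omega> \<in> A s} * prob (D c d -` B \<inter> space M)"
proof -
  \<comment> \<open>0 anchors the telescoping sums, and \<open>c\<close> makes the last increment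
    exactly \<open>D c d\<close>.\<close>
  let ?Q = "S \<union> {0, c}"
  define xs where "xs = sorted_list_of_set ?Q"
  have finQ: "finite ?Q" using S by simp
  have xs: "set xs = ?Q" "sorted_wrt (<) xs"
    unfolding xs_def by (rule set_sorted_list_of_set[OF finQ], rule strict_sorted_list_of_set)
  have len: "length xs > 0" using xs(1) by (cases xs) auto
  define m where "m = length xs - 1"
  define t where "t i = (if i \<le> m then xs ! i else d)" for i
  have lt: "xs ! i < xs ! j" if "i < j" "j \<le> m" for i j
    using sorted_wrt_nth_less[OF xs(2), of i j] that len by (auto simp: m_def)
  have mem: "\<exists>i\<le>m. xs ! i = s" if "s \<in> ?Q" for s
  proof -
    have "s \<in> set xs" using that xs(1) by blast
    then obtain i where "i < length xs" "xs ! i = s" unfolding in_set_conv_nth by blast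
    then show ?thesis by (intro exI[of _ i]) (auto simp: m_def)
  qed
  have rng: "xs ! i \<in> {0..c}" if "i \<le> m" for i
  proof -
    have "xs ! i \<in> set xs" using that len unfolding m_def by (intro nth_mem) linarith
    then show ?thesis using xs(1) S cd by auto
  qed
  have t0: "t 0 = 0"
  proof -
    obtain i where i: "i \<le> m" "xs ! i = 0" using mem[of 0] by auto
    have "i = 0" using lt[of 0 i] rng[of 0] i by (cases "i = 0") auto
    then show ?thesis using i by (simp add: t_def)
  qed
  have tm: "t m = c"
  proof -
    obtain i where i: "i \<le> m" "xs ! i = c" using mem[of c] by auto
    have "i = m" using lt[of i m] rng[of m] i by (cases "i = m") auto
    then show ?thesis using i by (simp add: t_def)
  qed
  have inc: "t k < t (Suc k)" if "k < Suc m" for k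
    using that lt[of k "Suc k"] tm cd by (cases "k = m") (auto simp: t_def)
  let ?D = "\<lambda>k \<omega>. D (t k) (t (Suc k)) \<omega>"
  have ind: "indep_vars (\<lambda>_. borel) ?D {..<Suc m}"
    by (rule W_increments) (use t0 inc in auto)
  obtain i where i: "\<And>s. s \<in> S \<Longrightarrow> i s \<le> m \<and> t (i s) = s"
  proof -
    have "\<forall>s\<in>S. \<exists>i. i \<le> m \<and> t i = s" using mem by (fastforce simp: t_def)
    then show ?thesis using that by metis
  qed
  have tel: "(\<Sum>k<j. ?D k \<omega>) = W (t j) \<omega> - W 0 \<omega>" for j \<omega>
    unfolding D_def using sum_lessThan_telescope[of "\<lambda>k. W (t k) \<omega>" j] t0 by simp
  let ?P = "PiM {..<m} (\<lambda>_. borel :: real measure)"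
  let ?Z = "\<lambda>\<omega>. restrict (\<lambda>k. ?D k \<omega>) {..<m}"
  define QQ where "QQ = {z \<in> space ?P. \<forall>s\<in>S. (\<Sum>k<i s. z k) \<in> A s}"
  have QQ: "QQ \<in> sets ?P"
    unfolding QQ_def
  proof (rule sets.sets_Collect_finite_All[OF _ S(1)])
    fix s assume s: "s \<in> S"
    have "(\<lambda>z. \<Sum>k<i s. z k) \<in> borel_measurable ?P"
      using i[OF s] by (intro borel_measurable_sum measurable_component_singleton) auto
    from measurable_sets[OF this A[OF s]]
    show "{z \<in> space ?P. (\<Sum>k<i s. z k) \<in> A s} \<in> sets ?P" by (simp add: vimage_def Int_def conj_commute)
  qed
  have B': "{z \<in> space (PiM {m} (\<lambda>_. borel :: real measure)). z m \<in> B} \<in> sets (PiM {m} (\<lambda>_. borel))" (is "?B' \<in> _")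
  proof -
    have "(\<lambda>z. z m) \<in> PiM {m} (\<lambda>_. borel :: real measure) \<rightarrow>\<^sub>M borel" by (rule measurable_component_singleton) simp
    from measurable_sets[OF this B] show ?thesis by (simp add: vimage_def Int_def conj_commute)
  qed
  have iv: "indep_var ?P ?Z (PiM {m} (\<lambda>_. borel)) (\<lambda>\<omega>. restrict (\<lambda>k. ?D k \<omega>) {m})"
    by (rule indep_var_restrict[OF ind]) auto
  have Zm: "?Z \<in> M \<rightarrow>\<^sub>M ?P" using iv by (rule indep_var_rv1)
  have tSm: "t (Suc m) = d" by (simp add: t_def)
  have e2: "(\<lambda>\<omega>. restrict (\<lambda>k. ?D k \<omega>) {m}) -` ?B' \<inter> space M = D c d -` B \<inter> space M"
    by (auto simp: space_PiM tm tSm)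
  have E1: "{\<omega> \<in> space M. \<forall>s\<in>S. W s \<omega> \<in> A s} \<in> events"
  proof (rule sets.sets_Collect_finite_All[OF _ S(1)])
    fix s assume s: "s \<in> S"
    then have "W s \<in> borel_measurable M" using S by (intro Wm) auto
    from measurable_sets[OF this A[OF s]]
    show "{\<omega> \<in> space M. W s \<omega> \<in> A s} \<in> events" by (simp add: vimage_def Int_def conj_commute)
  qed
  have E2: "D c d -` B \<inter> space M \<in> events" using cd by (intro measurable_sets[OF Dm B]) auto
  have E3: "?Z -` QQ \<inter> space M \<in> events" by (rule measurable_sets[OF Zm QQ])
  have "AE \<omega> in M. W 0 \<omega> = 0" using W by (simp add: wiener_process_def)
  \<comment> \<open>\<open>W 0 = 0\<close> holds only almost surely, so the past event agrees with
    an event of the first \<open>m\<close> increments up to a null set.\<close>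
  then have ae: "AE \<omega> in M. \<omega> \<in> {\<omega> \<in> space M. \<forall>s\<in>S. W s \<omega> \<in> A s} \<longleftrightarrow> \<omega> \<in> ?Z -` QQ \<inter> space M"
  proof (eventually_elim)
    case (elim \<omega>)
    have "(\<Sum>k<i s. ?Z \<omega> k) = W s \<omega>" if s: "s \<in> S" for s
    proof -
      have "(\<Sum>k<i s. ?Z \<omega> k) = (\<Sum>k<i s. ?D k \<omega>)" using i[OF s] by (intro sum.cong) auto
      then show ?thesis using tel[of \<omega> "i s"] i[OF s] elim by simp
    qed
    then show ?case by (auto simp: QQ_def space_PiM)
  qed
  have "prob ({\<omega> \<in> space M. \<forall>s\<in>S. W s \<omega> \<in> A s} \<inter> (D c d -` B \<inter> space M)) = prob ((?Z -` QQ \<inter> space M) \<inter> (D c d -` B \<inter> space M))"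
    using ae E1 E2 E3 by (intro finite_measure_eq_AE) auto
  also have "\<dots> = prob ((\<lambda>\<omega>. (?Z \<omega>, restrict (\<lambda>k. ?D k \<omega>) {m})) -` (QQ \<times> ?B') \<inter> space M)"
    using e2 by (intro arg_cong[where f=prob]) auto
  also have "\<dots> = prob (?Z -` QQ \<inter> space M) * prob (D c d -` B \<inter> space M)"
    unfolding e2[symmetric] by (rule indep_varD[OF iv QQ B'])
  also have "prob (?Z -` QQ \<inter> space M) = prob {\<omega> \<in> space M. \<forall>s\<in>S. W s \<omega> \<in> A s}"
    using ae E1 E3 by (intro finite_measure_eq_AE) auto
  finally show ?thesis .
qed

section \<open>The joint filtration and its independence of later increments\<close>

lemma space_F [simp]: "space (F c) = space M"
  unfolding joint_filtration_def by (rule space_measure_of) auto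

lemma sets_F: "sets (F c) = sigma_sets (space M)
       ({W s -` A \<inter> space M |s A. 0 \<le> s \<and> s \<le> c \<and> A \<in> sets borel} \<union>
        {Y s -` B \<inter> space M |s B. 0 \<le> s \<and> s \<le> c})"
  unfolding joint_filtration_def by (rule sets_measure_of) auto

lemma sets_F_mono: "a \<le> c \<Longrightarrow> sets (F a) \<subseteq> sets (F c)"
  unfolding sets_F
proof (rule sigma_sets_mono', rule Un_mono)
  assume ac: "a \<le> c"
  show "{W s -` A \<inter> space M |s A. 0 \<le> s \<and> s \<le> a \<and> A \<in> sets borel} \<subseteq> {W s -` A \<inter> space M |s A. 0 \<le> s \<and> s \<le> c \<and> A \<in> sets borel}"
    using order_trans[OF _ ac] by blast
  show "{Y s -` B \<inter> space M |s B. 0 \<le> s \<and> s \<le> a} \<subseteq> {Y s -` B \<inter> space M |s B. 0 \<le> s \<and> s \<le> c}"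
    using order_trans[OF _ ac] by blast
qed

lemma sets_F_subset: "sets (F c) \<subseteq> events"
  unfolding sets_F using Wm Ym by (intro sets.sigma_sets_subset) (auto intro: measurable_sets)

lemma F_measurable: "\<xi> \<in> borel_measurable (F c) \<Longrightarrow> \<xi> \<in> borel_measurable M"
  using borel_measurable_subalgebra[OF sets_F_subset space_F] by blast

lemma F_measurable_mono: "a \<le> c \<Longrightarrow> \<xi> \<in> borel_measurable (F a) \<Longrightarrow> \<xi> \<in> borel_measurable (F c)"
  using borel_measurable_subalgebra[OF sets_F_mono] by simp

lemma W_F: "0 \<le> s \<Longrightarrow> s \<le> c \<Longrightarrow> W s \<in> borel_measurable (F c)"
  by (rule measurableI) (auto simp: sets_F intro!: sigma_sets.Basic)

lemma Y_F:
  assumes "0 \<le> s" "s \<le> c" shows "Y s \<in> F c \<rightarrow>\<^sub>M count_space UNIV"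
proof (rule measurableI)
  fix A :: "nat set"
  show "Y s -` A \<inter> space (F c) \<in> sets (F c)"
    unfolding sets_F space_F by (rule sigma_sets.Basic, rule UnI2) (use assms in blast)
qed simp

lemma D_F: "0 \<le> a \<Longrightarrow> a \<le> c \<Longrightarrow> 0 \<le> b \<Longrightarrow> b \<le> c \<Longrightarrow> D a b \<in> borel_measurable (F c)"
  unfolding D_def by (intro borel_measurable_diff W_F)

text \<open>The generator \<open>G\<close> intersects finite-dimensional events of \<open>W\<close>
  up to \<open>c\<close> with arbitrary events of the whole path of \<open>Y\<close>. Independence
  of \<open>W\<close> and \<open>Y\<close> splits off the \<open>Y\<close> part, independent
  increments split the rest; \<open>G\<close> is stable under intersections and generates a
  sigma-algebra containing \<open>F c\<close>.\<close>

lemma F_indep: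
  assumes cd: "0 \<le> c" "c < d"
  shows "indep_set (sets (F c)) (sigma_sets (space M) {D c d -` B \<inter> space M |B. B \<in> sets borel})"
proof -
  let ?VW = "vimage_algebra (space M) (\<lambda>\<omega>. \<lambda>t\<in>{0..}. W t \<omega>) (PiM {0..} (\<lambda>_. borel))"
  let ?VY = "vimage_algebra (space M) (\<lambda>\<omega>. \<lambda>t\<in>{0..}. Y t \<omega>) (PiM {0..} (\<lambda>_. count_space UNIV))"
  have WYi: "indep_set (sets ?VW) (sets ?VY)" using WY by (simp add: indep_elements_def)
  have VW: "W s \<in> ?VW \<rightarrow>\<^sub>M borel" if "s \<ge> 0" for s
  proof -
    have "(\<lambda>\<omega>. \<lambda>t\<in>{0..}. W t \<omega>) \<in> ?VW \<rightarrow>\<^sub>M PiM {0..} (\<lambda>_. borel)"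
      by (rule measurable_vimage_algebra1) (auto simp: space_PiM)
    from measurable_compose[OF this measurable_component_singleton[of s]] show ?thesis using that by simp
  qed
  have VY: "Y s \<in> ?VY \<rightarrow>\<^sub>M count_space UNIV" if "s \<ge> 0" for s
  proof -
    have "(\<lambda>\<omega>. \<lambda>t\<in>{0..}. Y t \<omega>) \<in> ?VY \<rightarrow>\<^sub>M PiM {0..} (\<lambda>_. count_space UNIV)"
      by (rule measurable_vimage_algebra1) (auto simp: space_PiM)
    from measurable_compose[OF this measurable_component_singleton[of s]] show ?thesis using that by simp
  qed
  define E where "E S A = {\<omega> \<in> space M. \<forall>s\<in>S. W s \<omega> \<in> A s}" for S and A :: "real \<Rightarrow> real set"
  define G where "G = {E S A \<inter> V | S A V. finite S \<and> S \<subseteq> {0..c} \<and> (\<forall>s\<in>S. A s \<in> sets borel) \<and> V \<in> sets ?VY}"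
  let ?B = "{D c d -` B \<inter> space M |B. B \<in> sets borel}"
  have EVW: "E S A \<in> sets ?VW" if "finite S" "S \<subseteq> {0..c}" "\<forall>s\<in>S. A s \<in> sets borel" for S A
  proof -
    have "{\<omega> \<in> space ?VW. \<forall>s\<in>S. W s \<omega> \<in> A s} \<in> sets ?VW"
    proof (rule sets.sets_Collect_finite_All[OF _ that(1)])
      fix s assume s: "s \<in> S"
      then have "W s \<in> ?VW \<rightarrow>\<^sub>M borel" using that by (intro VW) auto
      from measurable_sets[OF this, of "A s"] s that(3)
      show "{\<omega> \<in> space ?VW. W s \<omega> \<in> A s} \<in> sets ?VW" by (simp add: vimage_def Int_def conj_commute)
    qed
    then show ?thesis by (simp add: E_def)
  qed
  have bVW: "b \<in> sets ?VW" if b: "b \<in> ?B" for b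
  proof -
    obtain B where B: "b = D c d -` B \<inter> space M" "B \<in> sets borel" using b by blast
    have "D c d \<in> ?VW \<rightarrow>\<^sub>M borel" unfolding D_def using cd by (intro borel_measurable_diff VW) auto
    from measurable_sets[OF this B(2)] show ?thesis using B(1) by simp
  qed
  have evW: "sets ?VW \<subseteq> events" and evY: "sets ?VY \<subseteq> events"
    using indep_setD_ev1[OF WYi] indep_setD_ev2[OF WYi] by auto
  have "indep_set G ?B"
  proof (rule indep_setI)
    show "G \<subseteq> events" unfolding G_def using EVW evW evY by blast
    show "?B \<subseteq> events" using bVW evW by blast
    fix a b assume "a \<in> G" and b: "b \<in> ?B"
    then obtain S A V where a: "a = E S A \<inter> V" "finite S" "S \<subseteq> {0..c}" "\<forall>s\<in>S. A s \<in> sets borel" "V \<in> sets ?VY"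
      unfolding G_def by blast
    note e = EVW[OF a(2-4)]
    have "prob (a \<inter> b) = prob ((E S A \<inter> b) \<inter> V)" using a(1) by (intro arg_cong[where f=prob]) auto
    also have "\<dots> = prob (E S A \<inter> b) * prob V" using e bVW[OF b] a(5) by (intro indep_setD[OF WYi]) auto
    also have "prob (E S A \<inter> b) = prob (E S A) * prob b"
      using b a(2-4) unfolding E_def by (auto intro!: D_past_indep cd)
    also have "prob (E S A) * prob b * prob V = (prob (E S A) * prob V) * prob b" by simp
    also have "prob (E S A) * prob V = prob a" unfolding a(1) using indep_setD[OF WYi e a(5)] by simp
    finally show "prob (a \<inter> b) = prob a * prob b" .
  qed
  moreover have "Int_stable G"
  proof (rule Int_stableI)
    fix a b assume "a \<in> G" "b \<in> G"
    then obtain S A V S' A' V' where a: "a = E S A \<inter> V" "finite S" "S \<subseteq> {0..c}" "\<forall>s\<in>S. A s \<in> sets borel" "V \<in> sets ?VY"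
      and b: "b = E S' A' \<inter> V'" "finite S'" "S' \<subseteq> {0..c}" "\<forall>s\<in>S'. A' s \<in> sets borel" "V' \<in> sets ?VY"
      unfolding G_def by blast
    \<comment> \<open>A time missing from one of the two index sets imposes the trivial condition
      \<open>UNIV\<close>.\<close>
    define A'' where "A'' s = (if s \<in> S then A s else UNIV) \<inter> (if s \<in> S' then A' s else UNIV)" for s
    have eq: "a \<inter> b = E (S \<union> S') A'' \<inter> (V \<inter> V')"
      unfolding a(1) b(1) E_def A''_def by auto
    have A'': "\<forall>s\<in>S \<union> S'. A'' s \<in> sets borel" using a(4) b(4) by (auto simp: A''_def)
    show "a \<inter> b \<in> G"
      unfolding G_def
      by (rule CollectI, intro exI conjI, rule eq, rule finite_UnI[OF a(2) b(2)], rule Un_least[OF a(3) b(3)],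
          rule A'', rule sets.Int[OF a(5) b(5)])
  qed
  moreover have "Int_stable ?B"
  proof (rule Int_stableI)
    fix a b assume "a \<in> ?B" "b \<in> ?B"
    then obtain A B where "a = D c d -` A \<inter> space M" "b = D c d -` B \<inter> space M" "A \<in> sets borel" "B \<in> sets borel" by blast
    then show "a \<inter> b \<in> ?B" by (intro CollectI exI[of _ "A \<inter> B"]) auto
  qed
  ultimately have i: "indep_set (sigma_sets (space M) G) (sigma_sets (space M) ?B)" by (rule indep_set_sigma_sets)
  have "sets (F c) \<subseteq> sigma_sets (space M) G"
    unfolding sets_F
  proof (rule sigma_sets_mono', rule subsetI)
    fix a assume "a \<in> {W s -` A \<inter> space M |s A. 0 \<le> s \<and> s \<le> c \<and> A \<in> sets borel} \<union> {Y s -` B \<inter> space M |s B. 0 \<le> s \<and> s \<le> c}"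
    then show "a \<in> G"
    proof
      assume "a \<in> {W s -` A \<inter> space M |s A. 0 \<le> s \<and> s \<le> c \<and> A \<in> sets borel}"
      then obtain s A where s: "a = W s -` A \<inter> space M" "0 \<le> s" "s \<le> c" "A \<in> sets borel" by blast
      have "space M \<in> sets ?VY" using sets.top[of ?VY] by simp
      moreover have "a = E {s} (\<lambda>_. A) \<inter> space M" using s(1) by (auto simp: E_def)
      ultimately show "a \<in> G" unfolding G_def using s by (intro CollectI exI[of _ "{s}"] exI[of _ "\<lambda>_. A"] exI[of _ "space M"]) auto
    next
      assume "a \<in> {Y s -` B \<inter> space M |s B. 0 \<le> s \<and> s \<le> c}"
      then obtain s B where s: "a = Y s -` B \<inter> space M" "0 \<le> s" "s \<le> c" by blast
      have "a \<in> sets ?VY" using measurable_sets[OF VY[OF s(2)], of B] s(1) by simp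
      moreover have "a = E {} (\<lambda>_. UNIV) \<inter> a" using s(1) by (auto simp: E_def)
      ultimately show "a \<in> G" unfolding G_def by (intro CollectI exI[of _ "{}"] exI[of _ "\<lambda>_. UNIV"] exI[of _ a]) auto
    qed
  qed
  then show ?thesis
    using i unfolding indep_set_def by (elim indep_sets_mono_sets) (auto split: bool.split)
qed

lemma F_indep_var:
  assumes cd: "0 \<le> c" "c < d" and \<xi>: "\<xi> \<in> borel_measurable (F c)"
  shows "indep_var borel \<xi> borel (D c d)"
  unfolding indep_var_eq
proof (intro conjI)
  show "random_variable borel \<xi>" by (rule F_measurable[OF \<xi>])
  show "random_variable borel (D c d)" using cd by (intro Dm) auto
  have "{\<xi> -` A \<inter> space M |A. A \<in> sets borel} \<subseteq> sets (F c)"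
    using measurable_sets[OF \<xi>] by auto
  then have "sigma_sets (space M) {\<xi> -` A \<inter> space M |A. A \<in> sets borel} \<subseteq> sets (F c)"
    using sets.sigma_sets_subset[of _ "F c"] by simp
  then show "indep_set (sigma_sets (space M) {\<xi> -` A \<inter> space M |A. A \<in> sets borel})
     (sigma_sets (space M) {D c d -` A \<inter> space M |A. A \<in> sets borel})"
    using F_indep[OF cd] unfolding indep_set_def by (elim indep_sets_mono_sets) (auto split: bool.split)
qed

section \<open>Increments weighted by past variables: moments and isometry\<close>

lemma D_self [simp]: "D c c = (\<lambda>_. 0)" by (simp add: D_def fun_eq_iff)

lemma D_distributed: "0 \<le> c \<Longrightarrow> c < d \<Longrightarrow> distributed M lborel (D c d) (normal_density 0 (sqrt (d - c)))"
  using W unfolding wiener_process_def D_def[abs_def] by blast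

lemma D_moments:
  assumes "0 \<le> c" "c \<le> d"
  shows "integrable M (D c d)" "integrable M (\<lambda>\<omega>. (D c d \<omega>)\<^sup>2)" "expectation (D c d) = 0" "expectation (\<lambda>\<omega>. (D c d \<omega>)\<^sup>2) = d - c"
proof -
  have "integrable M (D c d) \<and> integrable M (\<lambda>\<omega>. (D c d \<omega>)\<^sup>2) \<and> expectation (D c d) = 0 \<and> expectation (\<lambda>\<omega>. (D c d \<omega>)\<^sup>2) = d - c"
  proof (cases "c = d")
    case False
    then have cd: "c < d" using assms by simp
    note dd = D_distributed[OF assms(1) cd]
    have s: "sqrt (d - c) > 0" using cd by simp
    have 1: "integrable M (D c d)"
      using distributed_integrable[OF dd, of "\<lambda>x. x"] integrable_normal_moment[OF s, of 0 1] by simp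
    have 2: "integrable M (\<lambda>\<omega>. (D c d \<omega>)\<^sup>2)"
      using distributed_integrable[OF dd, of "\<lambda>x. x\<^sup>2"] integrable_normal_moment[OF s, of 0 2] by simp
    have 3: "expectation (D c d) = 0" by (rule normal_distributed_expectation[OF s dd])
    have "variance (D c d) = (sqrt (d - c))\<^sup>2" by (rule normal_distributed_variance[OF s dd])
    then show ?thesis using 1 2 3 cd by simp
  qed simp
  then show "integrable M (D c d)" "integrable M (\<lambda>\<omega>. (D c d \<omega>)\<^sup>2)" "expectation (D c d) = 0" "expectation (\<lambda>\<omega>. (D c d \<omega>)\<^sup>2) = d - c" by auto
qed

lemma expectation_past_times_D:
  assumes cd: "0 \<le> c" "c \<le> d" and \<zeta>: "\<zeta> \<in> borel_measurable (F c)" "integrable M \<zeta>"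
  shows "integrable M (\<lambda>\<omega>. \<zeta> \<omega> * D c d \<omega>)" "expectation (\<lambda>\<omega>. \<zeta> \<omega> * D c d \<omega>) = 0"
proof -
  have "integrable M (\<lambda>\<omega>. \<zeta> \<omega> * D c d \<omega>) \<and> expectation (\<lambda>\<omega>. \<zeta> \<omega> * D c d \<omega>) = 0"
  proof (cases "c = d")
    case False
    then have "c < d" using cd by simp
    note iv = F_indep_var[OF cd(1) this \<zeta>(1)]
    show ?thesis using indep_var_integrable[OF iv \<zeta>(2)] indep_var_lebesgue_integral[OF iv \<zeta>(2)] D_moments[OF cd] by simp
  qed simp
  then show "integrable M (\<lambda>\<omega>. \<zeta> \<omega> * D c d \<omega>)" "expectation (\<lambda>\<omega>. \<zeta> \<omega> * D c d \<omega>) = 0" by auto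
qed

lemma expectation_past_times_D2:
  assumes cd: "0 \<le> c" "c \<le> d" and \<zeta>: "\<zeta> \<in> borel_measurable (F c)" "integrable M \<zeta>"
  shows "expectation (\<lambda>\<omega>. \<zeta> \<omega> * (D c d \<omega>)\<^sup>2) = expectation \<zeta> * (d - c)"
proof (cases "c = d")
  case False
  then have "c < d" using cd by simp
  from indep_var_compose[OF F_indep_var[OF cd(1) this \<zeta>(1)], of "\<lambda>x. x" borel "\<lambda>x. x\<^sup>2" borel]
  have iv: "indep_var borel \<zeta> borel (\<lambda>\<omega>. (D c d \<omega>)\<^sup>2)" by (simp add: comp_def)
  show ?thesis using indep_var_lebesgue_integral[OF iv \<zeta>(2)] D_moments[OF cd] by simp
qed simp

text \<open>\<open>|x * z| \<le> x^2 + z^2\<close> dominates the product by integrable squares of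
  increments.\<close>

lemma bounded_times_D_D:
  assumes "0 \<le> a" "a \<le> b" "0 \<le> c" "c \<le> d" and \<zeta>: "\<zeta> \<in> borel_measurable M" "\<And>\<omega>. \<omega> \<in> space M \<Longrightarrow> \<bar>\<zeta> \<omega>\<bar> \<le> K"
  shows "integrable M (\<lambda>\<omega>. \<zeta> \<omega> * D a b \<omega> * D c d \<omega>)"
proof (rule Bochner_Integration.integrable_bound[of _ "\<lambda>\<omega>. K * ((D a b \<omega>)\<^sup>2 + (D c d \<omega>)\<^sup>2)"])
  show "integrable M (\<lambda>\<omega>. K * ((D a b \<omega>)\<^sup>2 + (D c d \<omega>)\<^sup>2))" using D_moments assms by auto
  show "(\<lambda>\<omega>. \<zeta> \<omega> * D a b \<omega> * D c d \<omega>) \<in> borel_measurable M" using assms by (intro borel_measurable_times Dm) auto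
  show "AE \<omega> in M. norm (\<zeta> \<omega> * D a b \<omega> * D c d \<omega>) \<le> norm (K * ((D a b \<omega>)\<^sup>2 + (D c d \<omega>)\<^sup>2))"
  proof (rule AE_I2)
    fix \<omega> assume \<omega>: "\<omega> \<in> space M"
    have K: "0 \<le> K" using \<zeta>(2)[OF \<omega>] by linarith
    have "\<bar>x * z\<bar> \<le> x\<^sup>2 + z\<^sup>2" for x z :: real
    proof -
      have "0 \<le> (\<bar>x\<bar> - \<bar>z\<bar>)\<^sup>2" by simp
      then have "2 * \<bar>x * z\<bar> \<le> x\<^sup>2 + z\<^sup>2" by (simp add: power2_diff abs_mult)
      then show ?thesis using zero_le_power2[of x] zero_le_power2[of z] by linarith
    qed
    then have "\<bar>\<zeta> \<omega>\<bar> * \<bar>D a b \<omega> * D c d \<omega>\<bar> \<le> K * ((D a b \<omega>)\<^sup>2 + (D c d \<omega>)\<^sup>2)"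
      using \<zeta>(2)[OF \<omega>] K by (intro mult_mono) auto
    then show "norm (\<zeta> \<omega> * D a b \<omega> * D c d \<omega>) \<le> norm (K * ((D a b \<omega>)\<^sup>2 + (D c d \<omega>)\<^sup>2))"
      using K by (simp add: abs_mult mult.assoc)
  qed
qed

lemma bounded_integrable:
  fixes \<zeta> :: "'a \<Rightarrow> real"
  assumes "\<zeta> \<in> borel_measurable M" "\<And>\<omega>. \<omega> \<in> space M \<Longrightarrow> \<bar>\<zeta> \<omega>\<bar> \<le> K"
  shows "integrable M \<zeta>"
  by (rule integrable_const_bound[of _ K]) (use assms in auto)

lemma orthogonal_increments:
  assumes "0 \<le> a" "a \<le> b" "b \<le> c" "c \<le> d" and \<zeta>: "\<zeta> \<in> borel_measurable (F c)" "\<And>\<omega>. \<omega> \<in> space M \<Longrightarrow> \<bar>\<zeta> \<omega>\<bar> \<le> K"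
  shows "expectation (\<lambda>\<omega>. \<zeta> \<omega> * D a b \<omega> * D c d \<omega>) = 0"
proof (rule expectation_past_times_D(2))
  show "(\<lambda>\<omega>. \<zeta> \<omega> * D a b \<omega>) \<in> borel_measurable (F c)" using assms by (intro borel_measurable_times D_F) auto
  show "integrable M (\<lambda>\<omega>. \<zeta> \<omega> * D a b \<omega>)"
  proof (rule Bochner_Integration.integrable_bound[of _ "\<lambda>\<omega>. K * D a b \<omega>"])
    show "integrable M (\<lambda>\<omega>. K * D a b \<omega>)" using D_moments[of a b] assms by auto
    show "(\<lambda>\<omega>. \<zeta> \<omega> * D a b \<omega>) \<in> borel_measurable M" using assms by (intro borel_measurable_times Dm F_measurable[OF \<zeta>(1)]) auto
    show "AE \<omega> in M. norm (\<zeta> \<omega> * D a b \<omega>) \<le> norm (K * D a b \<omega>)"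
    proof (rule AE_I2)
      fix \<omega> assume "\<omega> \<in> space M"
      from \<zeta>(2)[OF this] show "norm (\<zeta> \<omega> * D a b \<omega>) \<le> norm (K * D a b \<omega>)"
        by (simp add: abs_mult mult_right_mono)
    qed
  qed
qed (use assms in auto)

text \<open>Cut both increments at \<open>c\<close> and at \<open>e = min b d\<close>. The common
  part \<open>D c e\<close> yields the length of the overlap; every other product pairs an increment
  with a later one, hence is orthogonal, or contains a zero increment.\<close>

lemma expectation_D_D_aux:
  assumes ab: "0 \<le> a" "a \<le> b" and cd: "a \<le> c" "c \<le> d"
    and \<zeta>: "\<zeta> \<in> borel_measurable (F c)" "\<And>\<omega>. \<omega> \<in> space M \<Longrightarrow> \<bar>\<zeta> \<omega>\<bar> \<le> K"
  shows "expectation (\<lambda>\<omega>. \<zeta> \<omega> * D a b \<omega> * D c d \<omega>) = expectation \<zeta> * max 0 (min b d - c)"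
proof -
  note \<zeta>M = F_measurable[OF \<zeta>(1)]
  have i: "integrable M (\<lambda>\<omega>. \<zeta> \<omega> * D x y \<omega> * D u v \<omega>)" if "0 \<le> x" "x \<le> y" "0 \<le> u" "u \<le> v" for x y u v
    by (rule bounded_times_D_D[OF that \<zeta>M \<zeta>(2)])
  have \<zeta>i: "integrable M \<zeta>" by (rule bounded_integrable[OF \<zeta>M \<zeta>(2)])
  have c0: "0 \<le> c" using ab cd by simp
  show ?thesis
  proof (cases "b \<le> c")
    case True
    then show ?thesis using orthogonal_increments[of a b c d \<zeta> K] assms by simp
  next
    case False
    define e where "e = min b d"
    have e: "c \<le> e" "e \<le> b" "e \<le> d" using False cd by (auto simp: e_def)
    have split: "\<zeta> \<omega> * D a b \<omega> * D c d \<omega> = \<zeta> \<omega> * D a c \<omega> * D c d \<omega> + (\<zeta> \<omega> * (D c e \<omega>)\<^sup>2 + \<zeta> \<omega> * D c e \<omega> * D e b \<omega> + \<zeta> \<omega> * D c e \<omega> * D e d \<omega>)" for \<omega>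
    proof -
      have "D e b \<omega> * D e d \<omega> = 0" unfolding e_def by (cases "b \<le> d") (auto simp: min_def)
      moreover have "D a b \<omega> = D a c \<omega> + D c e \<omega> + D e b \<omega>" "D c d \<omega> = D c e \<omega> + D e d \<omega>" by (auto simp: D_def)
      ultimately show ?thesis by (simp add: algebra_simps power2_eq_square)
    qed
    have i2: "integrable M (\<lambda>\<omega>. \<zeta> \<omega> * (D c e \<omega>)\<^sup>2)"
      using i[of c e c e] c0 e by (simp add: power2_eq_square mult.assoc)
    have "expectation (\<lambda>\<omega>. \<zeta> \<omega> * D a b \<omega> * D c d \<omega>) = expectation (\<lambda>\<omega>. \<zeta> \<omega> * D a c \<omega> * D c d \<omega>) +
        (expectation (\<lambda>\<omega>. \<zeta> \<omega> * (D c e \<omega>)\<^sup>2) + expectation (\<lambda>\<omega>. \<zeta> \<omega> * D c e \<omega> * D e b \<omega>) + expectation (\<lambda>\<omega>. \<zeta> \<omega> * D c e \<omega> * D e d \<omega>))"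
      unfolding split using i i2 ab cd c0 e by simp
    also have "expectation (\<lambda>\<omega>. \<zeta> \<omega> * D a c \<omega> * D c d \<omega>) = 0" by (rule orthogonal_increments) (use ab cd \<zeta> in auto)
    also have "expectation (\<lambda>\<omega>. \<zeta> \<omega> * D c e \<omega> * D e b \<omega>) = 0"
      by (rule orthogonal_increments) (use c0 e \<zeta> F_measurable_mono[OF e(1)] in auto)
    also have "expectation (\<lambda>\<omega>. \<zeta> \<omega> * D c e \<omega> * D e d \<omega>) = 0"
      by (rule orthogonal_increments) (use c0 e \<zeta> F_measurable_mono[OF e(1)] in auto)
    also have "expectation (\<lambda>\<omega>. \<zeta> \<omega> * (D c e \<omega>)\<^sup>2) = expectation \<zeta> * (e - c)"
      by (rule expectation_past_times_D2[OF c0 e(1) \<zeta>(1) \<zeta>i])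
    finally show ?thesis using e by (simp add: e_def)
  qed
qed

lemma expectation_D_D:
  assumes ab: "0 \<le> a" "a \<le> b" and cd: "0 \<le> c" "c \<le> d"
    and \<xi>: "\<xi> \<in> borel_measurable (F a)" "\<And>\<omega>. \<omega> \<in> space M \<Longrightarrow> \<bar>\<xi> \<omega>\<bar> \<le> K"
    and \<eta>: "\<eta> \<in> borel_measurable (F c)" "\<And>\<omega>. \<omega> \<in> space M \<Longrightarrow> \<bar>\<eta> \<omega>\<bar> \<le> K"
  shows "expectation (\<lambda>\<omega>. (\<xi> \<omega> * D a b \<omega>) * (\<eta> \<omega> * D c d \<omega>)) = expectation (\<lambda>\<omega>. \<xi> \<omega> * \<eta> \<omega>) * max 0 (min b d - max a c)"
    and "integrable M (\<lambda>\<omega>. (\<xi> \<omega> * D a b \<omega>) * (\<eta> \<omega> * D c d \<omega>))"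
proof -
  have bd: "\<bar>\<xi> \<omega> * \<eta> \<omega>\<bar> \<le> K * K" if "\<omega> \<in> space M" for \<omega>
    unfolding abs_mult using \<xi>(2)[OF that] \<eta>(2)[OF that] by (intro mult_mono) auto
  have r1: "(\<lambda>\<omega>. (\<xi> \<omega> * D a b \<omega>) * (\<eta> \<omega> * D c d \<omega>)) = (\<lambda>\<omega>. (\<xi> \<omega> * \<eta> \<omega>) * D a b \<omega> * D c d \<omega>)"
    and r2: "(\<lambda>\<omega>. (\<xi> \<omega> * \<eta> \<omega>) * D a b \<omega> * D c d \<omega>) = (\<lambda>\<omega>. (\<xi> \<omega> * \<eta> \<omega>) * D c d \<omega> * D a b \<omega>)"
    by (auto simp: fun_eq_iff)
  show "integrable M (\<lambda>\<omega>. (\<xi> \<omega> * D a b \<omega>) * (\<eta> \<omega> * D c d \<omega>))"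
    unfolding r1
    by (rule bounded_times_D_D[OF ab cd borel_measurable_times[OF F_measurable[OF \<xi>(1)] F_measurable[OF \<eta>(1)]] bd])
  show "expectation (\<lambda>\<omega>. (\<xi> \<omega> * D a b \<omega>) * (\<eta> \<omega> * D c d \<omega>)) = expectation (\<lambda>\<omega>. \<xi> \<omega> * \<eta> \<omega>) * max 0 (min b d - max a c)"
  proof (cases "a \<le> c")
    case True
    show ?thesis unfolding r1
      using expectation_D_D_aux[OF ab True cd(2) borel_measurable_times[OF F_measurable_mono[OF True \<xi>(1)] \<eta>(1)] bd]
      by (simp only: max_absorb2[OF True])
  next
    case False
    then have ca: "c \<le> a" by simp
    show ?thesis unfolding r1 r2
      using expectation_D_D_aux[OF cd ca ab(2) borel_measurable_times[OF \<xi>(1) F_measurable_mono[OF ca \<eta>(1)]] bd]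
      by (simp only: max_absorb1[OF ca] min.commute[of b d])
  qed
qed

text \<open>The intervals are arbitrary and may overlap: both sides expand into the double sum of
  the means of \<open>\<xi> i * \<xi> j\<close> times the length of the overlap of the two
  intervals. Simple integrals over different partitions can therefore be subtracted without forming
  a common refinement.\<close>

lemma ito_isometry:
  fixes I :: "'i set" and a b :: "'i \<Rightarrow> real"
  assumes I: "finite I" and ab: "\<And>i. i \<in> I \<Longrightarrow> 0 \<le> a i \<and> a i \<le> b i"
    and \<xi>: "\<And>i. i \<in> I \<Longrightarrow> \<xi> i \<in> borel_measurable (F (a i))" "\<And>i \<omega>. i \<in> I \<Longrightarrow> \<omega> \<in> space M \<Longrightarrow> \<bar>\<xi> i \<omega>\<bar> \<le> K"
  shows "(\<integral>\<^sup>+\<omega>. ennreal ((\<Sum>i\<in>I. \<xi> i \<omega> * D (a i) (b i) \<omega>)\<^sup>2) \<partial>M) =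
    (\<integral>\<^sup>+\<omega>. (\<integral>\<^sup>+s. ennreal ((\<Sum>i\<in>I. \<xi> i \<omega> * indicator {a i<..b i} s)\<^sup>2) \<partial>lborel) \<partial>M)"
proof -
  define ov where "ov i j = max 0 (min (b i) (b j) - max (a i) (a j))" for i j
  have sq: "(\<Sum>i\<in>I. f i)\<^sup>2 = (\<Sum>i\<in>I. \<Sum>j\<in>I. f i * f j)" for f :: "'i \<Rightarrow> real"
    by (simp add: power2_eq_square sum_product)
  have m: "\<xi> i \<in> borel_measurable M" if "i \<in> I" for i using F_measurable \<xi>(1)[OF that] .
  have int2: "integrable M (\<lambda>\<omega>. \<xi> i \<omega> * \<xi> j \<omega>)" if "i \<in> I" "j \<in> I" for i j
  proof (rule bounded_integrable[of _ "K * K"])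
    show "(\<lambda>\<omega>. \<xi> i \<omega> * \<xi> j \<omega>) \<in> borel_measurable M" using m that by auto
    show "\<bar>\<xi> i \<omega> * \<xi> j \<omega>\<bar> \<le> K * K" if "\<omega> \<in> space M" for \<omega>
      unfolding abs_mult using \<xi>(2)[OF \<open>i \<in> I\<close> that] \<xi>(2)[OF \<open>j \<in> I\<close> that] by (intro mult_mono) auto
  qed
  have cross: "integrable M (\<lambda>\<omega>. (\<xi> i \<omega> * D (a i) (b i) \<omega>) * (\<xi> j \<omega> * D (a j) (b j) \<omega>))"
    "expectation (\<lambda>\<omega>. (\<xi> i \<omega> * D (a i) (b i) \<omega>) * (\<xi> j \<omega> * D (a j) (b j) \<omega>)) = expectation (\<lambda>\<omega>. \<xi> i \<omega> * \<xi> j \<omega>) * ov i j"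
    if "i \<in> I" "j \<in> I" for i j
    using expectation_D_D[of "a i" "b i" "a j" "b j" "\<xi> i" K "\<xi> j"] ab \<xi> that by (auto simp: ov_def)
  have "(\<integral>\<^sup>+\<omega>. ennreal ((\<Sum>i\<in>I. \<xi> i \<omega> * D (a i) (b i) \<omega>)\<^sup>2) \<partial>M) = ennreal (expectation (\<lambda>\<omega>. (\<Sum>i\<in>I. \<xi> i \<omega> * D (a i) (b i) \<omega>)\<^sup>2))"
  proof (rule nn_integral_eq_integral)
    show "integrable M (\<lambda>\<omega>. (\<Sum>i\<in>I. \<xi> i \<omega> * D (a i) (b i) \<omega>)\<^sup>2)"
      unfolding sq using cross by (intro Bochner_Integration.integrable_sum) auto
  qed simp
  also have "expectation (\<lambda>\<omega>. (\<Sum>i\<in>I. \<xi> i \<omega> * D (a i) (b i) \<omega>)\<^sup>2) = (\<Sum>i\<in>I. \<Sum>j\<in>I. expectation (\<lambda>\<omega>. \<xi> i \<omega> * \<xi> j \<omega>) * ov i j)"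
    unfolding sq using cross
    by (subst Bochner_Integration.integral_sum) (auto intro!: Bochner_Integration.integrable_sum sum.cong simp: Bochner_Integration.integral_sum)
  also have "\<dots> = expectation (\<lambda>\<omega>. \<Sum>i\<in>I. \<Sum>j\<in>I. \<xi> i \<omega> * \<xi> j \<omega> * ov i j)"
    using int2 by (subst Bochner_Integration.integral_sum)
      (auto intro!: Bochner_Integration.integrable_sum sum.cong simp: Bochner_Integration.integral_sum)
  finally have lhs: "(\<integral>\<^sup>+\<omega>. ennreal ((\<Sum>i\<in>I. \<xi> i \<omega> * D (a i) (b i) \<omega>)\<^sup>2) \<partial>M) = ennreal \<dots>" .
  have inner: "(\<integral>\<^sup>+s. ennreal ((\<Sum>i\<in>I. \<xi> i \<omega> * indicator {a i<..b i} s)\<^sup>2) \<partial>lborel) = ennreal (\<Sum>i\<in>I. \<Sum>j\<in>I. \<xi> i \<omega> * \<xi> j \<omega> * ov i j)"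
    "0 \<le> (\<Sum>i\<in>I. \<Sum>j\<in>I. \<xi> i \<omega> * \<xi> j \<omega> * ov i j)" for \<omega>
  proof -
    let ?c = "\<lambda>i j s. \<xi> i \<omega> * \<xi> j \<omega> * indicator ({max (a i) (a j)<..min (b i) (b j)}) s :: real"
    have e: "(\<Sum>i\<in>I. \<xi> i \<omega> * indicator {a i<..b i} s)\<^sup>2 = (\<Sum>i\<in>I. \<Sum>j\<in>I. ?c i j s)" for s
      unfolding sq by (intro sum.cong refl) (auto simp: indicator_def)
    have fin: "emeasure lborel {max (a i) (a j)<..min (b i) (b j)} < \<infinity>" for i j
      by (cases "max (a i) (a j) \<le> min (b i) (b j)") (auto simp: emeasure_lborel_Ioc)
    have ic: "integrable lborel (?c i j)" for i j
      using fin[of i j] by (intro integrable_mult_right integrable_real_indicator) auto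
    have vc: "integral\<^sup>L lborel (?c i j) = \<xi> i \<omega> * \<xi> j \<omega> * ov i j" for i j
      by (cases "max (a i) (a j) \<le> min (b i) (b j)") (auto simp: ov_def measure_def emeasure_lborel_Ioc)
    have isum: "integrable lborel (\<lambda>s. \<Sum>i\<in>I. \<Sum>j\<in>I. ?c i j s)"
      by (intro Bochner_Integration.integrable_sum ic)
    have v: "(\<integral>s. (\<Sum>i\<in>I. \<Sum>j\<in>I. ?c i j s) \<partial>lborel) = (\<Sum>i\<in>I. \<Sum>j\<in>I. \<xi> i \<omega> * \<xi> j \<omega> * ov i j)"
      using ic by (subst Bochner_Integration.integral_sum, (intro Bochner_Integration.integrable_sum ic)[1])
        (intro sum.cong refl, subst Bochner_Integration.integral_sum, auto simp: vc simp del: integral_mult_right_zero integral_mult_left_zero)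
    show "(\<integral>\<^sup>+s. ennreal ((\<Sum>i\<in>I. \<xi> i \<omega> * indicator {a i<..b i} s)\<^sup>2) \<partial>lborel) = ennreal (\<Sum>i\<in>I. \<Sum>j\<in>I. \<xi> i \<omega> * \<xi> j \<omega> * ov i j)"
      unfolding e v[symmetric] by (rule nn_integral_eq_integral[OF isum]) (simp add: e[symmetric])
    show "0 \<le> (\<Sum>i\<in>I. \<Sum>j\<in>I. \<xi> i \<omega> * \<xi> j \<omega> * ov i j)"
      unfolding v[symmetric] by (rule integral_nonneg_AE) (simp add: e[symmetric])
  qed
  have "(\<integral>\<^sup>+\<omega>. ennreal (\<Sum>i\<in>I. \<Sum>j\<in>I. \<xi> i \<omega> * \<xi> j \<omega> * ov i j) \<partial>M) = ennreal (expectation (\<lambda>\<omega>. \<Sum>i\<in>I. \<Sum>j\<in>I. \<xi> i \<omega> * \<xi> j \<omega> * ov i j))"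
    using inner(2) int2 by (intro nn_integral_eq_integral) (auto intro!: Bochner_Integration.integrable_sum)
  then show ?thesis unfolding lhs inner(1) by simp
qed

end

section \<open>Mean-square limits of simple integrals\<close>

lemma simple_process_time_nonneg:
  assumes "simple_process M F T n t \<xi>" "k \<le> n"
  shows "0 \<le> t k"
  using assms(2)
proof (induction k)
  case (Suc k)
  then show ?case using assms(1) unfolding simple_process_def by (metis Suc_leD less_eq_Suc_le less_imp_le order_trans)
qed (use assms in \<open>simp add: simple_process_def\<close>)

lemma simple_process_time_less: "simple_process M F T n t \<xi> \<Longrightarrow> k < n \<Longrightarrow> t k < t (Suc k)"
  by (simp add: simple_process_def)

lemma simple_value_nonpos:
  assumes sp: "simple_process M F T n t \<xi>" and u: "u \<le> 0"
  shows "simple_value n t \<xi> u \<omega> = 0"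
  unfolding simple_value_def
proof (rule sum.neutral, rule ballI)
  fix k assume "k \<in> {..<n}"
  then have "0 \<le> t k" by (intro simple_process_time_nonneg[OF sp]) simp
  then have "u \<notin> {t k<..t (Suc k)}" using u by simp
  then show "\<xi> k \<omega> * indicator {t k<..t (Suc k)} u = 0" by simp
qed

text \<open>Integrating up to \<open>s\<close> truncates the intervals at \<open>s\<close>. Those
  beginning at or after \<open>s\<close> are dropped, so that the remaining ones have ordered end
  points, as the isometry requires.\<close>

lemma simple_value_cut:
  "(\<Sum>k\<in>{k. k < n \<and> t k < s}. \<xi> k \<omega> * indicator {t k<..min (t (Suc k)) s} u) =
    (if u \<le> s then simple_value n t \<xi> u \<omega> else 0)"
proof (cases "u \<le> s")
  case True
  have "(\<Sum>k\<in>{k. k < n \<and> t k < s}. \<xi> k \<omega> * indicator {t k<..min (t (Suc k)) s} u)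
      = (\<Sum>k\<in>{k. k < n \<and> t k < s}. \<xi> k \<omega> * indicator {t k<..t (Suc k)} u)"
    using True by (intro sum.cong refl) (auto simp: indicator_def)
  also have "\<dots> = (\<Sum>k<n. \<xi> k \<omega> * indicator {t k<..t (Suc k)} u)"
    using True by (intro sum.mono_neutral_left) (auto simp: indicator_def)
  finally show ?thesis using True by (simp add: simple_value_def)
next
  case False
  then have "(\<Sum>k\<in>{k. k < n \<and> t k < s}. \<xi> k \<omega> * indicator {t k<..min (t (Suc k)) s} u) = 0"
    by (intro sum.neutral) (auto simp: indicator_def)
  then show ?thesis using False by simp
qed

context wiener_environment
begin

lemma simple_integral_cut:
  assumes sp: "simple_process M F T n t \<xi>"
  shows "simple_integral W n t \<xi> s \<omega> = (\<Sum>k\<in>{k. k < n \<and> t k < s}. \<xi> k \<omega> * D (t k) (min (t (Suc k)) s) \<omega>)"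
proof -
  have "simple_integral W n t \<xi> s \<omega> = (\<Sum>k<n. \<xi> k \<omega> * D (min (t k) s) (min (t (Suc k)) s) \<omega>)"
    by (simp add: simple_integral_def D_def)
  also have "\<dots> = (\<Sum>k\<in>{k. k < n \<and> t k < s}. \<xi> k \<omega> * D (min (t k) s) (min (t (Suc k)) s) \<omega>)"
  proof (rule sum.mono_neutral_right)
    show "\<forall>k\<in>{..<n} - {k. k < n \<and> t k < s}. \<xi> k \<omega> * D (min (t k) s) (min (t (Suc k)) s) \<omega> = 0"
    proof
      fix k assume k: "k \<in> {..<n} - {k. k < n \<and> t k < s}"
      then have "s \<le> t k" "s \<le> t (Suc k)" using simple_process_time_less[OF sp, of k] by auto
      then show "\<xi> k \<omega> * D (min (t k) s) (min (t (Suc k)) s) \<omega> = 0" by (simp add: min_absorb2 D_def)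
    qed
  qed auto
  also have "\<dots> = (\<Sum>k\<in>{k. k < n \<and> t k < s}. \<xi> k \<omega> * D (t k) (min (t (Suc k)) s) \<omega>)"
    by (intro sum.cong refl) (auto simp: min_absorb1)
  finally show ?thesis .
qed

lemma simple_process_measurable: "simple_process M F T n t \<xi> \<Longrightarrow> k < n \<Longrightarrow> \<xi> k \<in> borel_measurable M"
  using F_measurable unfolding simple_process_def by blast

lemma simple_integral_measurable:
  assumes sp: "simple_process M F T n t \<xi>" and s: "0 \<le> s"
  shows "simple_integral W n t \<xi> s \<in> borel_measurable M"
proof -
  have "(\<lambda>\<omega>. \<xi> k \<omega> * D (t k) (min (t (Suc k)) s) \<omega>) \<in> borel_measurable M" if k: "k < n" for k
    using simple_process_time_nonneg[OF sp, of k] simple_process_time_nonneg[OF sp, of "Suc k"] k s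
    by (intro borel_measurable_times simple_process_measurable[OF sp] Dm) auto
  then have "(\<lambda>\<omega>. \<Sum>k\<in>{k. k < n \<and> t k < s}. \<xi> k \<omega> * D (t k) (min (t (Suc k)) s) \<omega>) \<in> borel_measurable M"
    by (intro borel_measurable_sum) auto
  then show ?thesis by (simp add: simple_integral_cut[OF sp, abs_def])
qed

text \<open>The two simple processes form one family indexed by \<open>A <+> A'\<close>, the second
  with negative sign, and the isometry is applied to it.\<close>

lemma ito_diff:
  assumes sp: "simple_process M F T n t \<xi>" and sp': "simple_process M F T n' t' \<xi>'" and s: "s \<in> {0..T}"
  shows "(\<integral>\<^sup>+\<omega>. ennreal ((simple_integral W n t \<xi> s \<omega> - simple_integral W n' t' \<xi>' s \<omega>)\<^sup>2) \<partial>M)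
    \<le> (\<integral>\<^sup>+\<omega>. (\<integral>\<^sup>+u\<in>{0..T}. ennreal ((simple_value n t \<xi> u \<omega> - simple_value n' t' \<xi>' u \<omega>)\<^sup>2) \<partial>lborel) \<partial>M)"
proof -
  define A where "A = {k. k < n \<and> t k < s}"
  define A' where "A' = {k. k < n' \<and> t' k < s}"
  define a where "a = case_sum t t'"
  define b where "b = case_sum (\<lambda>k. min (t (Suc k)) s) (\<lambda>k. min (t' (Suc k)) s)"
  define x where "x = case_sum \<xi> (\<lambda>k \<omega>. - \<xi>' k \<omega>)"
  have fin: "finite A" "finite A'" by (auto simp: A_def A'_def)
  obtain B where B: "\<And>k \<omega>. k < n \<Longrightarrow> \<omega> \<in> space M \<Longrightarrow> \<bar>\<xi> k \<omega>\<bar> \<le> B" using sp unfolding simple_process_def by blast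
  obtain B' where B': "\<And>k \<omega>. k < n' \<Longrightarrow> \<omega> \<in> space M \<Longrightarrow> \<bar>\<xi>' k \<omega>\<bar> \<le> B'" using sp' unfolding simple_process_def by blast
  have iso: "(\<integral>\<^sup>+\<omega>. ennreal ((\<Sum>i\<in>A <+> A'. x i \<omega> * D (a i) (b i) \<omega>)\<^sup>2) \<partial>M) =
    (\<integral>\<^sup>+\<omega>. (\<integral>\<^sup>+u. ennreal ((\<Sum>i\<in>A <+> A'. x i \<omega> * indicator {a i<..b i} u)\<^sup>2) \<partial>lborel) \<partial>M)"
  proof (rule ito_isometry[where K="max B B'"])
    show "finite (A <+> A')" using fin by simp
    fix i assume i: "i \<in> A <+> A'"
    show "0 \<le> a i \<and> a i \<le> b i"
      using i simple_process_time_nonneg[OF sp] simple_process_time_less[OF sp]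
        simple_process_time_nonneg[OF sp'] simple_process_time_less[OF sp']
      by (auto simp: a_def b_def A_def A'_def less_imp_le)
    have "\<forall>k<n. \<xi> k \<in> borel_measurable (F (t k))" "\<forall>k<n'. \<xi>' k \<in> borel_measurable (F (t' k))"
      using sp sp' by (auto simp: simple_process_def)
    then show "x i \<in> borel_measurable (F (a i))"
      using i by (auto simp: a_def x_def A_def A'_def)
    fix \<omega> assume "\<omega> \<in> space M"
    then show "\<bar>x i \<omega>\<bar> \<le> max B B'"
      using i B[of _ \<omega>] B'[of _ \<omega>] by (auto simp: x_def A_def A'_def le_max_iff_disj)
  qed
  have 1: "(\<Sum>i\<in>A <+> A'. x i \<omega> * D (a i) (b i) \<omega>) = simple_integral W n t \<xi> s \<omega> - simple_integral W n' t' \<xi>' s \<omega>" for \<omega>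
    by (simp add: sum.Plus fin x_def a_def b_def simple_integral_cut[OF sp] simple_integral_cut[OF sp'] sum_negf comp_def A_def[symmetric] A'_def[symmetric])
  have 2: "(\<Sum>i\<in>A <+> A'. x i \<omega> * indicator {a i<..b i} u) = (if u \<le> s then simple_value n t \<xi> u \<omega> - simple_value n' t' \<xi>' u \<omega> else 0)" for \<omega> u
  proof -
    have "(\<Sum>i\<in>A <+> A'. x i \<omega> * indicator {a i<..b i} u) =
        (\<Sum>k\<in>A. \<xi> k \<omega> * indicator {t k<..min (t (Suc k)) s} u) - (\<Sum>k\<in>A'. \<xi>' k \<omega> * indicator {t' k<..min (t' (Suc k)) s} u)"
      unfolding sum.Plus[OF fin] comp_def x_def a_def b_def sum.case mult_minus_left sum_negf by (rule diff_conv_add_uminus[symmetric])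
    also have "\<dots> = (if u \<le> s then simple_value n t \<xi> u \<omega> else 0) - (if u \<le> s then simple_value n' t' \<xi>' u \<omega> else 0)"
      unfolding A_def A'_def simple_value_cut ..
    finally show ?thesis by (cases "u \<le> s") simp_all
  qed
  \<comment> \<open>The isometry integrates over all real \<open>u\<close>; left of 0 both simple
    processes vanish, so the restriction to \<open>[0,T]\<close> is harmless.\<close>
  note neg = simple_value_nonpos[OF sp] simple_value_nonpos[OF sp']
  have "(\<integral>\<^sup>+\<omega>. (\<integral>\<^sup>+u. ennreal ((if u \<le> s then simple_value n t \<xi> u \<omega> - simple_value n' t' \<xi>' u \<omega> else 0)\<^sup>2) \<partial>lborel) \<partial>M)
    \<le> (\<integral>\<^sup>+\<omega>. (\<integral>\<^sup>+u\<in>{0..T}. ennreal ((simple_value n t \<xi> u \<omega> - simple_value n' t' \<xi>' u \<omega>)\<^sup>2) \<partial>lborel) \<partial>M)"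
  proof (intro nn_integral_mono)
    fix \<omega> u
    show "ennreal ((if u \<le> s then simple_value n t \<xi> u \<omega> - simple_value n' t' \<xi>' u \<omega> else 0)\<^sup>2)
      \<le> ennreal ((simple_value n t \<xi> u \<omega> - simple_value n' t' \<xi>' u \<omega>)\<^sup>2) * indicator {0..T} u"
    proof (cases "0 \<le> u")
      case True
      then show ?thesis using s by (auto simp: indicator_def)
    next
      case False
      then show ?thesis using neg[of u \<omega>] by simp
    qed
  qed
  then show ?thesis using iso unfolding 1 2 by simp
qed

lemma square_sum_le: "ennreal ((x - z)\<^sup>2) \<le> 2 * ennreal ((x - y)\<^sup>2) + 2 * ennreal ((y - z)\<^sup>2)" for x y z :: real
proof -
  have "(x - z)\<^sup>2 \<le> 2 * (x - y)\<^sup>2 + 2 * (y - z)\<^sup>2"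
    using zero_le_power2[of "(x - y) - (y - z)"] by (simp add: power2_eq_square algebra_simps)
  then have "ennreal ((x - z)\<^sup>2) \<le> ennreal (2 * (x - y)\<^sup>2 + 2 * (y - z)\<^sup>2)" by (rule ennreal_leI)
  also have "\<dots> = 2 * ennreal ((x - y)\<^sup>2) + 2 * ennreal ((y - z)\<^sup>2)"
    by (simp add: ennreal_plus ennreal_mult)
  finally show ?thesis .
qed

lemma simple_value_pair_measurable:
  assumes sp: "simple_process M F T n t \<xi>"
  shows "(\<lambda>(u, \<omega>). simple_value n t \<xi> u \<omega>) \<in> borel_measurable (restrict_space lborel {0..T} \<Otimes>\<^sub>M M)"
proof -
  have "(\<lambda>z. \<xi> k (snd z) * indicator {t k<..t (Suc k)} (fst z)) \<in> borel_measurable (restrict_space lborel {0..T} \<Otimes>\<^sub>M M)"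
    if k: "k < n" for k
  proof (intro borel_measurable_times)
    show "(\<lambda>z. \<xi> k (snd z)) \<in> borel_measurable (restrict_space lborel {0..T} \<Otimes>\<^sub>M M)"
      by (rule measurable_compose[OF measurable_snd simple_process_measurable[OF sp k]])
    have "(\<lambda>u. indicator {t k<..t (Suc k)} u :: real) \<in> borel_measurable (restrict_space lborel {0..T})"
      by (rule measurable_restrict_space1) simp
    from measurable_compose[OF measurable_fst this]
    show "(\<lambda>z. indicator {t k<..t (Suc k)} (fst z) :: real) \<in> borel_measurable (restrict_space lborel {0..T} \<Otimes>\<^sub>M M)" .
  qed
  then show ?thesis
    unfolding simple_value_def case_prod_beta by (intro borel_measurable_sum) (simp only: lessThan_iff)
qed

lemma double_integral_restrict:
  "(\<integral>\<^sup>+\<omega>. (\<integral>\<^sup>+u\<in>{0..T}. f u \<omega> \<partial>lborel) \<partial>M) = (\<integral>\<^sup>+\<omega>. (\<integral>\<^sup>+u. f u \<omega> \<partial>restrict_space lborel {0..T}) \<partial>M)" for T :: real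
  by (simp add: nn_integral_restrict_space)

lemma inner_integral_measurable:
  assumes "(\<lambda>(u, \<omega>). f u \<omega>) \<in> borel_measurable (restrict_space lborel {0..T::real} \<Otimes>\<^sub>M M)"
  shows "(\<lambda>\<omega>. \<integral>\<^sup>+u. f u \<omega> \<partial>restrict_space lborel {0..T}) \<in> borel_measurable M"
proof -
  interpret L: finite_measure "restrict_space lborel {0..T}"
    by (rule finite_measureI) (simp add: emeasure_restrict_space emeasure_lborel_Icc_eq)
  have "(\<lambda>(\<omega>, u). f u \<omega>) \<in> borel_measurable (M \<Otimes>\<^sub>M restrict_space lborel {0..T})"
    using measurable_pair_swap[OF assms] by (simp add: case_prod_beta)
  then show ?thesis by (rule L.borel_measurable_nn_integral)
qed

text \<open>\<open>is_ito_integral\<close> grants some approximating sequence. The isometry for its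
  difference with the given sequence bounds the error by
  \<open>4 * ?E q + 4 * ?e m + 2 * ?f m\<close>. Let \<open>m\<close> and then \<open>q\<close> tend
  to infinity: every sequence approximating the integrand computes the same
  \<open>J\<close>.\<close>

lemma ito_L2_limit:
  assumes J: "is_ito_integral M F W T H J" and sp: "\<And>q::nat. simple_process M F T (n q) (t q) (\<xi> q)"
    and conv: "(\<lambda>q. \<integral>\<^sup>+\<omega>. (\<integral>\<^sup>+u\<in>{0..T}. ennreal ((simple_value (n q) (t q) (\<xi> q) u \<omega> - H u \<omega>)\<^sup>2) \<partial>lborel) \<partial>M) \<longlonglongrightarrow> 0"
    and s: "s \<in> {0..T}"
  shows "(\<lambda>q. \<integral>\<^sup>+\<omega>. ennreal ((simple_integral W (n q) (t q) (\<xi> q) s \<omega> - J s \<omega>)\<^sup>2) \<partial>M) \<longlonglongrightarrow> 0"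
proof -
  let ?L = "restrict_space lborel {0..T}"
  have Hm: "(\<lambda>(u, \<omega>). H u \<omega>) \<in> borel_measurable (?L \<Otimes>\<^sub>M M)"
  proof -
    have "sets (?L \<Otimes>\<^sub>M M) = sets (restrict_space borel {0..T} \<Otimes>\<^sub>M M)"
      by (intro sets_pair_measure_cong) (auto simp: sets_restrict_space)
    then show ?thesis using J unfolding is_ito_integral_def by (simp cong: measurable_cong_sets)
  qed
  have Jm: "J s \<in> borel_measurable M" using J s by (simp add: is_ito_integral_def)
  obtain n' t' \<xi>' where sp': "\<And>m. simple_process M F T (n' m) (t' m) (\<xi>' m)"
    and e: "(\<lambda>m. \<integral>\<^sup>+\<omega>. (\<integral>\<^sup>+u\<in>{0..T}. ennreal ((simple_value (n' m) (t' m) (\<xi>' m) u \<omega> - H u \<omega>)\<^sup>2) \<partial>lborel) \<partial>M) \<longlonglongrightarrow> 0" (is "?e \<longlonglongrightarrow> 0")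
    and f: "(\<lambda>m. \<integral>\<^sup>+\<omega>. ennreal ((simple_integral W (n' m) (t' m) (\<xi>' m) s \<omega> - J s \<omega>)\<^sup>2) \<partial>M) \<longlonglongrightarrow> 0" (is "?f \<longlonglongrightarrow> 0")
    using J s unfolding is_ito_integral_def by blast
  let ?E = "\<lambda>q. \<integral>\<^sup>+\<omega>. (\<integral>\<^sup>+u\<in>{0..T}. ennreal ((simple_value (n q) (t q) (\<xi> q) u \<omega> - H u \<omega>)\<^sup>2) \<partial>lborel) \<partial>M"
  let ?a = "\<lambda>q. \<integral>\<^sup>+\<omega>. ennreal ((simple_integral W (n q) (t q) (\<xi> q) s \<omega> - J s \<omega>)\<^sup>2) \<partial>M"
  have bound: "?a q \<le> 2 * (2 * ?E q + 2 * ?e m) + 2 * ?f m" for q m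
  proof -
    let ?I = "simple_integral W (n q) (t q) (\<xi> q) s" and ?I' = "simple_integral W (n' m) (t' m) (\<xi>' m) s"
    let ?v = "simple_value (n q) (t q) (\<xi> q)" and ?v' = "simple_value (n' m) (t' m) (\<xi>' m)"
    have Im [measurable]: "?I \<in> borel_measurable M" "?I' \<in> borel_measurable M"
      using simple_integral_measurable[OF sp] simple_integral_measurable[OF sp'] s by auto
    note Jm [measurable]
    have d1: "(\<lambda>(u, \<omega>). ennreal ((?v u \<omega> - H u \<omega>)\<^sup>2)) \<in> borel_measurable (?L \<Otimes>\<^sub>M M)"
      using Hm simple_value_pair_measurable[OF sp[of q]] by (simp add: case_prod_beta)
    have d2: "(\<lambda>(u, \<omega>). ennreal ((?v' u \<omega> - H u \<omega>)\<^sup>2)) \<in> borel_measurable (?L \<Otimes>\<^sub>M M)"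
      using Hm simple_value_pair_measurable[OF sp'[of m]] by (simp add: case_prod_beta)
    have d1s: "(\<lambda>u. ennreal ((?v u \<omega> - H u \<omega>)\<^sup>2)) \<in> borel_measurable ?L" if "\<omega> \<in> space M" for \<omega>
      using measurable_compose[OF measurable_Pair2'[OF that] d1] by simp
    have d2s: "(\<lambda>u. ennreal ((?v' u \<omega> - H u \<omega>)\<^sup>2)) \<in> borel_measurable ?L" if "\<omega> \<in> space M" for \<omega>
      using measurable_compose[OF measurable_Pair2'[OF that] d2] by simp
    have "(\<integral>\<^sup>+\<omega>. ennreal ((?I \<omega> - ?I' \<omega>)\<^sup>2) \<partial>M) \<le> (\<integral>\<^sup>+\<omega>. (\<integral>\<^sup>+u. ennreal ((?v u \<omega> - ?v' u \<omega>)\<^sup>2) \<partial>?L) \<partial>M)"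
      using ito_diff[OF sp[of q] sp'[of m] s] by (simp only: double_integral_restrict)
    also have "\<dots> \<le> (\<integral>\<^sup>+\<omega>. (\<integral>\<^sup>+u. 2 * ennreal ((?v u \<omega> - H u \<omega>)\<^sup>2) + 2 * ennreal ((?v' u \<omega> - H u \<omega>)\<^sup>2) \<partial>?L) \<partial>M)"
      by (intro nn_integral_mono) (metis square_sum_le power2_commute)
    also have "\<dots> = (\<integral>\<^sup>+\<omega>. 2 * (\<integral>\<^sup>+u. ennreal ((?v u \<omega> - H u \<omega>)\<^sup>2) \<partial>?L) + 2 * (\<integral>\<^sup>+u. ennreal ((?v' u \<omega> - H u \<omega>)\<^sup>2) \<partial>?L) \<partial>M)"
      using d1s d2s by (intro nn_integral_cong) (simp add: nn_integral_add nn_integral_cmult)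
    also have "\<dots> = 2 * (\<integral>\<^sup>+\<omega>. (\<integral>\<^sup>+u. ennreal ((?v u \<omega> - H u \<omega>)\<^sup>2) \<partial>?L) \<partial>M) + 2 * (\<integral>\<^sup>+\<omega>. (\<integral>\<^sup>+u. ennreal ((?v' u \<omega> - H u \<omega>)\<^sup>2) \<partial>?L) \<partial>M)"
      using inner_integral_measurable[OF d1] inner_integral_measurable[OF d2] by (simp add: nn_integral_add nn_integral_cmult)
    also have "\<dots> = 2 * ?E q + 2 * ?e m" by (simp only: double_integral_restrict)
    finally have 1: "(\<integral>\<^sup>+\<omega>. ennreal ((?I \<omega> - ?I' \<omega>)\<^sup>2) \<partial>M) \<le> 2 * ?E q + 2 * ?e m" .
    have "?a q \<le> (\<integral>\<^sup>+\<omega>. 2 * ennreal ((?I \<omega> - ?I' \<omega>)\<^sup>2) + 2 * ennreal ((?I' \<omega> - J s \<omega>)\<^sup>2) \<partial>M)"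
      by (intro nn_integral_mono square_sum_le)
    also have "\<dots> = 2 * (\<integral>\<^sup>+\<omega>. ennreal ((?I \<omega> - ?I' \<omega>)\<^sup>2) \<partial>M) + 2 * ?f m"
      by (simp add: nn_integral_add nn_integral_cmult)
    also have "\<dots> \<le> 2 * (2 * ?E q + 2 * ?e m) + 2 * ?f m" using 1 by (intro add_mono mult_left_mono) auto
    finally show ?thesis .
  qed
  have "?a q \<le> 2 * (2 * ?E q)" for q
  proof (rule tendsto_lowerbound)
    show "(\<lambda>m. 2 * (2 * ?E q + 2 * ?e m) + 2 * ?f m) \<longlonglongrightarrow> 2 * (2 * ?E q)"
    proof -
      have "(\<lambda>m. 2 * (2 * ?E q + 2 * ?e m) + 2 * ?f m) \<longlonglongrightarrow> 2 * (2 * ?E q + 2 * 0) + 2 * 0"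
        by (intro tendsto_add ennreal_tendsto_cmult tendsto_const e f) auto
      then show ?thesis by simp
    qed
  qed (use bound in auto)
  moreover have "(\<lambda>q. 2 * (2 * ?E q)) \<longlonglongrightarrow> 2 * (2 * 0)"
    by (intro ennreal_tendsto_cmult conv) auto
  ultimately have up: "\<And>q. ?a q \<le> 2 * (2 * ?E q)" and E0: "(\<lambda>q. 2 * (2 * ?E q)) \<longlonglongrightarrow> 0" by simp_all
  show ?thesis
  proof (rule tendsto_sandwich)
    show "eventually (\<lambda>q. 0 \<le> ?a q) sequentially" by simp
    show "eventually (\<lambda>q. ?a q \<le> 2 * (2 * ?E q)) sequentially" using up by (intro always_eventually allI)
    show "(\<lambda>q. 0 :: ennreal) \<longlonglongrightarrow> 0" by simp
    show "(\<lambda>q. 2 * (2 * ?E q)) \<longlonglongrightarrow> 0" by (rule E0)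
  qed
qed

end

section \<open>Approximation of the volatility along the environment\<close>

text \<open>By bisection: close to a point \<open>x\<close>, only \<open>x\<close> itself can fail.
  At every time outside this set, a sufficiently close grid time to the left already sees the
  current state.\<close>

lemma finite_left_discontinuities:
  fixes y :: "real \<Rightarrow> nat"
  assumes y: "cadlag_on {0..} y" and y1: "\<And>t. t \<ge> 0 \<Longrightarrow> y t \<ge> 1" and T: "0 \<le> T"
  shows "finite {s \<in> {0<..T}. \<not> (\<exists>d>0. \<forall>r. s - d < r \<and> r \<le> s \<longrightarrow> y r = y s)}"
proof -
  define C where "C s \<longleftrightarrow> (\<exists>d>0. \<forall>r. s - d < r \<and> r \<le> s \<longrightarrow> y r = y s)" for s
  define P where "P u v \<longleftrightarrow> (0 \<le> u \<longrightarrow> finite {s \<in> {u<..v}. \<not> C s})" for u v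
  have "P 0 T" using T
  proof (induct rule: Bolzano)
    case (trans u v w)
    have "{s \<in> {u<..w}. \<not> C s} = {s \<in> {u<..v}. \<not> C s} \<union> {s \<in> {v<..w}. \<not> C s}" using trans(3,4) by auto
    then show ?case using trans unfolding P_def by auto
  next
    case (local x)
    obtain d j where d: "d > 0" "\<And>s. x \<le> s \<Longrightarrow> s < x + d \<Longrightarrow> y s = y x"
      "\<And>s. 0 \<le> s \<Longrightarrow> x - d < s \<Longrightarrow> s < x \<Longrightarrow> y s = j"
      using cadlag_nat_locally_constant[OF y y1 local(1)] by metis
    have "P u v" if uv: "u \<le> x" "x \<le> v" "v - u < d" for u v
      unfolding P_def
    proof
      assume u: "0 \<le> u"
      have "C s" if s: "s \<in> {u<..v}" "s \<noteq> x" for s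
      proof (cases "s < x")
        case True
        have eq: "y r = y s" if "s - (s - u) < r \<and> r \<le> s" for r
          using d(3)[of r] d(3)[of s] that True s uv u by simp
        have "0 < s - u" using s by simp
        then show ?thesis unfolding C_def using eq by blast
      next
        case False
        have eq: "y r = y s" if "s - (s - x) < r \<and> r \<le> s" for r
          using d(2)[of r] d(2)[of s] that False s uv by simp
        have "0 < s - x" using s False by simp
        then show ?thesis unfolding C_def using eq by blast
      qed
      then have "{s \<in> {u<..v}. \<not> C s} \<subseteq> {x}" by auto
      then show "finite {s \<in> {u<..v}. \<not> C s}" by (rule finite_subset) simp
    qed
    then show ?case using d(1) by blast
  qed
  then show ?thesis unfolding P_def C_def by simp
qed

lemma grid_simple_value:
  fixes h :: "nat \<Rightarrow> real"
  assumes T: "T > 0" and N: "N > 0" and u: "u \<in> {0<..T}"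
  obtains k where "k < N" "real k * T / real N < u" "u \<le> real (Suc k) * T / real N"
    "(\<Sum>j<N. h j * indicator {real j * T / real N<..real (Suc j) * T / real N} u) = h k"
proof -
  let ?t = "\<lambda>j::nat. real j * T / real N"
  \<comment> \<open>The intervals are closed on the right, hence the ceiling minus 1 instead of the
    floor.\<close>
  define k where "k = nat (\<lceil>u * real N / T\<rceil> - 1)"
  have pos: "0 < u * real N / T" using u T N by simp
  then have c: "\<lceil>u * real N / T\<rceil> \<ge> 1" by (simp add: one_le_ceiling)
  have k: "real k < u * real N / T" "u * real N / T \<le> real k + 1"
    using c unfolding k_def by (auto simp: of_nat_nat) linarith+
  have "u * real N / T \<le> T * real N / T" using u T by (intro divide_right_mono mult_right_mono) auto
  then have le: "u * real N / T \<le> real N" using T by simp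
  have kN: "k < N" using k(1) le by linarith
  have b: "?t k < u" "u \<le> ?t (Suc k)" using k T N by (auto simp: field_simps)
  have mono: "?t i \<le> ?t j" if "i \<le> j" for i j using that T by (intro divide_right_mono mult_right_mono) auto
  have "(\<Sum>j<N. h j * indicator {?t j<..?t (Suc j)} u) = (\<Sum>j<N. if j = k then h k else 0)"
  proof (rule sum.cong[OF refl])
    fix j
    consider "j = k" | "Suc j \<le> k" | "Suc k \<le> j" by linarith
    then show "h j * indicator {?t j<..?t (Suc j)} u = (if j = k then h k else 0)"
    proof cases
      case 1 then show ?thesis using b by simp
    next
      case 2 then show ?thesis using mono[OF 2] b by (auto simp: indicator_def)
    next
      case 3 then show ?thesis using mono[OF 3] b by (auto simp: indicator_def)
    qed
  qed
  also have "\<dots> = h k" using kN by simp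
  finally show thesis using that kN b by blast
qed

context wiener_environment
begin

text \<open>The coefficient is read at the left end point, so that it is measurable at the beginning
  of its interval.\<close>

definition grid_xi :: "(nat \<Rightarrow> real) \<Rightarrow> real \<Rightarrow> nat \<Rightarrow> nat \<Rightarrow> 'a \<Rightarrow> real" where
  "grid_xi sig T N k \<omega> = sig (Y (real k * T / real N) \<omega>)"

lemma grid_simple_process:
  assumes T: "T > 0" and N: "N > 0" and Y1: "\<And>t \<omega>. \<omega> \<in> space M \<Longrightarrow> t \<ge> 0 \<Longrightarrow> Y t \<omega> \<ge> 1"
    and C: "\<And>j. j \<ge> 1 \<Longrightarrow> \<bar>sig j\<bar> \<le> C"
  shows "simple_process M F T N (\<lambda>k. real k * T / real N) (grid_xi sig T N)"
  unfolding simple_process_def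
proof (intro conjI allI impI)
  fix k
  show "real k * T / real N < real (Suc k) * T / real N"
    using T N by (intro divide_strict_right_mono mult_strict_right_mono) auto
  have "Y (real k * T / real N) \<in> F (real k * T / real N) \<rightarrow>\<^sub>M count_space UNIV" using T by (intro Y_F) auto
  from measurable_compose[OF this, of sig borel]
  show "grid_xi sig T N k \<in> borel_measurable (F (real k * T / real N))" unfolding grid_xi_def by simp
next
  show "\<exists>B. \<forall>k<N. \<forall>\<omega>\<in>space M. \<bar>grid_xi sig T N k \<omega>\<bar> \<le> B"
    unfolding grid_xi_def using T by (intro exI[of _ C] allI impI ballI C Y1) auto
qed (use N in auto)

text \<open>Dominated convergence twice, over \<open>u\<close> and over \<open>\<omega>\<close>. For
  \<open>u\<close> outside 0 and the finitely many left discontinuities the integrand is eventually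
  equal to 0, since the left grid point sees the same state.\<close>

lemma grid_L2_convergence:
  assumes T: "T > 0" and N: "\<And>q. N q > 0" "filterlim N at_top sequentially"
    and Yc: "\<And>\<omega>. \<omega> \<in> space M \<Longrightarrow> cadlag_on {0..} (\<lambda>t. Y t \<omega>)"
    and Y1: "\<And>t \<omega>. \<omega> \<in> space M \<Longrightarrow> t \<ge> 0 \<Longrightarrow> Y t \<omega> \<ge> 1"
    and C: "\<And>j. j \<ge> 1 \<Longrightarrow> \<bar>sig j\<bar> \<le> C"
    and H: "(\<lambda>(s, \<omega>). sig (Y s \<omega>)) \<in> borel_measurable (restrict_space borel {0..T} \<Otimes>\<^sub>M M)"
  shows "(\<lambda>q. \<integral>\<^sup>+\<omega>. (\<integral>\<^sup>+u\<in>{0..T}. ennreal ((simple_value (N q) (\<lambda>k. real k * T / real (N q)) (grid_xi sig T (N q)) u \<omega> - sig (Y u \<omega>))\<^sup>2) \<partial>lborel) \<partial>M) \<longlonglongrightarrow> 0"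
proof -
  let ?L = "restrict_space lborel {0..T}"
  let ?v = "\<lambda>q. simple_value (N q) (\<lambda>k. real k * T / real (N q)) (grid_xi sig T (N q))"
  let ?d = "\<lambda>q u \<omega>. ennreal ((?v q u \<omega> - sig (Y u \<omega>))\<^sup>2)"
  interpret L: finite_measure ?L
    by (rule finite_measureI) (simp add: emeasure_restrict_space emeasure_lborel_Icc_eq)
  have Hm: "(\<lambda>(s, \<omega>). sig (Y s \<omega>)) \<in> borel_measurable (?L \<Otimes>\<^sub>M M)"
  proof -
    have "sets (?L \<Otimes>\<^sub>M M) = sets (restrict_space borel {0..T} \<Otimes>\<^sub>M M)"
      by (intro sets_pair_measure_cong) (auto simp: sets_restrict_space)
    then show ?thesis using H by (simp cong: measurable_cong_sets)
  qed
  have dm: "(\<lambda>(u, \<omega>). ?d q u \<omega>) \<in> borel_measurable (?L \<Otimes>\<^sub>M M)" for q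
    using Hm simple_value_pair_measurable[OF grid_simple_process[OF T N(1)[of q] Y1 C]] by (simp add: case_prod_beta)
  have dms: "(\<lambda>u. ?d q u \<omega>) \<in> borel_measurable ?L" if "\<omega> \<in> space M" for \<omega> q
    using measurable_compose[OF measurable_Pair2'[OF that] dm] by simp
  have C0: "C \<ge> 0" using C[of 1] by simp
  have vval: "\<exists>k<N q. real k * T / real (N q) < u \<and> u \<le> real (Suc k) * T / real (N q) \<and> ?v q u \<omega> = sig (Y (real k * T / real (N q)) \<omega>)"
    if uT: "u \<in> {0<..T}" for q u \<omega>
  proof -
    obtain k where "k < N q" "real k * T / real (N q) < u" "u \<le> real (Suc k) * T / real (N q)"
      "(\<Sum>j<N q. grid_xi sig T (N q) j \<omega> * indicator {real j * T / real (N q)<..real (Suc j) * T / real (N q)} u) = grid_xi sig T (N q) k \<omega>"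
      by (rule grid_simple_value[OF T N(1)[of q] uT, where h="\<lambda>k. grid_xi sig T (N q) k \<omega>"])
    then show ?thesis unfolding simple_value_def grid_xi_def by blast
  qed
  have bound: "?d q u \<omega> \<le> ennreal ((2 * C)\<^sup>2)" if "u \<in> {0..T}" "\<omega> \<in> space M" for q u \<omega>
  proof -
    have 1: "\<bar>sig (Y u \<omega>)\<bar> \<le> C" using that by (intro C Y1) auto
    have "\<bar>?v q u \<omega>\<bar> \<le> C"
    \<comment> \<open>No left-open interval contains 0, so the simple process vanishes
      there.\<close>
    proof (cases "u = 0")
      case True
      have "?v q u \<omega> = 0" by (rule simple_value_nonpos[OF grid_simple_process[OF T N(1) Y1 C]]) (use True in auto)
      then show ?thesis using C0 by simp
    next
      case False
      then have "u \<in> {0<..T}" using that by auto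
      from vval[OF this, of q \<omega>] show ?thesis using that T by (auto intro!: C Y1)
    qed
    then have "\<bar>?v q u \<omega> - sig (Y u \<omega>)\<bar> \<le> 2 * C" using 1 by linarith
    then have "(?v q u \<omega> - sig (Y u \<omega>))\<^sup>2 \<le> (2 * C)\<^sup>2" using C0 by (subst power2_le_iff_abs_le) auto
    then show ?thesis by (rule ennreal_leI)
  qed
  have inner: "(\<lambda>q. \<integral>\<^sup>+u. ?d q u \<omega> \<partial>?L) \<longlonglongrightarrow> 0" if \<omega>: "\<omega> \<in> space M" for \<omega>
  proof -
    let ?D = "{s \<in> {0<..T}. \<not> (\<exists>d>0. \<forall>r. s - d < r \<and> r \<le> s \<longrightarrow> Y r \<omega> = Y s \<omega>)}"
    have fin: "finite ?D" using T by (intro finite_left_discontinuities Yc \<omega> Y1) auto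
    have lim: "(\<lambda>q. ?d q u \<omega>) \<longlonglongrightarrow> 0" if u: "u \<in> {0..T}" "u \<notin> insert 0 ?D" for u
    proof -
      have u0: "u \<in> {0<..T}" using u by auto
      obtain d where d: "d > 0" "\<And>r. u - d < r \<Longrightarrow> r \<le> u \<Longrightarrow> Y r \<omega> = Y u \<omega>" using u u0 by blast
      have "(\<lambda>q. T / real (N q)) \<longlonglongrightarrow> 0"
        by (rule filterlim_compose[OF lim_const_over_n N(2)])
      then have "eventually (\<lambda>q. T / real (N q) < d) sequentially" using d(1) by (rule order_tendstoD)
      then have "eventually (\<lambda>q. 0 = ?d q u \<omega>) sequentially"
      proof eventually_elim
        case (elim q)
        obtain k where k: "real k * T / real (N q) < u" "u \<le> real (Suc k) * T / real (N q)" "?v q u \<omega> = sig (Y (real k * T / real (N q)) \<omega>)"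
          using vval[OF u0, of q \<omega>] by blast
        have "real (Suc k) * T / real (N q) = real k * T / real (N q) + T / real (N q)" by (simp add: algebra_simps add_divide_distrib)
        then have "Y (real k * T / real (N q)) \<omega> = Y u \<omega>" using k elim by (intro d(2)) auto
        then show ?case using k(3) by simp
      qed
      then show ?thesis by (rule Lim_transform_eventually[OF tendsto_const])
    qed
    have "(\<lambda>q. \<integral>\<^sup>+u. ?d q u \<omega> \<partial>?L) \<longlonglongrightarrow> (\<integral>\<^sup>+u. 0 \<partial>?L)"
    proof (rule nn_integral_dominated_convergence[where w="\<lambda>_. ennreal ((2 * C)\<^sup>2)"])
      show "AE u in ?L. ?d q u \<omega> \<le> ennreal ((2 * C)\<^sup>2)" for q
        using bound \<omega> by (intro AE_I2) (auto simp: space_restrict_space)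
      show "(\<integral>\<^sup>+u. ennreal ((2 * C)\<^sup>2) \<partial>?L) < \<infinity>"
        by (simp add: emeasure_restrict_space emeasure_lborel_Icc_eq ennreal_mult_less_top space_restrict_space)
      have "insert 0 ?D \<in> null_sets lborel" using fin by (intro finite_imp_null_set_lborel) simp
      then have "AE u in lborel. u \<notin> insert 0 ?D" by (rule AE_not_in)
      then have "AE u in lborel. u \<in> {0..T} \<longrightarrow> (\<lambda>q. ?d q u \<omega>) \<longlonglongrightarrow> 0"
        by eventually_elim (use lim in blast)
      then show "AE u in ?L. (\<lambda>q. ?d q u \<omega>) \<longlonglongrightarrow> 0" by (subst AE_restrict_space_iff) auto
    qed (use dms[OF \<omega>] in auto)
    then show ?thesis by simp
  qed
  have "(\<lambda>q. \<integral>\<^sup>+\<omega>. (\<integral>\<^sup>+u. ?d q u \<omega> \<partial>?L) \<partial>M) \<longlonglongrightarrow> (\<integral>\<^sup>+\<omega>. 0 \<partial>M)"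
  proof (rule nn_integral_dominated_convergence[where w="\<lambda>_. ennreal ((2 * C)\<^sup>2) * ennreal T"])
    show "AE \<omega> in M. (\<integral>\<^sup>+u. ?d q u \<omega> \<partial>?L) \<le> ennreal ((2 * C)\<^sup>2) * ennreal T" for q
    proof (rule AE_I2)
      fix \<omega> assume \<omega>: "\<omega> \<in> space M"
      have "(\<integral>\<^sup>+u. ?d q u \<omega> \<partial>?L) \<le> (\<integral>\<^sup>+u. ennreal ((2 * C)\<^sup>2) \<partial>?L)"
        using bound \<omega> by (intro nn_integral_mono) (auto simp: space_restrict_space)
      also have "\<dots> = ennreal ((2 * C)\<^sup>2) * ennreal T"
        using T by (simp add: emeasure_restrict_space space_restrict_space)
      finally show "(\<integral>\<^sup>+u. ?d q u \<omega> \<partial>?L) \<le> ennreal ((2 * C)\<^sup>2) * ennreal T" .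
    qed
    show "(\<integral>\<^sup>+\<omega>. ennreal ((2 * C)\<^sup>2) * ennreal T \<partial>M) < \<infinity>" by (simp add: emeasure_space_1 ennreal_mult_less_top)
    show "AE \<omega> in M. (\<lambda>q. \<integral>\<^sup>+u. ?d q u \<omega> \<partial>?L) \<longlonglongrightarrow> 0" using inner by (rule AE_I2)
  qed (use inner_integral_measurable[OF dm] in auto)
  then show ?thesis by (simp add: double_integral_restrict)
qed

end

section \<open>Finite-dimensional distributions of the limit process\<close>

lemma sum_shift: "(\<Sum>i\<in>{0<..m}. f (i - 1)) = (\<Sum>k<m. f k)" for m :: nat
proof (induction m)
  case (Suc m)
  have "{0<..Suc m} = insert (Suc m) {0<..m}" by auto
  then show ?case using Suc by (simp add: add.commute)
qed simp

lemma sum_shift_diff: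
  fixes f :: "nat \<Rightarrow> real"
  assumes "a \<le> b"
  shows "(\<Sum>i\<in>{a<..b}. f (i - 1)) = (\<Sum>i\<in>{a<..b}. f i) + f a - f b"
  using assms
proof (induction b rule: dec_induct)
  case (step b)
  have "{a<..Suc b} = insert (Suc b) {a<..b}" using step by auto
  then show ?case using step by simp
qed simp

lemma riemann_sum_limit:
  fixes y :: "real \<Rightarrow> nat" and C :: "nat \<Rightarrow> real"
  assumes T: "T > 0" and y: "cadlag_on {0..} y" and y1: "\<And>t. t \<ge> 0 \<Longrightarrow> y t \<ge> 1" and ab: "0 \<le> a" "a \<le> b" "b \<le> T"
  shows "(\<lambda>N. \<Sum>i\<in>{idx T N a<..idx T N b}. C (y (real i * T / real N)) * T / real N) \<longlonglongrightarrow> (LBINT s:{a<..b}. C (y s))"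
proof (rule path_sum_limit'[where c="\<lambda>N i j. C j * T / real N", OF T y y1 _ _ ab])
  fix j t assume t: "t \<in> {0..T}"
  have "(\<lambda>N. real (idx T N t) / real N * (C j * T)) \<longlonglongrightarrow> t / T * (C j * T)"
    using t by (intro tendsto_mult tendsto_const idx_ratio[OF T]) auto
  moreover have "t / T * (C j * T) = C j * t" using T by simp
  moreover have "(\<Sum>i\<in>{0<..idx T N t}. C j * T / real N) = real (idx T N t) / real N * (C j * T)" for N by simp
  ultimately show "(\<lambda>N. \<Sum>i\<in>{0<..idx T N t}. C j * T / real N) \<longlonglongrightarrow> C j * t" by (simp only:)
next
  fix j show "\<exists>g. g \<longlonglongrightarrow> 0 \<and> (\<forall>N i. N \<ge> 1 \<longrightarrow> i \<le> N \<longrightarrow> \<bar>C j * T / real N\<bar> \<le> g N)"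
    by (intro exI[of _ "\<lambda>N. \<bar>C j * T\<bar> / real N"] conjI lim_const_over_n) auto
qed

lemma grid_ratio: "n > 0 \<Longrightarrow> T > 0 \<Longrightarrow> real (l * Suc q) * T / real (n * Suc q) = real l * T / real n"
proof -
  have "real (l * Suc q) * T / real (n * Suc q) = (real l * T) * real (Suc q) / (real n * real (Suc q))"
    by (simp only: of_nat_mult mult_ac)
  also have "\<dots> = real l * T / real n" by (rule mult_divide_mult_cancel_right) (simp del: of_nat_Suc)
  finally show ?thesis .
qed

lemma idx_grid: "n > 0 \<Longrightarrow> T > 0 \<Longrightarrow> idx T (n * Suc q) (real l * T / real n) = l * Suc q"
proof -
  assume "n > 0" "T > 0"
  then have "real l * T / real n * real (n * Suc q) / T = real (l * Suc q)" by (simp add: field_simps)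
  then show ?thesis unfolding idx_def by (simp only: floor_of_nat nat_int)
qed

lemma filterlim_grid: "n > 0 \<Longrightarrow> filterlim (\<lambda>q. n * Suc q) at_top sequentially"
  by (rule filterlim_at_top_mono[OF filterlim_ident]) (auto intro!: always_eventually simp: trans_le_add2)

text \<open>Ito sums read the path at left end points, the Riemann sums above at right end points.
  The shift changes only two boundary terms, each at most \<open>c * T / (n * Suc q)\<close>. Grids
  with \<open>n * Suc q\<close> steps contain all \<open>n\<close> coarse times, so blocks begin and
  end at grid points.\<close>

lemma shifted_sum_limit:
  fixes y :: "real \<Rightarrow> nat" and C :: "nat \<Rightarrow> real"
  assumes T: "T > 0" and y: "cadlag_on {0..} y" and y1: "\<And>t. t \<ge> 0 \<Longrightarrow> y t \<ge> 1"
    and n: "n > 0" and l: "l \<le> l'" "l' \<le> n" and c: "\<And>j. j \<ge> 1 \<Longrightarrow> \<bar>C j\<bar> \<le> c"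
  shows "(\<lambda>q. \<Sum>i\<in>{l * Suc q<..l' * Suc q}. C (y (real (i - 1) * T / real (n * Suc q))) * (T / real (n * Suc q)))
    \<longlonglongrightarrow> (LBINT s:{real l * T / real n<..real l' * T / real n}. C (y s))"
proof -
  let ?N = "\<lambda>q. n * Suc q"
  let ?f = "\<lambda>q i. C (y (real i * T / real (?N q))) * (T / real (?N q))"
  have ab: "0 \<le> real l * T / real n" "real l * T / real n \<le> real l' * T / real n" "real l' * T / real n \<le> T"
    using T n l by (auto simp: field_simps intro!: divide_right_mono mult_right_mono)
  have "(\<lambda>q. \<Sum>i\<in>{idx T (?N q) (real l * T / real n)<..idx T (?N q) (real l' * T / real n)}. C (y (real i * T / real (?N q))) * T / real (?N q))
      \<longlonglongrightarrow> (LBINT s:{real l * T / real n<..real l' * T / real n}. C (y s))"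
    by (rule filterlim_compose[OF riemann_sum_limit[OF T y y1 ab] filterlim_grid[OF n]])
  then have 1: "(\<lambda>q. \<Sum>i\<in>{l * Suc q<..l' * Suc q}. ?f q i) \<longlonglongrightarrow> (LBINT s:{real l * T / real n<..real l' * T / real n}. C (y s))"
    unfolding idx_grid[OF n T] by simp
  have small: "(\<lambda>q. ?f q (i q)) \<longlonglongrightarrow> 0" for i
  proof (rule Lim_null_comparison)
    show "eventually (\<lambda>q. norm (?f q (i q)) \<le> c * (T / real (?N q))) sequentially"
    proof (rule always_eventually, rule allI)
      fix q
      have "\<bar>C (y (real (i q) * T / real (?N q)))\<bar> \<le> c" using T by (intro c y1) auto
      then show "norm (?f q (i q)) \<le> c * (T / real (?N q))"
        using T unfolding real_norm_def abs_mult by (intro mult_mono) auto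
    qed
    have "(\<lambda>q. c * (T / real (?N q))) \<longlonglongrightarrow> c * 0"
      by (intro tendsto_mult tendsto_const filterlim_compose[OF lim_const_over_n filterlim_grid[OF n]])
    then show "(\<lambda>q. c * (T / real (?N q))) \<longlonglongrightarrow> 0" by simp
  qed
  have "(\<lambda>q. (\<Sum>i\<in>{l * Suc q<..l' * Suc q}. ?f q i) + ?f q (l * Suc q) - ?f q (l' * Suc q)) \<longlonglongrightarrow> (LBINT s:{real l * T / real n<..real l' * T / real n}. C (y s)) + 0 - 0"
    by (intro tendsto_add tendsto_diff 1 small)
  moreover have "(\<Sum>i\<in>{l * Suc q<..l' * Suc q}. ?f q (i - 1)) = (\<Sum>i\<in>{l * Suc q<..l' * Suc q}. ?f q i) + ?f q (l * Suc q) - ?f q (l' * Suc q)" for q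
    using l by (intro sum_shift_diff mult_le_mono) auto
  ultimately show ?thesis by (simp only: add_0_right diff_0_right)
qed

lemma path_integral_bound:
  fixes y :: "real \<Rightarrow> nat" and C :: "nat \<Rightarrow> real"
  assumes y: "cadlag_on {0..} y" and y1: "\<And>t. t \<ge> 0 \<Longrightarrow> y t \<ge> 1" and ab: "0 \<le> a" "a \<le> b"
    and c: "\<And>j. j \<ge> 1 \<Longrightarrow> \<bar>C j\<bar> \<le> c"
  shows "\<bar>LBINT s:{a<..b}. C (y s)\<bar> \<le> c * (b - a)"
proof -
  have i: "set_integrable lborel {a<..b} (\<lambda>s. C (y s))" by (rule path_set_integrable[OF y y1 ab])
  have ic: "set_integrable lborel {a<..b} (\<lambda>s. k)" for k :: real
    unfolding set_integrable_def using ab by auto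
  have v: "(LBINT s:{a<..b}. k) = k * (b - a)" for k :: real
    unfolding set_lebesgue_integral_def using ab by simp
  have b: "\<bar>C (y s)\<bar> \<le> c" if "s \<in> {a<..b}" for s using that ab by (intro c y1) auto
  have "(LBINT s:{a<..b}. C (y s)) \<le> (LBINT s:{a<..b}. c)"
    by (rule set_integral_mono[OF i ic]) (use b in \<open>auto simp: abs_le_iff\<close>)
  moreover have "(LBINT s:{a<..b}. - c) \<le> (LBINT s:{a<..b}. C (y s))"
    by (rule set_integral_mono[OF ic i]) (use b in \<open>force simp: abs_le_iff\<close>)
  ultimately show ?thesis unfolding v by (simp add: abs_le_iff)
qed

text \<open>Riemann sums belong to left-open intervals, the drift to closed ones; the extra point 0
  is a null set.\<close>

lemma path_integral_Icc:
  fixes y :: "real \<Rightarrow> nat" and C :: "nat \<Rightarrow> real"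
  assumes y: "cadlag_on {0..} y" and y1: "\<And>t. t \<ge> 0 \<Longrightarrow> y t \<ge> 1" and t: "0 \<le> t"
  shows "(LBINT s:{0..t}. C (y s)) = (LBINT s:{0<..t}. C (y s))"
  unfolding set_lebesgue_integral_def
proof (rule integral_cong_AE)
  show m: "(\<lambda>s. indicator {0<..t} s *\<^sub>R C (y s)) \<in> borel_measurable lborel"
    using path_set_integrable[OF y y1 order_refl t, of C] unfolding set_integrable_def by (rule borel_measurable_integrable)
  have "(\<lambda>s. indicator {0..t} s *\<^sub>R C (y s)) = (\<lambda>s. indicator {0<..t} s *\<^sub>R C (y s) + indicator {0} s *\<^sub>R C (y 0))"
    using t by (auto simp: fun_eq_iff indicator_def)
  then show "(\<lambda>s. indicator {0..t} s *\<^sub>R C (y s)) \<in> borel_measurable lborel" using m by simp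
  show "AE s in lborel. indicator {0..t} s *\<^sub>R C (y s) = indicator {0<..t} s *\<^sub>R C (y s)"
    using AE_lborel_singleton[of 0] by eventually_elim (auto simp: indicator_def)
qed

locale limit_model = wiener_environment M W Y
  for M :: "'a measure" and W :: "real \<Rightarrow> 'a \<Rightarrow> real" and Y :: "real \<Rightarrow> 'a \<Rightarrow> nat" +
  fixes T :: real and mu sig :: "nat \<Rightarrow> real" and J :: "real \<Rightarrow> 'a \<Rightarrow> real" and Cm Cs :: real
  assumes T: "T > 0"
    and Yc: "\<And>\<omega>. \<omega> \<in> space M \<Longrightarrow> cadlag_on {0..} (\<lambda>t. Y t \<omega>)"
    and Y1: "\<And>t \<omega>. \<omega> \<in> space M \<Longrightarrow> t \<ge> 0 \<Longrightarrow> Y t \<omega> \<ge> 1"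
    and sig_pos: "\<And>j. j \<ge> 1 \<Longrightarrow> sig j > 0"
    and Cs: "\<And>j. j \<ge> 1 \<Longrightarrow> \<bar>sig j\<bar> \<le> Cs" and Cm: "\<And>j. j \<ge> 1 \<Longrightarrow> \<bar>mu j\<bar> \<le> Cm"
    and J: "is_ito_integral M (joint_filtration M W Y) W T (\<lambda>s \<omega>. sig (Y s \<omega>)) J"
begin

definition b :: "nat \<Rightarrow> real" where "b j = mu j - (sig j)\<^sup>2 / 2"

definition drift :: "real \<Rightarrow> 'a \<Rightarrow> real" where
  "drift t \<omega> = (LBINT s:{0..t}. mu (Y s \<omega>) - (sig (Y s \<omega>))\<^sup>2 / 2)"

definition Zp :: "real \<Rightarrow> 'a \<Rightarrow> real" where "Zp t \<omega> = J t \<omega> + drift t \<omega>"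

lemma sig2_le: "j \<ge> 1 \<Longrightarrow> \<bar>(sig j)\<^sup>2\<bar> \<le> Cs\<^sup>2"
  using power_mono[OF Cs[of j] abs_ge_zero, of 2] by simp

lemma b_le: "j \<ge> 1 \<Longrightarrow> \<bar>b j\<bar> \<le> Cm + Cs\<^sup>2"
  using Cm[of j] sig2_le[of j] zero_le_power2[of "sig j"] unfolding b_def by linarith

lemma drift_Ioc: "\<omega> \<in> space M \<Longrightarrow> 0 \<le> t \<Longrightarrow> drift t \<omega> = (LBINT s:{0<..t}. b (Y s \<omega>))"
  unfolding drift_def b_def[symmetric] by (rule path_integral_Icc[OF Yc Y1])

lemma fY_measurable: "t \<ge> 0 \<Longrightarrow> (\<lambda>\<omega>. f (Y t \<omega>)) \<in> borel_measurable M" for f :: "nat \<Rightarrow> real"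
  using measurable_compose[OF Ym, of t f borel] by simp

text \<open>A limit of Riemann sums, each a function of finitely many states.\<close>

lemma drift_measurable:
  assumes t: "t \<in> {0..T}" shows "drift t \<in> borel_measurable M"
proof (rule borel_measurable_LIMSEQ_real)
  fix \<omega> assume \<omega>: "\<omega> \<in> space M"
  show "(\<lambda>N. \<Sum>i\<in>{idx T N 0<..idx T N t}. b (Y (real i * T / real N) \<omega>) * T / real N) \<longlonglongrightarrow> drift t \<omega>"
    using riemann_sum_limit[OF T Yc[OF \<omega>] Y1[OF \<omega>], of 0 t b] t drift_Ioc[OF \<omega>, of t] by simp
next
  fix N
  show "(\<lambda>\<omega>. \<Sum>i\<in>{idx T N 0<..idx T N t}. b (Y (real i * T / real N) \<omega>) * T / real N) \<in> borel_measurable M"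
    using T by (intro borel_measurable_sum borel_measurable_divide borel_measurable_times fY_measurable) auto
qed

text \<open>The drift coefficient is bounded, so the drift is Lipschitz in time.\<close>

lemma drift_continuous:
  assumes \<omega>: "\<omega> \<in> space M" shows "continuous_on {0..T} (\<lambda>t. drift t \<omega>)"
proof -
  let ?c = "Cm + Cs\<^sup>2"
  have c0: "?c \<ge> 0" using b_le[of 1] by linarith
  have lip: "\<bar>drift t \<omega> - drift s \<omega>\<bar> \<le> ?c * (t - s)" if "0 \<le> s" "s \<le> t" for s t
  proof -
    have "(LBINT u:{0<..s} \<union> {s<..t}. b (Y u \<omega>)) = (LBINT u:{0<..s}. b (Y u \<omega>)) + (LBINT u:{s<..t}. b (Y u \<omega>))"
      using that by (intro set_integral_Un path_set_integrable[OF Yc[OF \<omega>] Y1[OF \<omega>]]) auto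
    moreover have "{0<..s} \<union> {s<..t} = {0<..t}" using that by auto
    ultimately have "drift t \<omega> - drift s \<omega> = (LBINT u:{s<..t}. b (Y u \<omega>))"
      using that by (simp add: drift_Ioc[OF \<omega>])
    then show ?thesis using path_integral_bound[OF Yc[OF \<omega>] Y1[OF \<omega>] that b_le] by simp
  qed
  have "?c-lipschitz_on {0..T} (\<lambda>t. drift t \<omega>)"
  proof (rule lipschitz_onI)
    fix s t assume st: "s \<in> {0..T}" "t \<in> {0..T}"
    show "dist (drift s \<omega>) (drift t \<omega>) \<le> ?c * dist s t"
      using lip[of s t] lip[of t s] st by (cases "s \<le> t") (auto simp: dist_real_def abs_minus_commute)
  qed (rule c0)
  then show ?thesis by (rule lipschitz_on_continuous_on)
qed

lemma J_measurable: "t \<in> {0..T} \<Longrightarrow> J t \<in> borel_measurable M"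
  using J by (simp add: is_ito_integral_def)

lemma Zp_measurable: "t \<in> {0..T} \<Longrightarrow> Zp t \<in> borel_measurable M"
  unfolding Zp_def by (intro borel_measurable_add J_measurable drift_measurable)

lemma Zp_continuous: "\<omega> \<in> space M \<Longrightarrow> continuous_on {0..T} (\<lambda>t. Zp t \<omega>)"
  unfolding Zp_def using J by (intro continuous_on_add drift_continuous) (auto simp: is_ito_integral_def)

text \<open>Divided by its standard deviation the increment is standard normal, and the affine map
  of \<open>gauss\<close> then becomes \<open>s * D c d + e\<close>; positivity of \<open>s\<close>
  lets the square root simplify.\<close>

lemma distr_increment:
  assumes cd: "0 \<le> c" "c < d" and s: "s > 0"
  shows "distr M borel (\<lambda>\<omega>. s * D c d \<omega> + e) = gauss e (s\<^sup>2 * (d - c))"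
proof -
  let ?r = "sqrt (d - c)"
  have r: "?r > 0" using cd by simp
  have Dm' [measurable]: "D c d \<in> borel_measurable M" using cd by (intro Dm) auto
  have "distributed M lborel (\<lambda>\<omega>. (D c d \<omega> - 0) / ?r) std_normal_density"
    using D_distributed[OF cd] normal_standard_normal_convert[OF r, of "D c d" 0] by simp
  from distributed_distr_eq_density[OF this]
  have std: "distr M lborel (\<lambda>\<omega>. D c d \<omega> / ?r) = std_normal_distribution" by simp
  have "gauss e (s\<^sup>2 * (d - c)) = distr M borel ((\<lambda>x. e + sqrt (s\<^sup>2 * (d - c)) * x) \<circ> (\<lambda>\<omega>. D c d \<omega> / ?r))"
    unfolding gauss_def std[symmetric] by (rule distr_distr) auto
  also have "(\<lambda>x. e + sqrt (s\<^sup>2 * (d - c)) * x) \<circ> (\<lambda>\<omega>. D c d \<omega> / ?r) = (\<lambda>\<omega>. s * D c d \<omega> + e)"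
    using s cd r by (auto simp: fun_eq_iff real_sqrt_mult)
  finally show ?thesis ..
qed

section \<open>Euler sums on a grid that refines the coarse times\<close>

definition tt :: "nat \<Rightarrow> nat \<Rightarrow> nat \<Rightarrow> real" where "tt n q i = real i * T / real (n * Suc q)"

text \<open>One Euler step. The driving path \<open>w\<close> and the environment \<open>y\<close>
  are separate arguments, so they can be taken at independent sample points; coefficients are read
  at the beginning of the step, hence \<open>i - 1\<close>.\<close>

definition \<zeta> :: "nat \<Rightarrow> nat \<Rightarrow> nat \<Rightarrow> (real \<Rightarrow> real) \<Rightarrow> (real \<Rightarrow> nat) \<Rightarrow> real" where
  "\<zeta> n q i w y = sig (y (tt n q (i - 1))) * (w (tt n q i) - w (tt n q (i - 1))) + b (y (tt n q (i - 1))) * (T / real (n * Suc q))"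

definition U :: "nat \<Rightarrow> nat \<Rightarrow> (real \<Rightarrow> real) \<Rightarrow> (real \<Rightarrow> nat) \<Rightarrow> nat \<Rightarrow> real" where
  "U n q w y l = (\<Sum>i\<in>{0<..min l n * Suc q}. \<zeta> n q i w y)"

lemma tt_nonneg [simp]: "0 \<le> tt n q i" using T by (simp add: tt_def)

lemma tt_less: "n > 0 \<Longrightarrow> i < j \<Longrightarrow> tt n q i < tt n q j"
  unfolding tt_def using T
  by (intro divide_strict_right_mono mult_strict_right_mono) (simp_all only: of_nat_less_iff of_nat_0_less_iff nat_0_less_mult_iff zero_less_Suc simp_thms)

lemma tt_diff: "n > 0 \<Longrightarrow> i > 0 \<Longrightarrow> tt n q i - tt n q (i - 1) = T / real (n * Suc q)"
  unfolding tt_def by (cases i) (simp_all add: diff_divide_distrib[symmetric] left_diff_distrib[symmetric] del: of_nat_mult)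

text \<open>Along a frozen \<open>y\<close> the Euler increments are exactly normal, so the
  characteristic function of a block is an exponential of left Riemann sums, which converge to the
  integrals in \<open>limit_fid\<close>.\<close>

lemma inner_limit:
  fixes g :: "(nat \<Rightarrow> real) \<Rightarrow> real" and y :: "real \<Rightarrow> nat"
  assumes y: "cadlag_on {0..} y" and y1: "\<And>t. t \<ge> 0 \<Longrightarrow> y t \<ge> 1"
    and n: "n > 0" and g: "continuous_on UNIV g" and B: "\<And>x. \<bar>g x\<bar> \<le> B"
  shows "(\<lambda>q. \<integral>\<omega>. g (U n q (\<lambda>t. W t \<omega>) y) \<partial>M) \<longlonglongrightarrow> limit_fid T mu sig n y g"
proof -
  let ?I = "\<lambda>l. {real l * T / real n<..real (Suc l) * T / real n}"
  let ?a = "\<lambda>l. (LBINT s:?I l. mu (y s)) - (LBINT s:?I l. (sig (y s))\<^sup>2) / 2"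
  let ?v = "\<lambda>l. LBINT s:?I l. (sig (y s))\<^sup>2"
  let ?z = "\<lambda>q i \<omega>. \<zeta> n q i (\<lambda>t. W t \<omega>) y"
  have v0: "?v l \<ge> 0" for l unfolding set_lebesgue_integral_def by (rule integral_nonneg_AE) auto
  have "(\<lambda>q. \<integral>\<omega>. g (\<lambda>l. \<Sum>i\<in>{0<..min l n * Suc q}. ?z q i \<omega>) \<partial>M) \<longlonglongrightarrow> (\<integral>x. g (cum n x) \<partial>PiM {..<n} (\<lambda>l. gauss (?a l) (?v l)))"
  proof (rule block_convergence[where k="\<lambda>q l. l * Suc q", OF _ _ _ _ n _ _ g B])
    show "prob_space M" by (rule prob_space_axioms)
  next
    fix q
    let ?D = "\<lambda>k \<omega>. D (tt n q k) (tt n q (Suc k)) \<omega>"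
    have "indep_vars (\<lambda>_. borel) ?D {..<n * Suc q}"
      using tt_less[OF n] by (intro W_increments) auto
    \<comment> \<open>Step \<open>i\<close> uses the Wiener increment with index
      \<open>i - 1\<close>; the shift is injective on positive \<open>i\<close>, so the groups are
      disjoint.\<close>
    then have "indep_vars (\<lambda>i. PiM {i - 1} (\<lambda>_. borel)) (\<lambda>i \<omega>. restrict (\<lambda>k. ?D k \<omega>) {i - 1}) {0<..n * Suc q}"
      by (rule indep_vars_restrict) (auto simp: disjoint_family_on_def)
    then have "indep_vars (\<lambda>_. borel) (\<lambda>i \<omega>. (\<lambda>x. sig (y (tt n q (i - 1))) * x (i - 1) + b (y (tt n q (i - 1))) * (T / real (n * Suc q)))
        (restrict (\<lambda>k. ?D k \<omega>) {i - 1})) {0<..n * Suc q}"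
      by (rule indep_vars_compose2)
        (intro borel_measurable_add borel_measurable_times borel_measurable_const measurable_component_singleton, simp)
    then show "indep_vars (\<lambda>_. borel) (?z q) {0<..n * Suc q}"
      by (rule indep_vars_cong[THEN iffD1, rotated 3]) (auto simp: \<zeta>_def D_def fun_eq_iff)
  next
    fix l \<theta> assume l: "l < n"
    let ?A = "\<lambda>q. {l * Suc q<..Suc l * Suc q}"
    let ?h = "\<lambda>q. T / real (n * Suc q)"
    have ch: "char (distr M borel (?z q i)) \<theta> = exp (\<i> * \<theta> * (mu (y (tt n q (i - 1))) * ?h q - (sig (y (tt n q (i - 1))))\<^sup>2 * ?h q / 2) - \<theta>\<^sup>2 * ((sig (y (tt n q (i - 1))))\<^sup>2 * ?h q) / 2)"
      if i: "i > 0" for q i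
    proof -
      let ?s = "sig (y (tt n q (i - 1)))"
      have s: "?s > 0" by (intro sig_pos y1) simp
      have h: "?h q \<ge> 0" using T by simp
      have "distr M borel (?z q i) = gauss (b (y (tt n q (i - 1))) * ?h q) (?s\<^sup>2 * (tt n q i - tt n q (i - 1)))"
        using distr_increment[OF tt_nonneg tt_less[OF n, of "i - 1" i q] s, of "b (y (tt n q (i - 1))) * ?h q"] i
        by (simp add: \<zeta>_def D_def)
      also have "tt n q i - tt n q (i - 1) = ?h q" by (rule tt_diff[OF n i])
      finally have "char (distr M borel (?z q i)) \<theta> =
          exp (\<i> * \<theta> * (b (y (tt n q (i - 1))) * ?h q) - \<theta>\<^sup>2 * (?s\<^sup>2 * ?h q) / 2)"
        using h by (simp only:) (simp only: char_gauss mult_nonneg_nonneg zero_le_power2)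
      also have "b (y (tt n q (i - 1))) * ?h q = mu (y (tt n q (i - 1))) * ?h q - ?s\<^sup>2 * ?h q / 2"
        by (simp only: b_def left_diff_distrib times_divide_eq_left)
      finally show ?thesis .
    qed
    have prod: "(\<Prod>i\<in>?A q. char (distr M borel (?z q i)) \<theta>) =
        exp (\<i> * \<theta> * ((\<Sum>i\<in>?A q. mu (y (tt n q (i - 1))) * ?h q) - (\<Sum>i\<in>?A q. (sig (y (tt n q (i - 1))))\<^sup>2 * ?h q) / 2) - \<theta>\<^sup>2 * (\<Sum>i\<in>?A q. (sig (y (tt n q (i - 1))))\<^sup>2 * ?h q) / 2)" for q
    proof -
      have split: "(\<Sum>i\<in>S. \<i> * \<theta> * (mu (y (tt n q (i - 1))) * ?h q - (sig (y (tt n q (i - 1))))\<^sup>2 * ?h q / 2) - \<theta>\<^sup>2 * ((sig (y (tt n q (i - 1))))\<^sup>2 * ?h q) / 2)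
         = \<i> * \<theta> * ((\<Sum>i\<in>S. mu (y (tt n q (i - 1))) * ?h q) - (\<Sum>i\<in>S. (sig (y (tt n q (i - 1))))\<^sup>2 * ?h q) / 2) - \<theta>\<^sup>2 * (\<Sum>i\<in>S. (sig (y (tt n q (i - 1))))\<^sup>2 * ?h q) / 2" for S
        by (induction S rule: infinite_finite_induct)
          (simp_all add: ring_distribs add_divide_distrib diff_divide_distrib del: of_nat_mult of_nat_Suc)
      have "(\<Prod>i\<in>?A q. char (distr M borel (?z q i)) \<theta>) = (\<Prod>i\<in>?A q. exp (\<i> * \<theta> * (mu (y (tt n q (i - 1))) * ?h q - (sig (y (tt n q (i - 1))))\<^sup>2 * ?h q / 2) - \<theta>\<^sup>2 * ((sig (y (tt n q (i - 1))))\<^sup>2 * ?h q) / 2))"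
        by (intro prod.cong refl ch) auto
      also have "\<dots> = exp (\<Sum>i\<in>?A q. \<i> * \<theta> * (mu (y (tt n q (i - 1))) * ?h q - (sig (y (tt n q (i - 1))))\<^sup>2 * ?h q / 2) - \<theta>\<^sup>2 * ((sig (y (tt n q (i - 1))))\<^sup>2 * ?h q) / 2)"
        by (rule exp_sum[symmetric]) simp
      also have "(\<Sum>i\<in>?A q. \<i> * \<theta> * (mu (y (tt n q (i - 1))) * ?h q - (sig (y (tt n q (i - 1))))\<^sup>2 * ?h q / 2) - \<theta>\<^sup>2 * ((sig (y (tt n q (i - 1))))\<^sup>2 * ?h q) / 2)
         = \<i> * \<theta> * ((\<Sum>i\<in>?A q. mu (y (tt n q (i - 1))) * ?h q) - (\<Sum>i\<in>?A q. (sig (y (tt n q (i - 1))))\<^sup>2 * ?h q) / 2) - \<theta>\<^sup>2 * (\<Sum>i\<in>?A q. (sig (y (tt n q (i - 1))))\<^sup>2 * ?h q) / 2"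
        by (rule split)
      finally show ?thesis .
    qed
    have L1: "(\<lambda>q. \<Sum>i\<in>?A q. mu (y (tt n q (i - 1))) * ?h q) \<longlonglongrightarrow> (LBINT s:?I l. mu (y s))"
      unfolding tt_def by (rule shifted_sum_limit[OF T y y1 n _ _ Cm]) (use l in auto)
    have L2: "(\<lambda>q. \<Sum>i\<in>?A q. (sig (y (tt n q (i - 1))))\<^sup>2 * ?h q) \<longlonglongrightarrow> ?v l"
      unfolding tt_def by (rule shifted_sum_limit[where C="\<lambda>j. (sig j)\<^sup>2", OF T y y1 n _ _ sig2_le]) (use l in auto)
    show "(\<lambda>q. \<Prod>i\<in>?A q. char (distr M borel (?z q i)) \<theta>) \<longlonglongrightarrow> char (gauss (?a l) (?v l)) \<theta>"
      unfolding prod char_gauss[OF v0] by (intro tendsto_intros L1 L2) auto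
  qed auto
  then show ?thesis by (simp add: limit_fid_def Let_def U_def[abs_def])
qed

text \<open>When noise and environment share the sample point, Euler sums are a simple integral plus
  a Riemann sum of the drift. Coarse times are fine grid times, so the cut by \<open>min\<close>
  keeps or removes whole steps.\<close>

lemma U_simple_integral:
  assumes n: "n > 0"
  shows "U n q (\<lambda>t. W t \<omega>) (\<lambda>t. Y t \<omega>) l =
    simple_integral W (n * Suc q) (\<lambda>k. real k * T / real (n * Suc q)) (grid_xi sig T (n * Suc q)) (real (min l n) * T / real n) \<omega> +
    (\<Sum>i\<in>{0<..min l n * Suc q}. b (Y (tt n q (i - 1)) \<omega>) * (T / real (n * Suc q)))"
proof -
  let ?m = "min l n * Suc q"
  let ?s = "real (min l n) * T / real n"
  have s: "?s = tt n q ?m" unfolding tt_def using grid_ratio[OF n T, of "min l n" q] by simp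
  have mono: "tt n q i \<le> tt n q j" if "i \<le> j" for i j
    using that tt_less[OF n, of i j q] by (cases "i = j") auto
  have mN: "?m \<le> n * Suc q" by (intro mult_le_mono) auto
  have "simple_integral W (n * Suc q) (\<lambda>k. real k * T / real (n * Suc q)) (grid_xi sig T (n * Suc q)) ?s \<omega>
    = (\<Sum>k<n * Suc q. sig (Y (tt n q k) \<omega>) * (W (min (tt n q (Suc k)) (tt n q ?m)) \<omega> - W (min (tt n q k) (tt n q ?m)) \<omega>))"
    unfolding simple_integral_def grid_xi_def s by (simp only: tt_def[symmetric])
  also have "\<dots> = (\<Sum>k<?m. sig (Y (tt n q k) \<omega>) * (W (min (tt n q (Suc k)) (tt n q ?m)) \<omega> - W (min (tt n q k) (tt n q ?m)) \<omega>))"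
  proof (rule sum.mono_neutral_right)
    show "\<forall>k\<in>{..<n * Suc q} - {..<?m}. sig (Y (tt n q k) \<omega>) * (W (min (tt n q (Suc k)) (tt n q ?m)) \<omega> - W (min (tt n q k) (tt n q ?m)) \<omega>) = 0"
    proof
      fix k assume "k \<in> {..<n * Suc q} - {..<?m}"
      then have "tt n q ?m \<le> tt n q k" "tt n q ?m \<le> tt n q (Suc k)" by (auto intro!: mono)
      then show "sig (Y (tt n q k) \<omega>) * (W (min (tt n q (Suc k)) (tt n q ?m)) \<omega> - W (min (tt n q k) (tt n q ?m)) \<omega>) = 0"
        by (simp only: min_absorb2) simp
    qed
  qed (use mN in auto)
  also have "\<dots> = (\<Sum>k<?m. sig (Y (tt n q k) \<omega>) * (W (tt n q (Suc k)) \<omega> - W (tt n q k) \<omega>))"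
  proof (rule sum.cong[OF refl])
    fix k assume "k \<in> {..<?m}"
    then have "tt n q k \<le> tt n q ?m" "tt n q (Suc k) \<le> tt n q ?m" by (auto intro!: mono)
    then show "sig (Y (tt n q k) \<omega>) * (W (min (tt n q (Suc k)) (tt n q ?m)) \<omega> - W (min (tt n q k) (tt n q ?m)) \<omega>)
        = sig (Y (tt n q k) \<omega>) * (W (tt n q (Suc k)) \<omega> - W (tt n q k) \<omega>)"
      by (simp only: min_absorb1)
  qed
  also have "\<dots> = (\<Sum>i\<in>{0<..?m}. sig (Y (tt n q (i - 1)) \<omega>) * (W (tt n q (Suc (i - 1))) \<omega> - W (tt n q (i - 1)) \<omega>))"
    by (rule sum_shift[symmetric])
  also have "\<dots> = (\<Sum>i\<in>{0<..?m}. sig (Y (tt n q (i - 1)) \<omega>) * (W (tt n q i) \<omega> - W (tt n q (i - 1)) \<omega>))"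
    by (intro sum.cong refl) auto
  finally show ?thesis by (simp add: U_def \<zeta>_def sum.distrib)
qed

lemma U_measurable_pair:
  fixes g :: "(nat \<Rightarrow> real) \<Rightarrow> real"
  assumes g: "g \<in> borel_measurable borel"
  shows "(\<lambda>(w, y). g (U n q w y)) \<in> borel_measurable (PiM {0..} (\<lambda>_. borel) \<Otimes>\<^sub>M PiM {0..} (\<lambda>_. count_space UNIV))"
proof -
  let ?Q = "PiM {0..} (\<lambda>_. borel :: real measure) \<Otimes>\<^sub>M PiM {0..} (\<lambda>_. count_space (UNIV :: nat set))"
  have w: "(\<lambda>z. fst z (tt n q i)) \<in> borel_measurable ?Q" for i
    by (rule measurable_compose[OF measurable_fst measurable_component_singleton]) simp
  have y: "(\<lambda>z. snd z (tt n q i)) \<in> ?Q \<rightarrow>\<^sub>M count_space UNIV" for i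
    by (rule measurable_compose[OF measurable_snd measurable_component_singleton]) simp
  have fy: "(\<lambda>z. f (snd z (tt n q i))) \<in> borel_measurable ?Q" for i and f :: "nat \<Rightarrow> real"
    using measurable_compose[OF y, of f borel] by simp
  have "(\<lambda>z. U n q (fst z) (snd z)) \<in> borel_measurable ?Q"
    unfolding U_def[abs_def] \<zeta>_def
    by (intro measurable_coordinatewise_then_product borel_measurable_sum borel_measurable_add borel_measurable_times borel_measurable_diff w fy borel_measurable_const)
  from measurable_compose[OF this g] show ?thesis by (simp add: case_prod_beta)
qed

lemma U_fubini:
  fixes g :: "(nat \<Rightarrow> real) \<Rightarrow> real"
  assumes g: "g \<in> borel_measurable borel" and B: "\<And>x. \<bar>g x\<bar> \<le> B"
  shows "(\<integral>\<omega>. g (U n q (\<lambda>t. W t \<omega>) (\<lambda>t. Y t \<omega>)) \<partial>M) = (\<integral>\<omega>'. (\<integral>\<omega>. g (U n q (\<lambda>t. W t \<omega>) (\<lambda>t. Y t \<omega>')) \<partial>M) \<partial>M)"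
    and "(\<lambda>\<omega>'. \<integral>\<omega>. g (U n q (\<lambda>t. W t \<omega>) (\<lambda>t. Y t \<omega>')) \<partial>M) \<in> borel_measurable M"
proof -
  \<comment> \<open>\<open>U\<close> reads its arguments at nonnegative times only, so restricting
    the paths to \<open>{0..}\<close> is invisible.\<close>
  have r: "U n q (\<lambda>t\<in>{0..}. w t) (\<lambda>t\<in>{0..}. y t) = U n q w y" for w y
    by (simp add: U_def \<zeta>_def fun_eq_iff)
  from indep_elements_integral[OF WY U_measurable_pair[OF g, of n q] B]
  show "(\<integral>\<omega>. g (U n q (\<lambda>t. W t \<omega>) (\<lambda>t. Y t \<omega>)) \<partial>M) = (\<integral>\<omega>'. (\<integral>\<omega>. g (U n q (\<lambda>t. W t \<omega>) (\<lambda>t. Y t \<omega>')) \<partial>M) \<partial>M)"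
    unfolding r .
  have X: "(\<lambda>\<omega>. \<lambda>t\<in>{0..}. W t \<omega>) \<in> M \<rightarrow>\<^sub>M PiM {0..} (\<lambda>_. borel)"
    and X': "(\<lambda>\<omega>. \<lambda>t\<in>{0..}. Y t \<omega>) \<in> M \<rightarrow>\<^sub>M PiM {0..} (\<lambda>_. count_space UNIV)"
    using WY by (auto simp: indep_elements_def)
  have "(\<lambda>z. ((\<lambda>t\<in>{0..}. W t (snd z)), (\<lambda>t\<in>{0..}. Y t (fst z)))) \<in> M \<Otimes>\<^sub>M M \<rightarrow>\<^sub>M PiM {0..} (\<lambda>_. borel) \<Otimes>\<^sub>M PiM {0..} (\<lambda>_. count_space UNIV)"
    by (rule measurable_Pair[OF measurable_compose[OF measurable_snd X] measurable_compose[OF measurable_fst X']])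
  from measurable_compose[OF this U_measurable_pair[OF g, of n q]]
  have "(\<lambda>(\<omega>', \<omega>). g (U n q (\<lambda>t. W t \<omega>) (\<lambda>t. Y t \<omega>'))) \<in> borel_measurable (M \<Otimes>\<^sub>M M)"
    unfolding prod.case r by (simp add: case_prod_beta)
  then show "(\<lambda>\<omega>'. \<integral>\<omega>. g (U n q (\<lambda>t. W t \<omega>) (\<lambda>t. Y t \<omega>')) \<partial>M) \<in> borel_measurable M"
    by (rule borel_measurable_lebesgue_integral)
qed

text \<open>Nonnegativity of the variance bounds the mean of \<open>min 1 |X|\<close> by its root
  mean square, which is at most that of \<open>X\<close>. The truncated mean is the form of
  convergence in probability used below.\<close>

lemma expectation_min_L2:
  assumes X: "\<And>q::nat. X q \<in> borel_measurable M" and lim: "(\<lambda>q. \<integral>\<^sup>+\<omega>. ennreal ((X q \<omega>)\<^sup>2) \<partial>M) \<longlonglongrightarrow> 0"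
  shows "(\<lambda>q. expectation (\<lambda>\<omega>. min 1 \<bar>X q \<omega>\<bar>)) \<longlonglongrightarrow> 0"
proof -
  let ?m = "\<lambda>q \<omega>. min 1 \<bar>X q \<omega>\<bar>"
  note [measurable] = X
  have i1: "integrable M (?m q)" for q by (rule integrable_const_bound[of _ 1]) auto
  have i2: "integrable M (\<lambda>\<omega>. (?m q \<omega>)\<^sup>2)" for q
    by (rule integrable_const_bound[of _ 1]) (auto simp: power_le_one)
  have "(\<lambda>q. ennreal (expectation (\<lambda>\<omega>. (?m q \<omega>)\<^sup>2))) \<longlonglongrightarrow> 0"
  proof (rule tendsto_sandwich[OF _ _ tendsto_const lim])
    show "eventually (\<lambda>q. ennreal (expectation (\<lambda>\<omega>. (?m q \<omega>)\<^sup>2)) \<le> (\<integral>\<^sup>+\<omega>. ennreal ((X q \<omega>)\<^sup>2) \<partial>M)) sequentially"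
    proof (rule always_eventually, rule allI)
      fix q
      have "ennreal (expectation (\<lambda>\<omega>. (?m q \<omega>)\<^sup>2)) = (\<integral>\<^sup>+\<omega>. ennreal ((?m q \<omega>)\<^sup>2) \<partial>M)"
        by (rule nn_integral_eq_integral[OF i2, symmetric]) simp
      also have "\<dots> \<le> (\<integral>\<^sup>+\<omega>. ennreal ((X q \<omega>)\<^sup>2) \<partial>M)"
      proof (rule nn_integral_mono, rule ennreal_leI)
        fix \<omega>
        have "(?m q \<omega>)\<^sup>2 \<le> \<bar>X q \<omega>\<bar>\<^sup>2" by (rule power_mono) auto
        then show "(?m q \<omega>)\<^sup>2 \<le> (X q \<omega>)\<^sup>2" by simp
      qed
      finally show "ennreal (expectation (\<lambda>\<omega>. (?m q \<omega>)\<^sup>2)) \<le> (\<integral>\<^sup>+\<omega>. ennreal ((X q \<omega>)\<^sup>2) \<partial>M)" .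
    qed
  qed simp
  then have "(\<lambda>q. ennreal (expectation (\<lambda>\<omega>. (?m q \<omega>)\<^sup>2))) \<longlonglongrightarrow> ennreal 0" by simp
  from tendsto_enn2real[OF this]
  have "(\<lambda>q. expectation (\<lambda>\<omega>. (?m q \<omega>)\<^sup>2)) \<longlonglongrightarrow> 0" by simp
  then have s: "(\<lambda>q. sqrt (expectation (\<lambda>\<omega>. (?m q \<omega>)\<^sup>2))) \<longlonglongrightarrow> 0" using tendsto_real_sqrt by fastforce
  show ?thesis
  proof (rule Lim_null_comparison[OF _ s], rule always_eventually, rule allI)
    fix q
    have "0 \<le> variance (?m q)" by (rule variance_positive)
    then have "(expectation (?m q))\<^sup>2 \<le> expectation (\<lambda>\<omega>. (?m q \<omega>)\<^sup>2)" using variance_eq[OF i1 i2] by simp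
    then show "norm (expectation (?m q)) \<le> sqrt (expectation (\<lambda>\<omega>. (?m q \<omega>)\<^sup>2))"
      by (simp add: real_le_rsqrt)
  qed
qed

text \<open>The error at each coarse time splits into a stochastic part \<open>A\<close>, which
  vanishes in mean square, and a drift part \<open>R\<close>, which vanishes pointwise. Truncated at
  1, both vanish in mean, and the change of \<open>g\<close> is bounded by a multiple of their
  sum.\<close>

lemma U_converges:
  fixes g :: "(nat \<Rightarrow> real) \<Rightarrow> real"
  assumes n: "n > 0" and g: "g \<in> borel_measurable borel" and B: "\<And>x. \<bar>g x\<bar> \<le> B" and L: "L \<ge> 0"
    and lip: "\<And>x z. \<bar>g x - g z\<bar> \<le> L * (\<Sum>l\<le>n. \<bar>x l - z l\<bar>)"
  shows "(\<lambda>q. \<integral>\<omega>. g (U n q (\<lambda>t. W t \<omega>) (\<lambda>t. Y t \<omega>)) \<partial>M) \<longlonglongrightarrow> (\<integral>\<omega>. g (\<lambda>l. Zp (real (min l n) * T / real n) \<omega>) \<partial>M)"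
proof -
  define s where "s l = real (min l n) * T / real n" for l
  have s: "s l \<in> {0..T}" for l unfolding s_def using n T by (auto simp: field_simps min_def)
  define A where "A l q \<omega> = simple_integral W (n * Suc q) (\<lambda>k. real k * T / real (n * Suc q)) (grid_xi sig T (n * Suc q)) (s l) \<omega> - J (s l) \<omega>" for l q \<omega>
  define R where "R l q \<omega> = (\<Sum>i\<in>{0<..min l n * Suc q}. b (Y (tt n q (i - 1)) \<omega>) * (T / real (n * Suc q))) - drift (s l) \<omega>" for l q \<omega>
  have Npos: "n * Suc q > 0" for q using n by simp
  note sp = grid_simple_process[OF T Npos Y1 Cs]
  have Am [measurable]: "A l q \<in> borel_measurable M" for l q
    unfolding A_def using s[of l] by (intro borel_measurable_diff simple_integral_measurable[OF sp] J_measurable) auto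
  have Rm [measurable]: "R l q \<in> borel_measurable M" for l q
    unfolding R_def by (intro borel_measurable_diff borel_measurable_sum borel_measurable_times fY_measurable drift_measurable s) auto
  have H: "(\<lambda>(s, \<omega>). sig (Y s \<omega>)) \<in> borel_measurable (restrict_space borel {0..T} \<Otimes>\<^sub>M M)"
    using J by (simp add: is_ito_integral_def)
  have Alim: "(\<lambda>q. expectation (\<lambda>\<omega>. min 1 \<bar>A l q \<omega>\<bar>)) \<longlonglongrightarrow> 0" for l
  proof (rule expectation_min_L2[OF Am])
    show "(\<lambda>q. \<integral>\<^sup>+\<omega>. ennreal ((A l q \<omega>)\<^sup>2) \<partial>M) \<longlonglongrightarrow> 0"
      unfolding A_def
      by (rule ito_L2_limit[OF J sp grid_L2_convergence[OF T Npos filterlim_grid[OF n] Yc Y1 Cs H] s])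
  qed
  have Rlim: "(\<lambda>q. expectation (\<lambda>\<omega>. min 1 \<bar>R l q \<omega>\<bar>)) \<longlonglongrightarrow> 0" for l
  proof -
    have "(\<lambda>q. expectation (\<lambda>\<omega>. min 1 \<bar>R l q \<omega>\<bar>)) \<longlonglongrightarrow> expectation (\<lambda>_. 0)"
    proof (rule integral_dominated_convergence[where w="\<lambda>_. 1"])
      show "AE \<omega> in M. (\<lambda>q. min 1 \<bar>R l q \<omega>\<bar>) \<longlonglongrightarrow> 0"
      proof (rule AE_I2)
        fix \<omega> assume \<omega>: "\<omega> \<in> space M"
        have "(\<lambda>q. \<Sum>i\<in>{0 * Suc q<..min l n * Suc q}. b (Y (tt n q (i - 1)) \<omega>) * (T / real (n * Suc q)))
            \<longlonglongrightarrow> (LBINT u:{real 0 * T / real n<..s l}. b (Y u \<omega>))"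
          unfolding tt_def s_def by (rule shifted_sum_limit[OF T Yc[OF \<omega>] Y1[OF \<omega>] n _ _ b_le]) auto
        then have "(\<lambda>q. R l q \<omega>) \<longlonglongrightarrow> drift (s l) \<omega> - drift (s l) \<omega>"
          unfolding R_def using drift_Ioc[OF \<omega>, of "s l"] s[of l] by (intro tendsto_diff tendsto_const) simp
        then have "(\<lambda>q. R l q \<omega>) \<longlonglongrightarrow> 0" by simp
        then have "(\<lambda>q. min 1 \<bar>R l q \<omega>\<bar>) \<longlonglongrightarrow> min 1 \<bar>0\<bar>" by (intro tendsto_intros)
        then show "(\<lambda>q. min 1 \<bar>R l q \<omega>\<bar>) \<longlonglongrightarrow> 0" by simp
      qed
    qed auto
    then show ?thesis by simp
  qed
  \<comment> \<open>\<open>L\<close> serves when all errors are below 1; otherwise the change of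
    \<open>g\<close> is at most \<open>2 * B\<close> and some truncated error equals 1.\<close>
  let ?K = "L + 2 * B"
  have B0: "B \<ge> 0" using B[of "\<lambda>_. 0"] by linarith
  let ?U = "\<lambda>q \<omega>. U n q (\<lambda>t. W t \<omega>) (\<lambda>t. Y t \<omega>)" and ?Z = "\<lambda>\<omega> l. Zp (s l) \<omega>"
  have UZ: "?U q \<omega> l - ?Z \<omega> l = A l q \<omega> + R l q \<omega>" for q \<omega> l
    unfolding U_simple_integral[OF n] A_def R_def Zp_def s_def by simp
  have pw: "\<bar>g (?U q \<omega>) - g (?Z \<omega>)\<bar> \<le> ?K * (\<Sum>l\<le>n. min 1 \<bar>A l q \<omega>\<bar> + min 1 \<bar>R l q \<omega>\<bar>)" for q \<omega>
  proof (cases "\<exists>l\<le>n. \<bar>A l q \<omega>\<bar> \<ge> 1 \<or> \<bar>R l q \<omega>\<bar> \<ge> 1")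
    case True
    then obtain l where l: "l \<le> n" "\<bar>A l q \<omega>\<bar> \<ge> 1 \<or> \<bar>R l q \<omega>\<bar> \<ge> 1" by blast
    then have "1 \<le> min 1 \<bar>A l q \<omega>\<bar> + min 1 \<bar>R l q \<omega>\<bar>" by (auto simp: min_def)
    also have "\<dots> \<le> (\<Sum>l\<le>n. min 1 \<bar>A l q \<omega>\<bar> + min 1 \<bar>R l q \<omega>\<bar>)" by (rule member_le_sum) (use l in auto)
    finally have "?K * 1 \<le> ?K * (\<Sum>l\<le>n. min 1 \<bar>A l q \<omega>\<bar> + min 1 \<bar>R l q \<omega>\<bar>)" using L B0 by (intro mult_left_mono) auto
    then have "?K \<le> ?K * (\<Sum>l\<le>n. min 1 \<bar>A l q \<omega>\<bar> + min 1 \<bar>R l q \<omega>\<bar>)" by (simp only: mult_1_right)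
    moreover have "\<bar>g (?U q \<omega>) - g (?Z \<omega>)\<bar> \<le> ?K" using B[of "?U q \<omega>"] B[of "?Z \<omega>"] L by linarith
    ultimately show ?thesis by linarith
  next
    case False
    have "\<bar>g (?U q \<omega>) - g (?Z \<omega>)\<bar> \<le> L * (\<Sum>l\<le>n. \<bar>?U q \<omega> l - ?Z \<omega> l\<bar>)" by (rule lip)
    also have "\<dots> \<le> L * (\<Sum>l\<le>n. min 1 \<bar>A l q \<omega>\<bar> + min 1 \<bar>R l q \<omega>\<bar>)"
    proof (intro mult_left_mono sum_mono L)
      fix l assume "l \<in> {..n}"
      then have "\<bar>A l q \<omega>\<bar> < 1" "\<bar>R l q \<omega>\<bar> < 1" using False by (meson atMost_iff not_le)+
      then show "\<bar>?U q \<omega> l - ?Z \<omega> l\<bar> \<le> min 1 \<bar>A l q \<omega>\<bar> + min 1 \<bar>R l q \<omega>\<bar>"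
        unfolding UZ by (simp add: min_def abs_triangle_ineq)
    qed
    also have "\<dots> \<le> ?K * (\<Sum>l\<le>n. min 1 \<bar>A l q \<omega>\<bar> + min 1 \<bar>R l q \<omega>\<bar>)"
      using B0 by (intro mult_right_mono sum_nonneg) auto
    finally show ?thesis .
  qed
  have Zm: "(\<lambda>\<omega>. g (?Z \<omega>)) \<in> borel_measurable M"
    by (rule measurable_compose[OF measurable_nat_fun g]) (intro Zp_measurable s)
  have Um: "(\<lambda>\<omega>. g (?U q \<omega>)) \<in> borel_measurable M" for q
  proof (rule measurable_compose[OF measurable_nat_fun g])
    fix l
    have "(\<lambda>\<omega>. A l q \<omega> + R l q \<omega> + Zp (s l) \<omega>) \<in> borel_measurable M" using Zp_measurable[OF s] by auto
    moreover have "?U q \<omega> l = A l q \<omega> + R l q \<omega> + Zp (s l) \<omega>" for \<omega> using UZ[of q \<omega> l] by simp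
    ultimately show "(\<lambda>\<omega>. ?U q \<omega> l) \<in> borel_measurable M" by simp
  qed
  have iU: "integrable M (\<lambda>\<omega>. g (?U q \<omega>))" for q by (rule integrable_const_bound[of _ B]) (use B Um in auto)
  have iZ: "integrable M (\<lambda>\<omega>. g (?Z \<omega>))" by (rule integrable_const_bound[of _ B]) (use B Zm in auto)
  have im: "integrable M (\<lambda>\<omega>. min 1 \<bar>A l q \<omega>\<bar>)" "integrable M (\<lambda>\<omega>. min 1 \<bar>R l q \<omega>\<bar>)" for l q
    by (rule integrable_const_bound[of _ 1]; auto)+
  have "(\<lambda>q. (\<integral>\<omega>. g (?U q \<omega>) \<partial>M) - (\<integral>\<omega>. g (?Z \<omega>) \<partial>M)) \<longlonglongrightarrow> 0"
  proof (rule Lim_null_comparison)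
    show "eventually (\<lambda>q. norm ((\<integral>\<omega>. g (?U q \<omega>) \<partial>M) - (\<integral>\<omega>. g (?Z \<omega>) \<partial>M))
        \<le> ?K * (\<Sum>l\<le>n. expectation (\<lambda>\<omega>. min 1 \<bar>A l q \<omega>\<bar>) + expectation (\<lambda>\<omega>. min 1 \<bar>R l q \<omega>\<bar>))) sequentially"
    proof (rule always_eventually, rule allI)
      fix q
      have "norm ((\<integral>\<omega>. g (?U q \<omega>) \<partial>M) - (\<integral>\<omega>. g (?Z \<omega>) \<partial>M)) = norm (\<integral>\<omega>. g (?U q \<omega>) - g (?Z \<omega>) \<partial>M)"
        using iU iZ by simp
      also have "\<dots> \<le> (\<integral>\<omega>. norm (g (?U q \<omega>) - g (?Z \<omega>)) \<partial>M)" by (rule integral_norm_bound)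
      also have "\<dots> \<le> (\<integral>\<omega>. ?K * (\<Sum>l\<le>n. min 1 \<bar>A l q \<omega>\<bar> + min 1 \<bar>R l q \<omega>\<bar>) \<partial>M)"
      proof (rule integral_mono)
        show "integrable M (\<lambda>\<omega>. norm (g (?U q \<omega>) - g (?Z \<omega>)))" by (rule integrable_norm[OF Bochner_Integration.integrable_diff[OF iU iZ]])
        show "integrable M (\<lambda>\<omega>. ?K * (\<Sum>l\<le>n. min 1 \<bar>A l q \<omega>\<bar> + min 1 \<bar>R l q \<omega>\<bar>))"
          by (intro integrable_mult_right Bochner_Integration.integrable_sum Bochner_Integration.integrable_add im)
      qed (use pw in simp)
      also have "\<dots> = ?K * (\<Sum>l\<le>n. expectation (\<lambda>\<omega>. min 1 \<bar>A l q \<omega>\<bar>) + expectation (\<lambda>\<omega>. min 1 \<bar>R l q \<omega>\<bar>))"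
        using im by simp
      finally show "norm ((\<integral>\<omega>. g (?U q \<omega>) \<partial>M) - (\<integral>\<omega>. g (?Z \<omega>) \<partial>M))
        \<le> ?K * (\<Sum>l\<le>n. expectation (\<lambda>\<omega>. min 1 \<bar>A l q \<omega>\<bar>) + expectation (\<lambda>\<omega>. min 1 \<bar>R l q \<omega>\<bar>))" .
    qed
    have "(\<lambda>q. ?K * (\<Sum>l\<le>n. expectation (\<lambda>\<omega>. min 1 \<bar>A l q \<omega>\<bar>) + expectation (\<lambda>\<omega>. min 1 \<bar>R l q \<omega>\<bar>))) \<longlonglongrightarrow> ?K * (\<Sum>l\<le>n. 0 + 0)"
      by (intro tendsto_mult tendsto_const tendsto_sum tendsto_add Alim Rlim)
    then show "(\<lambda>q. ?K * (\<Sum>l\<le>n. expectation (\<lambda>\<omega>. min 1 \<bar>A l q \<omega>\<bar>) + expectation (\<lambda>\<omega>. min 1 \<bar>R l q \<omega>\<bar>))) \<longlonglongrightarrow> 0" by simp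
  qed
  then show ?thesis unfolding s_def by (simp add: LIM_zero_iff)
qed

lemma expectation_fid:
  fixes g :: "(nat \<Rightarrow> real) \<Rightarrow> real"
  assumes n: "n > 0" and g: "continuous_on UNIV g" and B: "\<And>x. \<bar>g x\<bar> \<le> B" and L: "L \<ge> 0"
    and lip: "\<And>x z. \<bar>g x - g z\<bar> \<le> L * (\<Sum>l\<le>n. \<bar>x l - z l\<bar>)"
  shows "(\<lambda>\<omega>. limit_fid T mu sig n (\<lambda>t. Y t \<omega>) g) \<in> borel_measurable M"
    and "\<And>\<omega>. \<omega> \<in> space M \<Longrightarrow> \<bar>limit_fid T mu sig n (\<lambda>t. Y t \<omega>) g\<bar> \<le> B"
    and "(\<integral>\<omega>. g (\<lambda>l. Zp (real (min l n) * T / real n) \<omega>) \<partial>M) = (\<integral>\<omega>. limit_fid T mu sig n (\<lambda>t. Y t \<omega>) g \<partial>M)"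
proof -
  have gm: "g \<in> borel_measurable borel" using g by (rule borel_measurable_continuous_onI)
  let ?I = "\<lambda>q \<omega>'. \<integral>\<omega>. g (U n q (\<lambda>t. W t \<omega>) (\<lambda>t. Y t \<omega>')) \<partial>M"
  have lim: "(\<lambda>q. ?I q \<omega>') \<longlonglongrightarrow> limit_fid T mu sig n (\<lambda>t. Y t \<omega>') g" if "\<omega>' \<in> space M" for \<omega>'
    by (rule inner_limit[OF Yc[OF that] Y1[OF that] n g B])
  have Ib: "\<bar>?I q \<omega>'\<bar> \<le> B" for q \<omega>'
  proof (cases "integrable M (\<lambda>\<omega>. g (U n q (\<lambda>t. W t \<omega>) (\<lambda>t. Y t \<omega>')))")
    case True
    have "\<bar>?I q \<omega>'\<bar> \<le> (\<integral>\<omega>. \<bar>g (U n q (\<lambda>t. W t \<omega>) (\<lambda>t. Y t \<omega>'))\<bar> \<partial>M)"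
      using integral_norm_bound[of M "\<lambda>\<omega>. g (U n q (\<lambda>t. W t \<omega>) (\<lambda>t. Y t \<omega>'))"] by simp
    also have "\<dots> \<le> B" by (rule integral_le_const[OF integrable_abs[OF True]]) (use B in auto)
    finally show ?thesis .
  next
    case False
    then show ?thesis using B[of "\<lambda>_. 0"] by (simp add: not_integrable_integral_eq)
  qed
  show m: "(\<lambda>\<omega>. limit_fid T mu sig n (\<lambda>t. Y t \<omega>) g) \<in> borel_measurable M"
    by (rule borel_measurable_LIMSEQ_real[OF lim U_fubini(2)[OF gm B]])
  show "\<bar>limit_fid T mu sig n (\<lambda>t. Y t \<omega>) g\<bar> \<le> B" if "\<omega> \<in> space M" for \<omega>
    by (rule tendsto_upperbound[OF tendsto_rabs[OF lim[OF that]]]) (use Ib in auto)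
  have "(\<lambda>q. \<integral>\<omega>'. ?I q \<omega>' \<partial>M) \<longlonglongrightarrow> (\<integral>\<omega>. limit_fid T mu sig n (\<lambda>t. Y t \<omega>) g \<partial>M)"
  proof (rule integral_dominated_convergence[where w="\<lambda>_. B", OF m U_fubini(2)[OF gm B]])
    show "AE \<omega> in M. (\<lambda>q. ?I q \<omega>) \<longlonglongrightarrow> limit_fid T mu sig n (\<lambda>t. Y t \<omega>) g" using lim by (rule AE_I2)
  qed (use Ib in auto)
  then have "(\<lambda>q. \<integral>\<omega>. g (U n q (\<lambda>t. W t \<omega>) (\<lambda>t. Y t \<omega>)) \<partial>M) \<longlonglongrightarrow> (\<integral>\<omega>. limit_fid T mu sig n (\<lambda>t. Y t \<omega>) g \<partial>M)"
    unfolding U_fubini(1)[OF gm B] .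
  then show "(\<integral>\<omega>. g (\<lambda>l. Zp (real (min l n) * T / real n) \<omega>) \<partial>M) = (\<integral>\<omega>. limit_fid T mu sig n (\<lambda>t. Y t \<omega>) g \<partial>M)"
    by (rule LIMSEQ_unique[OF U_converges[OF n gm B L lip]])
qed

end

section \<open>Convergence of the cumulative log-returns\<close>

context discrete_model
begin

definition log_sum :: "nat \<Rightarrow> (nat \<Rightarrow> nat) \<Rightarrow> nat \<Rightarrow> 'b \<Rightarrow> real" where
  "log_sum N y m \<omega> = (\<Sum>i\<in>{0<..min m N}. ln (1 + R N i (y i) \<omega>))"

lemma log_sum_cong: "(\<And>i. 0 < i \<Longrightarrow> i \<le> N \<Longrightarrow> y i = z i) \<Longrightarrow> log_sum N y = log_sum N z"
  unfolding log_sum_def by (intro ext sum.cong) auto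

lemma log_sum_measurable:
  assumes "N \<ge> 1" and y: "\<And>i. (\<lambda>\<omega>. y i \<omega>) \<in> P N \<rightarrow>\<^sub>M count_space UNIV" and y1: "\<And>i \<omega>. \<omega> \<in> space (P N) \<Longrightarrow> y i \<omega> \<ge> 1"
  shows "(\<lambda>\<omega>. log_sum N (\<lambda>i. y i \<omega>) m \<omega>) \<in> borel_measurable (P N)"
  unfolding log_sum_def
proof (intro borel_measurable_sum)
  fix i assume i: "i \<in> {0<..min m N}"
  \<comment> \<open>Measurability of the returns is known for states from 1 on; \<open>max 1\<close>
    makes every case of the countable index measurable and agrees with the actual state.\<close>
  have "(\<lambda>\<omega>. R N i (max 1 (y i \<omega>)) \<omega>) \<in> borel_measurable (P N)"
    by (rule measurable_compose_countable[OF _ y]) (use i assms(1) R_measurable in auto)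
  then have "(\<lambda>\<omega>. R N i (y i \<omega>) \<omega>) \<in> borel_measurable (P N)"
    by (rule measurable_cong[THEN iffD1, rotated]) (use y1[of _ i] in \<open>auto simp: max_def\<close>)
  then show "(\<lambda>\<omega>. ln (1 + R N i (y i \<omega>) \<omega>)) \<in> borel_measurable (P N)" by measurable
qed

text \<open>Condition (iv) lets the environment be taken at an independent sample point. The sums
  start at \<open>i = 1\<close>, so they read exactly coordinates that belong to the two independent
  families.\<close>

lemma expectation_mixture:
  fixes f :: "(real \<Rightarrow> real) \<Rightarrow> real"
  assumes N: "N \<ge> 1" and y1: "\<And>i \<omega>. \<omega> \<in> space (P N) \<Longrightarrow> y i \<omega> \<ge> 1"
    and ind: "indep_elements (P N)
          (PiM ({0..N} \<times> {1..}) (\<lambda>_. borel)) (\<lambda>\<omega>. \<lambda>(i, j)\<in>{0..N} \<times> {1..}. R N i j \<omega>)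
          (PiM {1..N} (\<lambda>_. count_space UNIV)) (\<lambda>\<omega>. \<lambda>k\<in>{1..N}. y k \<omega>)"
    and f [measurable]: "f \<in> borel_measurable (borel_of_top (skorokhod_topology T))"
    and B: "\<And>x. x \<in> skorokhod_space T \<Longrightarrow> \<bar>f x\<bar> \<le> B"
  shows "(\<integral>\<omega>. f (grid_step T N (\<lambda>m. log_sum N (\<lambda>i. y i \<omega>) m \<omega>)) \<partial>P N) =
    (\<integral>\<omega>'. (\<integral>\<omega>. f (grid_step T N (\<lambda>m. log_sum N (\<lambda>i. y i \<omega>') m \<omega>)) \<partial>P N) \<partial>P N)"
proof -
  interpret prob_space "P N" by (rule P[OF N])
  let ?S = "PiM ({0..N} \<times> {1::nat..}) (\<lambda>_. borel :: real measure)" and ?S' = "PiM {1..N} (\<lambda>_. count_space (UNIV :: nat set))"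
  let ?X = "\<lambda>\<omega>. \<lambda>(i, j)\<in>{0..N} \<times> {1..}. R N i j \<omega>" and ?Y = "\<lambda>\<omega>. \<lambda>k\<in>{1..N}. y k \<omega>"
  \<comment> \<open>\<open>G\<close> must be measurable on all state sequences, also on those
    containing 0; hence \<open>max 1\<close>.\<close>
  define G :: "(nat \<times> nat \<Rightarrow> real) \<Rightarrow> (nat \<Rightarrow> nat) \<Rightarrow> real" where
    "G r z = f (grid_step T N (\<lambda>m. \<Sum>i\<in>{0<..min m N}. ln (1 + r (i, max 1 (z i)))))" for r z
  have m1: "(\<lambda>w. fst w (i, max 1 (snd w i))) \<in> borel_measurable (?S \<Otimes>\<^sub>M ?S')" if "i \<in> {0<..min m N}" for i m
  proof (rule measurable_compose_countable[where f = "\<lambda>j w. fst w (i, max 1 j)" and g = "\<lambda>w. snd w i"])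
    show "(\<lambda>w. fst w (i, max 1 j)) \<in> borel_measurable (?S \<Otimes>\<^sub>M ?S')" for j
      using that by (intro measurable_compose[OF measurable_fst measurable_component_singleton]) auto
    show "(\<lambda>w. snd w i) \<in> ?S \<Otimes>\<^sub>M ?S' \<rightarrow>\<^sub>M count_space UNIV"
      using that by (intro measurable_compose[OF measurable_snd measurable_component_singleton]) auto
  qed
  have "(\<lambda>w. (\<Sum>i\<in>{0<..min m N}. ln (1 + fst w (i, max 1 (snd w i))))) \<in> borel_measurable (?S \<Otimes>\<^sub>M ?S')" for m
    by (intro borel_measurable_sum borel_measurable_ln borel_measurable_add borel_measurable_const m1)
  then have "(\<lambda>w m. (\<Sum>i\<in>{0<..min m N}. ln (1 + fst w (i, max 1 (snd w i))))) \<in> borel_measurable (?S \<Otimes>\<^sub>M ?S')"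
    by (rule measurable_nat_fun)
  from measurable_compose[OF measurable_compose[OF this measurable_grid_step[OF T]] f]
  have Gm: "(\<lambda>(r, z). G r z) \<in> borel_measurable (?S \<Otimes>\<^sub>M ?S')" by (simp add: G_def split_beta')
  have GB: "\<bar>G r z\<bar> \<le> B" for r z unfolding G_def by (rule B[OF grid_step_skorokhod[OF T]])
  have eq: "G (?X \<omega>) (?Y \<omega>') = f (grid_step T N (\<lambda>m. log_sum N (\<lambda>i. y i \<omega>') m \<omega>))" if "\<omega>' \<in> space (P N)" for \<omega> \<omega>'
  proof -
    have "(\<Sum>i\<in>{0<..min m N}. ln (1 + ?X \<omega> (i, max 1 (?Y \<omega>' i)))) = log_sum N (\<lambda>i. y i \<omega>') m \<omega>" for m
      unfolding log_sum_def using y1[OF that] by (intro sum.cong refl) (auto simp: max_def)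
    then show ?thesis by (simp add: G_def)
  qed
  have "(\<integral>\<omega>. f (grid_step T N (\<lambda>m. log_sum N (\<lambda>i. y i \<omega>) m \<omega>)) \<partial>P N) = (\<integral>\<omega>. G (?X \<omega>) (?Y \<omega>) \<partial>P N)"
    by (intro Bochner_Integration.integral_cong refl eq[symmetric])
  also have "\<dots> = (\<integral>\<omega>'. (\<integral>\<omega>. G (?X \<omega>) (?Y \<omega>') \<partial>P N) \<partial>P N)" by (rule indep_elements_integral[OF ind Gm GB])
  also have "\<dots> = (\<integral>\<omega>'. (\<integral>\<omega>. f (grid_step T N (\<lambda>m. log_sum N (\<lambda>i. y i \<omega>') m \<omega>)) \<partial>P N) \<partial>P N)"
    by (intro Bochner_Integration.integral_cong refl eq)
  finally show ?thesis .
qed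

end

text \<open>Sampled step paths of the continuous process converge to it uniformly, so
  \<open>f\<close> of them converges boundedly; for each \<open>n > 0\<close> their expectation is
  the mean of \<open>limit_fid\<close>.\<close>

lemma (in limit_model) expectation_limit:
  fixes f :: "(real \<Rightarrow> real) \<Rightarrow> real"
  assumes L: "L \<ge> 0" and lip: "\<And>x z. x \<in> skorokhod_space T \<Longrightarrow> z \<in> skorokhod_space T \<Longrightarrow> \<bar>f x - f z\<bar> \<le> L * skorokhod_dist T x z"
    and B: "\<And>x. x \<in> skorokhod_space T \<Longrightarrow> \<bar>f x\<bar> \<le> B"
  shows "(\<lambda>n. \<integral>\<omega>. limit_fid T mu sig n (\<lambda>t. Y t \<omega>) (\<lambda>x. f (grid_step T n x)) \<partial>M) \<longlonglongrightarrow> (\<integral>\<omega>. f (\<lambda>t\<in>{0..T}. Zp t \<omega>) \<partial>M)"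
    and "n > 0 \<Longrightarrow> (\<lambda>\<omega>. limit_fid T mu sig n (\<lambda>t. Y t \<omega>) (\<lambda>x. f (grid_step T n x))) \<in> borel_measurable M"
    and "n > 0 \<Longrightarrow> \<omega> \<in> space M \<Longrightarrow> \<bar>limit_fid T mu sig n (\<lambda>t. Y t \<omega>) (\<lambda>x. f (grid_step T n x))\<bar> \<le> B"
proof -
  interpret D: Metric_space "skorokhod_space T" "skorokhod_dist T" by (rule Metric_space_skorokhod)
  have fc: "continuous_map (skorokhod_topology T) euclideanreal f"
    unfolding skorokhod_topology_def by (rule D.Lipschitz_continuous_map_real[OF L lip])
  have fm: "f \<in> borel_measurable (borel_of_top (skorokhod_topology T))"
    by (rule borel_measurable_continuous_map[OF fc])
  note sp = grid_step_skorokhod[OF T]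
  let ?g = "\<lambda>n x. f (grid_step T n x)"
  have gc: "continuous_on UNIV (?g n)" for n by (rule continuous_on_grid_step[OF T fc])
  have gB: "\<bar>?g n x\<bar> \<le> B" for n x by (rule B[OF sp])
  \<comment> \<open>The distance of step paths is at most a maximum over \<open>n + 1\<close>
    coordinates; bounding it by the sum gives the form required by
    \<open>expectation_fid\<close>.\<close>
  have gL: "\<bar>?g n x - ?g n z\<bar> \<le> L * (\<Sum>l\<le>n. \<bar>x l - z l\<bar>)" for n x z
  proof -
    have "\<bar>?g n x - ?g n z\<bar> \<le> L * skorokhod_dist T (grid_step T n x) (grid_step T n z)" by (rule lip[OF sp sp])
    also have "\<dots> \<le> L * (\<Sum>l\<le>n. \<bar>x l - z l\<bar>)"
      by (intro mult_left_mono L grid_step_dist_le[OF T] sum_nonneg member_le_sum[of _ "{..n}" "\<lambda>l. \<bar>x l - z l\<bar>"]) auto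
    finally show ?thesis .
  qed
  note ef = expectation_fid[OF _ gc gB L gL]
  show "n > 0 \<Longrightarrow> (\<lambda>\<omega>. limit_fid T mu sig n (\<lambda>t. Y t \<omega>) (?g n)) \<in> borel_measurable M" by (rule ef(1))
  show "n > 0 \<Longrightarrow> \<omega> \<in> space M \<Longrightarrow> \<bar>limit_fid T mu sig n (\<lambda>t. Y t \<omega>) (?g n)\<bar> \<le> B" by (rule ef(2))
  let ?z = "\<lambda>\<omega>. \<lambda>t\<in>{0..T}. Zp t \<omega>"
  let ?s = "\<lambda>n l. real (min l n) * T / real n"
  have s: "?s n l \<in> {0..T}" for n l
    using T by (cases "n = 0") (auto simp: field_simps mult_right_mono)
  have s': "?s n l = min T (real l * T / real n)" if "n > 0" for n l
    using T that by (auto simp: min_def field_simps)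
  have lim: "(\<lambda>n. \<integral>\<omega>. ?g n (\<lambda>l. Zp (?s n l) \<omega>) \<partial>M) \<longlonglongrightarrow> (\<integral>\<omega>. f (?z \<omega>) \<partial>M)"
  proof (rule integral_dominated_convergence[where w = "\<lambda>_. B"])
    show "(\<lambda>\<omega>. f (?z \<omega>)) \<in> borel_measurable M"
      by (rule measurable_compose[OF measurable_continuous_skorokhod[OF T Zp_measurable Zp_continuous] fm])
    show "(\<lambda>\<omega>. ?g n (\<lambda>l. Zp (?s n l) \<omega>)) \<in> borel_measurable M" for n
      by (rule measurable_compose[OF measurable_compose[OF measurable_nat_fun measurable_grid_step[OF T]] fm])
        (rule Zp_measurable[OF s])
    show "AE \<omega> in M. (\<lambda>n. ?g n (\<lambda>l. Zp (?s n l) \<omega>)) \<longlonglongrightarrow> f (?z \<omega>)"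
    proof (rule AE_I2)
      fix \<omega> assume \<omega>: "\<omega> \<in> space M"
      have zs: "?z \<omega> \<in> skorokhod_space T" by (rule continuous_restrict_skorokhod[OF Zp_continuous[OF \<omega>]])
      show "(\<lambda>n. ?g n (\<lambda>l. Zp (?s n l) \<omega>)) \<longlonglongrightarrow> f (?z \<omega>)"
      proof (rule tendstoI)
        fix e :: real assume e: "e > 0"
        define \<epsilon> where "\<epsilon> = e / (2 * (L + 1))"
        have \<epsilon>: "\<epsilon> > 0" "L * \<epsilon> < e" using e L by (auto simp: \<epsilon>_def field_simps intro: add_nonneg_pos)
        show "eventually (\<lambda>n. dist (?g n (\<lambda>l. Zp (?s n l) \<omega>)) (f (?z \<omega>)) < e) sequentially"
          using grid_sample_dist_small[OF T Zp_continuous[OF \<omega>] \<epsilon>(1)] eventually_gt_at_top[of 0]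
        proof eventually_elim
          case (elim n)
          have "\<bar>?g n (\<lambda>l. Zp (?s n l) \<omega>) - f (?z \<omega>)\<bar> \<le> L * skorokhod_dist T (grid_step T n (\<lambda>l. Zp (?s n l) \<omega>)) (?z \<omega>)"
            by (rule lip[OF sp zs])
          also have "\<dots> \<le> L * \<epsilon>"
            using elim \<epsilon> by (intro mult_left_mono L skorokhod_dist_le_sup[OF sp zs]) (simp_all only: s', simp_all)
          finally show ?case using \<epsilon> by (simp add: dist_real_def)
        qed
      qed
    qed
  qed (use gB in auto)
  show "(\<lambda>n. \<integral>\<omega>. limit_fid T mu sig n (\<lambda>t. Y t \<omega>) (?g n) \<partial>M) \<longlonglongrightarrow> (\<integral>\<omega>. f (?z \<omega>) \<partial>M)"
    by (rule Lim_transform_eventually[OF lim]) (use eventually_gt_at_top[of 0] in eventually_elim, rule ef(3))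
qed

theorem theorem4:
  fixes T :: real
    and M :: "'a measure" and W :: "real \<Rightarrow> 'a \<Rightarrow> real" and Y :: "real \<Rightarrow> 'a \<Rightarrow> nat"
    and p :: "real \<Rightarrow> nat \<Rightarrow> nat pmf" and lam :: "nat \<Rightarrow> real" and rate :: "nat \<Rightarrow> nat \<Rightarrow> real"
    and mu sigma :: "nat \<Rightarrow> real" and J :: "real \<Rightarrow> 'a \<Rightarrow> real"
    and P :: "nat \<Rightarrow> 'b measure" and YN :: "nat \<Rightarrow> nat \<Rightarrow> 'b \<Rightarrow> nat"
    and K :: "nat \<Rightarrow> nat \<Rightarrow> nat pmf" and R :: "nat \<Rightarrow> nat \<Rightarrow> nat \<Rightarrow> 'b \<Rightarrow> real"
    and muN :: "nat \<Rightarrow> nat \<Rightarrow> real" and gam :: "nat \<Rightarrow> real"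
  assumes T: "T > 0"
    \<comment> \<open>limit model\<close>
    and M: "prob_space M"
    and W: "wiener_process M W"
    and Y: "markov_jump_process M Y p" and Y0: "\<forall>\<omega>\<in>space M. Y 0 \<omega> = 1"
    and WY: "indep_elements M
               (PiM {0..} (\<lambda>_. borel)) (\<lambda>\<omega>. \<lambda>t\<in>{0..}. W t \<omega>)
               (PiM {0..} (\<lambda>_. count_space UNIV)) (\<lambda>\<omega>. \<lambda>t\<in>{0..}. Y t \<omega>)"
    and ergodic: "uniformly_ergodic p"
    and generator: "infinitesimal_matrix p (\<lambda>i j. if i = j then - lam i else rate i j)"
    and rate_pos: "\<And>i j. i \<ge> 1 \<Longrightarrow> j \<ge> 1 \<Longrightarrow> i \<noteq> j \<Longrightarrow> rate i j > 0"
    and rate_sum: "\<And>i. i \<ge> 1 \<Longrightarrow> (rate i has_sum lam i) ({1..} - {i})"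
    and lam_inf: "(INF i\<in>{1..}. lam i) > 0" and lam_sup: "bdd_above (lam ` {1..})"
    and sigma_pos: "\<And>k. k \<ge> 1 \<Longrightarrow> sigma k > 0"
    and mu_bdd: "bounded (mu ` {1..})" and sigma_bdd: "bounded (sigma ` {1..})"
    and J: "is_ito_integral M (joint_filtration M W Y) W T (\<lambda>s \<omega>. sigma (Y s \<omega>)) J"
    \<comment> \<open>discrete models\<close>
    and P: "\<And>N. N \<ge> 1 \<Longrightarrow> prob_space (P N)"
    and YN: "\<And>N. N \<ge> 1 \<Longrightarrow> markov_chain (P N) (YN N) (K N)"
    and YN0: "\<And>N. N \<ge> 1 \<Longrightarrow> \<forall>\<omega>\<in>space (P N). YN N 0 \<omega> = 1"
    and K: "\<And>N. N \<ge> 1 \<Longrightarrow> completes_step_matrix (K N) p lam (T / real N)"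
    and R_indep: "\<And>N. N \<ge> 1 \<Longrightarrow>
          prob_space.indep_vars (P N) (\<lambda>_. borel) (\<lambda>(i, j). R N i j) ({0..N} \<times> {1..})"
    \<comment> \<open>condition (i)\<close>
    and R_gt: "\<And>N i j. N \<ge> 1 \<Longrightarrow> i \<le> N \<Longrightarrow> j \<ge> 1 \<Longrightarrow> AE \<omega> in P N. R N i j \<omega> > -1"
    and gam_nonneg: "\<And>N. N \<ge> 1 \<Longrightarrow> gam N \<ge> 0" and gam_lim: "gam \<longlonglongrightarrow> 0"
    and R_le: "\<And>N. N \<ge> 1 \<Longrightarrow> AE \<omega> in P N. \<forall>i\<le>N. \<forall>j\<ge>1. \<bar>R N i j \<omega>\<bar> \<le> gam N"
    \<comment> \<open>condition (ii)\<close>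
    and R_mean: "\<And>N i j. N \<ge> 1 \<Longrightarrow> i \<le> N \<Longrightarrow> j \<ge> 1 \<Longrightarrow>
          prob_space.expectation (P N) (R N i j) = muN N j"
    and muN_lim: "\<And>j. j \<ge> 1 \<Longrightarrow> (\<lambda>N. (1 + muN N j) ^ N) \<longlonglongrightarrow> exp (mu j * T)"
    \<comment> \<open>condition (iii)\<close>
    and R_var: "\<And>t. t \<in> {0..T} \<Longrightarrow>
          uniform_limit {1..}
            (\<lambda>N j. \<Sum>i=1..nat \<lfloor>real N * t / T\<rfloor>. prob_space.variance (P N) (R N i j))
            (\<lambda>j. (sigma j)\<^sup>2 * t) sequentially"
    \<comment> \<open>condition (iv)\<close>
    and R_YN: "\<And>N. N \<ge> 1 \<Longrightarrow> indep_elements (P N)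
          (PiM ({0..N} \<times> {1..}) (\<lambda>_. borel)) (\<lambda>\<omega>. \<lambda>(i, j)\<in>{0..N} \<times> {1..}. R N i j \<omega>)
          (PiM {1..N} (\<lambda>_. count_space UNIV)) (\<lambda>\<omega>. \<lambda>k\<in>{1..N}. YN N k \<omega>)"
  shows "converges_weakly (skorokhod_topology T)
           P (\<lambda>N \<omega>. \<lambda>t\<in>{0..T}. \<Sum>i=1..nat \<lfloor>t * real N / T\<rfloor>. ln (1 + R N i (YN N i \<omega>) \<omega>))
           M (\<lambda>\<omega>. \<lambda>t\<in>{0..T}. J t \<omega> +
                 (LBINT s:{0..t}. mu (Y s \<omega>) - (sigma (Y s \<omega>))\<^sup>2 / 2))"
proof -
  obtain \<Lambda>0 where \<Lambda>0: "\<And>i. i \<ge> 1 \<Longrightarrow> lam i \<le> \<Lambda>0" using lam_sup unfolding bdd_above_def by auto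
  obtain Cm where Cm: "\<And>j. j \<ge> 1 \<Longrightarrow> \<bar>mu j\<bar> \<le> Cm" using mu_bdd unfolding bounded_iff by auto
  obtain Cs where Cs: "\<And>j. j \<ge> 1 \<Longrightarrow> \<bar>sigma j\<bar> \<le> Cs" using sigma_bdd unfolding bounded_iff by auto
  have Cs2: "(sigma j)\<^sup>2 \<le> Cs\<^sup>2" if "j \<ge> 1" for j
    using power_mono[OF Cs[OF that] abs_ge_zero, of 2] by simp
  have Ym: "Y t \<in> M \<rightarrow>\<^sub>M count_space UNIV" if "t \<ge> 0" for t
    using Y that unfolding markov_jump_process_def by blast
  have Yc: "cadlag_on {0..} (\<lambda>t. Y t \<omega>)" and Y1: "t \<ge> 0 \<Longrightarrow> Y t \<omega> \<ge> 1" if "\<omega> \<in> space M" for \<omega> t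
    using Y that unfolding markov_jump_process_def by blast+
  have YNm: "YN N k \<in> P N \<rightarrow>\<^sub>M count_space UNIV" if "N \<ge> 1" for N k
    using YN[OF that] unfolding markov_chain_def by blast
  have YN1: "YN N k \<omega> \<ge> 1" if "N \<ge> 1" "\<omega> \<in> space (P N)" for N k \<omega>
    using YN[OF that(1)] that(2) unfolding markov_chain_def by blast
  have Icc: "{Suc 0..k} = {0<..k}" for k :: nat by auto
  \<comment> \<open>\<open>max 0\<close> supplies the sign condition on the bound.\<close>
  interpret B: bounded_rates p lam "max 0 \<Lambda>0"
  proof
    show "transition_function p" using Y unfolding markov_jump_process_def by blast
    fix i :: nat assume i: "i \<ge> 1"
    show "((\<lambda>t. pmf (p t i) i) has_real_derivative - lam i) (at 0 within {0..})"
      using generator[unfolded infinitesimal_matrix_def, rule_format, OF i i] by simp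
    show "lam i \<le> max 0 \<Lambda>0" using \<Lambda>0[OF i] by simp
  qed simp
  have var: "(\<lambda>N. \<Sum>i\<in>{0<..idx T N t}. prob_space.variance (P N) (R N i j)) \<longlonglongrightarrow> (sigma j)\<^sup>2 * t"
    if "j \<ge> 1" "t \<in> {0..T}" for j t
    using tendsto_uniform_limitI[OF R_var[OF that(2)], of j] that(1) by (simp add: Icc idx_def mult.commute)
  interpret D: discrete_model T P R muN gam mu sigma Cm "Cs\<^sup>2"
    by (rule discrete_model.intro) (fact T P R_indep gam_nonneg gam_lim R_le R_mean muN_lim var Cm Cs2)+
  interpret L: limit_model M W Y T mu sigma J Cm Cs
    by (intro limit_model.intro wiener_environment.intro wiener_environment_axioms.intro limit_model_axioms.intro)
      (fact M T W WY Ym Yc Y1 sigma_pos Cs Cm J)+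
  interpret S: Metric_space "skorokhod_space T" "skorokhod_dist T" by (rule Metric_space_skorokhod)
  note sp = grid_step_skorokhod[OF T]
  let ?X = "\<lambda>N \<omega>. grid_step T N (\<lambda>m. D.log_sum N (\<lambda>i. YN N i \<omega>) m \<omega>)"
  let ?Z = "\<lambda>\<omega>. \<lambda>t\<in>{0..T}. L.Zp t \<omega>"
  have X_eq: "(\<lambda>N \<omega>. \<lambda>t\<in>{0..T}. \<Sum>i=1..nat \<lfloor>t * real N / T\<rfloor>. ln (1 + R N i (YN N i \<omega>) \<omega>)) = ?X"
    by (intro ext) (auto simp: grid_step_def D.log_sum_def restrict_def Icc min_absorb1 grid_index_le[OF T])
  have "converges_weakly S.mtopology P ?X M ?Z"
  proof (rule S.converges_weakly_Lipschitz[OF P M])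
    show "?X N \<in> P N \<rightarrow>\<^sub>M borel_of_top S.mtopology" if "N \<ge> 1" for N
      unfolding skorokhod_topology_def[symmetric]
      by (rule measurable_compose[OF measurable_nat_fun measurable_grid_step[OF T]])
        (rule D.log_sum_measurable[OF that YNm[OF that] YN1[OF that]])
    show "?Z \<in> M \<rightarrow>\<^sub>M borel_of_top S.mtopology"
      unfolding skorokhod_topology_def[symmetric]
      by (rule measurable_continuous_skorokhod[OF T L.Zp_measurable L.Zp_continuous])
  next
    fix f :: "(real \<Rightarrow> real) \<Rightarrow> real" and L' B
    assume L: "L' \<ge> 0"
      and lip: "\<And>x y. x \<in> skorokhod_space T \<Longrightarrow> y \<in> skorokhod_space T \<Longrightarrow> \<bar>f x - f y\<bar> \<le> L' * skorokhod_dist T x y"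
      and B: "\<And>x. x \<in> skorokhod_space T \<Longrightarrow> \<bar>f x\<bar> \<le> B"
    have fm: "f \<in> borel_measurable (borel_of_top (skorokhod_topology T))"
      unfolding skorokhod_topology_def
      by (rule borel_measurable_continuous_map[OF S.Lipschitz_continuous_map_real[OF L lip]])
    have B0: "B \<ge> 0" using B[OF sp[of 0 "\<lambda>_. 0"]] by linarith
    \<comment> \<open>Expectation over the returns with the environment frozen at an integer-indexed
      sequence; it depends only on the entries 1 to N.\<close>
    define H where "H N y = (\<integral>\<omega>. f (grid_step T N (\<lambda>m. D.log_sum N y m \<omega>)) \<partial>P N)" for N y
    have HB: "\<bar>H N y\<bar> \<le> B" if "N \<ge> 1" for N y
    proof -
      interpret prob_space "P N" by (rule P[OF that])
      let ?F = "\<lambda>\<omega>. f (grid_step T N (\<lambda>m. D.log_sum N y m \<omega>))"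
      show ?thesis
      proof (cases "integrable (P N) ?F")
        case True
        have "\<bar>H N y\<bar> \<le> (\<integral>\<omega>. \<bar>?F \<omega>\<bar> \<partial>P N)" unfolding H_def using integral_norm_bound[of "P N" ?F] by simp
        also have "\<dots> \<le> B" by (rule integral_le_const[OF integrable_abs[OF True]]) (use B[OF sp] in auto)
        finally show ?thesis .
      qed (simp add: H_def not_integrable_integral_eq B0)
    qed
    \<comment> \<open>In the reversed list of length \<open>N + 1\<close>, time \<open>i\<close>
      sits at position \<open>N - i\<close>; this turns \<open>H N\<close> into a function of finite
      paths.\<close>
    have Hcong: "H N (\<lambda>i. rev_path y N \<omega> ! (N - i)) = H N (\<lambda>i. y i \<omega>)" for N \<omega> and y :: "nat \<Rightarrow> 'c \<Rightarrow> nat"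
    proof -
      have "D.log_sum N (\<lambda>i. rev_path y N \<omega> ! (N - i)) = D.log_sum N (\<lambda>i. y i \<omega>)"
        by (rule D.log_sum_cong) (rule rev_path_nth)
      then show ?thesis by (simp add: H_def)
    qed
    show "(\<lambda>N. \<integral>\<omega>. f (?X N \<omega>) \<partial>P N) \<longlonglongrightarrow> (\<integral>\<omega>. f (?Z \<omega>) \<partial>M)"
    proof -
      let ?H = "\<lambda>N \<omega>. H N (\<lambda>i. Y (real i * (T / real N)) \<omega>)"
      let ?\<Gamma> = "\<lambda>n \<omega>. limit_fid T mu sigma n (\<lambda>t. Y t \<omega>) (\<lambda>x. f (grid_step T n x))"
      \<comment> \<open>For each path of the jump process one number is reached both from the
        discrete models and from the Gaussian functionals.\<close>
      have "\<exists>\<phi>. (\<lambda>N. ?H N \<omega>) \<longlonglongrightarrow> \<phi> \<and> (\<lambda>n. ?\<Gamma> n \<omega>) \<longlonglongrightarrow> \<phi>" if \<omega>: "\<omega> \<in> space M" for \<omega>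
      proof -
        interpret Q: quenched_model T P R muN gam mu sigma Cm "Cs\<^sup>2" "\<lambda>t. Y t \<omega>"
          by (intro quenched_model.intro quenched_model_axioms.intro D.discrete_model_axioms Yc[OF \<omega>] Y1[OF \<omega>])
        have S_eq: "Q.S N = D.log_sum N (\<lambda>i. Y (real i * (T / real N)) \<omega>)" for N
          unfolding fun_eq_iff Q.S_def Q.Z_def Q.X_def D.log_sum_def by (simp only: times_divide_eq_right) simp
        show ?thesis using Q.quenched_convergence[OF L lip B] unfolding H_def S_eq .
      qed
      then have "\<exists>\<phi>. \<forall>\<omega>\<in>space M. (\<lambda>N. ?H N \<omega>) \<longlonglongrightarrow> \<phi> \<omega> \<and> (\<lambda>n. ?\<Gamma> n \<omega>) \<longlonglongrightarrow> \<phi> \<omega>"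
        by (intro bchoice ballI)
      then obtain \<phi> where \<phi>': "\<forall>\<omega>\<in>space M. (\<lambda>N. ?H N \<omega>) \<longlonglongrightarrow> \<phi> \<omega> \<and> (\<lambda>n. ?\<Gamma> n \<omega>) \<longlonglongrightarrow> \<phi> \<omega>" ..
      have \<phi>: "(\<lambda>N. ?H N \<omega>) \<longlonglongrightarrow> \<phi> \<omega>" "(\<lambda>n. ?\<Gamma> n \<omega>) \<longlonglongrightarrow> \<phi> \<omega>" if "\<omega> \<in> space M" for \<omega>
        by (rule \<phi>'[THEN bspec, OF that, THEN conjunct1], rule \<phi>'[THEN bspec, OF that, THEN conjunct2])
      note el = L.expectation_limit[OF L lip B]
      have \<phi>m: "\<phi> \<in> borel_measurable M"
        by (rule borel_measurable_LIMSEQ_real[of M "\<lambda>n. ?\<Gamma> (Suc n)"]) (use \<phi>(2) el(2) in \<open>auto intro: LIMSEQ_Suc\<close>)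
      have "(\<lambda>n. \<integral>\<omega>. ?\<Gamma> (Suc n) \<omega> \<partial>M) \<longlonglongrightarrow> (\<integral>\<omega>. \<phi> \<omega> \<partial>M)"
      proof (rule integral_dominated_convergence[where w = "\<lambda>_. B"])
        show "AE \<omega> in M. (\<lambda>n. ?\<Gamma> (Suc n) \<omega>) \<longlonglongrightarrow> \<phi> \<omega>" by (rule AE_I2) (rule LIMSEQ_Suc[OF \<phi>(2)])
      qed (use \<phi>m el(2,3) in auto)
      \<comment> \<open>The means of the Gaussian functionals also tend to the functional of the
        limit process, which identifies the mean of \<open>\<phi>\<close>.\<close>
      then have Z_eq: "(\<integral>\<omega>. \<phi> \<omega> \<partial>M) = (\<integral>\<omega>. f (?Z \<omega>) \<partial>M)"
        using LIMSEQ_Suc[OF el(1)] by (rule LIMSEQ_unique)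
      \<comment> \<open>As a function of a list, \<open>H N\<close> is trivially measurable, because
        lists of states carry the discrete sigma-algebra.\<close>
      have Hm: "?H N \<in> borel_measurable M" for N
      proof -
        have "rev_path (\<lambda>k. Y (real k * (T / real N))) N \<in> M \<rightarrow>\<^sub>M count_space UNIV"
          by (rule measurable_rev_path) (use T in \<open>auto intro!: Ym\<close>)
        then have "(\<lambda>\<omega>. H N (\<lambda>i. rev_path (\<lambda>k. Y (real k * (T / real N))) N \<omega> ! (N - i))) \<in> borel_measurable M"
          by (rule measurable_compose) simp
        then show ?thesis by (simp only: Hcong)
      qed
      have "(\<lambda>N. \<integral>\<omega>. ?H (Suc N) \<omega> \<partial>M) \<longlonglongrightarrow> (\<integral>\<omega>. \<phi> \<omega> \<partial>M)"
      proof (rule integral_dominated_convergence[where w = "\<lambda>_. B"])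
        show "AE \<omega> in M. (\<lambda>N. ?H (Suc N) \<omega>) \<longlonglongrightarrow> \<phi> \<omega>" by (rule AE_I2) (rule LIMSEQ_Suc[OF \<phi>(1)])
        show "AE \<omega> in M. norm (?H (Suc N) \<omega>) \<le> B" for N using HB[of "Suc N"] by simp
        show "?H (Suc N) \<in> borel_measurable M" for N by (rule Hm)
      qed (simp_all add: \<phi>m)
      then have lim: "(\<lambda>N. \<integral>\<omega>. ?H N \<omega> \<partial>M) \<longlonglongrightarrow> (\<integral>\<omega>. f (?Z \<omega>) \<partial>M)"
        unfolding Z_eq by (rule LIMSEQ_imp_Suc)
      \<comment> \<open>The environment of model N is replaced by the skeleton of the jump process:
        N kernel errors of order \<open>1 / N^2\<close> add up to order
        \<open>1 / N\<close>.\<close>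
      have diff: "norm ((\<integral>\<omega>. f (?X N \<omega>) \<partial>P N) - (\<integral>\<omega>. ?H N \<omega> \<partial>M)) \<le> 2 * B * (max 0 \<Lambda>0 * T)\<^sup>2 / real N" if N: "N \<ge> 1" for N
      proof -
        let ?\<phi> = "\<lambda>xs. H N (\<lambda>i. xs ! (N - i))"
        have "\<bar>(\<integral>\<omega>. ?\<phi> (rev_path (YN N) N \<omega>) \<partial>P N) - (\<integral>\<omega>. ?\<phi> (rev_path (\<lambda>k. Y (real k * (T / real N))) N \<omega>) \<partial>M)\<bar>
            \<le> 2 * B * real N * (max 0 \<Lambda>0 * (T / real N))\<^sup>2"
          by (rule B.rev_path_expectation_diff[OF M Y _ P[OF N] YN[OF N] _ K[OF N], where ?i0.0 = 1])
            (use Y0 YN0[OF N] HB[OF N] T N in auto)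
        also have "2 * B * real N * (max 0 \<Lambda>0 * (T / real N))\<^sup>2 = 2 * B * (max 0 \<Lambda>0 * T)\<^sup>2 / real N"
          using N by (simp add: power2_eq_square field_simps)
        finally have "\<bar>(\<integral>\<omega>. H N (\<lambda>i. YN N i \<omega>) \<partial>P N) - (\<integral>\<omega>. ?H N \<omega> \<partial>M)\<bar> \<le> 2 * B * (max 0 \<Lambda>0 * T)\<^sup>2 / real N"
          by (simp only: Hcong)
        moreover have "(\<integral>\<omega>. f (?X N \<omega>) \<partial>P N) = (\<integral>\<omega>. H N (\<lambda>i. YN N i \<omega>) \<partial>P N)"
          unfolding H_def by (rule D.expectation_mixture[OF N YN1[OF N] R_YN[OF N] fm B])
        ultimately show ?thesis by simp
      qed
      have "(\<lambda>N. (\<integral>\<omega>. f (?X N \<omega>) \<partial>P N) - (\<integral>\<omega>. ?H N \<omega> \<partial>M)) \<longlonglongrightarrow> 0"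
        by (rule Lim_null_comparison[OF _ lim_const_over_n[of "2 * B * (max 0 \<Lambda>0 * T)\<^sup>2"]])
          (use eventually_ge_at_top[of 1] in eventually_elim, rule diff)
      from tendsto_add[OF this lim] show ?thesis by simp
    qed
  qed
  then show ?thesis unfolding X_eq L.Zp_def L.drift_def skorokhod_topology_def .
qed

end
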